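(* Let $V\subseteq\mathbb{G}^n$ be an absolutely irreducible simple variety. Then $\check V\subseteq\mathbb{G}^{2n}$ is an absolutely free, absolutely irreducible rotund variety. Moreover, if $\dim M\cdot\check V=\mathrm{rank}\,M$ for some integer matrix $M\in\mathcal{M}_{p,2n}(\mathbb{Z})$ of rank $p>0$, then $V$ is perfectly rotund, and one of the following holds: (1) $\mathrm{rank}\,M=2n$; (2) $\mathrm{rank}\,M=n$ and $M=(N\,|\,P)$ where $N,P\in\mathcal{M}_{n,n}(\mathbb{Z})$ are square matrices of maximum rank.
   Context: $K$ is an algebraically closed field of characteristic $0$ with an automorphism $\sigma$ of order two; $R=K^\sigma$ (a real closed field), $i\in K$ with $i^2=-1$, so $K=R(i)$. For $z\in K$: $\Re(z)=(z+\sigma(z))/2$, $\Im(z)=(z-\sigma(z))/(2i)$; for $w\in K^\times$: $|w|=\sqrt{w\sigma(w)}\in R_{>0}$, $\Theta(w)=w/|w|$, lying in $\mathbb{S}^1=\{z:|z|=1\}$. $\mathbb{G}=\mathbb{G}_a\times\mathbb{G}_m$ with $\mathbb{G}_a(K)=(K,+)$, $\mathbb{G}_m(K)=(K^\times,\cdot)$; $\langle\bar z;\bar w\rangle=((z_1,w_1),\dots,(z_n,w_n))\in\mathbb{G}^n$. An integer matrix $M=(m_{ij})\in\mathcal{M}_{k,n}(\mathbb{Z})$ acts $\mathbb{G}^n\to\mathbb{G}^k$ by $M\cdot\langle\bar z;\bar w\rangle=\langle(\sum_jm_{ij}z_j)_i;(\prod_jw_j^{m_{ij}})_i\rangle$;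 $M\cdot V$ denotes the Zariski closure of the image of $V$. An irreducible $V\subseteq\mathbb{G}^n$ is rotund if $\dim M\cdot V\geq\mathrm{rank}\,M$ for all $M\in\mathcal{M}_{n,n}(\mathbb{Z})$; absolutely free if for every nonzero $M\in\mathcal{M}_{1,n}(\mathbb{Z})$ the projections of $M\cdot V$ to $\mathbb{G}_a$ and to $\mathbb{G}_m$ have dimension $1$; simple if absolutely free, rotund, and $\dim M\cdot V>\mathrm{rank}\,M$ whenever $0<\mathrm{rank}\,M<n$; perfectly rotund if simple and $\dim V=n$. The realisation map $r:\mathbb{G}^n(K)\to\mathbb{G}^{2n}(K)$ is $r(\langle\bar z;\bar w\rangle)=\langle\Re(\bar z);|\bar w|\rangle\times\langle i\Im(\bar z);\Theta(\bar w)\rangle$ (componentwise; the first $n$ coordinates carry real parts and moduli, the last $n$ carry $i$ times imaginary parts and phases). For $V\subseteq\mathbb{G}^n$, $r(V)=\{r(P):P\in V(K)\}$ and the $\mathbb{G}$-restriction of scalars $\check V$ is the Zariski closure of $r(V)$ in $\mathbb{G}^{2n}$. *)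

theory Defs
  imports Complex_Main "HOL-Computational_Algebra.Polynomial"
begin

text \<open>A point of G^n = G_a^n x G_m^n is a pair (z, w) of coordinate functions,
  padded canonically: z j = 0 and w j = 1 for j >= n; and w j is nonzero for j < n.\<close>

type_synonym 'a gpt = "(nat \<Rightarrow> 'a) \<times> (nat \<Rightarrow> 'a)"

definition Gpts :: "nat \<Rightarrow> ('a::field) gpt set" where
  "Gpts n = {(z, w). (\<forall>j\<ge>n. z j = 0 \<and> w j = 1) \<and> (\<forall>j<n. w j \<noteq> 0)}"

definition Ga1 :: "('a::field) gpt set" where
  "Ga1 = {(z, w). (\<forall>j\<ge>1. z j = 0) \<and> (\<forall>j. w j = 1)}"

definition Gm1 :: "('a::field) gpt set" where
  "Gm1 = {(z, w). (\<forall>j. z j = 0) \<and> (\<forall>j\<ge>1. w j = 1) \<and> w 0 \<noteq> 0}"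

definition proj_a :: "('a::field) gpt \<Rightarrow> 'a gpt" where
  "proj_a P = (fst P, (\<lambda>_. 1))"

definition proj_m :: "('a::field) gpt \<Rightarrow> 'a gpt" where
  "proj_m P = ((\<lambda>_. 0), snd P)"

inductive gpoly :: "(('a::comm_ring_1) gpt \<Rightarrow> 'a) \<Rightarrow> bool" where
  gpoly_const: "gpoly (\<lambda>_. c)"
| gpoly_z: "gpoly (\<lambda>P. fst P j)"
| gpoly_w: "gpoly (\<lambda>P. snd P j)"
| gpoly_add: "gpoly f \<Longrightarrow> gpoly g \<Longrightarrow> gpoly (\<lambda>P. f P + g P)"
| gpoly_mult: "gpoly f \<Longrightarrow> gpoly g \<Longrightarrow> gpoly (\<lambda>P. f P * g P)"

definition zclosed_in :: "('a::comm_ring_1) gpt set \<Rightarrow> 'a gpt set \<Rightarrow> bool" where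
  "zclosed_in X C \<longleftrightarrow> C \<subseteq> X \<and>
     (\<exists>F. (\<forall>f\<in>F. gpoly f) \<and> C = {P\<in>X. \<forall>f\<in>F. f P = 0})"

definition zcl :: "('a::comm_ring_1) gpt set \<Rightarrow> 'a gpt set \<Rightarrow> 'a gpt set" where
  "zcl A S = {P\<in>A. \<forall>f. gpoly f \<and> (\<forall>Q\<in>S. f Q = 0) \<longrightarrow> f P = 0}"

definition zirred :: "('a::comm_ring_1) gpt set \<Rightarrow> bool" where
  "zirred C \<longleftrightarrow> C \<noteq> {} \<and>
     (\<forall>A B. zclosed_in C A \<and> zclosed_in C B \<and> C = A \<union> B \<longrightarrow> A = C \<or> B = C)"

definition kdim :: "('a::comm_ring_1) gpt set \<Rightarrow> nat" where
  "kdim X = Max {k. \<exists>c. (\<forall>i\<le>k. zclosed_in X (c i) \<and> zirred (c i)) \<and>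
                         (\<forall>i<k. c i \<subset> c (Suc i))}"

definition gvariety :: "nat \<Rightarrow> ('a::field) gpt set \<Rightarrow> bool" where
  "gvariety n V \<longleftrightarrow> zclosed_in (Gpts n) V \<and> zirred V"

text \<open>A k x n integer matrix is M :: nat => nat => int; only entries i < k, j < n matter.\<close>

definition mact :: "nat \<Rightarrow> nat \<Rightarrow> (nat \<Rightarrow> nat \<Rightarrow> int) \<Rightarrow> ('a::field) gpt \<Rightarrow> 'a gpt" where
  "mact k n M P = ((\<lambda>i. if i < k then (\<Sum>j<n. of_int (M i j) * fst P j) else 0),
                   (\<lambda>i. if i < k then (\<Prod>j<n. snd P j powi M i j) else 1))"

definition mimg :: "nat \<Rightarrow> nat \<Rightarrow> (nat \<Rightarrow> nat \<Rightarrow> int) \<Rightarrow> ('a::field) gpt set \<Rightarrow> 'a gpt set" where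
  "mimg k n M V = zcl (Gpts k) (mact k n M ` V)"

text \<open>Rank = maximal number of linearly independent rows (over Z, equivalently over Q).\<close>

definition mrank :: "nat \<Rightarrow> nat \<Rightarrow> (nat \<Rightarrow> nat \<Rightarrow> int) \<Rightarrow> nat" where
  "mrank k n M = Max {card I | I. I \<subseteq> {..<k} \<and>
      (\<forall>c::nat \<Rightarrow> int. (\<forall>j<n. (\<Sum>i\<in>I. c i * M i j) = 0) \<longrightarrow> (\<forall>i\<in>I. c i = 0))}"

definition rotund :: "nat \<Rightarrow> ('a::field) gpt set \<Rightarrow> bool" where
  "rotund n V \<longleftrightarrow> (\<forall>M. kdim (mimg n n M V) \<ge> mrank n n M)"

definition abs_free :: "nat \<Rightarrow> ('a::field) gpt set \<Rightarrow> bool" where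
  "abs_free n V \<longleftrightarrow> (\<forall>M. (\<exists>j<n. M 0 j \<noteq> 0) \<longrightarrow>
      kdim (zcl Ga1 (proj_a ` mimg 1 n M V)) = 1 \<and>
      kdim (zcl Gm1 (proj_m ` mimg 1 n M V)) = 1)"

definition simple_var :: "nat \<Rightarrow> ('a::field) gpt set \<Rightarrow> bool" where
  "simple_var n V \<longleftrightarrow> abs_free n V \<and> rotund n V \<and>
     (\<forall>M. 0 < mrank n n M \<and> mrank n n M < n \<longrightarrow> kdim (mimg n n M V) > mrank n n M)"

definition perf_rotund :: "nat \<Rightarrow> ('a::field) gpt set \<Rightarrow> bool" where
  "perf_rotund n V \<longleftrightarrow> simple_var n V \<and> kdim V = n"

text \<open>R = fixed field of sigma; positives of R are its nonzero squares (R is real closed).\<close>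

definition absv :: "('a::field \<Rightarrow> 'a) \<Rightarrow> 'a \<Rightarrow> 'a" where
  "absv \<sigma> w = (THE r. \<sigma> r = r \<and> (\<exists>s. \<sigma> s = s \<and> s \<noteq> 0 \<and> r = s\<^sup>2) \<and> r\<^sup>2 = w * \<sigma> w)"

definition Theta :: "('a::field \<Rightarrow> 'a) \<Rightarrow> 'a \<Rightarrow> 'a" where
  "Theta \<sigma> w = w / absv \<sigma> w"

definition ReK :: "('a::field \<Rightarrow> 'a) \<Rightarrow> 'a \<Rightarrow> 'a" where
  "ReK \<sigma> z = (z + \<sigma> z) / 2"

definition ImK :: "('a::field \<Rightarrow> 'a) \<Rightarrow> 'a \<Rightarrow> 'a \<Rightarrow> 'a" where
  "ImK \<sigma> i z = (z - \<sigma> z) / (2 * i)"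

definition realis :: "('a::field \<Rightarrow> 'a) \<Rightarrow> 'a \<Rightarrow> nat \<Rightarrow> 'a gpt \<Rightarrow> 'a gpt" where
  "realis \<sigma> i n P =
     ((\<lambda>j. if j < n then ReK \<sigma> (fst P j)
           else if j < 2 * n then i * ImK \<sigma> i (fst P (j - n)) else 0),
      (\<lambda>j. if j < n then absv \<sigma> (snd P j)
           else if j < 2 * n then Theta \<sigma> (snd P (j - n)) else 1))"

definition restr :: "('a::field \<Rightarrow> 'a) \<Rightarrow> 'a \<Rightarrow> nat \<Rightarrow> 'a gpt set \<Rightarrow> 'a gpt set" where
  "restr \<sigma> i n V = zcl (Gpts (2 * n)) (realis \<sigma> i n ` V)"

end

theory Submission
  imports Defs "HOL-Library.Function_Algebras"
begin

text \<open>Let U be a component of the preimage of V under multiplication by 2. On the points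
  of V, written as doubles of Q in U, the realisation map is the polynomial map
  sending Q to the image of (Q, Q') under (sum, difference), where Q' is the conjugate
  of Q. The pairs (Q, Q') are Zariski dense in the product of U with its conjugate,
  so the restriction of scalars is the closure of the image of that product under an isogeny, and a
  matrix (N | P) acts on it as the sum of N + P on U and N - P on its
  conjugate. Rotundity and freeness then follow factor by factor. When the dimension equals the rank,
  simplicity of both factors forces N + P and N - P to have rank 0 or n; if both are
  of rank n in rank n altogether, a translate of the image of U is a closed submonoid of dimension n,
  whereas by freeness and independence of characters it has dimension at least n + 1, so one of them vanishes and N and P agree up to sign.\<close>

section \<open>Prime ideals and algebraic dependence\<close>

text \<open>The realisation map is not algebraic, since moduli are square roots. On a square
  \<open>u^2\<close> the modulus is \<open>u * \<sigma> u\<close>, because a square root of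
  \<open>u\<close> exhibits this element as the square of a fixed nonzero element; this is why
  points of V are written as doubles. Conjugation is still not a polynomial map. It is used only as
  a map that carries zero sets to zero sets, and density of its graph rests on the fact that a
  polynomial vanishing at all \<open>(c, \<sigma> c)\<close> vanishes everywhere.
  \<open>kdim\<close> is a maximum over lengths of chains, meaningful only once these are bounded.
  Bounds and comparisons of dimensions pass through chains of prime ideals and lists of functions
  that are algebraically independent modulo a prime: chains yield such lists and lists yield chains.
  Quotient rings and fraction fields are avoided by working with subrings and ideals of one ring of
  functions and with leading coefficients outside the prime. Matrices of full rank are inverted only
  up to a positive integer factor, which is harmless because multiplication by it preserves
  dimension.\<close>

definition is_subring :: "'b::comm_ring_1 set \<Rightarrow> bool" where
  "is_subring A \<longleftrightarrow> 1 \<in> A \<and> (\<forall>a\<in>A. \<forall>b\<in>A. a - b \<in> A \<and> a * b \<in> A)"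

definition ideal_in :: "'b::comm_ring_1 set \<Rightarrow> 'b set \<Rightarrow> bool" where
  "ideal_in B J \<longleftrightarrow> J \<subseteq> B \<and> 0 \<in> J \<and> (\<forall>a\<in>J. \<forall>b\<in>J. a + b \<in> J) \<and> (\<forall>a\<in>B. \<forall>b\<in>J. a * b \<in> J)"

definition prime_in :: "'b::comm_ring_1 set \<Rightarrow> 'b set \<Rightarrow> bool" where
  "prime_in B P \<longleftrightarrow> ideal_in B P \<and> 1 \<notin> P \<and> (\<forall>a\<in>B. \<forall>b\<in>B. a * b \<in> P \<longrightarrow> a \<in> P \<or> b \<in> P)"

definition polys :: "'b::comm_ring_1 set \<Rightarrow> 'b poly set" where
  "polys A = {p. \<forall>k. coeff p k \<in> A}"

text \<open>Values outside \<open>A\<close> are arbitrary; \<open>\<phi> 0 = 0\<close> and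
  compatibility with differences follow from additivity on a subring.\<close>

definition hom_on :: "'b::comm_ring_1 set \<Rightarrow> ('b \<Rightarrow> 'a::field) \<Rightarrow> bool" where
  "hom_on A \<phi> \<longleftrightarrow> \<phi> 1 = 1 \<and> (\<forall>a\<in>A. \<forall>b\<in>A. \<phi> (a + b) = \<phi> a + \<phi> b \<and> \<phi> (a * b) = \<phi> a * \<phi> b)"

inductive_set alg :: "'b::comm_ring_1 set \<Rightarrow> 'b set \<Rightarrow> 'b set" for A X where
  alg_base: "a \<in> A \<Longrightarrow> a \<in> alg A X"
| alg_gen: "a \<in> X \<Longrightarrow> a \<in> alg A X"
| alg_add: "a \<in> alg A X \<Longrightarrow> b \<in> alg A X \<Longrightarrow> a + b \<in> alg A X"
| alg_mult: "a \<in> alg A X \<Longrightarrow> b \<in> alg A X \<Longrightarrow> a * b \<in> alg A X"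

section \<open>Polynomials over a subring and generated algebras\<close>

lemma degree_less_if_coeff_0:
  assumes "degree p \<le> d" "coeff p d = 0" "0 < d"
  shows "degree p < d"
proof (rule le_neq_implies_less[OF assms(1)])
  show "degree p \<noteq> d"
    using assms(2,3) leading_coeff_0_iff[of p] by auto
qed

context
  fixes A :: "'b::comm_ring_1 set"
  assumes A: "is_subring A"
begin

lemma subring_1: "1 \<in> A" and subring_diff: "a \<in> A \<Longrightarrow> b \<in> A \<Longrightarrow> a - b \<in> A"
  and subring_mult: "a \<in> A \<Longrightarrow> b \<in> A \<Longrightarrow> a * b \<in> A"
  using A by (auto simp: is_subring_def)

lemma subring_0: "0 \<in> A"
  using subring_diff[OF subring_1 subring_1] by simp

lemma subring_uminus: "a \<in> A \<Longrightarrow> - a \<in> A"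
  using subring_diff[OF subring_0] by force

lemma subring_add: "a \<in> A \<Longrightarrow> b \<in> A \<Longrightarrow> a + b \<in> A"
  using subring_diff[of a "- b"] subring_uminus by simp

lemma subring_sum: "(\<And>s. s \<in> S \<Longrightarrow> f s \<in> A) \<Longrightarrow> sum f S \<in> A"
  by (induction S rule: infinite_finite_induct) (auto simp: subring_0 subring_add)

lemma subring_power: "a \<in> A \<Longrightarrow> a ^ k \<in> A"
  by (induction k) (auto simp: subring_1 subring_mult)

lemmas subring_intros = subring_1 subring_0 subring_diff subring_uminus subring_add subring_mult
  subring_sum subring_power

lemma polys_pCons: "c \<in> A \<Longrightarrow> p \<in> polys A \<Longrightarrow> pCons c p \<in> polys A"
  by (auto simp: polys_def coeff_pCons split: nat.split)

lemma polys_0: "0 \<in> polys A" and polys_1: "1 \<in> polys A"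
  and polys_add: "p \<in> polys A \<Longrightarrow> q \<in> polys A \<Longrightarrow> p + q \<in> polys A"
  and polys_diff: "p \<in> polys A \<Longrightarrow> q \<in> polys A \<Longrightarrow> p - q \<in> polys A"
  and polys_mult: "p \<in> polys A \<Longrightarrow> q \<in> polys A \<Longrightarrow> p * q \<in> polys A"
  and polys_smult: "c \<in> A \<Longrightarrow> p \<in> polys A \<Longrightarrow> smult c p \<in> polys A"
  and polys_monom: "c \<in> A \<Longrightarrow> monom c k \<in> polys A"
  by (auto simp: polys_def coeff_mult intro!: subring_intros)

lemma polys_const: "c \<in> A \<Longrightarrow> [:c:] \<in> polys A"
  by (simp add: polys_pCons polys_0)

lemma alg_subring: "is_subring (alg A X)"
  unfolding is_subring_def
proof (intro conjI ballI)
  show "1 \<in> alg A X"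
    by (intro alg_base subring_1)
  fix a b assume ab: "a \<in> alg A X" "b \<in> alg A X"
  have "a + (- 1) * b \<in> alg A X"
    by (intro alg_add alg_mult ab alg_base subring_uminus subring_1)
  then show "a - b \<in> alg A X" by simp
qed (rule alg_mult)

lemma poly_in_alg: "p \<in> polys A \<Longrightarrow> poly p x \<in> alg A {x}"
proof (induction p)
  case 0
  then show ?case by (auto intro: alg_base subring_0)
next
  case (pCons c p)
  have coeffs: "coeff (pCons c p) k \<in> A" for k
    using pCons.prems by (auto simp: polys_def)
  have "c \<in> A"
    using coeffs[of 0] by simp
  moreover have "p \<in> polys A"
    using coeffs[of "Suc k" for k] by (simp add: polys_def)
  ultimately show ?case
    using pCons.IH by (auto intro!: alg_add alg_mult intro: alg_base alg_gen)
qed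

lemma alg_singleton_iff: "y \<in> alg A {x} \<longleftrightarrow> (\<exists>p\<in>polys A. y = poly p x)"
proof
  assume "y \<in> alg A {x}"
  then show "\<exists>p\<in>polys A. y = poly p x"
  proof induction
    case (alg_base a)
    then show ?case by (intro bexI[of _ "[:a:]"]) (auto simp: polys_const)
  next
    case (alg_gen a)
    then show ?case
      by (intro bexI[of _ "[:0, 1:]"]) (auto simp: polys_pCons polys_0 subring_intros)
  next
    case (alg_add a b)
    then show ?case by (auto intro!: bexI[of _ "p + q" for p q] polys_add)
  next
    case (alg_mult a b)
    then show ?case by (auto intro!: bexI[of _ "p * q" for p q] polys_mult)
  qed
qed (auto simp: poly_in_alg)

text \<open>Division with remainder needs no inverses if \<open>f\<close> is first multiplied by a
  power of the leading coefficient of \<open>s\<close>. The degree bound on \<open>u\<close> is kept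
  because it later forces a quotient below the degree of a minimal relation.\<close>

lemma pseudo_division:
  assumes s: "s \<in> polys A" "degree s > 0" and f: "f \<in> polys A"
  shows "\<exists>N u r. u \<in> polys A \<and> r \<in> polys A \<and> smult (lead_coeff s ^ N) f = s * u + r
    \<and> degree r < degree s \<and> (u = 0 \<or> degree u + degree s \<le> degree f)"
  using f
proof (induction "degree f" arbitrary: f rule: less_induct)
  case less
  show ?case
  proof (cases "degree f < degree s")
    case True
    then show ?thesis
      using less.prems polys_0 by (intro exI[of _ 0] exI[of _ 0] exI[of _ f]) auto
  next
    case False
    define b d where "b = lead_coeff s" and "d = degree f - degree s"
    have inA: "b \<in> A" "lead_coeff f \<in> A"
      using s less.prems by (auto simp: b_def polys_def)
    \<comment> \<open>Both terms have coefficient \<open>b * lead_coeff f\<close> in degree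
      \<open>degree f\<close>, which cancels.\<close>
    define f' where "f' = smult b f - s * monom (lead_coeff f) d"
    have f'A: "f' \<in> polys A"
      unfolding f'_def using inA s less.prems by (intro polys_diff polys_smult polys_mult polys_monom)
    have "degree (s * monom (lead_coeff f) d) \<le> degree s + d"
      by (rule le_trans[OF degree_mult_le add_left_mono[OF degree_monom_le]])
    then have le: "degree f' \<le> degree f"
      unfolding f'_def using False d_def
      by (intro degree_diff_le) (auto intro: le_trans[OF degree_smult_le])
    have "coeff f' (degree f) = 0"
      using False by (simp add: f'_def b_def d_def mult.commute[of s] coeff_monom_mult)
    then have "degree f' < degree f"
      using le s False by (intro degree_less_if_coeff_0) auto
    from less.hyps[OF this f'A] obtain N u r where IH:
      "u \<in> polys A" "r \<in> polys A" "smult (b ^ N) f' = s * u + r" "degree r < degree s"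
      "u = 0 \<or> degree u + degree s \<le> degree f'" by (auto simp: b_def)
    define u' where "u' = u + smult (b ^ N) (monom (lead_coeff f) d)"
    have "smult (b ^ Suc N) f = smult (b ^ N) f' + s * smult (b ^ N) (monom (lead_coeff f) d)"
      by (simp add: f'_def smult_diff_right mult.commute)
    then have "smult (b ^ Suc N) f = s * u' + r"
      by (simp add: IH(3) u'_def algebra_simps)
    moreover have "u' \<in> polys A"
      unfolding u'_def using IH(1) inA by (intro polys_add polys_smult polys_monom subring_power)
    moreover have "degree u' + degree s \<le> degree f"
    proof -
      have "degree u \<le> d" using IH(5) le d_def by auto
      then have "degree u' \<le> d"
        unfolding u'_def
        by (intro degree_add_le) (auto intro: le_trans[OF degree_smult_le] degree_monom_le)
      then show ?thesis using False d_def by simp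
    qed
    ultimately show ?thesis using IH unfolding b_def by blast
  qed
qed

text \<open>A polynomial in \<open>G\<close> of degree below \<open>e\<close> must have its leading
  coefficient in \<open>P\<close>; subtracting the leading monomial stays in \<open>G\<close>, so
  the argument descends to every coefficient. \<open>G\<close> is left abstract: it stands for being
  a relation of \<open>x\<close> modulo \<open>P\<close>, and for having a value at \<open>x\<close>
  that is a multiple of a fixed element modulo \<open>P\<close>.\<close>

lemma coeffs_in_ideal:
  assumes min: "\<And>q. q \<in> polys A \<Longrightarrow> G q \<Longrightarrow> lead_coeff q \<notin> P \<Longrightarrow> e \<le> degree q"
    and G: "\<And>q c k. q \<in> polys A \<Longrightarrow> G q \<Longrightarrow> c \<in> A \<Longrightarrow> c \<in> P \<Longrightarrow> G (q - monom c k)"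
    and P0: "0 \<in> P"
    and r: "r \<in> polys A" "G r" "degree r < e"
  shows "coeff r k \<in> P"
  using r
proof (induction "degree r" arbitrary: r k rule: less_induct)
  case less
  have lead: "lead_coeff r \<in> P" "lead_coeff r \<in> A"
    using min[of r] less.prems by (force, simp add: polys_def)
  show ?case
  proof (cases "degree r = 0")
    case True
    then show ?thesis
      using lead P0 by (cases "k = 0") (auto simp: coeff_eq_0)
  next
    case False
    define r' where "r' = r - monom (lead_coeff r) (degree r)"
    have "degree r' \<le> degree r"
      unfolding r'_def by (intro degree_diff_le) (auto simp: degree_monom_le)
    moreover have "coeff r' (degree r) = 0" by (simp add: r'_def)
    ultimately have lt: "degree r' < degree r"
      using False by (intro degree_less_if_coeff_0) auto
    have "coeff r' k \<in> P"
    proof (rule less.hyps[OF lt])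
      show "r' \<in> polys A" "G r'"
        unfolding r'_def using less.prems lead by (auto intro!: polys_diff polys_monom G)
    qed (use lt less.prems in simp)
    then show ?thesis
      using lead by (cases "k = degree r") (auto simp: r'_def)
  qed
qed

end

lemma alg_mono: "A \<subseteq> A' \<Longrightarrow> X \<subseteq> X' \<Longrightarrow> alg A X \<subseteq> alg A' X'"
proof
  fix y assume "A \<subseteq> A'" "X \<subseteq> X'" "y \<in> alg A X"
  from this(3,1,2) show "y \<in> alg A' X'" by induction (auto intro: alg.intros)
qed

lemma alg_least: "is_subring B \<Longrightarrow> A \<subseteq> B \<Longrightarrow> X \<subseteq> B \<Longrightarrow> alg A X \<subseteq> B"
proof
  fix y assume "is_subring B" "A \<subseteq> B" "X \<subseteq> B" "y \<in> alg A X"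
  from this(4,1-3) show "y \<in> B" by induction (auto intro: subring_add subring_mult)
qed

text \<open>Turns the adjunction of a finite set into successive adjunctions of single
  elements.\<close>

lemma alg_alg: "alg (alg A X) Y = alg A (X \<union> Y)"
proof
  show "alg (alg A X) Y \<subseteq> alg A (X \<union> Y)"
  proof
    fix y assume "y \<in> alg (alg A X) Y"
    then show "y \<in> alg A (X \<union> Y)"
      by induction (use alg_mono[of A A X "X \<union> Y"] in \<open>auto intro: alg.intros\<close>)
  qed
  show "alg A (X \<union> Y) \<subseteq> alg (alg A X) Y"
  proof
    fix y assume "y \<in> alg A (X \<union> Y)"
    then show "y \<in> alg (alg A X) Y"
      by induction (auto intro: alg.intros)
  qed
qed

lemma alg_empty: "is_subring A \<Longrightarrow> alg A {} = A"
  using alg_least[of A A "{}"] by (auto intro: alg_base)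

lemma ideal_inD:
  assumes "ideal_in B J"
  shows "a \<in> J \<Longrightarrow> a \<in> B" "0 \<in> J" "a \<in> J \<Longrightarrow> b \<in> J \<Longrightarrow> a + b \<in> J"
    "a \<in> B \<Longrightarrow> b \<in> J \<Longrightarrow> a * b \<in> J" "a \<in> J \<Longrightarrow> b \<in> B \<Longrightarrow> a * b \<in> J"
  using assms by (auto simp: ideal_in_def mult.commute)

lemma ideal_in_diff:
  assumes "is_subring B" "ideal_in B J" "a \<in> J" "b \<in> J"
  shows "a - b \<in> J"
proof -
  have "(- 1) * b \<in> J"
    using assms by (intro ideal_inD(4)[OF assms(2)] subring_uminus subring_1) auto
  then show ?thesis
    using ideal_inD(3)[OF assms(2) assms(3)] by fastforce
qed

lemma ideal_in_sum: "ideal_in B J \<Longrightarrow> (\<And>s. s \<in> S \<Longrightarrow> f s \<in> J) \<Longrightarrow> sum f S \<in> J"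
  by (induction S rule: infinite_finite_induct) (auto simp: ideal_in_def)

lemma prime_inD:
  assumes "prime_in B P"
  shows "ideal_in B P" "1 \<notin> P" "a \<in> B \<Longrightarrow> b \<in> B \<Longrightarrow> a * b \<in> P \<Longrightarrow> a \<in> P \<or> b \<in> P"
  using assms by (auto simp: prime_in_def)

lemma prime_in_power:
  assumes "is_subring B" "prime_in B P" "a \<in> B" "a ^ k \<in> P"
  shows "a \<in> P"
  using assms(4)
proof (induction k)
  case 0
  then show ?case using prime_inD(2)[OF assms(2)] by simp
next
  case (Suc k)
  then show ?case
    using prime_inD(3)[OF assms(2,3), of "a ^ k"] subring_power[OF assms(1,3)] by auto
qed

lemma prime_in_contract:
  assumes "prime_in B P" "is_subring A" "A \<subseteq> B"
  shows "prime_in A (P \<inter> A)"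
  unfolding prime_in_def ideal_in_def
proof (intro conjI ballI impI)
  fix a b assume "a \<in> A" "b \<in> A" "a * b \<in> P \<inter> A"
  then show "a \<in> P \<inter> A \<or> b \<in> P \<inter> A"
    using prime_inD(3)[OF assms(1), of a b] assms(3) by auto
qed (use assms in \<open>auto simp: prime_in_def ideal_in_def subring_intros\<close>)

text \<open>For a prime \<open>P\<close> this says that the class of \<open>x\<close> modulo
  \<open>P\<close> is transcendental over the fraction field of \<open>A\<close> modulo
  \<open>P\<close>, phrased without forming quotients or fractions.\<close>

definition transc :: "'b::comm_ring_1 set \<Rightarrow> 'b set \<Rightarrow> 'b \<Rightarrow> bool" where
  "transc P A x \<longleftrightarrow> (\<forall>p\<in>polys A. poly p x \<in> P \<longrightarrow> (\<forall>k. coeff p k \<in> P))"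

locale prime_ext =
  fixes B P A :: "'b::comm_ring_1 set" and x :: 'b
  assumes B: "is_subring B" and P: "prime_in B P" and A: "is_subring A"
    and AB: "A \<subseteq> B" and xB: "x \<in> B"
begin

lemma poly_in_B: "p \<in> polys A \<Longrightarrow> poly p x \<in> B"
  using poly_in_alg[OF A, of p x] alg_least[OF B AB, of "{x}"] xB by auto

lemma alg_subset_B: "alg A {x} \<subseteq> B"
  using alg_least[OF B AB, of "{x}"] xB by auto

lemma coeff_in_B: "p \<in> polys A \<Longrightarrow> coeff p k \<in> B"
  using AB by (auto simp: polys_def)

lemma poly_in_P:
  assumes "p \<in> polys A" "\<And>k. coeff p k \<in> P"
  shows "poly p x \<in> P"
proof -
  have "coeff p k * x ^ k \<in> P" for k
    using ideal_inD(5)[OF prime_inD(1)[OF P] assms(2)] subring_power[OF B xB] by blast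
  then show ?thesis
    unfolding poly_altdef by (intro ideal_in_sum[OF prime_inD(1)[OF P]])
qed

lemma coeffs_in_P:
  assumes min: "\<And>q. q \<in> polys A \<Longrightarrow> poly q x \<in> P \<Longrightarrow> lead_coeff q \<notin> P \<Longrightarrow> e \<le> degree q"
    and r: "r \<in> polys A" "poly r x \<in> P" "degree r < e"
  shows "coeff r k \<in> P"
proof (rule coeffs_in_ideal[where G = "\<lambda>p. poly p x \<in> P", OF A _ _ ideal_inD(2)[OF prime_inD(1)[OF P]] r])
  show "e \<le> degree q" if "q \<in> polys A" "poly q x \<in> P" "lead_coeff q \<notin> P" for q
    using min that by blast
  fix q c k assume "q \<in> polys A" "poly q x \<in> P" "c \<in> A" "c \<in> P"
  then show "poly (q - monom c k) x \<in> P"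
    using ideal_inD(5)[OF prime_inD(1)[OF P], of c "x ^ k"] subring_power[OF B xB]
    by (auto simp: poly_monom intro!: ideal_in_diff[OF B prime_inD(1)[OF P]])
qed

text \<open>Substitute for the minimal polynomial over the fraction field: least degree among the
  relations whose leading coefficient survives modulo \<open>P\<close>. If no relation had such a
  leading coefficient, \<open>coeffs_in_P\<close> would put all coefficients of every relation into
  \<open>P\<close>.\<close>

lemma minimal_relation:
  assumes "\<not> transc P A x"
  obtains q where "q \<in> polys A" "poly q x \<in> P" "lead_coeff q \<notin> P" "degree q > 0"
    "\<And>p. p \<in> polys A \<Longrightarrow> poly p x \<in> P \<Longrightarrow> lead_coeff p \<notin> P \<Longrightarrow> degree q \<le> degree p"
proof -
  define Q where "Q = {q \<in> polys A. poly q x \<in> P \<and> lead_coeff q \<notin> P}"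
  obtain p k where p: "p \<in> polys A" "poly p x \<in> P" "coeff p k \<notin> P"
    using assms by (auto simp: transc_def)
  have "Q \<noteq> {}"
  proof
    assume "Q = {}"
    \<comment> \<open>With no admissible relation every bound is valid;
      \<open>Suc (degree p)\<close> is one that exceeds the degree of \<open>p\<close>.\<close>
    then show False
      using coeffs_in_P[of "Suc (degree p)" p k] p by (auto simp: Q_def)
  qed
  then obtain q where q: "q \<in> Q" "\<And>p. p \<in> Q \<Longrightarrow> degree q \<le> degree p"
    using ex_has_least_nat[of "\<lambda>q. q \<in> Q" _ degree] by (metis all_not_in_conv)
  have "degree q > 0"
  proof (rule ccontr)
    assume "\<not> degree q > 0"
    then obtain c where "q = [:c:]" by (auto dest: degree_eq_zeroE)
    then show False using q(1) by (auto simp: Q_def)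
  qed
  then show ?thesis using that[of q] q by (auto simp: Q_def)
qed

text \<open>The pseudo-remainder of a relation is again a relation, of degree below the minimal one,
  hence trivial modulo \<open>P\<close>.\<close>

lemma multiple_of_minimal:
  assumes q: "q \<in> polys A" "poly q x \<in> P" "degree q > 0"
    and min: "\<And>p. p \<in> polys A \<Longrightarrow> poly p x \<in> P \<Longrightarrow> lead_coeff p \<notin> P \<Longrightarrow> degree q \<le> degree p"
    and f: "f \<in> polys A" "poly f x \<in> P"
  obtains N u r where "u \<in> polys A" "r \<in> polys A" "smult (lead_coeff q ^ N) f = q * u + r"
    "\<And>k. coeff r k \<in> P" "u = 0 \<or> degree u + degree q \<le> degree f"
proof -
  obtain N u r where *: "u \<in> polys A" "r \<in> polys A" "smult (lead_coeff q ^ N) f = q * u + r"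
    "degree r < degree q" "u = 0 \<or> degree u + degree q \<le> degree f"
    using pseudo_division[OF A q(1,3) f(1)] by blast
  have "poly r x = lead_coeff q ^ N * poly f x - poly q x * poly u x"
    using arg_cong[OF *(3), of "\<lambda>p. poly p x"] by simp
  also have "\<dots> \<in> P"
    using f q *(1) coeff_in_B poly_in_B
    by (intro ideal_in_diff[OF B prime_inD(1)[OF P]] ideal_inD(4)[OF prime_inD(1)[OF P]]
        subring_power[OF B] ideal_inD(5)[OF prime_inD(1)[OF P], of "poly q x"])
  finally have "coeff r k \<in> P" for k
    using coeffs_in_P[of "degree q" r k] min *(2,4) by blast
  then show ?thesis using * that by blast
qed

text \<open>The ideal generated by \<^term>\<open>P\<close> and \<^term>\<open>g\<close> is studied through an element of least degree over
  the fraction field of \<^term>\<open>A\<close> modulo \<^term>\<open>P\<close>; this is Bezout's identity without denominators.\<close>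

lemma algebraic_multiple_in_base:
  assumes alg: "\<not> transc P A x" and g: "g \<in> alg A {x}" "g \<notin> P"
  obtains h v where "h \<in> A" "h \<notin> P" "v \<in> alg A {x}" "h - v * g \<in> P"
proof -
  note PI = prime_inD(1)[OF P]
  note C = alg_subring[OF A, of "{x}"]
  have gB: "g \<in> B" using g alg_subset_B by blast
  obtain q where q: "q \<in> polys A" "poly q x \<in> P" "lead_coeff q \<notin> P" "degree q > 0"
    and qmin: "\<And>p. p \<in> polys A \<Longrightarrow> poly p x \<in> P \<Longrightarrow> lead_coeff p \<notin> P \<Longrightarrow> degree q \<le> degree p"
    using minimal_relation[OF alg] by blast
  define G where "G p \<longleftrightarrow> (\<exists>v\<in>alg A {x}. poly p x - v * g \<in> P)" for p
  have G_P: "G p" if "poly p x \<in> P" for p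
    using that subring_0[OF C] by (auto simp: G_def intro!: bexI[of _ 0])
  define J where "J = {s \<in> polys A. G s \<and> lead_coeff s \<notin> P}"
  have "q \<in> J" using q by (auto simp: J_def G_P)
  then obtain s where s: "s \<in> J" "\<And>p. p \<in> J \<Longrightarrow> degree s \<le> degree p"
    using ex_has_least_nat[of "\<lambda>q. q \<in> J" _ degree] by metis
  then have sA: "s \<in> polys A" and sG: "G s" and slead: "lead_coeff s \<notin> P" by (auto simp: J_def)
  \<comment> \<open>Once \<open>s\<close> is constant, its value is the required \<open>h\<close>.
    For positive degree, division of the minimal relation \<open>q\<close> by \<open>s\<close> shows
    that \<open>s\<close> or the quotient vanishes at \<open>x\<close> modulo \<open>P\<close>, and
    both are excluded.\<close>
  have "degree s = 0"
  proof (rule ccontr)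
    assume pos: "degree s \<noteq> 0"
    have div: "\<exists>N u r. u \<in> polys A \<and> r \<in> polys A \<and> smult (lead_coeff s ^ N) f = s * u + r
       \<and> (\<forall>k. coeff r k \<in> P) \<and> (u = 0 \<or> degree u + degree s \<le> degree f)"
      if f: "f \<in> polys A" "G f" for f
    proof -
      obtain N u r where *: "u \<in> polys A" "r \<in> polys A" "smult (lead_coeff s ^ N) f = s * u + r"
        "degree r < degree s" "u = 0 \<or> degree u + degree s \<le> degree f"
        using pseudo_division[OF A sA _ f(1)] pos by blast
      obtain v w where v: "v \<in> alg A {x}" "poly f x - v * g \<in> P"
        and w: "w \<in> alg A {x}" "poly s x - w * g \<in> P"
        using f(2) sG by (auto simp: G_def)
      have lC: "lead_coeff s \<in> alg A {x}" "poly u x \<in> alg A {x}"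
        using sA poly_in_alg[OF A *(1)] by (auto simp: polys_def intro: alg_base)
      have "poly r x = lead_coeff s ^ N * poly f x - poly s x * poly u x"
        using arg_cong[OF *(3), of "\<lambda>p. poly p x"] by simp
      then have "poly r x - (lead_coeff s ^ N * v - poly u x * w) * g
        = lead_coeff s ^ N * (poly f x - v * g) - poly u x * (poly s x - w * g)"
        by (simp add: algebra_simps)
      also have "\<dots> \<in> P"
        using lC alg_subset_B subring_power[OF B]
        by (intro ideal_in_diff[OF B PI] ideal_inD(4)[OF PI] v w) auto
      finally have "G r"
        unfolding G_def
        by (intro bexI[of _ "lead_coeff s ^ N * v - poly u x * w"] subring_diff[OF C]
            subring_mult[OF C] subring_power[OF C] lC v(1) w(1))
      have "coeff r k \<in> P" for k
      proof (rule coeffs_in_ideal[where G = G, OF A _ _ ideal_inD(2)[OF PI] *(2) \<open>G r\<close> *(4)])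
        fix p assume "p \<in> polys A" "G p" "lead_coeff p \<notin> P"
        then show "degree s \<le> degree p" using s(2) by (auto simp: J_def)
      next
        fix p c k assume p: "p \<in> polys A" "G p" "c \<in> A" "c \<in> P"
        then obtain v where v: "v \<in> alg A {x}" "poly p x - v * g \<in> P" by (auto simp: G_def)
        have "(poly p x - v * g) - c * x ^ k \<in> P"
          by (intro ideal_in_diff[OF B PI] v(2) ideal_inD(5)[OF PI p(4)] subring_power[OF B xB])
        then show "G (p - monom c k)"
          using v(1) unfolding G_def by (intro bexI[of _ v]) (auto simp: poly_monom algebra_simps)
      qed
      then show ?thesis using * by blast
    qed
    obtain N u r where qd: "u \<in> polys A" "r \<in> polys A" "smult (lead_coeff s ^ N) q = s * u + r"
      "\<forall>k. coeff r k \<in> P" "u = 0 \<or> degree u + degree s \<le> degree q"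
      using div[OF q(1) G_P[OF q(2)]] by blast
    have lB: "lead_coeff s \<in> B" "lead_coeff q \<in> B" by (rule coeff_in_B, fact)+
    have "poly s x * poly u x = lead_coeff s ^ N * poly q x - poly r x"
      using arg_cong[OF qd(3), of "\<lambda>p. poly p x"] by simp
    also have "\<dots> \<in> P"
      using ideal_inD(4)[OF PI subring_power[OF B lB(1)] q(2)] poly_in_P[OF qd(2)] qd(4)
      by (intro ideal_in_diff[OF B PI]) auto
    finally consider "poly s x \<in> P" | "poly u x \<in> P"
      using prime_inD(3)[OF P] poly_in_B sA qd by blast
    then show False
    proof cases
      case 1
      \<comment> \<open>A polynomial with value \<open>g\<close> satisfies \<open>G\<close>, so
        dividing it by \<open>s\<close> puts a power of the leading coefficient of \<open>s\<close>
        times \<open>g\<close> into \<open>P\<close>.\<close>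
      obtain f where f: "f \<in> polys A" "g = poly f x"
        using g(1) alg_singleton_iff[OF A] by blast
      have "G f"
        unfolding G_def using f subring_1[OF C] ideal_inD(2)[OF PI] by (intro bexI[of _ 1]) auto
      then obtain N u r where fd: "u \<in> polys A" "r \<in> polys A" "smult (lead_coeff s ^ N) f = s * u + r"
        "\<forall>k. coeff r k \<in> P"
        using div[OF f(1)] by blast
      have "lead_coeff s ^ N * g = poly s x * poly u x + poly r x"
        using arg_cong[OF fd(3), of "\<lambda>p. poly p x"] f by simp
      also have "\<dots> \<in> P"
        using ideal_inD(5)[OF PI 1 poly_in_B[OF fd(1)]] poly_in_P[OF fd(2)] fd(4)
        by (intro ideal_inD(3)[OF PI]) auto
      finally have "lead_coeff s ^ N \<in> P \<or> g \<in> P"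
        using prime_inD(3)[OF P] subring_power[OF B lB(1)] gB by blast
      then show False using prime_in_power[OF B P lB(1)] slead g(2) by blast
    next
      case 2
      \<comment> \<open>The degree of \<open>u\<close> is below that of \<open>q\<close>, so
        minimality of \<open>q\<close> kills \<open>u\<close> modulo \<open>P\<close>; then the
        leading coefficient of \<open>q\<close> would lie in \<open>P\<close>.\<close>
      have "coeff u k \<in> P" for k
      proof (cases "u = 0")
        case True
        then show ?thesis using ideal_inD(2)[OF PI] by simp
      next
        case False
        then have "degree u < degree q" using qd(5) pos by linarith
        then show ?thesis using coeffs_in_P[of "degree q" u k] qmin qd(1) 2 by blast
      qed
      then have "coeff (s * u) k \<in> P" for k
        unfolding coeff_mult using coeff_in_B[OF sA] by (intro ideal_in_sum[OF PI] ideal_inD(4)[OF PI]) auto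
      then have "coeff (smult (lead_coeff s ^ N) q) (degree q) \<in> P"
        unfolding qd(3) coeff_add using qd(4) by (blast intro: ideal_inD(3)[OF PI])
      then have "lead_coeff s ^ N \<in> P \<or> lead_coeff q \<in> P"
        using prime_inD(3)[OF P] subring_power[OF B lB(1)] lB by auto
      then show False using prime_in_power[OF B P lB(1)] slead q(3) by blast
    qed
  qed
  then obtain h where "s = [:h:]" by (auto dest: degree_eq_zeroE)
  then show ?thesis
    using that[of h] sA sG slead by (auto simp: G_def polys_def coeff_pCons split: nat.splits)
qed

text \<open>The extension sends \<open>poly p x\<close> to the value at \<open>c\<close> of the
  polynomial with mapped coefficients. The condition on \<open>c\<close> makes this independent of
  the choice of \<open>p\<close>, since the difference of two choices is a relation.\<close>

lemma hom_extension_by_value: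
  assumes \<phi>: "hom_on A \<phi>"
    and c: "\<And>p. p \<in> polys A \<Longrightarrow> poly p x \<in> P \<Longrightarrow> poly (map_poly \<phi> p) c = 0"
  shows "\<exists>\<psi>. hom_on (alg A {x}) \<psi> \<and> (\<forall>a\<in>A. \<psi> a = \<phi> a) \<and> \<psi> x = c
    \<and> (\<forall>a\<in>alg A {x}. a \<in> P \<longrightarrow> \<psi> a = 0)
    \<and> (\<forall>p\<in>polys A. \<psi> (poly p x) = poly (map_poly \<phi> p) c)"
proof -
  have \<phi>_add: "\<phi> (a + b) = \<phi> a + \<phi> b" and \<phi>_mult: "\<phi> (a * b) = \<phi> a * \<phi> b" if "a \<in> A" "b \<in> A" for a b
    using \<phi> that by (auto simp: hom_on_def)
  have "\<phi> 0 + \<phi> 0 = \<phi> 0 + 0" using \<phi>_add[of 0 0] subring_0[OF A] by (metis add.right_neutral)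
  then have \<phi>0: "\<phi> 0 = 0" by (rule add_left_imp_eq)
  have \<phi>_sum: "\<phi> (sum f S) = (\<Sum>s\<in>S. \<phi> (f s))" if "\<And>s. s \<in> S \<Longrightarrow> f s \<in> A" for f and S :: "nat set"
    using that by (induction S rule: infinite_finite_induct) (auto simp: \<phi>0 \<phi>_add subring_sum[OF A])
  have \<phi>_diff: "\<phi> (a - b) = \<phi> a - \<phi> b" if "a \<in> A" "b \<in> A" for a b
    using \<phi>_add[of "a - b" b] that subring_diff[OF A] by (simp add: algebra_simps)
  have co: "coeff p k \<in> A" if "p \<in> polys A" for p k using that by (auto simp: polys_def)
  note [simp] = coeff_map_poly[where f = \<phi>, OF \<phi>0]
  have map_add: "map_poly \<phi> (p + q) = map_poly \<phi> p + map_poly \<phi> q"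
    and map_diff: "map_poly \<phi> (p - q) = map_poly \<phi> p - map_poly \<phi> q" if "p \<in> polys A" "q \<in> polys A" for p q
    by (rule poly_eqI, simp add: \<phi>_add \<phi>_diff co that)+
  have map_mult: "map_poly \<phi> (p * q) = map_poly \<phi> p * map_poly \<phi> q" if "p \<in> polys A" "q \<in> polys A" for p q
  proof (rule poly_eqI)
    fix k
    have "\<phi> (coeff (p * q) k) = (\<Sum>l\<le>k. \<phi> (coeff p l * coeff q (k - l)))"
      unfolding coeff_mult using that by (intro \<phi>_sum subring_mult[OF A] co)
    also have "\<dots> = coeff (map_poly \<phi> p * map_poly \<phi> q) k"
      unfolding coeff_mult using that by (intro sum.cong refl) (simp add: \<phi>_mult co)
    finally show "coeff (map_poly \<phi> (p * q)) k = coeff (map_poly \<phi> p * map_poly \<phi> q) k" by simp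
  qed
  define \<psi> where "\<psi> y = poly (map_poly \<phi> (SOME p. p \<in> polys A \<and> y = poly p x)) c" for y
  have \<psi>: "\<psi> (poly p x) = poly (map_poly \<phi> p) c" if "p \<in> polys A" for p
  proof -
    define q where "q = (SOME q. q \<in> polys A \<and> poly p x = poly q x)"
    have q: "q \<in> polys A" "poly p x = poly q x"
      using someI[of "\<lambda>q. q \<in> polys A \<and> poly p x = poly q x" p] that by (auto simp: q_def)
    have "poly (map_poly \<phi> (q - p)) c = 0"
      using q that ideal_inD(2)[OF prime_inD(1)[OF P]] by (intro c polys_diff[OF A]) auto
    then show ?thesis using map_diff[OF q(1) that] unfolding \<psi>_def q_def by simp
  qed
  have const: "\<psi> a = \<phi> a" if "a \<in> A" for a
    using \<psi>[OF polys_const[OF A that]] by (simp add: map_poly_pCons \<phi>0)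
  show ?thesis
  proof (intro exI[of _ \<psi>] conjI ballI impI)
    show "hom_on (alg A {x}) \<psi>"
      unfolding hom_on_def
    proof (intro conjI ballI)
      show "\<psi> 1 = 1" using const subring_1[OF A] \<phi> by (simp add: hom_on_def)
      fix a b assume "a \<in> alg A {x}" "b \<in> alg A {x}"
      then obtain p q where pq: "p \<in> polys A" "a = poly p x" "q \<in> polys A" "b = poly q x"
        by (auto simp: alg_singleton_iff[OF A])
      show "\<psi> (a + b) = \<psi> a + \<psi> b"
        using \<psi>[OF polys_add[OF A pq(1,3)]] \<psi>[OF pq(1)] \<psi>[OF pq(3)] pq by (simp add: map_add)
      show "\<psi> (a * b) = \<psi> a * \<psi> b"
        using \<psi>[OF polys_mult[OF A pq(1,3)]] \<psi>[OF pq(1)] \<psi>[OF pq(3)] pq by (simp add: map_mult)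
    qed
    have "[:0, 1:] \<in> polys A" by (intro polys_pCons[OF A] polys_0[OF A] subring_intros[OF A])
    then show "\<psi> x = c" using \<psi>[of "[:0,1:]"] \<phi> by (simp add: map_poly_pCons \<phi>0 hom_on_def)
    fix a assume "a \<in> alg A {x}" "a \<in> P"
    then show "\<psi> a = 0" using \<psi> c by (auto simp: alg_singleton_iff[OF A])
  qed (use const \<psi> in auto)
qed

text \<open>If \<open>x\<close> is transcendental, \<open>h\<close> is a coefficient of a polynomial
  for \<open>g\<close> outside \<open>P\<close>: the specialised polynomial is then nonzero, and
  some value of \<open>x\<close> avoids its roots. If \<open>x\<close> is algebraic,
  \<open>h\<close> is the product of the leading coefficient of a minimal relation, which must
  survive for a root to exist, and of an element of \<open>A\<close> that is a multiple of
  \<open>g\<close> modulo \<open>P\<close>, which keeps \<open>g\<close> nonzero.\<close>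

lemma hom_extension:
  fixes \<phi>0 :: "'b \<Rightarrow> 'a::field_char_0"
  assumes alg_closed: "\<And>p::'a poly. degree p > 0 \<Longrightarrow> \<exists>x. poly p x = 0"
    and g: "g \<in> alg A {x}" "g \<notin> P"
  obtains h where "h \<in> A" "h \<notin> P"
    "\<And>\<phi> :: 'b \<Rightarrow> 'a. hom_on A \<phi> \<Longrightarrow> (\<And>a. a \<in> A \<Longrightarrow> a \<in> P \<Longrightarrow> \<phi> a = 0) \<Longrightarrow> \<phi> h \<noteq> 0 \<Longrightarrow>
      \<exists>\<psi>. hom_on (alg A {x}) \<psi> \<and> (\<forall>a\<in>A. \<psi> a = \<phi> a) \<and> (\<forall>a\<in>alg A {x}. a \<in> P \<longrightarrow> \<psi> a = 0) \<and> \<psi> g \<noteq> 0"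
proof (cases "transc P A x")
  case True
  obtain G where G: "G \<in> polys A" "g = poly G x"
    using g(1) alg_singleton_iff[OF A] by blast
  obtain k where k: "coeff G k \<notin> P" using poly_in_P[OF G(1)] G(2) g(2) by blast
  show ?thesis
  proof (rule that[of "coeff G k"])
    fix \<phi> :: "'b \<Rightarrow> 'a"
    assume \<phi>: "hom_on A \<phi>" "\<And>a. a \<in> A \<Longrightarrow> a \<in> P \<Longrightarrow> \<phi> a = 0" "\<phi> (coeff G k) \<noteq> 0"
    have \<phi>0: "\<phi> 0 = 0" using \<phi>(2)[OF subring_0[OF A]] ideal_inD(2)[OF prime_inD(1)[OF P]] by simp
    have "map_poly \<phi> G \<noteq> 0" using \<phi>(3) by (metis \<phi>0 coeff_map_poly coeff_0)
    then obtain c where c: "poly (map_poly \<phi> G) c \<noteq> 0"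
      using poly_all_0_iff_0 by blast
    have "poly (map_poly \<phi> p) c = 0" if "p \<in> polys A" "poly p x \<in> P" for p
    proof -
      have "map_poly \<phi> p = 0"
        using that True \<phi>(2) by (intro poly_eqI) (auto simp: coeff_map_poly \<phi>0 transc_def polys_def)
      then show ?thesis by simp
    qed
    then have "\<exists>\<psi>. hom_on (alg A {x}) \<psi> \<and> (\<forall>a\<in>A. \<psi> a = \<phi> a) \<and> \<psi> x = c
      \<and> (\<forall>a\<in>alg A {x}. a \<in> P \<longrightarrow> \<psi> a = 0)
      \<and> (\<forall>p\<in>polys A. \<psi> (poly p x) = poly (map_poly \<phi> p) c)"
      by (intro hom_extension_by_value \<phi>(1))
    then obtain \<psi> where \<psi>: "hom_on (alg A {x}) \<psi>" "\<forall>a\<in>A. \<psi> a = \<phi> a"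
      "\<forall>a\<in>alg A {x}. a \<in> P \<longrightarrow> \<psi> a = 0"
      "\<forall>p\<in>polys A. \<psi> (poly p x) = poly (map_poly \<phi> p) c" by (elim exE conjE)
    then show "\<exists>\<psi>. hom_on (alg A {x}) \<psi> \<and> (\<forall>a\<in>A. \<psi> a = \<phi> a) \<and> (\<forall>a\<in>alg A {x}. a \<in> P \<longrightarrow> \<psi> a = 0) \<and> \<psi> g \<noteq> 0"
      unfolding G(2) using c G(1) \<psi> by (intro exI[of _ \<psi>] conjI) simp_all
  qed (use G k in \<open>auto simp: polys_def\<close>)
next
  case False
  note PI = prime_inD(1)[OF P]
  obtain q where q: "q \<in> polys A" "poly q x \<in> P" "lead_coeff q \<notin> P" "degree q > 0"
    and qmin: "\<And>p. p \<in> polys A \<Longrightarrow> poly p x \<in> P \<Longrightarrow> lead_coeff p \<notin> P \<Longrightarrow> degree q \<le> degree p"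
    using minimal_relation[OF False] by blast
  obtain h v where h: "h \<in> A" "h \<notin> P" "v \<in> alg A {x}" "h - v * g \<in> P"
    using algebraic_multiple_in_base[OF False g] by blast
  have qA: "lead_coeff q \<in> A" using q by (auto simp: polys_def)
  show ?thesis
  proof (rule that[of "lead_coeff q * h"])
    show "lead_coeff q * h \<in> A" using qA h by (intro subring_mult[OF A])
    show "lead_coeff q * h \<notin> P"
      using prime_inD(3)[OF P, of "lead_coeff q" h] qA h q AB by auto
    fix \<phi> :: "'b \<Rightarrow> 'a"
    assume \<phi>: "hom_on A \<phi>" "\<And>a. a \<in> A \<Longrightarrow> a \<in> P \<Longrightarrow> \<phi> a = 0" "\<phi> (lead_coeff q * h) \<noteq> 0"
    have \<phi>0: "\<phi> 0 = 0" using \<phi>(2)[OF subring_0[OF A]] ideal_inD(2)[OF PI] by simp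
    have \<phi>_nz: "\<phi> (lead_coeff q) \<noteq> 0" "\<phi> h \<noteq> 0"
      using \<phi>(1,3) qA h by (auto simp: hom_on_def)
    \<comment> \<open>Nonvanishing of the leading coefficient keeps the degree positive, so
      algebraic closedness provides the value \<open>c\<close> of \<open>x\<close>.\<close>
    have "degree (map_poly \<phi> q) = degree q"
      using \<phi>_nz by (intro antisym map_poly_degree_leq le_degree) (simp add: coeff_map_poly \<phi>0)
    then obtain c where c: "poly (map_poly \<phi> q) c = 0" using alg_closed q(4) by metis
    \<comment> \<open>Up to a power of the leading coefficient every relation is a multiple of
      \<open>q\<close> plus terms with coefficients in \<open>P\<close>, so the root
      \<open>c\<close> of \<open>q\<close> is a root of all of them.\<close>
    have "poly (map_poly \<phi> f) c = 0" if f: "f \<in> polys A" "poly f x \<in> P" for f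
    proof -
      obtain N u r where u: "u \<in> polys A" "r \<in> polys A" "smult (lead_coeff q ^ N) f = q * u + r"
        "\<And>k. coeff r k \<in> P"
      proof (rule multiple_of_minimal[OF q(1,2,4) _ f])
        show "degree q \<le> degree p" if "p \<in> polys A" "poly p x \<in> P" "lead_coeff p \<notin> P" for p
          using qmin that by blast
      qed blast
      have hom: "\<phi> (a + b) = \<phi> a + \<phi> b" "\<phi> (a * b) = \<phi> a * \<phi> b" if "a \<in> A" "b \<in> A" for a b
        using \<phi>(1) that by (auto simp: hom_on_def)
      have co: "coeff p k \<in> A" if "p \<in> polys A" for p k using that by (auto simp: polys_def)
      have sum: "\<phi> (sum f S) = (\<Sum>s\<in>S. \<phi> (f s))" if "\<And>s. s \<in> S \<Longrightarrow> f s \<in> A" for f and S :: "nat set"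
        using that by (induction S rule: infinite_finite_induct) (auto simp: \<phi>0 hom subring_sum[OF A])
      have pow: "\<phi> (lead_coeff q ^ N) = \<phi> (lead_coeff q) ^ N"
        using \<phi>(1) by (induction N) (auto simp: hom_on_def qA subring_power[OF A qA])
      have "map_poly \<phi> (smult (lead_coeff q ^ N) f) = map_poly \<phi> q * map_poly \<phi> u"
        unfolding u(3)
      proof (rule poly_eqI)
        fix k
        have "\<phi> (coeff r k) = 0" using \<phi>(2) u(2,4) co by blast
        then show "coeff (map_poly \<phi> (q * u + r)) k = coeff (map_poly \<phi> q * map_poly \<phi> u) k"
        proof -
          have "\<phi> (coeff (q * u) k) = (\<Sum>l\<le>k. \<phi> (coeff q l * coeff u (k - l)))"
            unfolding coeff_mult using q u by (intro sum subring_mult[OF A] co)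
          also have "\<dots> = coeff (map_poly \<phi> q * map_poly \<phi> u) k"
            unfolding coeff_mult using q u by (intro sum.cong refl) (simp add: coeff_map_poly \<phi>0 hom co)
          finally show ?thesis
            using \<open>\<phi> (coeff r k) = 0\<close> hom(1)[of "coeff (q * u) k" "coeff r k"]
              co[OF polys_mult[OF A q(1) u(1)], of k] co[OF u(2), of k]
            by (simp add: coeff_map_poly \<phi>0)
        qed
      qed
      moreover have "map_poly \<phi> (smult (lead_coeff q ^ N) f) = smult (\<phi> (lead_coeff q) ^ N) (map_poly \<phi> f)"
        using co[OF f(1)] subring_power[OF A qA]
        by (intro poly_eqI) (simp add: coeff_map_poly \<phi>0 hom pow)
      ultimately have "poly (smult (\<phi> (lead_coeff q) ^ N) (map_poly \<phi> f)) c = 0"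
        using c by simp
      then show ?thesis using \<phi>_nz by simp
    qed
    then have "\<exists>\<psi>. hom_on (alg A {x}) \<psi> \<and> (\<forall>a\<in>A. \<psi> a = \<phi> a) \<and> \<psi> x = c
      \<and> (\<forall>a\<in>alg A {x}. a \<in> P \<longrightarrow> \<psi> a = 0)
      \<and> (\<forall>p\<in>polys A. \<psi> (poly p x) = poly (map_poly \<phi> p) c)"
      by (intro hom_extension_by_value \<phi>(1))
    then obtain \<psi> where \<psi>: "hom_on (alg A {x}) \<psi>" "\<forall>a\<in>A. \<psi> a = \<phi> a"
      "\<forall>a\<in>alg A {x}. a \<in> P \<longrightarrow> \<psi> a = 0" by (elim exE conjE)
    \<comment> \<open>Modulo \<open>P\<close> the element \<open>h\<close> is a multiple of
      \<open>g\<close>, so \<open>\<psi> g = 0\<close> would give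
      \<open>\<phi> h = 0\<close>.\<close>
    have "\<psi> g \<noteq> 0"
    proof
      assume "\<psi> g = 0"
      have C: "is_subring (alg A {x})" by (rule alg_subring[OF A])
      have in_alg: "h \<in> alg A {x}" "v * g \<in> alg A {x}" "h - v * g \<in> alg A {x}"
        using h g by (auto intro: alg_base subring_mult[OF C] subring_diff[OF C])
      have "\<psi> ((h - v * g) + v * g) = \<psi> (h - v * g) + \<psi> (v * g)"
        using \<psi>(1) in_alg unfolding hom_on_def by blast
      then have "\<psi> h = \<psi> (h - v * g) + \<psi> (v * g)" by simp
      also have "\<dots> = 0"
        using \<psi>(1,3) in_alg h g \<open>\<psi> g = 0\<close> by (auto simp: hom_on_def)
      finally show False using \<psi>(2) h \<phi>_nz by simp
    qed
    then show "\<exists>\<psi>. hom_on (alg A {x}) \<psi> \<and> (\<forall>a\<in>A. \<psi> a = \<phi> a) \<and> (\<forall>a\<in>alg A {x}. a \<in> P \<longrightarrow> \<psi> a = 0) \<and> \<psi> g \<noteq> 0"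
      using \<psi> by blast
  qed
qed

end

section \<open>Finitely many generators: specialisation and multiples in the base\<close>

lemma transc_antimono: "transc P A' x \<Longrightarrow> A \<subseteq> A' \<Longrightarrow> transc P A x"
  by (auto simp: transc_def polys_def)

text \<open>Chevalley's theorem on images in algebraic form. The element \<open>h1\<close> that has
  to stay nonzero on one level becomes the element \<open>g\<close> of the level below.\<close>

lemma finite_alg_hom_extension:
  assumes alg_closed: "\<And>p::'a::field_char_0 poly. degree p > 0 \<Longrightarrow> \<exists>x. poly p x = 0"
    and B: "is_subring B" "prime_in B P" and A: "is_subring A" "A \<subseteq> B"
    and X: "finite X" "X \<subseteq> B" and g: "g \<in> alg A X" "g \<notin> P"
  shows "\<exists>h\<in>A. h \<notin> P \<and> (\<forall>\<phi> :: _ \<Rightarrow> 'a. hom_on A \<phi> \<and> (\<forall>a\<in>A. a \<in> P \<longrightarrow> \<phi> a = 0) \<and> \<phi> h \<noteq> 0 \<longrightarrow>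
    (\<exists>\<psi>. hom_on (alg A X) \<psi> \<and> (\<forall>a\<in>A. \<psi> a = \<phi> a) \<and> (\<forall>a\<in>alg A X. a \<in> P \<longrightarrow> \<psi> a = 0) \<and> \<psi> g \<noteq> 0))"
  using X g
proof (induction X arbitrary: g rule: finite_induct)
  case empty
  then show ?case by (auto simp: alg_empty[OF A(1)])
next
  case (insert x X)
  define C where "C = alg A X"
  have eq: "alg A (insert x X) = alg C {x}" by (simp add: C_def alg_alg)
  interpret E: prime_ext B P C x
    using B A insert.prems alg_least[OF B(1) A(2)] alg_subring[OF A(1)]
    by unfold_locales (auto simp: C_def)
  have gC: "g \<in> alg C {x}" using insert.prems eq by simp
  obtain h1 where h1: "h1 \<in> C" "h1 \<notin> P" and ext: "\<And>\<phi> :: _ \<Rightarrow> 'a. hom_on C \<phi> \<Longrightarrow>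
      (\<And>a. a \<in> C \<Longrightarrow> a \<in> P \<Longrightarrow> \<phi> a = 0) \<Longrightarrow> \<phi> h1 \<noteq> 0 \<Longrightarrow>
      \<exists>\<psi>. hom_on (alg C {x}) \<psi> \<and> (\<forall>a\<in>C. \<psi> a = \<phi> a) \<and> (\<forall>a\<in>alg C {x}. a \<in> P \<longrightarrow> \<psi> a = 0) \<and> \<psi> g \<noteq> 0"
  proof (rule E.hom_extension[where 'a = 'a, OF _ gC insert.prems(3)])
    show "\<exists>x. poly p x = 0" if "0 < degree p" for p :: "'a poly"
      using alg_closed that by blast
  qed (use that in blast)
  obtain h where h: "h \<in> A" "h \<notin> P" and ext': "\<And>\<phi> :: _ \<Rightarrow> 'a. hom_on A \<phi> \<Longrightarrow> (\<forall>a\<in>A. a \<in> P \<longrightarrow> \<phi> a = 0) \<Longrightarrow> \<phi> h \<noteq> 0 \<Longrightarrow>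
    (\<exists>\<psi>. hom_on C \<psi> \<and> (\<forall>a\<in>A. \<psi> a = \<phi> a) \<and> (\<forall>a\<in>C. a \<in> P \<longrightarrow> \<psi> a = 0) \<and> \<psi> h1 \<noteq> 0)"
    using insert.IH[of h1] insert.prems h1 unfolding C_def by auto
  show ?case
  proof (intro bexI[OF _ h(1)] conjI[OF h(2)] allI impI, elim conjE)
    fix \<phi> :: "_ \<Rightarrow> 'a"
    assume \<phi>: "hom_on A \<phi>" "\<forall>a\<in>A. a \<in> P \<longrightarrow> \<phi> a = 0" "\<phi> h \<noteq> 0"
    obtain \<psi>1 where \<psi>1: "hom_on C \<psi>1" "\<forall>a\<in>A. \<psi>1 a = \<phi> a" "\<forall>a\<in>C. a \<in> P \<longrightarrow> \<psi>1 a = 0" "\<psi>1 h1 \<noteq> 0"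
      using ext'[OF \<phi>] by blast
    obtain \<psi> where \<psi>: "hom_on (alg C {x}) \<psi>" "\<forall>a\<in>C. \<psi> a = \<psi>1 a"
      "\<forall>a\<in>alg C {x}. a \<in> P \<longrightarrow> \<psi> a = 0" "\<psi> g \<noteq> 0"
      using ext[OF \<psi>1(1) _ \<psi>1(4)] \<psi>1(3) by blast
    have "A \<subseteq> C" unfolding C_def by (auto intro: alg_base)
    then have "\<forall>a\<in>A. \<psi> a = \<phi> a"
      using \<psi>(2) \<psi>1(2) by auto
    then show "\<exists>\<psi>. hom_on (alg A (insert x X)) \<psi> \<and> (\<forall>a\<in>A. \<psi> a = \<phi> a)
      \<and> (\<forall>a\<in>alg A (insert x X). a \<in> P \<longrightarrow> \<psi> a = 0) \<and> \<psi> g \<noteq> 0"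
      unfolding eq using \<psi> by blast
  qed
qed

text \<open>An element algebraic over \<open>A\<close> stays algebraic over each intermediate
  algebra, so \<open>algebraic_multiple_in_base\<close> applies to one generator at a time, and the
  multipliers are multiplied.\<close>

lemma finite_alg_multiple_in_base:
  assumes B: "is_subring B" "prime_in B P" and A: "is_subring A" "A \<subseteq> B"
    and X: "finite X" "X \<subseteq> B" "\<And>x. x \<in> X \<Longrightarrow> \<not> transc P A x" and g: "g \<in> alg A X" "g \<notin> P"
  shows "\<exists>h\<in>A. h \<notin> P \<and> (\<exists>v\<in>alg A X. h - v * g \<in> P)"
  using X g
proof (induction X arbitrary: g rule: finite_induct)
  case empty
  then show ?case
    using ideal_inD(2)[OF prime_inD(1)[OF B(2)]]
    by (intro bexI[of _ g] conjI bexI[of _ 1]) (auto simp: alg_empty[OF A(1)] subring_1[OF A(1)])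
next
  case (insert x X)
  define C where "C = alg A X"
  have eq: "alg A (insert x X) = alg C {x}" by (simp add: C_def alg_alg)
  interpret E: prime_ext B P C x
    using B A insert.prems alg_least[OF B(1) A(2)] alg_subring[OF A(1)]
    by unfold_locales (auto simp: C_def)
  have "\<not> transc P C x"
    using insert.prems(2)[of x] transc_antimono[of P C x A] by (auto simp: C_def intro: alg_base)
  then obtain h1 v1 where h1: "h1 \<in> C" "h1 \<notin> P" "v1 \<in> alg C {x}" "h1 - v1 * g \<in> P"
    using E.algebraic_multiple_in_base[of g] insert.prems eq by metis
  obtain h v where h: "h \<in> A" "h \<notin> P" "v \<in> C" "h - v * h1 \<in> P"
    using insert.IH[of h1] insert.prems h1 unfolding C_def by auto
  have "v * (h1 - v1 * g) \<in> P"
    using h h1 E.AB by (intro ideal_inD(4)[OF prime_inD(1)[OF B(2)]]) auto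
  from ideal_inD(3)[OF prime_inD(1)[OF B(2)] h(4) this] have "h - (v * v1) * g \<in> P"
    by (simp add: algebra_simps)
  moreover have "v * v1 \<in> alg C {x}"
    using h h1 by (intro alg_mult) (auto intro: alg_base)
  ultimately show ?case using h eq by auto
qed

text \<open>Over an algebraic extension a strict enlargement of a prime already shows in the base: a
  multiple of \<open>g\<close> agrees modulo \<open>P\<close> with some \<open>h\<close> in
  \<open>A\<close> outside \<open>P\<close>.\<close>

lemma ideal_meets_base:
  assumes B: "is_subring B" "prime_in B P" and A: "is_subring A" "A \<subseteq> B"
    and X: "finite X" "X \<subseteq> B" "\<And>x. x \<in> X \<Longrightarrow> \<not> transc P A x"
    and Q: "ideal_in B Q" "P \<subseteq> Q" and g: "g \<in> alg A X" "g \<in> Q" "g \<notin> P"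
  shows "\<exists>h\<in>A. h \<in> Q \<and> h \<notin> P"
proof -
  obtain h v where h: "h \<in> A" "h \<notin> P" "v \<in> alg A X" "h - v * g \<in> P"
    using finite_alg_multiple_in_base[OF B A X g(1,3)] by blast
  have "(h - v * g) + v * g \<in> Q"
    using h g Q alg_least[OF B(1) A(2) X(2)] by (intro ideal_inD(3)[OF Q(1)] ideal_inD(4)[OF Q(1)]) auto
  then show ?thesis using h by auto
qed

section \<open>Primes avoiding a multiplicative set, and bounded chains\<close>

lemma ideal_in_insert:
  assumes B: "is_subring B" and J: "ideal_in B J" and a: "a \<in> B"
  shows "ideal_in B {p + r * a |p r. p \<in> J \<and> r \<in> B}" "J \<subseteq> {p + r * a |p r. p \<in> J \<and> r \<in> B}"
    "a \<in> {p + r * a |p r. p \<in> J \<and> r \<in> B}"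
proof -
  note JD = ideal_inD[OF J]
  show "J \<subseteq> {p + r * a |p r. p \<in> J \<and> r \<in> B}"
  proof
    fix p assume "p \<in> J"
    moreover have "p = p + 0 * a" by simp
    ultimately show "p \<in> {p + r * a |p r. p \<in> J \<and> r \<in> B}" using subring_0[OF B] by blast
  qed
  show "a \<in> {p + r * a |p r. p \<in> J \<and> r \<in> B}"
    using subring_1[OF B] JD(2) by (intro CollectI exI[of _ 0] exI[of _ 1]) simp
  show "ideal_in B {p + r * a |p r. p \<in> J \<and> r \<in> B}"
    unfolding ideal_in_def
  proof (intro conjI ballI)
    show "{p + r * a |p r. p \<in> J \<and> r \<in> B} \<subseteq> B"
      using JD(1) a by (auto intro!: subring_add[OF B] subring_mult[OF B])
    show "0 \<in> {p + r * a |p r. p \<in> J \<and> r \<in> B}"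
      using subring_0[OF B] JD(2) by (auto intro!: exI[of _ 0])
  next
    fix x y assume "x \<in> {p + r * a |p r. p \<in> J \<and> r \<in> B}" "y \<in> {p + r * a |p r. p \<in> J \<and> r \<in> B}"
    then obtain p r p' r' where *: "x = p + r * a" "y = p' + r' * a" "p \<in> J" "p' \<in> J" "r \<in> B" "r' \<in> B" by auto
    have "x + y = (p + p') + (r + r') * a" by (simp add: * algebra_simps)
    then show "x + y \<in> {p + r * a |p r. p \<in> J \<and> r \<in> B}"
      using * JD(3) subring_add[OF B] by blast
  next
    fix x y assume "x \<in> B" "y \<in> {p + r * a |p r. p \<in> J \<and> r \<in> B}"
    then obtain p r where *: "x \<in> B" "y = p + r * a" "p \<in> J" "r \<in> B" by auto
    have "x * y = x * p + (x * r) * a" by (simp add: * algebra_simps)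
    then show "x * y \<in> {p + r * a |p r. p \<in> J \<and> r \<in> B}"
      using * JD(4) subring_mult[OF B] by blast
  qed
qed

text \<open>Zorn's lemma gives an ideal maximal among those that contain \<open>J\<close> and miss
  \<open>S\<close>; such an ideal is prime.\<close>

lemma exists_prime_avoiding:
  assumes B: "is_subring B" and J: "ideal_in B J"
    and S: "S \<subseteq> B" "1 \<in> S" "\<And>a b. a \<in> S \<Longrightarrow> b \<in> S \<Longrightarrow> a * b \<in> S" "S \<inter> J = {}"
  obtains Q where "prime_in B Q" "J \<subseteq> Q" "Q \<inter> S = {}"
proof -
  define \<A> where "\<A> = {I. ideal_in B I \<and> J \<subseteq> I \<and> I \<inter> S = {}}"
  have "\<A> \<noteq> {}" using J S(4) by (auto simp: \<A>_def)
  moreover have "\<Union>\<C> \<in> \<A>" if "\<C> \<noteq> {}" and ch: "subset.chain \<A> \<C>" for \<C>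
  proof -
    have sub: "\<C> \<subseteq> \<A>" and lin: "\<And>X Y. X \<in> \<C> \<Longrightarrow> Y \<in> \<C> \<Longrightarrow> X \<subseteq> Y \<or> Y \<subseteq> X"
      using ch by (auto simp: subset.chain_def)
    then have id: "ideal_in B I" if "I \<in> \<C>" for I using that by (auto simp: \<A>_def)
    have "ideal_in B (\<Union>\<C>)"
      unfolding ideal_in_def
    proof (intro conjI ballI)
      show "\<Union>\<C> \<subseteq> B" using ideal_inD(1)[OF id] by blast
      show "0 \<in> \<Union>\<C>" using ideal_inD(2)[OF id] \<open>\<C> \<noteq> {}\<close> by blast
      fix a b assume "a \<in> \<Union>\<C>" "b \<in> \<Union>\<C>"
      then obtain X Y where "X \<in> \<C>" "Y \<in> \<C>" "a \<in> X" "b \<in> Y" by blast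
      then obtain Z where "Z \<in> \<C>" "a \<in> Z" "b \<in> Z" using lin by blast
      then show "a + b \<in> \<Union>\<C>" using ideal_inD(3)[OF id] by blast
    next
      fix a b assume "a \<in> B" "b \<in> \<Union>\<C>"
      then show "a * b \<in> \<Union>\<C>" using ideal_inD(4)[OF id] by blast
    qed
    then show ?thesis using sub \<open>\<C> \<noteq> {}\<close> by (auto simp: \<A>_def)
  qed
  ultimately obtain Q where Q: "Q \<in> \<A>" and max: "\<And>X. X \<in> \<A> \<Longrightarrow> Q \<subseteq> X \<Longrightarrow> X = Q"
    using subset_Zorn_nonempty[of \<A>] by blast
  have QI: "ideal_in B Q" and JQ: "J \<subseteq> Q" and QS: "Q \<inter> S = {}" using Q by (auto simp: \<A>_def)
  \<comment> \<open>By maximality the ideal enlarged by an outside element must meet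
    \<open>S\<close>.\<close>
  have hit: "\<exists>p\<in>Q. \<exists>r\<in>B. p + r * a \<in> S" if "a \<in> B" "a \<notin> Q" for a
  proof (rule ccontr)
    assume no: "\<not> ?thesis"
    have "{p + r * a |p r. p \<in> Q \<and> r \<in> B} \<in> \<A>"
      using ideal_in_insert[OF B QI that(1)] JQ no unfolding \<A>_def by blast
    then show False using max ideal_in_insert[OF B QI that(1)] that(2) by blast
  qed
  have "prime_in B Q"
    unfolding prime_in_def
  proof (intro conjI ballI impI QI)
    show "1 \<notin> Q" using QS S(2) by blast
    fix a b assume ab: "a \<in> B" "b \<in> B" "a * b \<in> Q"
    show "a \<in> Q \<or> b \<in> Q"
    proof (rule ccontr)
      assume "\<not> (a \<in> Q \<or> b \<in> Q)"
      then obtain p r p' r' where *: "p \<in> Q" "r \<in> B" "p + r * a \<in> S" "p' \<in> Q" "r' \<in> B" "p' + r' * b \<in> S"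
        using hit ab by meson
      \<comment> \<open>A product of two elements of \<open>S\<close>, which lies in
        \<open>Q\<close> as soon as \<open>a * b\<close> does.\<close>
      have "(p + r * a) * (p' + r' * b) = (p' + r' * b) * p + ((r * a) * p' + (r * r') * (a * b))"
        by (simp add: algebra_simps)
      also have "\<dots> \<in> Q"
        using * S(1) ideal_inD(4)[OF QI subring_mult[OF B *(2,5)] ab(3)]
          ideal_inD(4)[OF QI subring_mult[OF B *(2) ab(1)] *(4)]
        by (intro ideal_inD(3)[OF QI] ideal_inD(4)[OF QI _ *(1)]) auto
      finally show False using S(3) * QS by blast
    qed
  qed
  then show ?thesis using that JQ QS by blast
qed

definition prime_chain :: "'b::comm_ring_1 set \<Rightarrow> (nat \<Rightarrow> 'b set) \<Rightarrow> nat \<Rightarrow> bool" where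
  "prime_chain B c k \<longleftrightarrow> (\<forall>l\<le>k. prime_in B (c l)) \<and> (\<forall>l<k. c l \<subset> c (Suc l))"

text \<open>Three successive primes of \<open>alg A {x}\<close> cannot all have the same trace on
  \<open>A\<close>. Every second member of a chain therefore gives a strict chain in
  \<open>A\<close>, whence \<open>2 * N + 1\<close>.\<close>

lemma prime_chain_bound_step:
  assumes A: "is_subring A" and N: "\<And>c k. prime_chain A c k \<Longrightarrow> k \<le> N"
    and c: "prime_chain (alg A {x}) c k"
  shows "k \<le> 2 * N + 1"
proof (rule ccontr)
  assume "\<not> ?thesis"
  then have k: "2 * N + 2 \<le> k" by simp
  define B where "B = alg A {x}"
  have B: "is_subring B" "A \<subseteq> B" "x \<in> B"
    using alg_subring[OF A] by (auto simp: B_def intro: alg.intros)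
  define c' where "c' l = c (2 * l) \<inter> A" for l
  have pr: "prime_in B (c l)" if "l \<le> k" for l using c that by (simp add: prime_chain_def B_def)
  have step: "c l \<subset> c (Suc l)" if "l < k" for l using c that by (simp add: prime_chain_def)
  have "prime_chain A c' (Suc N)"
    unfolding prime_chain_def
  proof (intro conjI allI impI)
    fix l assume "l \<le> Suc N"
    then show "prime_in A (c' l)"
      unfolding c'_def using k by (intro prime_in_contract[OF pr A B(2)]) auto
  next
    fix l assume l: "l < Suc N"
    define P0 P1 P2 where "P0 = c (2 * l)" and "P1 = c (Suc (2 * l))" and "P2 = c (Suc (Suc (2 * l)))"
    have prs: "prime_in B P0" "prime_in B P1" "prime_in B P2"
      using l k by (auto simp: P0_def P1_def P2_def intro!: pr)
    have sub: "P0 \<subset> P1" "P1 \<subset> P2"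
      unfolding P0_def P1_def P2_def using l k by (auto intro!: step simp del: psubsetI)
    \<comment> \<open>If \<open>x\<close> is transcendental modulo \<open>P1\<close>, all
      coefficients of an element of \<open>P1\<close> lie in \<open>P1\<close>, and one of them is
      outside \<open>P0\<close> when the element is. If \<open>x\<close> is algebraic,
      \<open>ideal_meets_base\<close> separates \<open>P1\<close> from \<open>P2\<close> over
      \<open>A\<close>.\<close>
    have "\<exists>h\<in>A. h \<in> P2 \<and> h \<notin> P0"
    proof (cases "transc P1 A x")
      case True
      interpret E: prime_ext B P0 A x by unfold_locales (use B prs A in auto)
      obtain g where g: "g \<in> P1" "g \<notin> P0" using sub by blast
      then obtain G where G: "G \<in> polys A" "g = poly G x"
        using ideal_inD(1)[OF prime_inD(1)[OF prs(2)]] alg_singleton_iff[OF A] unfolding B_def by blast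
      obtain k where "coeff G k \<notin> P0" using E.poly_in_P[OF G(1)] G(2) g(2) by blast
      moreover have "coeff G k \<in> P1" "coeff G k \<in> A" using True G g by (auto simp: transc_def polys_def)
      ultimately show ?thesis using sub by blast
    next
      case False
      obtain g where g: "g \<in> P2" "g \<notin> P1" using sub by blast
      have "\<exists>h\<in>A. h \<in> P2 \<and> h \<notin> P1"
        using False B g sub prs(3)
        by (intro ideal_meets_base[OF B(1) prs(2) A B(2), of "{x}" P2 g])
          (auto simp: B_def[symmetric] dest: prime_inD(1) ideal_inD(1))
      then show ?thesis using sub by blast
    qed
    then show "c' l \<subset> c' (Suc l)" using sub by (auto simp: c'_def P0_def P2_def P1_def)
  qed
  from N[OF this] show False by simp
qed

text \<open>Each generator roughly doubles the bound, which is crude but makes \<open>kdim\<close> a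
  maximum over a finite set.\<close>

lemma prime_chain_bound:
  assumes "finite X" and A: "is_subring A" and N: "\<And>c k. prime_chain A c k \<Longrightarrow> k \<le> N"
  shows "\<exists>M. \<forall>c k. prime_chain (alg A X) c k \<longrightarrow> k \<le> M"
  using assms(1)
proof induction
  case empty
  then show ?case using N alg_empty[OF A] by auto
next
  case (insert x X)
  then obtain M where M: "\<forall>c k. prime_chain (alg A X) c k \<longrightarrow> k \<le> M" by blast
  have "k \<le> 2 * M + 1" if "prime_chain (alg A (insert x X)) c k" for c k
    using that M by (intro prime_chain_bound_step[OF alg_subring[OF A], of X M x c k]) (auto simp: alg_alg)
  then show ?case by blast
qed

text \<open>Algebraic independence over \<open>A\<close> modulo \<open>P\<close>, with each entry
  transcendental over the algebra of the entries after it; new functions are therefore added at the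
  head.\<close>

fun indep :: "'b::comm_ring_1 set \<Rightarrow> 'b set \<Rightarrow> 'b list \<Rightarrow> bool" where
  "indep P A [] \<longleftrightarrow> True"
| "indep P A (t # ts) \<longleftrightarrow> transc P (alg A (set ts)) t \<and> indep P A ts"

text \<open>Modulo \<open>P\<close> the list behaves like free variables, so an element of the
  generated algebra lies in \<open>P\<close> only if its coefficients, in the end elements of
  \<open>A\<close>, do; and these lie in \<open>P'\<close>.\<close>

lemma indep_ideal:
  assumes B: "is_subring B" and P': "prime_in B P'" and A: "is_subring A" "A \<subseteq> B"
    and sub: "A \<inter> P \<subseteq> P'" and ts: "indep P A ts" "set ts \<subseteq> B"
  shows "alg A (set ts) \<inter> P \<subseteq> P'"
  using ts
proof (induction ts)
  case Nil
  then show ?case using sub by (simp add: alg_empty[OF A(1)])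
next
  case (Cons t ts)
  define C where "C = alg A (set ts)"
  interpret E: prime_ext B P' C t
    using B P' A Cons.prems alg_least[OF B(1) A(2)] alg_subring[OF A(1)]
    by unfold_locales (auto simp: C_def)
  have eq: "alg A (set (t # ts)) = alg C {t}" by (simp add: C_def alg_alg)
  show ?case
  proof
    fix a assume a: "a \<in> alg A (set (t # ts)) \<inter> P"
    then obtain p where p: "p \<in> polys C" "a = poly p t"
      unfolding eq using alg_singleton_iff[OF E.A, of a t] by blast
    have "coeff p k \<in> P'" for k
      using Cons p a by (auto simp: transc_def C_def[symmetric] polys_def)
    then show "a \<in> P'" using p E.poly_in_P by blast
  qed
qed

text \<open>A relation modulo the smaller prime is one modulo \<open>P\<close>, so its coefficients
  lie in \<open>P\<close>; \<open>indep_ideal\<close> brings them back into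
  \<open>P'\<close>.\<close>

lemma indep_antimono:
  assumes B: "is_subring B" and P': "prime_in B P'" and A: "is_subring A" "A \<subseteq> B"
    and sub: "A \<inter> P \<subseteq> P'" "P' \<subseteq> P" and ts: "indep P A ts" "set ts \<subseteq> B"
  shows "indep P' A ts"
  using ts
proof (induction ts)
  case (Cons t ts)
  have "alg A (set ts) \<inter> P \<subseteq> P'"
    using Cons.prems by (intro indep_ideal[OF B P' A sub(1)]) auto
  then have "transc P' (alg A (set ts)) t"
    using Cons.prems(1) sub(2) unfolding transc_def polys_def indep.simps by blast
  then show ?case using Cons by simp
qed simp

text \<open>Turns one strict step of a chain into one more independent function. In a relation for
  \<open>g\<close> modulo \<open>P'\<close> the constant term lies in \<open>P\<close>, because
  \<open>g\<close> does, and hence in \<open>P'\<close> by independence of \<open>ts\<close>; then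
  one factor \<open>g\<close> cancels, as \<open>g\<close> is outside the prime \<open>P'\<close>,
  and the next coefficient is treated in the same way.\<close>

lemma indep_extend:
  assumes B: "is_subring B" and P': "prime_in B P'" and P: "ideal_in B P" and A: "is_subring A" "A \<subseteq> B"
    and sub: "A \<inter> P \<subseteq> P'" "P' \<subseteq> P" and ts: "indep P A ts" "set ts \<subseteq> B"
    and g: "g \<in> P" "g \<notin> P'"
  shows "indep P' A (g # ts)"
proof -
  define C where "C = alg A (set ts)"
  have C: "is_subring C" "C \<subseteq> B" "C \<inter> P \<subseteq> P'"
    using alg_subring[OF A(1)] alg_least[OF B A(2) ts(2)] indep_ideal[OF B P' A sub(1) ts]
    by (auto simp: C_def)
  have gB: "g \<in> B" using ideal_inD(1)[OF P g(1)] .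
  interpret E: prime_ext B P' C g by unfold_locales (use B P' C gB in auto)
  have "\<forall>k. coeff p k \<in> P'" if "p \<in> polys C" "poly p g \<in> P'" for p
    using that
  proof (induction p)
    case 0
    then show ?case by simp
  next
    case (pCons a p)
    have coeffs: "coeff (pCons a p) k \<in> C" for k using pCons.prems by (auto simp: polys_def)
    have a: "a \<in> C" using coeffs[of 0] by simp
    have p: "p \<in> polys C" using coeffs[of "Suc k" for k] by (simp add: polys_def)
    have gp: "g * poly p g \<in> P" using ideal_inD(5)[OF P g(1) E.poly_in_B[OF p]] .
    have "(a + g * poly p g) - g * poly p g \<in> P"
      using pCons.prems sub(2) gp by (intro ideal_in_diff[OF B P]) auto
    then have aP: "a \<in> P'" using C(3) a by auto
    have "(a + g * poly p g) - a \<in> P'"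
      using pCons.prems aP by (intro ideal_in_diff[OF B prime_inD(1)[OF P']]) auto
    then have "poly p g \<in> P'"
      using prime_inD(3)[OF P' gB E.poly_in_B[OF p]] g(2) by simp
    then have "\<forall>k. coeff p k \<in> P'" using pCons.IH p by blast
    then show ?case using aP by (simp add: coeff_pCons split: nat.split)
  qed
  then have "transc P' C g" unfolding transc_def by blast
  then show ?thesis
    using indep_antimono[OF B P' A sub ts] by (simp add: C_def)
qed

section \<open>Nullstellensatz and chains of prime ideals\<close>

locale field_algebra =
  fixes \<kappa> :: "'a::field_char_0 \<Rightarrow> 'b::comm_ring_1"
  assumes \<kappa>_1: "\<kappa> 1 = 1" and \<kappa>_add: "\<And>a b. \<kappa> (a + b) = \<kappa> a + \<kappa> b"
    and \<kappa>_mult: "\<And>a b. \<kappa> (a * b) = \<kappa> a * \<kappa> b"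
    and alg_closed: "\<And>p::'a poly. degree p > 0 \<Longrightarrow> \<exists>x. poly p x = 0"
begin

lemma \<kappa>_0: "\<kappa> 0 = 0"
  using \<kappa>_add[of 0 0] by simp

lemma \<kappa>_diff: "\<kappa> (a - b) = \<kappa> a - \<kappa> b"
  using \<kappa>_add[of "a - b" b] by (simp add: algebra_simps)

abbreviation "K \<equiv> range \<kappa>"

lemma subring_K: "is_subring K"
proof -
  have "1 \<in> K" using \<kappa>_1 by (metis rangeI)
  then show ?thesis
    by (auto simp: is_subring_def simp flip: \<kappa>_diff \<kappa>_mult)
qed

text \<open>A nonzero constant is a unit.\<close>

lemma K_inter_prime:
  assumes P: "prime_in B P" and K: "K \<subseteq> B" and a: "a \<in> K" "a \<in> P"
  shows "a = 0"
proof -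
  obtain c where c: "a = \<kappa> c" using a by auto
  have "c = 0"
  proof (rule ccontr)
    assume "c \<noteq> 0"
    then have "\<kappa> (inverse c) * a = 1" by (simp add: c \<kappa>_1 flip: \<kappa>_mult)
    then show False
      using ideal_inD(4)[OF prime_inD(1)[OF P] _ a(2), of "\<kappa> (inverse c)"] prime_inD(2)[OF P] K by auto
  qed
  then show ?thesis by (simp add: c \<kappa>_0)
qed

lemma \<kappa>_inject: "(1::'b) \<noteq> 0 \<Longrightarrow> \<kappa> c = \<kappa> d \<longleftrightarrow> c = d"
proof
  assume "(1::'b) \<noteq> 0" "\<kappa> c = \<kappa> d"
  then have "\<kappa> (c - d) = 0" by (simp add: \<kappa>_diff)
  show "c = d"
  proof (rule ccontr)
    assume "c \<noteq> d"
    then have "\<kappa> (inverse (c - d)) * \<kappa> (c - d) = 1" by (simp add: \<kappa>_1 flip: \<kappa>_mult)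
    then show False using \<open>\<kappa> (c - d) = 0\<close> \<open>(1::'b) \<noteq> 0\<close> by simp
  qed
qed simp

text \<open>This is \<open>finite_alg_hom_extension\<close> over the field of constants, starting
  from the inverse of \<open>\<kappa>\<close>: there the condition
  \<open>\<phi> h \<noteq> 0\<close> only says that a constant is nonzero.\<close>

theorem nullstellensatz:
  assumes X: "finite X" and P: "prime_in (alg K X) P" and g: "g \<in> alg K X" "g \<notin> P"
  obtains \<psi> where "hom_on (alg K X) \<psi>" "\<And>c. \<psi> (\<kappa> c) = c"
    "\<And>a. a \<in> P \<Longrightarrow> \<psi> a = 0" "\<psi> g \<noteq> 0"
proof -
  define B where "B = alg K X"
  have B: "is_subring B" "prime_in B P" "K \<subseteq> B" "X \<subseteq> B"
    using P alg_subring[OF subring_K] by (auto simp: B_def intro: alg_base alg_gen)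
  have "(1::'b) \<noteq> 0"
    using prime_inD(2)[OF P] ideal_inD(2)[OF prime_inD(1)[OF P]] by metis
  then have inv: "inv \<kappa> (\<kappa> c) = c" for c
    by (intro inv_f_f injI) (simp add: \<kappa>_inject)
  have "\<exists>h\<in>K. h \<notin> P \<and> (\<forall>\<phi> :: _ \<Rightarrow> 'a. hom_on K \<phi> \<and> (\<forall>a\<in>K. a \<in> P \<longrightarrow> \<phi> a = 0) \<and> \<phi> h \<noteq> 0 \<longrightarrow>
    (\<exists>\<psi>. hom_on B \<psi> \<and> (\<forall>a\<in>K. \<psi> a = \<phi> a) \<and> (\<forall>a\<in>B. a \<in> P \<longrightarrow> \<psi> a = 0) \<and> \<psi> g \<noteq> 0))"
    unfolding B_def
    by (rule finite_alg_hom_extension[OF _ B(1,2) subring_K B(3) X B(4) g]) (erule alg_closed)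
  then obtain h where h: "h \<in> K" "h \<notin> P" and ext: "\<And>\<phi> :: _ \<Rightarrow> 'a. hom_on K \<phi> \<Longrightarrow> (\<forall>a\<in>K. a \<in> P \<longrightarrow> \<phi> a = 0) \<Longrightarrow> \<phi> h \<noteq> 0 \<Longrightarrow>
    (\<exists>\<psi>. hom_on B \<psi> \<and> (\<forall>a\<in>K. \<psi> a = \<phi> a) \<and> (\<forall>a\<in>B. a \<in> P \<longrightarrow> \<psi> a = 0) \<and> \<psi> g \<noteq> 0)"
    by blast
  obtain c where c: "h = \<kappa> c" using h by auto
  have "c \<noteq> 0" using h c \<kappa>_0 ideal_inD(2)[OF prime_inD(1)[OF P]] by auto
  have "hom_on K (inv \<kappa>)"
    by (auto simp: hom_on_def inv simp flip: \<kappa>_add \<kappa>_mult) (metis \<kappa>_1 inv)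
  moreover have "\<forall>a\<in>K. a \<in> P \<longrightarrow> inv \<kappa> a = 0"
    using K_inter_prime[OF B(2,3)] inv \<kappa>_0 by metis
  moreover have "inv \<kappa> h \<noteq> 0" using c \<open>c \<noteq> 0\<close> inv by simp
  ultimately obtain \<psi> where "hom_on B \<psi>" "\<forall>a\<in>K. \<psi> a = inv \<kappa> a"
    "\<forall>a\<in>B. a \<in> P \<longrightarrow> \<psi> a = 0" "\<psi> g \<noteq> 0" using ext by blast
  then show ?thesis
    using that[of \<psi>] inv ideal_inD(1)[OF prime_inD(1)[OF B(2)]] by (auto simp: B_def)
qed

text \<open>The prime obtained here contains a fibre of \<^term>\<open>t\<close> over which \<^term>\<open>ts\<close> stays independent;
  the constant \<^term>\<open>c\<close> only has to avoid the zeros of the leading coefficients met while eliminating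
  the generators.\<close>

theorem prime_above_fibre:
  assumes X: "finite X" and P: "prime_in (alg K X) P"
    and ind: "indep P K (t # ts)" and in_alg: "set (t # ts) \<subseteq> alg K X"
  obtains Q c where "prime_in (alg K X) Q" "P \<subseteq> Q" "t - \<kappa> c \<in> Q" "t - \<kappa> c \<notin> P" "indep Q K ts"
proof -
  define B C C' where "B = alg K X" and "C = alg K (set ts)" and "C' = alg C {t}"
  note PI = prime_inD(1)[OF P, folded B_def]
  have KB: "K \<subseteq> B" "X \<subseteq> B" by (auto simp: B_def intro: alg_base alg_gen)
  have B: "is_subring B" "prime_in B P" using P alg_subring[OF subring_K] by (auto simp: B_def)
  have tB: "t \<in> B" "set ts \<subseteq> B" using in_alg by (auto simp: B_def)
  have C: "is_subring C" "C \<subseteq> B" "K \<subseteq> C"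
    using alg_subring[OF subring_K] alg_least[OF B(1) KB(1) tB(2)] by (auto simp: C_def intro: alg_base)
  have C': "is_subring C'" "C' \<subseteq> B" "C \<subseteq> C'"
    using alg_subring[OF C(1)] alg_least[OF B(1) C(2), of "{t}"] tB by (auto simp: C'_def intro: alg_base)
  have BX: "alg C' X = B"
  proof
    show "alg C' X \<subseteq> B" by (rule alg_least[OF B(1) C'(2) KB(2)])
    show "B \<subseteq> alg C' X" unfolding B_def using C(3) C'(3) by (intro alg_mono) auto
  qed
  interpret E: prime_ext B P C t by unfold_locales (use B C tB in auto)
  have tr: "transc P C t" using ind by (simp add: C_def)
  have one: "1 \<in> alg C' X" "1 \<notin> P" using BX subring_1[OF B(1)] prime_inD(2)[OF B(2)] by auto
  \<comment> \<open>Outside the zeros of \<open>h\<close>, every point of the subalgebra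
    \<open>C'\<close> generated by \<open>t\<close> and \<open>ts\<close> lifts to a point of
    \<open>B\<close>.\<close>
  have "\<exists>h\<in>C'. h \<notin> P \<and> (\<forall>\<phi> :: _ \<Rightarrow> 'a. hom_on C' \<phi> \<and> (\<forall>a\<in>C'. a \<in> P \<longrightarrow> \<phi> a = 0) \<and> \<phi> h \<noteq> 0 \<longrightarrow>
    (\<exists>\<psi>. hom_on (alg C' X) \<psi> \<and> (\<forall>a\<in>C'. \<psi> a = \<phi> a) \<and> (\<forall>a\<in>alg C' X. a \<in> P \<longrightarrow> \<psi> a = 0) \<and> \<psi> 1 \<noteq> 0))"
    by (rule finite_alg_hom_extension[OF _ B C'(1,2) X KB(2) one]) (erule alg_closed)
  then obtain h where h: "h \<in> C'" "h \<notin> P"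
    and ext: "\<And>\<phi> :: _ \<Rightarrow> 'a. hom_on C' \<phi> \<Longrightarrow> (\<forall>a\<in>C'. a \<in> P \<longrightarrow> \<phi> a = 0) \<Longrightarrow> \<phi> h \<noteq> 0 \<Longrightarrow>
    (\<exists>\<psi>. hom_on B \<psi> \<and> (\<forall>a\<in>C'. \<psi> a = \<phi> a) \<and> (\<forall>a\<in>B. a \<in> P \<longrightarrow> \<psi> a = 0) \<and> \<psi> 1 \<noteq> 0)"
    unfolding BX by blast
  obtain H where H: "H \<in> polys C" "h = poly H t"
    using h(1) alg_singleton_iff[OF C(1)] unfolding C'_def by blast
  obtain k where k: "coeff H k \<notin> P" using E.poly_in_P[OF H(1)] H(2) h(2) by blast
  have eval: "\<phi> (poly p (\<kappa> c)) = poly (map_poly \<phi> p) c" "poly p (\<kappa> c) \<in> C"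
    if "hom_on C \<phi>" "\<And>c. \<phi> (\<kappa> c) = c" "p \<in> polys C" for \<phi> :: "'b \<Rightarrow> 'a" and p c
  proof -
    have \<phi>0: "\<phi> 0 = 0" using that(2)[of 0] \<kappa>_0 by simp
    have "\<phi> (poly p (\<kappa> c)) = poly (map_poly \<phi> p) c \<and> poly p (\<kappa> c) \<in> C"
      using that(3)
    proof (induction p)
      case 0
      then show ?case by (simp add: \<phi>0 subring_0[OF C(1)])
    next
      case (pCons a p)
      have coeffs: "coeff (pCons a p) k \<in> C" for k using pCons.prems by (auto simp: polys_def)
      have a: "a \<in> C" using coeffs[of 0] by simp
      have p: "p \<in> polys C" using coeffs[of "Suc k" for k] by (simp add: polys_def)
      have "\<kappa> c \<in> C" using C(3) by auto
      then show ?case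
        using that(1,2) pCons.IH[OF p] a
        by (auto simp: map_poly_pCons \<phi>0 hom_on_def subring_mult[OF C(1)] subring_add[OF C(1)])
    qed
    then show "\<phi> (poly p (\<kappa> c)) = poly (map_poly \<phi> p) c" "poly p (\<kappa> c) \<in> C" by auto
  qed
  have prC: "prime_in (alg K (set ts)) (P \<inter> C)"
    using prime_in_contract[OF B(2) C(1,2)] by (simp add: C_def)
  \<comment> \<open>\<open>h\<close> is the polynomial \<open>H\<close> in \<open>t\<close>; at a
    point of \<open>C\<close> where some coefficient of \<open>H\<close> is nonzero, only the
    finitely many roots of the specialised polynomial are forbidden.\<close>
  obtain c where c: "poly H (\<kappa> c) \<in> C" "poly H (\<kappa> c) \<notin> P"
  proof -
    have "coeff H k \<in> C" using H by (auto simp: polys_def)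
    then obtain \<phi> where \<phi>: "hom_on C \<phi>" "\<And>c. \<phi> (\<kappa> c) = c"
      "\<And>a. a \<in> P \<inter> C \<Longrightarrow> \<phi> a = 0" "\<phi> (coeff H k) \<noteq> 0"
      using nullstellensatz[OF _ prC, of "coeff H k"] k unfolding C_def by auto
    have \<phi>0: "\<phi> 0 = 0" using \<phi>(2)[of 0] \<kappa>_0 by simp
    have "map_poly \<phi> H \<noteq> 0" using \<phi>(4) by (metis \<phi>0 coeff_map_poly coeff_0)
    then obtain c where "poly (map_poly \<phi> H) c \<noteq> 0" using poly_all_0_iff_0 by blast
    moreover note ev = eval[OF \<phi>(1,2) H(1), of c]
    ultimately have "poly H (\<kappa> c) \<notin> P" using \<phi>(3)[of "poly H (\<kappa> c)"] by auto
    then show ?thesis using that ev(2) by blast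
  qed
  define J where "J = {p + r * (t - \<kappa> c) |p r. p \<in> P \<and> r \<in> B}"
  have "\<kappa> c \<in> B" using KB by auto
  then have tcB: "t - \<kappa> c \<in> B" using tB subring_diff[OF B(1)] by auto
  note J = ideal_in_insert[OF B(1) PI tcB, folded J_def]
  \<comment> \<open>An element \<open>s\<close> of the intersection is tested at a point of
    \<open>C\<close> where both \<open>s\<close> and \<open>poly H (\<kappa> c)\<close> are nonzero.
    Extended by the value \<open>c\<close> of \<open>t\<close> and then to \<open>B\<close>, the
    point kills \<open>P\<close> and \<open>t - \<kappa> c\<close>, hence also
    \<open>s\<close>.\<close>
  have "(C - P) \<inter> J = {}"
  proof (rule ccontr)
    assume "\<not> ?thesis"
    then obtain p r where s: "p + r * (t - \<kappa> c) \<in> C" "p + r * (t - \<kappa> c) \<notin> P" "p \<in> P" "r \<in> B"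
      by (auto simp: J_def)
    define s where "s = p + r * (t - \<kappa> c)"
    have "s * poly H (\<kappa> c) \<in> C" "s * poly H (\<kappa> c) \<notin> P"
      using s c C prime_inD(3)[OF B(2), of s "poly H (\<kappa> c)"] subring_mult[OF C(1)] by (auto simp: s_def)
    then obtain \<phi> where \<phi>: "hom_on C \<phi>" "\<And>c. \<phi> (\<kappa> c) = c"
      "\<And>a. a \<in> P \<inter> C \<Longrightarrow> \<phi> a = 0" "\<phi> (s * poly H (\<kappa> c)) \<noteq> 0"
      using nullstellensatz[OF _ prC, of "s * poly H (\<kappa> c)"] unfolding C_def by auto
    have \<phi>0: "\<phi> 0 = 0" using \<phi>(2)[of 0] \<kappa>_0 by simp
    have nz: "\<phi> s \<noteq> 0" "\<phi> (poly H (\<kappa> c)) \<noteq> 0"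
      using \<phi>(1,4) s c by (auto simp: hom_on_def s_def)
    have "\<exists>\<psi>. hom_on (alg C {t}) \<psi> \<and> (\<forall>a\<in>C. \<psi> a = \<phi> a) \<and> \<psi> t = c
      \<and> (\<forall>a\<in>alg C {t}. a \<in> P \<longrightarrow> \<psi> a = 0)
      \<and> (\<forall>p\<in>polys C. \<psi> (poly p t) = poly (map_poly \<phi> p) c)"
    proof (rule E.hom_extension_by_value[OF \<phi>(1)])
      fix p assume p: "p \<in> polys C" "poly p t \<in> P"
      then have "map_poly \<phi> p = 0"
        using tr \<phi>(3) by (intro poly_eqI) (auto simp: coeff_map_poly \<phi>0 transc_def polys_def)
      then show "poly (map_poly \<phi> p) c = 0" by simp
    qed
    then obtain \<psi> where \<psi>: "hom_on C' \<psi>" "\<forall>a\<in>C. \<psi> a = \<phi> a" "\<psi> t = c"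
      "\<forall>a\<in>C'. a \<in> P \<longrightarrow> \<psi> a = 0" "\<forall>p\<in>polys C. \<psi> (poly p t) = poly (map_poly \<phi> p) c"
      unfolding C'_def by (elim exE conjE)
    have "\<psi> h \<noteq> 0"
      using \<psi>(5) H nz(2) eval(1)[OF \<phi>(1,2) H(1)] by simp
    with ext[OF \<psi>(1,4)] obtain \<chi> where \<chi>: "hom_on B \<chi>" "\<forall>a\<in>C'. \<chi> a = \<psi> a" "\<forall>a\<in>B. a \<in> P \<longrightarrow> \<chi> a = 0"
      by blast
    have "\<kappa> c \<in> C" "t \<in> C'" using C(3) by (auto simp: C'_def intro: alg_gen)
    then have "\<chi> t = c" "\<chi> (\<kappa> c) = c" using \<chi>(2) \<psi>(2,3) \<phi>(2) C'(3) by auto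
    moreover have "\<chi> ((t - \<kappa> c) + \<kappa> c) = \<chi> (t - \<kappa> c) + \<chi> (\<kappa> c)"
      using \<chi>(1) tcB \<open>\<kappa> c \<in> B\<close> unfolding hom_on_def by blast
    ultimately have "\<chi> (t - \<kappa> c) = 0" by simp
    moreover have "p \<in> B" using s ideal_inD(1)[OF PI] by auto
    ultimately have "\<chi> s = 0"
      using \<chi>(1,3) tcB s subring_mult[OF B(1) s(4) tcB] by (auto simp: hom_on_def s_def)
    then show False using nz \<chi>(2) \<psi>(2) s C'(3) by (auto simp: s_def)
  qed
  moreover have "a * b \<in> C - P" if "a \<in> C - P" "b \<in> C - P" for a b
    using that C subring_mult[OF C(1)] prime_inD(3)[OF B(2), of a b] by auto
  moreover have "C - P \<subseteq> B" "1 \<in> C - P" using C one subring_1[OF C(1)] by auto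
  ultimately obtain Q where Q: "prime_in B Q" "J \<subseteq> Q" "Q \<inter> (C - P) = {}"
    using exists_prime_avoiding[OF B(1) J(1), of "C - P"] by blast
  have PQ: "P \<subseteq> Q" using Q J by blast
  \<comment> \<open>Since \<open>Q\<close> meets \<open>C\<close> only in elements of
    \<open>P\<close>, relations over \<open>C\<close> modulo \<open>Q\<close> are relations modulo
    \<open>P\<close>.\<close>
  have "indep Q K us" if "indep P K us" "set us \<subseteq> set ts" for us
    using that
  proof (induction us)
    case (Cons u us)
    define D where "D = alg K (set us)"
    have D: "is_subring D" "D \<subseteq> C"
      using alg_subring[OF subring_K] alg_mono[of K K "set us" "set ts"] Cons.prems by (auto simp: D_def C_def)
    have "u \<in> C" using Cons.prems by (auto simp: C_def intro: alg_gen)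
    then have "alg D {u} \<subseteq> C" by (intro alg_least[OF C(1) D(2)]) auto
    then have "poly p u \<in> P" if "p \<in> polys D" "poly p u \<in> Q" for p
      using that poly_in_alg[OF D(1), of p u] Q(3) by auto
    then show ?case using Cons PQ by (auto simp: transc_def D_def)
  qed simp
  moreover have "t - \<kappa> c \<notin> P"
  proof
    assume "t - \<kappa> c \<in> P"
    moreover have "[:- \<kappa> c, 1:] \<in> polys C"
    proof -
      have "\<kappa> c \<in> C" using C(3) by auto
      then show ?thesis by (intro polys_pCons[OF C(1)] polys_0[OF C(1)] subring_uminus[OF C(1)] subring_1[OF C(1)])
    qed
    moreover have "poly [:- \<kappa> c, 1:] t = t - \<kappa> c" by simp
    ultimately have "coeff [:- \<kappa> c, 1:] 1 \<in> P" using tr unfolding transc_def by metis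
    then show False using one(2) by simp
  qed
  ultimately show ?thesis
    using that[of Q c] Q(1) PQ J(3) Q(2) ind unfolding B_def by auto
qed

text \<open>The chain is listed from the largest prime down to \<^term>\<open>P\<close>, as its zero sets increase.\<close>

lemma prime_chain_of_indep:
  assumes X: "finite X" and P: "prime_in (alg K X) P"
    and ind: "indep P K ts" and in_alg: "set ts \<subseteq> alg K X"
  shows "\<exists>c. c (length ts) = P \<and> (\<forall>l\<le>length ts. prime_in (alg K X) (c l)) \<and>
    (\<forall>l<length ts. c (Suc l) \<subseteq> c l \<and> (\<exists>t\<in>set ts. \<exists>a. t - \<kappa> a \<in> c l \<and> t - \<kappa> a \<notin> c (Suc l)))"
  using P ind in_alg
proof (induction ts arbitrary: P)
  case Nil
  then show ?case by (intro exI[of _ "\<lambda>_. P"]) auto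
next
  case (Cons t ts)
  obtain Q a where Q: "prime_in (alg K X) Q" "P \<subseteq> Q" "t - \<kappa> a \<in> Q" "t - \<kappa> a \<notin> P" "indep Q K ts"
    using prime_above_fibre[OF X Cons.prems] by blast
  obtain c where c: "c (length ts) = Q" "\<forall>l\<le>length ts. prime_in (alg K X) (c l)"
    "\<forall>l<length ts. c (Suc l) \<subseteq> c l \<and> (\<exists>t\<in>set ts. \<exists>a. t - \<kappa> a \<in> c l \<and> t - \<kappa> a \<notin> c (Suc l))"
    using Cons.IH[OF Q(1,5)] Cons.prems by auto
  show ?case
  proof (intro exI[of _ "c(Suc (length ts) := P)"] conjI allI impI)
    fix l assume "l < length (t # ts)"
    then consider "l < length ts" | "l = length ts" by force
    then show "(c(Suc (length ts) := P)) (Suc l) \<subseteq> (c(Suc (length ts) := P)) l"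
      "\<exists>t\<in>set (t # ts). \<exists>a. t - \<kappa> a \<in> (c(Suc (length ts) := P)) l \<and>
        t - \<kappa> a \<notin> (c(Suc (length ts) := P)) (Suc l)"
      using c Q by (cases; auto)+
  qed (use c Cons.prems in auto)
qed

lemma prime_chain_K: "prime_chain K c k \<Longrightarrow> k \<le> 0"
proof (rule ccontr)
  assume c: "prime_chain K c k" and "\<not> k \<le> 0"
  then have "prime_in K (c 0)" "prime_in K (c 1)" "c 0 \<subset> c 1" by (auto simp: prime_chain_def)
  then obtain a where a: "a \<in> c 1" "a \<notin> c 0" by blast
  note I = \<open>prime_in K (c 0)\<close>[THEN prime_inD(1)] \<open>prime_in K (c 1)\<close>[THEN prime_inD(1)]
  have "a = 0" using K_inter_prime[OF \<open>prime_in K (c 1)\<close>] a(1) ideal_inD(1)[OF I(2)] by blast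
  then show False using a(2) ideal_inD(2)[OF I(1)] by simp
qed

end

section \<open>Closed sets and dimension\<close>

definition cst :: "'a \<Rightarrow> 's \<Rightarrow> 'a" where "cst c = (\<lambda>_. c)"

definition zc :: "nat \<Rightarrow> ('a::field) gpt \<Rightarrow> 'a" where "zc j = (\<lambda>P. fst P j)"
definition wc :: "nat \<Rightarrow> ('a::field) gpt \<Rightarrow> 'a" where "wc j = (\<lambda>P. snd P j)"
definition wi :: "nat \<Rightarrow> ('a::field) gpt \<Rightarrow> 'a" where "wi j = (\<lambda>P. inverse (snd P j))"

definition lgens :: "nat \<Rightarrow> (('a::field) gpt \<Rightarrow> 'a) set" where
  "lgens m = zc ` {..<m} \<union> wc ` {..<m} \<union> wi ` {..<m}"

text \<open>The coordinate ring of \<open>Gpts m\<close>, but as functions on all points of the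
  type. Identities such as \<open>wi j * wc j = 1\<close> hold only on \<open>Gpts m\<close>, so
  primes that are to have zeros there must contain \<open>van m (Gpts m)\<close>.\<close>

definition laurent :: "nat \<Rightarrow> (('a::field) gpt \<Rightarrow> 'a) set" where
  "laurent m = alg (range cst) (lgens m)"

definition van :: "nat \<Rightarrow> ('a::field) gpt set \<Rightarrow> ('a gpt \<Rightarrow> 'a) set" where
  "van m S = {f \<in> laurent m. \<forall>p\<in>S. f p = 0}"

text \<open>Irreducibility as primality of the vanishing ideal, the form in which it passes to
  images and closures.\<close>

definition irr :: "nat \<Rightarrow> ('a::field) gpt set \<Rightarrow> bool" where
  "irr m S \<longleftrightarrow> S \<noteq> {} \<and> (\<forall>f\<in>laurent m. \<forall>g\<in>laurent m.
     (\<forall>p\<in>S. f p * g p = 0) \<longrightarrow> (\<forall>p\<in>S. f p = 0) \<or> (\<forall>p\<in>S. g p = 0))"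

abbreviation cl :: "nat \<Rightarrow> ('a::field) gpt set \<Rightarrow> 'a gpt set" where
  "cl m S \<equiv> zcl (Gpts m) S"

lemma cst_apply [simp]: "cst c s = c"
  by (simp add: cst_def)

lemma zc_apply [simp]: "zc j p = fst p j"
  and wc_apply [simp]: "wc j p = snd p j" and wi_apply [simp]: "wi j p = inverse (snd p j)"
  by (simp_all add: zc_def wc_def wi_def)

lemma subring_cst: "is_subring (range (cst :: 'a::comm_ring_1 \<Rightarrow> 's \<Rightarrow> 'a))"
  unfolding is_subring_def
proof (intro conjI ballI)
  have "1 = (cst 1 :: 's \<Rightarrow> 'a)" by (auto simp: fun_eq_iff)
  then show "1 \<in> range (cst :: 'a \<Rightarrow> 's \<Rightarrow> 'a)" by blast
  fix a b :: "'s \<Rightarrow> 'a" assume "a \<in> range cst" "b \<in> range cst"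
  then obtain c d where *: "a = cst c" "b = cst d" by auto
  have "a - b = cst (c - d)" "a * b = cst (c * d)" by (auto simp: * fun_eq_iff)
  then show "a - b \<in> range cst" "a * b \<in> range cst" by blast+
qed

lemma finite_lgens: "finite (lgens m)"
  by (simp add: lgens_def)

lemma subring_laurent: "is_subring (laurent m)"
  unfolding laurent_def by (rule alg_subring[OF subring_cst])

lemma laurent_cst: "cst c \<in> laurent m" and laurent_zc: "j < m \<Longrightarrow> zc j \<in> laurent m"
  and laurent_wc: "j < m \<Longrightarrow> wc j \<in> laurent m" and laurent_wi: "j < m \<Longrightarrow> wi j \<in> laurent m"
  unfolding laurent_def lgens_def by (auto intro: alg_base alg_gen)

lemmas laurent_intros = laurent_cst laurent_zc laurent_wc laurent_wi subring_intros[OF subring_laurent]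

lemma laurent_induct [consumes 1, case_names cst zc wc wi add mult]:
  assumes "f \<in> laurent m" "\<And>c. Q (cst c)" "\<And>j. j < m \<Longrightarrow> Q (zc j)" "\<And>j. j < m \<Longrightarrow> Q (wc j)"
    "\<And>j. j < m \<Longrightarrow> Q (wi j)"
    "\<And>f g. f \<in> laurent m \<Longrightarrow> g \<in> laurent m \<Longrightarrow> Q f \<Longrightarrow> Q g \<Longrightarrow> Q (f + g)"
    "\<And>f g. f \<in> laurent m \<Longrightarrow> g \<in> laurent m \<Longrightarrow> Q f \<Longrightarrow> Q g \<Longrightarrow> Q (f * g)"
  shows "Q f"
  using assms(1) unfolding laurent_def
proof (induction rule: alg.induct)
  case (alg_base a)
  then show ?case using assms(2) by auto
next
  case (alg_gen a)
  then show ?case using assms(3-5) by (auto simp: lgens_def)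
next
  case (alg_add a b)
  then show ?case by (intro assms(6)) (simp_all only: laurent_def)
next
  case (alg_mult a b)
  then show ?case by (intro assms(7)) (simp_all only: laurent_def)
qed

lemma gpoly_prod: "(\<And>s. s \<in> S \<Longrightarrow> gpoly (f s)) \<Longrightarrow> gpoly (\<lambda>P. \<Prod>s\<in>S. f s P)"
  by (induction S rule: infinite_finite_induct) (auto intro: gpoly.intros)

lemma gpoly_power: "gpoly f \<Longrightarrow> gpoly (\<lambda>P. f P ^ k)"
  by (induction k) (auto intro: gpoly.intros)

lemma gpoly_diff: "gpoly f \<Longrightarrow> gpoly g \<Longrightarrow> gpoly (\<lambda>P. f P - g P)"
  using gpoly_add[OF _ gpoly_mult[OF gpoly_const[of "- 1"]], of f g] by simp

text \<open>Coordinates of index at least \<open>m\<close> are the constants 0 and 1 on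
  \<open>Gpts m\<close>.\<close>

lemma gpoly_imp_laurent:
  assumes "gpoly f"
  shows "\<exists>g\<in>laurent m. \<forall>p\<in>Gpts m. g p = f p"
  using assms
proof induction
  case (gpoly_const c)
  then show ?case by (intro bexI[of _ "cst c"]) (auto intro: laurent_intros)
next
  case (gpoly_z j)
  show ?case
  proof (cases "j < m")
    case True
    then show ?thesis by (intro bexI[of _ "zc j"]) (auto intro: laurent_intros)
  next
    case False
    then show ?thesis by (intro bexI[of _ "cst 0"]) (auto simp: Gpts_def intro: laurent_cst)
  qed
next
  case (gpoly_w j)
  show ?case
  proof (cases "j < m")
    case True
    then show ?thesis by (intro bexI[of _ "wc j"]) (auto intro: laurent_intros)
  next
    case False
    then show ?thesis by (intro bexI[of _ "cst 1"]) (auto simp: Gpts_def intro: laurent_cst)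
  qed
next
  case (gpoly_add f g)
  then obtain f' g' where "f' \<in> laurent m" "g' \<in> laurent m" "\<forall>p\<in>Gpts m. f' p = f p" "\<forall>p\<in>Gpts m. g' p = g p" by blast
  then show ?case by (intro bexI[of _ "f' + g'"]) (auto intro: subring_add[OF subring_laurent])
next
  case (gpoly_mult f g)
  then obtain f' g' where "f' \<in> laurent m" "g' \<in> laurent m" "\<forall>p\<in>Gpts m. f' p = f p" "\<forall>p\<in>Gpts m. g' p = g p" by blast
  then show ?case by (intro bexI[of _ "f' * g'"]) (auto intro: subring_mult[OF subring_laurent])
qed

lemma Gpts_nz: "p \<in> Gpts m \<Longrightarrow> snd p j \<noteq> 0"
  by (cases "j < m") (auto simp: Gpts_def)

text \<open>A power of the product of the multiplicative coordinates, which has no zeros on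
  \<open>Gpts m\<close>, clears all inverses; so Laurent functions and polynomials define the same
  closed sets.\<close>

lemma laurent_clear_denominator:
  fixes f :: "'a::field gpt \<Rightarrow> 'a"
  assumes "f \<in> laurent m"
  shows "\<exists>g N. gpoly g \<and> (\<forall>p\<in>Gpts m. g p = f p * (\<Prod>j<m. snd p j) ^ N)"
  using assms
proof (induction rule: laurent_induct)
  case (cst c)
  then show ?case by (intro exI[of _ "\<lambda>_. c"] exI[of _ 0]) (auto intro: gpoly.intros)
next
  case (zc j)
  show ?case by (intro exI[of _ "\<lambda>P. fst P j"] exI[of _ 0]) (auto intro: gpoly.intros)
next
  case (wc j)
  show ?case by (intro exI[of _ "\<lambda>P. snd P j"] exI[of _ 0]) (auto intro: gpoly.intros)
next
  case (wi j)
  show ?case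
  proof (intro exI[of _ "\<lambda>P. \<Prod>k\<in>{..<m} - {j}. snd P k"] exI[of _ 1] conjI ballI)
    show "gpoly (\<lambda>P. \<Prod>k\<in>{..<m} - {j}. snd P k :: 'a)" by (intro gpoly_prod gpoly_w)
    fix p :: "'a gpt" assume "p \<in> Gpts m"
    then have "snd p j \<noteq> 0" by (rule Gpts_nz)
    moreover have "(\<Prod>k<m. snd p k) = snd p j * (\<Prod>k\<in>{..<m} - {j}. snd p k)"
      using wi by (intro prod.remove) auto
    ultimately show "(\<Prod>k\<in>{..<m} - {j}. snd p k) = wi j p * (\<Prod>j<m. snd p j) ^ 1"
      by (simp add: field_simps)
  qed
next
  case (add f g)
  then obtain f' g' M N where *: "gpoly f'" "gpoly g'" "\<forall>p\<in>Gpts m. f' p = f p * (\<Prod>j<m. snd p j) ^ M"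
     "\<forall>p\<in>Gpts m. g' p = g p * (\<Prod>j<m. snd p j) ^ N" by blast
  have "gpoly (\<lambda>P. f' P * (\<Prod>j<m. snd P j) ^ N + g' P * (\<Prod>j<m. snd P j) ^ M)"
    by (intro gpoly_add gpoly_mult gpoly_power gpoly_prod gpoly_w *)
  then show ?case
    by (intro exI[of _ "\<lambda>P. f' P * (\<Prod>j<m. snd P j) ^ N + g' P * (\<Prod>j<m. snd P j) ^ M"] exI[of _ "M + N"])
      (use * in \<open>auto simp: algebra_simps power_add\<close>)
next
  case (mult f g)
  then obtain f' g' M N where *: "gpoly f'" "gpoly g'" "\<forall>p\<in>Gpts m. f' p = f p * (\<Prod>j<m. snd p j) ^ M"
     "\<forall>p\<in>Gpts m. g' p = g p * (\<Prod>j<m. snd p j) ^ N" by blast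
  have "gpoly (\<lambda>P. f' P * g' P)"
    by (intro gpoly_mult *)
  then show ?case
    by (intro exI[of _ "\<lambda>P. f' P * g' P"] exI[of _ "M + N"])
      (use * in \<open>auto simp: algebra_simps power_add\<close>)
qed

lemma laurent_imp_gpoly:
  assumes "f \<in> laurent m"
  obtains g where "gpoly g" "\<And>p. p \<in> Gpts m \<Longrightarrow> g p = 0 \<longleftrightarrow> f p = 0"
proof -
  obtain g N where g: "gpoly g" "\<forall>p\<in>Gpts m. g p = f p * (\<Prod>j<m. snd p j) ^ N"
    using laurent_clear_denominator[OF assms] by blast
  have "g p = 0 \<longleftrightarrow> f p = 0" if "p \<in> Gpts m" for p
    using g(2) that Gpts_nz[OF that] by auto
  then show ?thesis using that g by blast
qed

lemma gpoly_zero_iff_laurent: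
  assumes "S \<subseteq> Gpts m" "p \<in> Gpts m"
  shows "(\<forall>f. gpoly f \<and> (\<forall>q\<in>S. f q = 0) \<longrightarrow> f p = 0) \<longleftrightarrow> (\<forall>f\<in>laurent m. (\<forall>q\<in>S. f q = 0) \<longrightarrow> f p = 0)"
proof (intro iffI allI ballI impI)
  fix f assume *: "\<forall>f. gpoly f \<and> (\<forall>q\<in>S. f q = 0) \<longrightarrow> f p = 0" "f \<in> laurent m" "\<forall>q\<in>S. f q = 0"
  then show "f p = 0" using laurent_imp_gpoly[OF *(2)] assms by (metis subsetD)
next
  fix f assume *: "\<forall>f\<in>laurent m. (\<forall>q\<in>S. f q = 0) \<longrightarrow> f p = 0" "gpoly f \<and> (\<forall>q\<in>S. f q = 0)"
  then obtain g where "g \<in> laurent m" "\<forall>p\<in>Gpts m. g p = f p" using gpoly_imp_laurent by blast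
  then show "f p = 0" using * assms by (metis subsetD)
qed

lemma cl_iff:
  assumes "S \<subseteq> Gpts m"
  shows "p \<in> cl m S \<longleftrightarrow> p \<in> Gpts m \<and> (\<forall>f\<in>laurent m. (\<forall>q\<in>S. f q = 0) \<longrightarrow> f p = 0)"
  using gpoly_zero_iff_laurent[OF assms, of p] by (auto simp: zcl_def)

lemma cl_subset_Gpts: "cl m S \<subseteq> Gpts m" and cl_superset: "S \<subseteq> Gpts m \<Longrightarrow> S \<subseteq> cl m S"
  and cl_mono: "S \<subseteq> T \<Longrightarrow> cl m S \<subseteq> cl m T"
  by (auto simp: zcl_def)

lemma cl_vanish:
  assumes "S \<subseteq> Gpts m" "f \<in> laurent m"
  shows "(\<forall>p\<in>cl m S. f p = 0) \<longleftrightarrow> (\<forall>p\<in>S. f p = 0)"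
  using assms cl_superset[OF assms(1)] by (auto simp: cl_iff)

lemma cl_least: "S \<subseteq> cl m T \<Longrightarrow> T \<subseteq> Gpts m \<Longrightarrow> cl m S \<subseteq> cl m T"
  unfolding zcl_def by blast

lemma cl_cl: "S \<subseteq> Gpts m \<Longrightarrow> cl m (cl m S) = cl m S"
  using cl_least[of "cl m S" m S] cl_superset[OF cl_subset_Gpts, of m S] by blast

lemma zclosed_in_cl: "zclosed_in (Gpts m) (cl m S)"
  unfolding zclosed_in_def by (auto simp: zcl_def intro!: exI[of _ "{f. gpoly f \<and> (\<forall>Q\<in>S. f Q = 0)}"])

lemma zclosed_in_iff: "zclosed_in (Gpts m) X \<longleftrightarrow> X \<subseteq> Gpts m \<and> cl m X = X"
proof
  assume "zclosed_in (Gpts m) X"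
  then obtain F where F: "X \<subseteq> Gpts m" "\<forall>f\<in>F. gpoly f" "X = {P\<in>Gpts m. \<forall>f\<in>F. f P = 0}"
    by (auto simp: zclosed_in_def)
  have "cl m X \<subseteq> X"
  proof
    fix p assume "p \<in> cl m X"
    then have p: "p \<in> Gpts m" "\<And>f. gpoly f \<Longrightarrow> \<forall>q\<in>X. f q = 0 \<Longrightarrow> f p = 0" by (auto simp: zcl_def)
    have "f p = 0" if "f \<in> F" for f
      using p(2)[of f] F(2,3) that by blast
    then show "p \<in> X" using F(3) p(1) by blast
  qed
  then show "X \<subseteq> Gpts m \<and> cl m X = X" using F(1) cl_superset by blast
qed (metis zclosed_in_cl)

lemma zclosed_in_zclosed:
  assumes "zclosed_in (Gpts m) X"
  shows "zclosed_in X C \<longleftrightarrow> C \<subseteq> X \<and> zclosed_in (Gpts m) C"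
proof
  assume C: "C \<subseteq> X \<and> zclosed_in (Gpts m) C"
  then obtain F where F: "\<forall>f\<in>F. gpoly f" "C = {P\<in>Gpts m. \<forall>f\<in>F. f P = 0}"
    unfolding zclosed_in_def by blast
  have "X \<subseteq> Gpts m" using assms by (simp add: zclosed_in_iff)
  then have "C = {P\<in>X. \<forall>f\<in>F. f P = 0}" using F(2) C by blast
  then show "zclosed_in X C" using C F(1) unfolding zclosed_in_def by blast
next
  assume C: "zclosed_in X C"
  obtain F where F: "\<forall>f\<in>F. gpoly f" "X = {P\<in>Gpts m. \<forall>f\<in>F. f P = 0}"
    using assms unfolding zclosed_in_def by blast
  obtain G where G: "\<forall>f\<in>G. gpoly f" "C = {P\<in>X. \<forall>f\<in>G. f P = 0}"
    using C unfolding zclosed_in_def by blast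
  have "C = {P\<in>Gpts m. \<forall>f\<in>F \<union> G. f P = 0}" using F(2) G(2) by blast
  then show "C \<subseteq> X \<and> zclosed_in (Gpts m) C"
    using F G unfolding zclosed_in_def by (intro conjI exI[of _ "F \<union> G"]) auto
qed

text \<open>If a product vanishes on \<open>X\<close>, the zero sets of its factors are closed and
  cover \<open>X\<close>. Conversely, two proper closed subsets covering \<open>X\<close> lie in
  zero sets of functions that each fail to vanish somewhere on \<open>X\<close>, while their product
  vanishes.\<close>

lemma zirred_iff:
  assumes "X \<subseteq> Gpts m"
  shows "zirred X \<longleftrightarrow> irr m X"
proof
  assume X: "zirred X"
  show "irr m X"
    unfolding irr_def
  proof (intro conjI ballI impI)
    show "X \<noteq> {}" using X by (simp add: zirred_def)
    fix f g assume fg: "f \<in> laurent m" "g \<in> laurent m" "\<forall>p\<in>X. f p * g p = 0"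
    obtain f' where f': "gpoly f'" "\<And>p. p \<in> Gpts m \<Longrightarrow> f' p = 0 \<longleftrightarrow> f p = 0"
      using laurent_imp_gpoly[OF fg(1)] by blast
    obtain g' where g': "gpoly g'" "\<And>p. p \<in> Gpts m \<Longrightarrow> g' p = 0 \<longleftrightarrow> g p = 0"
      using laurent_imp_gpoly[OF fg(2)] by blast
    define A B where "A = {p\<in>X. \<forall>h\<in>{f'}. h p = 0}" and "B = {p\<in>X. \<forall>h\<in>{g'}. h p = 0}"
    have "zclosed_in X A" "zclosed_in X B"
      unfolding zclosed_in_def using f'(1) g'(1)
      by (intro conjI exI[of _ "{f'}"] exI[of _ "{g'}"]; auto simp: A_def B_def)+
    moreover have "X = A \<union> B"
    proof -
      have "f' p = 0 \<or> g' p = 0" if "p \<in> X" for p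
        using fg(3) f'(2)[of p] g'(2)[of p] assms that by (metis mult_eq_0_iff subsetD)
      then show ?thesis unfolding A_def B_def by blast
    qed
    ultimately have "A = X \<or> B = X" using X unfolding zirred_def by blast
    then have "(\<forall>p\<in>X. f' p = 0) \<or> (\<forall>p\<in>X. g' p = 0)" unfolding A_def B_def by blast
    then show "(\<forall>p\<in>X. f p = 0) \<or> (\<forall>p\<in>X. g p = 0)"
      using f'(2) g'(2) assms by blast
  qed
next
  assume X: "irr m X"
  show "zirred X"
    unfolding zirred_def
  proof (intro conjI allI impI)
    show "X \<noteq> {}" using X by (simp add: irr_def)
    fix A B assume *: "zclosed_in X A \<and> zclosed_in X B \<and> X = A \<union> B"
    show "A = X \<or> B = X"
    proof (rule ccontr)
      assume neg: "\<not> (A = X \<or> B = X)"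
      obtain F where F: "\<forall>f\<in>F. gpoly f" "A = {P\<in>X. \<forall>f\<in>F. f P = 0}"
        using * by (auto simp: zclosed_in_def)
      obtain G where G: "\<forall>f\<in>G. gpoly f" "B = {P\<in>X. \<forall>f\<in>G. f P = 0}"
        using * by (auto simp: zclosed_in_def)
      obtain p f where pf: "p \<in> X" "f \<in> F" "f p \<noteq> 0" using neg F by auto
      obtain q g where qg: "q \<in> X" "g \<in> G" "g q \<noteq> 0" using neg G by auto
      obtain f' where f': "f' \<in> laurent m" "\<forall>p\<in>Gpts m. f' p = f p" using gpoly_imp_laurent F pf by blast
      obtain g' where g': "g' \<in> laurent m" "\<forall>p\<in>Gpts m. g' p = g p" using gpoly_imp_laurent G qg by blast
      have "\<forall>p\<in>X. f p * g p = 0" using * F(2) G(2) pf qg by auto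
      then have "\<forall>p\<in>X. f' p * g' p = 0" using f'(2) g'(2) assms by (metis subsetD)
      then have "(\<forall>p\<in>X. f' p = 0) \<or> (\<forall>p\<in>X. g' p = 0)"
        using X f' g' unfolding irr_def by blast
      then show False using pf qg f' g' assms by (metis subsetD)
    qed
  qed
qed

lemma gvariety_iff: "gvariety m X \<longleftrightarrow> X \<subseteq> Gpts m \<and> cl m X = X \<and> irr m X"
  using zirred_iff by (auto simp: gvariety_def zclosed_in_iff)

lemma gvariety_cl:
  assumes "S \<subseteq> Gpts m" "irr m S"
  shows "gvariety m (cl m S)"
proof -
  have "irr m (cl m S)"
    unfolding irr_def
  proof (intro conjI ballI impI)
    show "cl m S \<noteq> {}" using assms cl_superset[OF assms(1)] by (auto simp: irr_def)
    fix f g assume fg: "f \<in> laurent m" "g \<in> laurent m" "\<forall>p\<in>cl m S. f p * g p = 0"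
    then have "\<forall>p\<in>S. f p * g p = 0" using cl_superset[OF assms(1)] by blast
    then show "(\<forall>p\<in>cl m S. f p = 0) \<or> (\<forall>p\<in>cl m S. g p = 0)"
      using assms(2) fg by (auto simp: irr_def cl_vanish[OF assms(1)])
  qed
  then show ?thesis
    using cl_cl[OF assms(1)] cl_subset_Gpts by (simp add: gvariety_iff)
qed

lemma ideal_van: "ideal_in (laurent m) (van m S)"
  using subring_intros[OF subring_laurent[of m]] by (auto simp: ideal_in_def van_def)

lemma prime_van: "irr m S \<longleftrightarrow> prime_in (laurent m) (van m S)"
proof
  assume S: "irr m S"
  have "1 \<notin> van m S" using S by (auto simp: van_def irr_def)
  moreover have "f \<in> van m S \<or> g \<in> van m S"
    if "f \<in> laurent m" "g \<in> laurent m" "f * g \<in> van m S" for f g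
  proof -
    have "\<forall>p\<in>S. f p * g p = 0" using that(3) by (auto simp: van_def)
    then show ?thesis using S that(1,2) unfolding irr_def van_def by blast
  qed
  ultimately show "prime_in (laurent m) (van m S)"
    using ideal_van by (auto simp: prime_in_def)
next
  assume P: "prime_in (laurent m) (van m S)"
  have "S \<noteq> {}" using prime_inD(2)[OF P] subring_1[OF subring_laurent] by (auto simp: van_def)
  moreover have "(\<forall>p\<in>S. f p = 0) \<or> (\<forall>p\<in>S. g p = 0)"
    if "f \<in> laurent m" "g \<in> laurent m" "\<forall>p\<in>S. f p * g p = 0" for f g
  proof -
    have "f * g \<in> van m S" using that by (auto simp: van_def intro: subring_mult[OF subring_laurent])
    then show ?thesis using prime_inD(3)[OF P that(1,2)] by (auto simp: van_def)
  qed
  ultimately show "irr m S" by (auto simp: irr_def)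
qed

lemma van_antimono: "S \<subseteq> T \<Longrightarrow> van m T \<subseteq> van m S"
  by (auto simp: van_def)

lemma subset_iff_van:
  assumes "T \<subseteq> Gpts m" "cl m S = S" "S \<subseteq> Gpts m"
  shows "T \<subseteq> S \<longleftrightarrow> van m S \<subseteq> van m T"
proof
  assume *: "van m S \<subseteq> van m T"
  have "T \<subseteq> cl m S"
  proof
    fix p assume "p \<in> T"
    then have "f p = 0" if "f \<in> laurent m" "\<forall>q\<in>S. f q = 0" for f
      using * that unfolding van_def by blast
    then show "p \<in> cl m S"
      using \<open>p \<in> T\<close> assms(1) unfolding cl_iff[OF assms(3)] by blast
  qed
  then show "T \<subseteq> S" using assms by simp
qed (rule van_antimono)

section \<open>Chains of irreducible closed sets\<close>

definition vchain :: "nat \<Rightarrow> (nat \<Rightarrow> ('a::field) gpt set) \<Rightarrow> nat \<Rightarrow> bool" where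
  "vchain m c k \<longleftrightarrow> (\<forall>l\<le>k. gvariety m (c l)) \<and> (\<forall>l<k. c l \<subset> c (Suc l))"

lemma vchain_mono: "vchain m c k \<Longrightarrow> l \<le> l' \<Longrightarrow> l' \<le> k \<Longrightarrow> c l \<subseteq> c l'"
proof (induction l')
  case (Suc l')
  show ?case
  proof (cases "l = Suc l'")
    case False
    then have "c l \<subseteq> c l'" using Suc by auto
    also have "c l' \<subseteq> c (Suc l')" using Suc.prems unfolding vchain_def by (meson Suc_le_lessD psubsetE)
    finally show ?thesis .
  qed simp
qed simp

text \<open>Replaces sets closed in \<open>X\<close> by closed subsets of \<open>Gpts m\<close>, so
  that chains can be compared across different \<open>X\<close>; only the top member has to be
  checked against \<open>X\<close>.\<close>

lemma kdim_eq_Max: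
  assumes "zclosed_in (Gpts m) X"
  shows "kdim X = Max {k. \<exists>c. vchain m c k \<and> c k \<subseteq> X}"
proof -
  have "(\<forall>l\<le>k. zclosed_in X (c l) \<and> zirred (c l)) \<and> (\<forall>l<k. c l \<subset> c (Suc l)) \<longleftrightarrow> vchain m c k \<and> c k \<subseteq> X" for c k
  proof
    assume "(\<forall>l\<le>k. zclosed_in X (c l) \<and> zirred (c l)) \<and> (\<forall>l<k. c l \<subset> c (Suc l))"
    then show "vchain m c k \<and> c k \<subseteq> X"
      by (auto simp: vchain_def gvariety_def zclosed_in_zclosed[OF assms])
  next
    assume *: "vchain m c k \<and> c k \<subseteq> X"
    then have "c l \<subseteq> X" if "l \<le> k" for l using vchain_mono[of m c k l k] that by blast
    then show "(\<forall>l\<le>k. zclosed_in X (c l) \<and> zirred (c l)) \<and> (\<forall>l<k. c l \<subset> c (Suc l))"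
      using * by (auto simp: vchain_def gvariety_def zclosed_in_zclosed[OF assms])
  qed
  then show ?thesis by (simp add: kdim_def)
qed

declare image_cong_simp [cong del]

lemma cst_subset_laurent: "range cst \<subseteq> laurent m"
  by (rule image_subsetI) (rule laurent_cst)

locale alg_closed_field =
  fixes ty :: "'a::field_char_0 itself"
  assumes alg_closed: "\<And>p::'a poly. degree p > 0 \<Longrightarrow> \<exists>x. poly p x = 0"
begin

sublocale fa: field_algebra "cst :: 'a \<Rightarrow> 'a gpt \<Rightarrow> 'a"
  by unfold_locales (auto simp: fun_eq_iff alg_closed)

text \<open>Vanishing ideals reverse inclusions, whence the index \<open>k - l\<close>; the bound is
  that of prime chains in a finitely generated algebra over the constants.\<close>

lemma vchain_bound: "\<exists>M. \<forall>c k. vchain m (c :: nat \<Rightarrow> 'a gpt set) k \<longrightarrow> k \<le> M"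
proof -
  obtain M where M: "\<And>c k. prime_chain (laurent m :: ('a gpt \<Rightarrow> 'a) set) c k \<Longrightarrow> k \<le> M"
    using prime_chain_bound[OF finite_lgens subring_cst, of 0 m] fa.prime_chain_K unfolding laurent_def by blast
  have "k \<le> M" if c: "vchain m c k" for c :: "nat \<Rightarrow> 'a gpt set" and k
  proof -
    have gv: "gvariety m (c l)" if "l \<le> k" for l using c that by (simp add: vchain_def)
    have "prime_chain (laurent m) (\<lambda>l. van m (c (k - l))) k"
      unfolding prime_chain_def
    proof (intro conjI allI impI)
      fix l assume "l \<le> k"
      show "prime_in (laurent m) (van m (c (k - l)))"
        using gv[of "k - l"] by (simp add: gvariety_iff prime_van)
    next
      fix l assume l: "l < k"
      have "Suc (k - Suc l) = k - l" using l by simp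
      moreover have "k - Suc l < k" using l by simp
      ultimately have "c (k - Suc l) \<subset> c (k - l)" using c unfolding vchain_def by metis
      moreover have "van m (c (k - l)) \<subseteq> van m (c (k - Suc l)) \<longleftrightarrow> c (k - Suc l) \<subseteq> c (k - l)"
        "van m (c (k - Suc l)) \<subseteq> van m (c (k - l)) \<longleftrightarrow> c (k - l) \<subseteq> c (k - Suc l)"
        using gv[of "k - l"] gv[of "k - Suc l"] unfolding gvariety_iff
        by (intro subset_iff_van[symmetric]; simp)+
      ultimately show "van m (c (k - l)) \<subset> van m (c (k - Suc l))" by blast
    qed
    then show ?thesis by (rule M)
  qed
  then show ?thesis by blast
qed

lemma finite_vchain_lengths: "finite {k. \<exists>c. vchain m (c :: nat \<Rightarrow> 'a gpt set) k \<and> c k \<subseteq> X}"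
proof -
  obtain M where "\<forall>c k. vchain m (c :: nat \<Rightarrow> 'a gpt set) k \<longrightarrow> k \<le> M" using vchain_bound by blast
  then have "{k. \<exists>c. vchain m (c :: nat \<Rightarrow> 'a gpt set) k \<and> c k \<subseteq> X} \<subseteq> {..M}" by blast
  then show ?thesis using finite_subset finite_atMost by blast
qed

lemma kdim_ge:
  fixes X :: "'a gpt set"
  assumes "zclosed_in (Gpts m) X" "vchain m c k" "c k \<subseteq> X"
  shows "k \<le> kdim X"
  unfolding kdim_eq_Max[OF assms(1)] using assms by (intro Max_ge finite_vchain_lengths) blast

lemma kdim_chain:
  fixes X :: "'a gpt set"
  assumes "gvariety m X"
  obtains c where "vchain m c (kdim X)" "c (kdim X) \<subseteq> X"
proof -
  have cl: "zclosed_in (Gpts m) X" using assms by (simp add: gvariety_def)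
  have "vchain m (\<lambda>_. X) 0" using assms by (simp add: vchain_def)
  then have "{k. \<exists>c. vchain m c k \<and> c k \<subseteq> X} \<noteq> {}" by blast
  from Max_in[OF finite_vchain_lengths this] show ?thesis
    using that unfolding kdim_eq_Max[OF cl, symmetric] by blast
qed

text \<open>A longest chain in \<open>X\<close> can be prolonged by \<open>Y\<close>.\<close>

lemma kdim_less:
  fixes X Y :: "'a gpt set"
  assumes "gvariety m X" "gvariety m Y" "X \<subset> Y"
  shows "kdim X < kdim Y"
proof -
  obtain c where c: "vchain m c (kdim X)" "c (kdim X) \<subseteq> X" using kdim_chain[OF assms(1)] by blast
  have "vchain m (c(Suc (kdim X) := Y)) (Suc (kdim X))"
    using c assms unfolding vchain_def by (auto simp: less_Suc_eq)
  from kdim_ge[OF _ this, of Y] show ?thesis using assms(2) by (simp add: gvariety_def)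
qed

lemma van_inter_cst:
  fixes S :: "'a gpt set"
  assumes "irr m S" "0 \<in> P"
  shows "range cst \<inter> van m S \<subseteq> P"
proof -
  have "a = 0" if "a \<in> range cst" "a \<in> van m S" for a
  proof (rule fa.K_inter_prime[OF _ _ that])
    show "prime_in (laurent m) (van m S)" using assms(1) by (simp add: prime_van)
  qed (rule cst_subset_laurent)
  then show ?thesis using assms(2) by (metis IntE subsetI)
qed

text \<open>Each strict step provides a function vanishing on the smaller variety but not on the
  larger one, and \<open>indep_extend\<close> adds it to the list.\<close>

lemma indep_of_vchain:
  assumes "vchain m c k"
  shows "\<exists>ts :: ('a gpt \<Rightarrow> 'a) list. length ts = k \<and> set ts \<subseteq> laurent m \<and> indep (van m (c k)) (range cst) ts"
  using assms
proof (induction k)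
  case 0
  then show ?case by auto
next
  case (Suc k)
  then have "vchain m c k" by (simp add: vchain_def)
  then obtain ts where ts: "length ts = k" "set ts \<subseteq> laurent m" "indep (van m (c k)) (range cst) ts"
    using Suc.IH by blast
  have gv: "gvariety m (c k)" "gvariety m (c (Suc k))" and sub: "c k \<subset> c (Suc k)"
    using Suc.prems by (auto simp: vchain_def)
  then have pr: "irr m (c k)" "prime_in (laurent m) (van m (c (Suc k)))" by (auto simp: gvariety_iff prime_van)
  have "\<not> van m (c k) \<subseteq> van m (c (Suc k))"
    using sub gv subset_iff_van[of "c (Suc k)" m "c k"] by (auto simp: gvariety_iff)
  then obtain g where g: "g \<in> van m (c k)" "g \<notin> van m (c (Suc k))" by blast
  note K = cst_subset_laurent
  have "0 \<in> van m (c (Suc k))" by (rule ideal_inD(2)[OF ideal_van])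
  then have "indep (van m (c (Suc k))) (range cst) (g # ts)"
    by (rule indep_extend[OF subring_laurent pr(2) ideal_van subring_cst K van_inter_cst[OF pr(1)]
          van_antimono[OF psubset_imp_subset[OF sub]] ts(3,2) g])
  moreover have "g \<in> laurent m" using g(1) by (simp add: van_def)
  ultimately show ?case using ts(1,2) by (intro exI[of _ "g # ts"]) (simp del: cst_apply)
qed

text \<open>A longest chain is only known to end inside \<open>X\<close>; its independent list is
  carried over to the smaller ideal of \<open>X\<close> by \<open>indep_antimono\<close>.\<close>

lemma kdim_indep:
  fixes X :: "'a gpt set"
  assumes X: "gvariety m X"
  shows "\<exists>ts. length ts = kdim X \<and> set ts \<subseteq> laurent m \<and> indep (van m X) (range cst) ts"
proof -
  obtain c where c: "vchain m c (kdim X)" "c (kdim X) \<subseteq> X" using kdim_chain[OF X] by blast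
  obtain ts :: "('a gpt \<Rightarrow> 'a) list" where ts: "length ts = kdim X" "set ts \<subseteq> laurent m"
    "indep (van m (c (kdim X))) (range cst) ts"
    using indep_of_vchain[OF c(1)] by blast
  have pr: "irr m (c (kdim X))" "prime_in (laurent m) (van m X)"
    using c X by (auto simp: vchain_def gvariety_iff prime_van)
  note K = cst_subset_laurent
  have "0 \<in> van m X" by (rule ideal_inD(2)[OF ideal_van])
  then have "indep (van m X) (range cst) ts"
    by (intro indep_antimono[OF subring_laurent pr(2) subring_cst K van_inter_cst[OF pr(1)] van_antimono[OF c(2)] ts(3,2)])
  then show ?thesis using ts by blast
qed

text \<open>The point is read off from the images of the coordinate functions, with 0 and 1 as the
  canonical padding. Killing \<open>van m (Gpts m)\<close> forces \<open>wi j\<close> to go to the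
  inverse of the image of \<open>wc j\<close>.\<close>

lemma laurent_hom_eval:
  fixes \<psi> :: "('a gpt \<Rightarrow> 'a) \<Rightarrow> 'a"
  assumes \<psi>: "hom_on (laurent m) \<psi>" "\<And>c. \<psi> (cst c) = c" "\<And>f. f \<in> van m (Gpts m) \<Longrightarrow> \<psi> f = 0"
  obtains p where "p \<in> Gpts m" "\<And>f. f \<in> laurent m \<Longrightarrow> \<psi> f = f p"
proof -
  define p where "p = (\<lambda>j. if j < m then \<psi> (zc j) else 0, \<lambda>j. if j < m then \<psi> (wc j) else 1)"
  have inv: "\<psi> (wi j) * \<psi> (wc j) = 1" if "j < m" for j
  proof -
    have "wi j * wc j - cst 1 \<in> van m (Gpts m)"
      using that by (auto simp: van_def Gpts_nz intro!: laurent_intros)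
    moreover have "wi j * wc j \<in> laurent m" "wi j * wc j - cst 1 \<in> laurent m"
      using that by (auto intro!: laurent_intros)
    moreover have "\<psi> ((wi j * wc j - cst 1) + cst 1) = \<psi> (wi j * wc j - cst 1) + \<psi> (cst 1)"
      using \<psi>(1) calculation(3) laurent_cst unfolding hom_on_def by blast
    ultimately have "\<psi> (wi j * wc j) = 1" using \<psi> by simp
    then show ?thesis
      using \<psi>(1) laurent_wi[OF that] laurent_wc[OF that] unfolding hom_on_def by metis
  qed
  have "\<psi> (wc j) \<noteq> 0" if "j < m" for j using inv[OF that] by auto
  then have "p \<in> Gpts m" by (auto simp: p_def Gpts_def)
  moreover have "\<psi> f = f p" if "f \<in> laurent m" for f
    using that
  proof (induction rule: laurent_induct)
    case (wi j)
    have "inverse (\<psi> (wc j)) = \<psi> (wi j)"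
      using inv[OF wi] by (intro inverse_unique) (simp add: mult.commute)
    then have "wi j p = \<psi> (wi j)" using wi by (simp add: p_def)
    then show ?case by (rule sym)
  next
    case (add f g)
    then have "\<psi> (f + g) = (f + g) p" using \<psi>(1) unfolding hom_on_def plus_fun_apply by metis
    then show ?case .
  next
    case (mult f g)
    then have "\<psi> (f * g) = (f * g) p" using \<psi>(1) unfolding hom_on_def times_fun_apply by metis
    then show ?case .
  next
    case (cst c)
    have "\<psi> (cst c) = cst c p" using \<psi>(2) by simp
    then show ?case .
  next
    case (zc j)
    then have "\<psi> (zc j) = zc j p" by (simp add: p_def)
    then show ?case .
  next
    case (wc j)
    then have "\<psi> (wc j) = wc j p" by (simp add: p_def)
    then show ?case .
  qed
  ultimately show ?thesis using that by blast
qed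

definition zeros :: "nat \<Rightarrow> ('a gpt \<Rightarrow> 'a) set \<Rightarrow> 'a gpt set" where
  "zeros m Q = {p \<in> Gpts m. \<forall>f\<in>Q. f p = 0}"

text \<open>By the Nullstellensatz a function outside \<open>Q\<close> is nonzero under some
  homomorphism that kills \<open>Q\<close>, and that homomorphism is evaluation at a zero of
  \<open>Q\<close>.\<close>

lemma zeros_prime:
  assumes Q: "prime_in (laurent m) Q" "van m (Gpts m) \<subseteq> Q"
  shows "van m (zeros m Q) = Q" "gvariety m (zeros m Q)"
proof -
  have sub: "Q \<subseteq> van m (zeros m Q)"
    using ideal_inD(1)[OF prime_inD(1)[OF Q(1)]] unfolding van_def zeros_def by blast
  have "g \<in> Q" if g: "g \<in> van m (zeros m Q)" for g
  proof (rule ccontr)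
    assume "g \<notin> Q"
    have pr: "prime_in (alg (range cst) (lgens m)) Q" using Q by (simp add: laurent_def)
    have gL: "g \<in> alg (range cst) (lgens m)" using g by (auto simp: van_def laurent_def)
    obtain \<psi> :: "('a gpt \<Rightarrow> 'a) \<Rightarrow> 'a" where \<psi>: "hom_on (laurent m) \<psi>" "\<And>c. \<psi> (cst c) = c"
      "\<And>a. a \<in> Q \<Longrightarrow> \<psi> a = 0" "\<psi> g \<noteq> 0"
      using fa.nullstellensatz[OF finite_lgens pr gL \<open>g \<notin> Q\<close>] unfolding laurent_def by blast
    obtain p where p: "p \<in> Gpts m" "\<And>f. f \<in> laurent m \<Longrightarrow> \<psi> f = f p"
      using laurent_hom_eval[OF \<psi>(1,2)] \<psi>(3) Q(2) by blast
    have "f p = 0" if "f \<in> Q" for f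
      using p(2)[of f] \<psi>(3)[OF that] sub that by (auto simp: van_def)
    then have "p \<in> zeros m Q"
      using p(1) by (simp add: zeros_def)
    then show False using g p(2)[of g] \<psi>(4) by (auto simp: van_def)
  qed
  then show eq: "van m (zeros m Q) = Q" using sub by blast
  have "zeros m Q \<subseteq> Gpts m" by (auto simp: zeros_def)
  moreover have "cl m (zeros m Q) \<subseteq> zeros m Q"
  proof
    fix p assume p: "p \<in> cl m (zeros m Q)"
    then have "f p = 0" if "f \<in> Q" for f
      using that sub unfolding cl_iff[OF \<open>zeros m Q \<subseteq> Gpts m\<close>] van_def by blast
    then show "p \<in> zeros m Q" using p cl_subset_Gpts by (auto simp: zeros_def)
  qed
  ultimately show "gvariety m (zeros m Q)"
    using Q(1) cl_superset[of "zeros m Q" m] unfolding gvariety_iff prime_van eq by blast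
qed

lemma zeros_van: "gvariety m X \<Longrightarrow> zeros m (van m X) = X"
proof -
  assume X: "gvariety m X"
  then have "X \<subseteq> Gpts m" "cl m X = X" by (simp_all add: gvariety_iff)
  then have "p \<in> X \<longleftrightarrow> p \<in> Gpts m \<and> (\<forall>f\<in>laurent m. (\<forall>q\<in>X. f q = 0) \<longrightarrow> f p = 0)" for p
    using cl_iff[of X m p] by simp
  then show ?thesis unfolding zeros_def van_def by blast
qed

text \<open>Converse of \<open>indep_of_vchain\<close>, through primes above fibres. That successive
  members are separated by some \<open>t - a\<close> with \<open>t\<close> from the list matters
  later: if the list is pulled back from an image, so are the separating functions.\<close>

theorem vchain_of_indep:
  fixes X :: "'a gpt set"
  assumes X: "gvariety m X" and ts: "indep (van m X) (range cst) ts" "set ts \<subseteq> laurent m"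
  obtains c where "vchain m c (length ts)" "c (length ts) = X"
    "\<And>l. l < length ts \<Longrightarrow> \<exists>t\<in>set ts. \<exists>a. (\<forall>p\<in>c l. t p = a) \<and> (\<exists>p\<in>c (Suc l). t p \<noteq> a)"
proof -
  have pr: "prime_in (alg (range cst) (lgens m)) (van m X)" using X by (simp add: gvariety_iff prime_van laurent_def)
  obtain q where q: "q (length ts) = van m X" "\<forall>l\<le>length ts. prime_in (laurent m) (q l)"
    "\<forall>l<length ts. q (Suc l) \<subseteq> q l \<and> (\<exists>t\<in>set ts. \<exists>a. t - cst a \<in> q l \<and> t - cst a \<notin> q (Suc l))"
    using fa.prime_chain_of_indep[OF finite_lgens pr ts[unfolded laurent_def]] unfolding laurent_def
    by (elim exE conjE)
  have base: "van m (Gpts m) \<subseteq> q l" if "l \<le> length ts" for l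
    using that
  proof (induction "length ts - l" arbitrary: l)
    case 0
    then have "l = length ts" by simp
    then show ?case using q(1) X van_antimono[of X "Gpts m" m] by (simp add: gvariety_iff)
  next
    case (Suc d)
    then have "l < length ts" by linarith
    then have "q (Suc l) \<subseteq> q l" using q(3) by blast
    moreover have "van m (Gpts m) \<subseteq> q (Suc l)" using Suc \<open>l < length ts\<close> by (intro Suc.hyps(1)) auto
    ultimately show ?case by blast
  qed
  define c where "c l = zeros m (q l)" for l
  have c: "van m (c l) = q l" "gvariety m (c l)" if "l \<le> length ts" for l
    using zeros_prime[of m "q l"] q(2) base that by (auto simp: c_def)
  have sep: "\<exists>t\<in>set ts. \<exists>a. (\<forall>p\<in>c l. t p = a) \<and> (\<exists>p\<in>c (Suc l). t p \<noteq> a)" if l: "l < length ts" for l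
  proof -
    obtain t a where t: "t \<in> set ts" "t - cst a \<in> van m (c l)" "t - cst a \<notin> van m (c (Suc l))"
      using q(3) l c(1)[of l] c(1)[of "Suc l"] by fastforce
    moreover have "t - cst a \<in> laurent m" using t(2) by (auto simp: van_def)
    ultimately show ?thesis by (intro bexI[of _ t] exI[of _ a]) (auto simp: van_def)
  qed
  have "c l \<subset> c (Suc l)" if l: "l < length ts" for l
  proof -
    have "c l \<subseteq> c (Suc l)" using q(3) l by (auto simp: c_def zeros_def)
    then show ?thesis using sep[OF l] by blast
  qed
  then have "vchain m c (length ts)" using c by (auto simp: vchain_def)
  moreover have "c (length ts) = X" using zeros_van[OF X] q(1) by (simp add: c_def)
  ultimately show ?thesis using sep by (rule that)
qed

end

section \<open>Morphisms\<close>

text \<open>Weaker than \<open>morph\<close>: zero sets pull back to zero sets. Conjugation of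
  coordinates is of this kind, since it pulls a function back to the conjugate of a
  function.\<close>

definition zmorph :: "nat \<Rightarrow> nat \<Rightarrow> (('a::field) gpt \<Rightarrow> 'a gpt) \<Rightarrow> bool" where
  "zmorph m k \<phi> \<longleftrightarrow> \<phi> ` Gpts m \<subseteq> Gpts k \<and>
     (\<forall>f\<in>laurent k. \<exists>g\<in>laurent m. \<forall>p\<in>Gpts m. g p = 0 \<longleftrightarrow> f (\<phi> p) = 0)"

definition morph :: "nat \<Rightarrow> nat \<Rightarrow> (('a::field) gpt \<Rightarrow> 'a gpt) \<Rightarrow> bool" where
  "morph m k \<phi> \<longleftrightarrow> \<phi> ` Gpts m \<subseteq> Gpts k \<and> (\<forall>f\<in>laurent k. (\<lambda>p. f (\<phi> p)) \<in> laurent m)"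

lemma morph_imp_zmorph: "morph m k \<phi> \<Longrightarrow> zmorph m k \<phi>"
  unfolding morph_def zmorph_def by (metis (mono_tags, lifting))

lemma laurent_add: "f \<in> laurent m \<Longrightarrow> g \<in> laurent m \<Longrightarrow> (\<lambda>p. f p + g p) \<in> laurent m"
  using subring_add[OF subring_laurent] unfolding plus_fun_def by blast

lemma laurent_mult: "f \<in> laurent m \<Longrightarrow> g \<in> laurent m \<Longrightarrow> (\<lambda>p. f p * g p) \<in> laurent m"
  using subring_mult[OF subring_laurent] unfolding times_fun_def by blast

lemma laurent_const: "(\<lambda>_. c) \<in> laurent m"
  using laurent_cst unfolding cst_def by blast

lemma laurent_sum: "(\<And>s. s \<in> S \<Longrightarrow> f s \<in> laurent m) \<Longrightarrow> (\<lambda>p. \<Sum>s\<in>S. f s p) \<in> laurent m"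
  by (induction S rule: infinite_finite_induct) (auto intro: laurent_add laurent_const)

lemma laurent_prod: "(\<And>s. s \<in> S \<Longrightarrow> f s \<in> laurent m) \<Longrightarrow> (\<lambda>p. \<Prod>s\<in>S. f s p) \<in> laurent m"
  by (induction S rule: infinite_finite_induct) (auto intro: laurent_mult laurent_const)

lemma laurent_pow: "f \<in> laurent m \<Longrightarrow> (\<lambda>p. f p ^ k) \<in> laurent m"
  by (induction k) (auto intro: laurent_mult laurent_const)

lemma laurent_fst: "j < m \<Longrightarrow> (\<lambda>p. fst p j) \<in> laurent m"
  and laurent_snd: "j < m \<Longrightarrow> (\<lambda>p. snd p j) \<in> laurent m"
  and laurent_inverse_snd: "j < m \<Longrightarrow> (\<lambda>p. inverse (snd p j)) \<in> laurent m"
  using laurent_zc laurent_wc laurent_wi unfolding zc_def wc_def wi_def by blast+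

lemma laurent_powi: "j < m \<Longrightarrow> (\<lambda>p. snd p j powi e) \<in> laurent m"
  by (cases "e \<ge> 0") (auto simp: power_int_def intro: laurent_pow laurent_snd laurent_inverse_snd)

lemma laurent_comp:
  assumes "f \<in> laurent k" "\<And>j. j < k \<Longrightarrow> (\<lambda>p. fst (\<phi> p) j) \<in> laurent m"
    "\<And>j. j < k \<Longrightarrow> (\<lambda>p. snd (\<phi> p) j) \<in> laurent m"
    "\<And>j. j < k \<Longrightarrow> (\<lambda>p. inverse (snd (\<phi> p) j)) \<in> laurent m"
  shows "(\<lambda>p. f (\<phi> p)) \<in> laurent m"
  using assms(1)
proof (induction rule: laurent_induct)
  case (cst c)
  then show ?case by (simp add: laurent_const)
next
  case (add f g)
  then show ?case using laurent_add[OF add(3,4)] by simp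
next
  case (mult f g)
  then show ?case using laurent_mult[OF mult(3,4)] by simp
qed (simp_all add: assms)

lemma morphI:
  assumes "\<And>p. p \<in> Gpts m \<Longrightarrow> \<phi> p \<in> Gpts k" "\<And>j. j < k \<Longrightarrow> (\<lambda>p. fst (\<phi> p) j) \<in> laurent m"
    "\<And>j. j < k \<Longrightarrow> (\<lambda>p. snd (\<phi> p) j) \<in> laurent m"
    "\<And>j. j < k \<Longrightarrow> (\<lambda>p. inverse (snd (\<phi> p) j)) \<in> laurent m"
  shows "morph m k \<phi>"
  using assms laurent_comp[of _ k \<phi> m] unfolding morph_def by blast

lemma zmorph_in: "zmorph m k \<phi> \<Longrightarrow> p \<in> Gpts m \<Longrightarrow> \<phi> p \<in> Gpts k"
  unfolding zmorph_def by blast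

lemma zmorph_pull:
  assumes "zmorph m k \<phi>" "f \<in> laurent k"
  obtains g where "g \<in> laurent m" "\<And>p. p \<in> Gpts m \<Longrightarrow> g p = 0 \<longleftrightarrow> f (\<phi> p) = 0"
proof -
  have "\<exists>g\<in>laurent m. \<forall>p\<in>Gpts m. g p = 0 \<longleftrightarrow> f (\<phi> p) = 0"
    by (rule bspec[OF conjunct2[OF assms(1)[unfolded zmorph_def]] assms(2)])
  then show ?thesis by (elim bexE) (rule that, assumption, erule bspec)
qed

lemma zmorph_Gpts: "zmorph m k \<phi> \<Longrightarrow> S \<subseteq> Gpts m \<Longrightarrow> \<phi> ` S \<subseteq> Gpts k"
  unfolding zmorph_def by blast

lemma zmorph_comp:
  assumes "zmorph m k \<phi>" "zmorph k l \<chi>"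
  shows "zmorph m l (\<lambda>p. \<chi> (\<phi> p))"
  unfolding zmorph_def
proof (intro conjI ballI)
  show "(\<lambda>p. \<chi> (\<phi> p)) ` Gpts m \<subseteq> Gpts l"
    by (intro image_subsetI zmorph_in[OF assms(2)] zmorph_in[OF assms(1)])
  fix f :: "'a gpt \<Rightarrow> 'a" assume "f \<in> laurent l"
  then obtain g where g: "g \<in> laurent k" "\<And>p. p \<in> Gpts k \<Longrightarrow> g p = 0 \<longleftrightarrow> f (\<chi> p) = 0"
    using zmorph_pull[OF assms(2)] by blast
  obtain h where h: "h \<in> laurent m" "\<And>p. p \<in> Gpts m \<Longrightarrow> h p = 0 \<longleftrightarrow> g (\<phi> p) = 0"
    using zmorph_pull[OF assms(1) g(1)] by blast
  show "\<exists>h\<in>laurent m. \<forall>p\<in>Gpts m. h p = 0 \<longleftrightarrow> f (\<chi> (\<phi> p)) = 0"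
    using g(2) h zmorph_in[OF assms(1)] by (intro bexI[of _ h]) simp_all
qed

lemma irr_image:
  assumes "irr m S" "S \<subseteq> Gpts m" "zmorph m k \<phi>"
  shows "irr k (\<phi> ` S)"
  unfolding irr_def
proof (intro conjI ballI impI)
  show "\<phi> ` S \<noteq> {}" using assms by (simp add: irr_def)
  fix f g assume fg: "f \<in> laurent k" "g \<in> laurent k" "\<forall>p\<in>\<phi> ` S. f p * g p = 0"
  obtain f' where f': "f' \<in> laurent m" "\<And>p. p \<in> Gpts m \<Longrightarrow> f' p = 0 \<longleftrightarrow> f (\<phi> p) = 0"
    using zmorph_pull[OF assms(3) fg(1)] by blast
  obtain g' where g': "g' \<in> laurent m" "\<And>p. p \<in> Gpts m \<Longrightarrow> g' p = 0 \<longleftrightarrow> g (\<phi> p) = 0"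
    using zmorph_pull[OF assms(3) fg(2)] by blast
  note * = f' g'
  have "f' p * g' p = 0" if "p \<in> S" for p
    using fg(3) * assms(2) that by (metis imageI mult_eq_0_iff subsetD)
  then have "(\<forall>p\<in>S. f' p = 0) \<or> (\<forall>p\<in>S. g' p = 0)"
    using assms(1) * unfolding irr_def by blast
  then show "(\<forall>p\<in>\<phi> ` S. f p = 0) \<or> (\<forall>p\<in>\<phi> ` S. g p = 0)"
    using * assms(2) by (metis image_iff subsetD)
qed

lemma zmorph_cl_subset:
  assumes "S \<subseteq> Gpts m" "zmorph m k \<phi>"
  shows "\<phi> ` cl m S \<subseteq> cl k (\<phi> ` S)"
proof
  fix q assume "q \<in> \<phi> ` cl m S"
  then obtain p where p: "p \<in> cl m S" "q = \<phi> p" by blast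
  have pG: "p \<in> Gpts m" using p cl_subset_Gpts by blast
  show "q \<in> cl k (\<phi> ` S)"
    unfolding cl_iff[OF zmorph_Gpts[OF assms(2,1)]]
  proof (intro conjI ballI impI)
    show "q \<in> Gpts k" using zmorph_in[OF assms(2) pG] p by simp
    fix f assume f: "f \<in> laurent k" "\<forall>q\<in>\<phi> ` S. f q = 0"
    obtain g where g: "g \<in> laurent m" "\<And>p. p \<in> Gpts m \<Longrightarrow> g p = 0 \<longleftrightarrow> f (\<phi> p) = 0"
      using zmorph_pull[OF assms(2) f(1)] by blast
    have "\<forall>p\<in>S. g p = 0" using f(2) g(2) assms(1) by (metis imageI subsetD)
    then have "g p = 0" using p(1) g(1) unfolding cl_iff[OF assms(1)] by blast
    then show "f q = 0" using g(2) pG p(2) by blast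
  qed
qed

lemma cl_image_cl:
  assumes "S \<subseteq> Gpts m" "zmorph m k \<phi>"
  shows "cl k (\<phi> ` cl m S) = cl k (\<phi> ` S)"
  using cl_least[OF zmorph_cl_subset[OF assms] zmorph_Gpts[OF assms(2,1)]]
    cl_mono[OF image_mono[OF cl_superset[OF assms(1)]], of k \<phi>] by blast

lemma gvariety_image:
  assumes "gvariety m X" "zmorph m k \<phi>"
  shows "gvariety k (cl k (\<phi> ` X))"
  using assms by (intro gvariety_cl irr_image[of m] zmorph_Gpts[of m]) (auto simp: gvariety_iff)

lemma gvariety_iso_image:
  assumes X: "gvariety m X" and \<phi>: "zmorph m m \<phi>" "zmorph m m \<chi>"
    and inv: "\<And>p. p \<in> Gpts m \<Longrightarrow> \<chi> (\<phi> p) = p" "\<And>p. p \<in> Gpts m \<Longrightarrow> \<phi> (\<chi> p) = p"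
  shows "gvariety m (\<phi> ` X)"
proof -
  have XG: "X \<subseteq> Gpts m" and XC: "cl m X = X" using X by (auto simp: gvariety_iff)
  have "cl m (\<phi> ` X) \<subseteq> \<phi> ` X"
  proof
    fix q assume q: "q \<in> cl m (\<phi> ` X)"
    have "\<chi> q \<in> cl m (\<chi> ` \<phi> ` X)" using zmorph_cl_subset[OF zmorph_Gpts[OF \<phi>(1) XG] \<phi>(2)] q by blast
    moreover have "\<chi> ` \<phi> ` X = X" using inv(1) XG by force
    ultimately have "\<chi> q \<in> X" using XC by simp
    then show "q \<in> \<phi> ` X" using inv(2)[of q] q cl_subset_Gpts by (metis imageI subsetD)
  qed
  then have "cl m (\<phi> ` X) = \<phi> ` X" using cl_superset[OF zmorph_Gpts[OF \<phi>(1) XG]] by blast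
  then show ?thesis using gvariety_image[OF X \<phi>(1)] by simp
qed

lemma vchain_iso_image:
  assumes c: "vchain m c k" and \<phi>: "zmorph m m \<phi>" "zmorph m m \<chi>"
    and inv: "\<And>p. p \<in> Gpts m \<Longrightarrow> \<chi> (\<phi> p) = p" "\<And>p. p \<in> Gpts m \<Longrightarrow> \<phi> (\<chi> p) = p"
  shows "vchain m (\<lambda>l. \<phi> ` c l) k"
  unfolding vchain_def
proof (intro conjI allI impI)
  fix l assume "l \<le> k"
  then show "gvariety m (\<phi> ` c l)"
    using c by (intro gvariety_iso_image[OF _ \<phi> inv]) (auto simp: vchain_def)
next
  fix l assume l: "l < k"
  have sub: "c l \<subset> c (Suc l)" using c l by (simp add: vchain_def)
  have G: "c (Suc l) \<subseteq> Gpts m" using c l by (simp add: vchain_def gvariety_iff)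
  have "inj_on \<phi> (c (Suc l))" using inv(1) G by (intro inj_on_inverseI[of _ \<chi>]) auto
  from inj_on_image_eq_iff[OF this, of "c l" "c (Suc l)"]
  show "\<phi> ` c l \<subset> \<phi> ` c (Suc l)" using sub by blast
qed

section \<open>Independent functions pulled back along a map\<close>

lemma poly_map_hom:
  assumes "\<theta> 0 = 0" "\<And>a b. \<theta> (a + b) = \<theta> a + \<theta> b" "\<And>a b. \<theta> (a * b) = \<theta> a * \<theta> b"
  shows "poly (map_poly \<theta> p) (\<theta> x) = \<theta> (poly p x)"
  by (induction p) (auto simp: map_poly_pCons assms)

lemma polys_image:
  assumes "p \<in> polys (\<theta> ` A)" "\<theta> 0 = 0" "0 \<in> A"
  shows "\<exists>q\<in>polys A. p = map_poly \<theta> q"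
  using assms(1)
proof (induction p)
  case 0
  then show ?case using assms by (intro bexI[of _ 0]) (auto simp: polys_def)
next
  case (pCons a p)
  have coeffs: "coeff (pCons a p) k \<in> \<theta> ` A" for k using pCons.prems by (auto simp: polys_def)
  have a: "a \<in> \<theta> ` A" using coeffs[of 0] by simp
  have p: "p \<in> polys (\<theta> ` A)" using coeffs[of "Suc k" for k] by (simp add: polys_def)
  obtain q b where "q \<in> polys A" "p = map_poly \<theta> q" "b \<in> A" "a = \<theta> b" using pCons.IH[OF p] a by blast
  then show ?case
    using assms by (intro bexI[of _ "pCons b q"]) (auto simp: map_poly_pCons polys_def coeff_pCons split: nat.split)
qed

lemma alg_image:
  assumes "\<And>a b. \<theta> (a + b) = \<theta> a + \<theta> b" "\<And>a b. \<theta> (a * b) = \<theta> a * \<theta> b"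
  shows "alg (\<theta> ` A) (\<theta> ` X) = \<theta> ` alg A X"
proof
  show "alg (\<theta> ` A) (\<theta> ` X) \<subseteq> \<theta> ` alg A X"
  proof
    fix y assume "y \<in> alg (\<theta> ` A) (\<theta> ` X)"
    then show "y \<in> \<theta> ` alg A X"
    proof induction
      case (alg_add a b)
      then obtain a' b' where "a = \<theta> a'" "b = \<theta> b'" "a' \<in> alg A X" "b' \<in> alg A X" by blast
      then show ?case by (intro image_eqI[of _ _ "a' + b'"] alg.alg_add) (simp_all only: assms)
    next
      case (alg_mult a b)
      then obtain a' b' where "a = \<theta> a'" "b = \<theta> b'" "a' \<in> alg A X" "b' \<in> alg A X" by blast
      then show ?case by (intro image_eqI[of _ _ "a' * b'"] alg.alg_mult) (simp_all only: assms)
    qed (auto intro: alg_base alg_gen)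
  qed
  show "\<theta> ` alg A X \<subseteq> alg (\<theta> ` A) (\<theta> ` X)"
  proof
    fix y assume "y \<in> \<theta> ` alg A X"
    then obtain x where "x \<in> alg A X" "y = \<theta> x" by blast
    then show "y \<in> alg (\<theta> ` A) (\<theta> ` X)"
    proof (induction arbitrary: y)
      case (alg_add a b)
      then show ?case by (simp only: assms alg.alg_add)
    next
      case (alg_mult a b)
      then show ?case by (simp only: assms alg.alg_mult)
    qed (auto intro: alg_base alg_gen)
  qed
qed

text \<open>A relation among the images lifts coefficient by coefficient to one among
  \<open>ts\<close>, and membership in the two ideals corresponds exactly along
  \<open>\<theta>\<close>.\<close>

lemma indep_hom:
  assumes \<theta>: "\<theta> 0 = 0" "\<And>a b. \<theta> (a + b) = \<theta> a + \<theta> b" "\<And>a b. \<theta> (a * b) = \<theta> a * \<theta> b"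
    and B: "is_subring B" and A: "is_subring A" "A \<subseteq> B"
    and P: "\<And>a. a \<in> B \<Longrightarrow> \<theta> a \<in> P' \<longleftrightarrow> a \<in> P"
    and ts: "indep P A ts" "set ts \<subseteq> B"
  shows "indep P' (\<theta> ` A) (map \<theta> ts)"
  using ts
proof (induction ts)
  case (Cons t ts)
  define C where "C = alg A (set ts)"
  have C: "is_subring C" "C \<subseteq> B"
    using alg_subring[OF A(1)] alg_least[OF B A(2)] Cons.prems by (auto simp: C_def)
  have "transc P' (\<theta> ` C) (\<theta> t)"
    unfolding transc_def
  proof (intro ballI impI allI)
    fix p k assume p: "p \<in> polys (\<theta> ` C)" "poly p (\<theta> t) \<in> P'"
    obtain q where q: "q \<in> polys C" "p = map_poly \<theta> q"
      using polys_image[where \<theta> = \<theta>, OF p(1) \<theta>(1) subring_0[OF C(1)]] by blast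
    have "poly q t \<in> B"
      using poly_in_alg[OF C(1) q(1), of t] alg_least[OF B C(2), of "{t}"] Cons.prems by auto
    then have "poly q t \<in> P" using p(2) P unfolding q(2) poly_map_hom[where \<theta> = \<theta>, OF \<theta>] by blast
    then have "coeff q k \<in> P" using Cons.prems q(1) by (auto simp: transc_def C_def)
    moreover have "coeff q k \<in> B" using q(1) C(2) by (auto simp: polys_def)
    ultimately show "coeff p k \<in> P'" using P by (simp add: q(2) coeff_map_poly \<theta>(1))
  qed
  then show ?case
    using Cons alg_image[where \<theta> = \<theta>, OF \<theta>(2,3), of A "set ts"] by (simp add: C_def)
qed simp

context alg_closed_field
begin

text \<open>Independent functions on the closure of the image stay independent when pulled back to
  \<open>X\<close>. The resulting chain ends in \<open>X\<close> itself, and its steps are detected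
  by functions of \<open>\<phi> p\<close> alone, so that they remain visible after
  \<open>\<phi>\<close>.\<close>

theorem vchain_over_image:
  fixes X :: "'a gpt set"
  assumes X: "gvariety m X" and \<phi>: "morph m k \<phi>"
  obtains c where "vchain m c (kdim (cl k (\<phi> ` X)))" "c (kdim (cl k (\<phi> ` X))) = X"
    "\<And>l. l < kdim (cl k (\<phi> ` X)) \<Longrightarrow>
      \<exists>f\<in>laurent k. (\<forall>p\<in>c l. f (\<phi> p) = 0) \<and> (\<exists>p\<in>c (Suc l). f (\<phi> p) \<noteq> 0)"
proof -
  define Y where "Y = cl k (\<phi> ` X)"
  have XG: "X \<subseteq> Gpts m" using X by (simp add: gvariety_iff)
  have YG: "\<phi> ` X \<subseteq> Gpts k" using zmorph_Gpts[OF morph_imp_zmorph[OF \<phi>] XG] .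
  have "gvariety k Y" unfolding Y_def by (rule gvariety_image[OF X morph_imp_zmorph[OF \<phi>]])
  then obtain ts where ts: "length ts = kdim Y" "set ts \<subseteq> laurent k" "indep (van k Y) (range cst) ts"
    using kdim_indep by blast
  define \<theta> where "\<theta> = (\<lambda>(f :: 'a gpt \<Rightarrow> 'a) p. f (\<phi> p))"
  have \<theta>: "\<theta> 0 = 0" "\<theta> (f + g) = \<theta> f + \<theta> g" "\<theta> (f * g) = \<theta> f * \<theta> g" for f g
    by (auto simp: \<theta>_def fun_eq_iff)
  have \<theta>L: "\<theta> f \<in> laurent m" if "f \<in> laurent k" for f
    using \<phi> that unfolding morph_def \<theta>_def by blast
  have "\<theta> f \<in> van m X \<longleftrightarrow> f \<in> van k Y" if "f \<in> laurent k" for f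
    using that \<theta>L[OF that] cl_vanish[OF YG that] by (simp add: van_def Y_def \<theta>_def)
  then have "indep (van m X) (\<theta> ` range cst) (map \<theta> ts)"
    by (intro indep_hom[where \<theta> = \<theta>, OF \<theta> subring_laurent subring_cst cst_subset_laurent _ ts(3,2)])
  moreover have "\<theta> ` range cst = range cst"
    unfolding image_image by (rule image_cong) (auto simp: \<theta>_def fun_eq_iff)
  ultimately have ind: "indep (van m X) (range cst) (map \<theta> ts)" by simp
  have "set (map \<theta> ts) \<subseteq> laurent m" using ts(2) \<theta>L by auto
  then obtain c where c: "vchain m c (length (map \<theta> ts))" "c (length (map \<theta> ts)) = X"
    "\<And>l. l < length (map \<theta> ts) \<Longrightarrow> \<exists>t\<in>set (map \<theta> ts). \<exists>a. (\<forall>p\<in>c l. t p = a) \<and> (\<exists>p\<in>c (Suc l). t p \<noteq> a)"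
    by (rule vchain_of_indep[OF X ind]) (rule that)
  show ?thesis
  proof (rule that[of c, folded Y_def])
    fix l assume "l < kdim Y"
    then have "l < length (map \<theta> ts)" using ts(1) by simp
    from c(3)[OF this] obtain t' where "t' \<in> set (map \<theta> ts)"
      and "\<exists>a. (\<forall>p\<in>c l. t' p = a) \<and> (\<exists>p\<in>c (Suc l). t' p \<noteq> a)" by (rule bexE)
    from this(2) obtain a where t': "(\<forall>p\<in>c l. t' p = a) \<and> (\<exists>p\<in>c (Suc l). t' p \<noteq> a)" by (rule exE)
    obtain t where t: "t \<in> set ts" "t' = \<theta> t" using \<open>t' \<in> set (map \<theta> ts)\<close> unfolding set_map by (elim imageE)
    have "t - cst a \<in> laurent k" using t(1) ts(2) by (intro subring_diff[OF subring_laurent] laurent_cst) auto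
    then show "\<exists>f\<in>laurent k. (\<forall>p\<in>c l. f (\<phi> p) = 0) \<and> (\<exists>p\<in>c (Suc l). f (\<phi> p) \<noteq> 0)"
      using t' unfolding t(2) \<theta>_def by (intro bexI[of _ "t - cst a"]) simp_all
  qed (use c ts in simp_all)
qed

corollary kdim_image_le:
  fixes X :: "'a gpt set"
  assumes X: "gvariety m X" and \<phi>: "morph m k \<phi>"
  shows "kdim (cl k (\<phi> ` X)) \<le> kdim X"
proof -
  obtain c where "vchain m c (kdim (cl k (\<phi> ` X)))" "c (kdim (cl k (\<phi> ` X))) = X"
    by (rule vchain_over_image[OF assms]) (rule that)
  then show ?thesis using X by (intro kdim_ge[of m X c]) (auto simp: gvariety_def)
qed

end

section \<open>The group structure and halving\<close>

definition gadd :: "('a::field) gpt \<Rightarrow> 'a gpt \<Rightarrow> 'a gpt" where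
  "gadd P Q = (\<lambda>j. fst P j + fst Q j, \<lambda>j. snd P j * snd Q j)"

definition ginv :: "('a::field) gpt \<Rightarrow> 'a gpt" where
  "ginv P = (\<lambda>j. - fst P j, \<lambda>j. inverse (snd P j))"

definition gscale :: "nat \<Rightarrow> ('a::field) gpt \<Rightarrow> 'a gpt" where
  "gscale e P = (\<lambda>j. of_nat e * fst P j, \<lambda>j. snd P j ^ e)"

lemma Gpts_iff: "P \<in> Gpts n \<longleftrightarrow> (\<forall>j\<ge>n. fst P j = 0 \<and> snd P j = 1) \<and> (\<forall>j<n. snd P j \<noteq> 0)"
  by (cases P) (simp add: Gpts_def)

lemma gpt_eqI: "(\<And>j. fst P j = fst Q j) \<Longrightarrow> (\<And>j. snd P j = snd Q j) \<Longrightarrow> P = Q"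
  by (cases P, cases Q) (auto simp: fun_eq_iff)

lemma gadd_in_Gpts: "P \<in> Gpts n \<Longrightarrow> Q \<in> Gpts n \<Longrightarrow> gadd P Q \<in> Gpts n"
  and ginv_in_Gpts: "P \<in> Gpts n \<Longrightarrow> ginv P \<in> Gpts n"
  and gscale_in_Gpts: "P \<in> Gpts n \<Longrightarrow> gscale e P \<in> Gpts n"
  by (auto simp: Gpts_iff gadd_def ginv_def gscale_def)

lemma gadd_commute: "gadd P Q = gadd Q P"
  and gadd_assoc: "gadd (gadd P Q) S = gadd P (gadd Q S)"
  by (auto simp: gadd_def algebra_simps)

lemma gadd_ginv:
  assumes "a \<in> Gpts n"
  shows "gadd (ginv a) (gadd a P) = P" "gadd a (gadd (ginv a) P) = P"
  using Gpts_nz[OF assms] by (auto intro!: gpt_eqI simp: gadd_def ginv_def)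

lemma mact_in_Gpts: "P \<in> Gpts n \<Longrightarrow> mact k n M P \<in> Gpts k"
  using Gpts_nz[of P n] by (simp add: Gpts_iff mact_def)

lemma morph_mact: "morph n k (mact k n M :: ('a::field) gpt \<Rightarrow> _)"
proof (rule morphI)
  fix j assume "j < k"
  then show "(\<lambda>p. fst (mact k n M p) j) \<in> laurent n" "(\<lambda>p. snd (mact k n M p) j) \<in> laurent n"
    by (auto simp: mact_def intro!: laurent_sum laurent_prod laurent_mult laurent_const laurent_fst laurent_powi)
  have "(\<lambda>p. inverse (snd (mact k n M p) j)) = (\<lambda>p. \<Prod>l<n. snd p l powi (- M j l) :: 'a)"
    using \<open>j < k\<close> by (auto simp: mact_def power_int_minus fun_eq_iff simp flip: prod_inversef)
  then show "(\<lambda>p. inverse (snd (mact k n M p) j) :: 'a) \<in> laurent n"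
    by (simp only:) (auto intro!: laurent_prod laurent_powi)
qed (rule mact_in_Gpts)

lemma morph_gscale: "morph n n (gscale e :: ('a::field) gpt \<Rightarrow> _)"
proof (rule morphI)
  fix j assume "j < n"
  then show "(\<lambda>p. fst (gscale e p) j) \<in> laurent n" "(\<lambda>p. snd (gscale e p) j) \<in> laurent n"
    "(\<lambda>p. inverse (snd (gscale e p) j)) \<in> laurent n"
    by (auto simp: gscale_def simp flip: power_inverse
        intro!: laurent_mult laurent_const laurent_fst laurent_pow laurent_snd laurent_inverse_snd)
qed (rule gscale_in_Gpts)

lemma morph_gadd: "a \<in> Gpts n \<Longrightarrow> morph n n (gadd a)"
  by (rule morphI)
    (auto simp: gadd_def inverse_mult_distrib gadd_in_Gpts[unfolded gadd_def]
      intro!: laurent_mult laurent_add laurent_const laurent_fst laurent_snd laurent_inverse_snd)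

lemma powi_sum: "(x :: 'a::field) \<noteq> 0 \<Longrightarrow> x powi (\<Sum>t\<in>S. f t) = (\<Prod>t\<in>S. x powi f t)"
  by (induction S rule: infinite_finite_induct) (auto simp: power_int_add)

lemma prod_powi: "(\<Prod>t\<in>S. f t :: 'a::field) powi e = (\<Prod>t\<in>S. f t powi e)"
  by (induction S rule: infinite_finite_induct) (auto simp: power_int_mult_distrib)

lemma mact_mact:
  assumes "P \<in> Gpts m"
  shows "mact k l A (mact l m B P) = mact k m (\<lambda>i j. \<Sum>t<l. A i t * B t j) P"
proof (rule gpt_eqI)
  fix i
  have "(\<Sum>t<l. of_int (A i t) * (\<Sum>j<m. of_int (B t j) * fst P j))
    = (\<Sum>j<m. of_int (\<Sum>t<l. A i t * B t j) * fst P j)"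
    unfolding sum_distrib_left of_int_sum sum_distrib_right of_int_mult
    by (subst sum.swap) (simp add: mult.assoc)
  then show "fst (mact k l A (mact l m B P)) i = fst (mact k m (\<lambda>i j. \<Sum>t<l. A i t * B t j) P) i"
    by (simp add: mact_def)
  have "(\<Prod>t<l. (\<Prod>j<m. snd P j powi B t j) powi A i t) = (\<Prod>j<m. snd P j powi (\<Sum>t<l. A i t * B t j))"
    unfolding prod_powi powi_sum[OF Gpts_nz[OF assms]]
    by (subst prod.swap) (simp add: mult.commute flip: power_int_mult)
  then show "snd (mact k l A (mact l m B P)) i = snd (mact k m (\<lambda>i j. \<Sum>t<l. A i t * B t j) P) i"
    by (simp add: mact_def)
qed

lemma mact_cong: "(\<And>i j. i < k \<Longrightarrow> j < n \<Longrightarrow> A i j = B i j) \<Longrightarrow> mact k n A P = mact k n B P"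
  by (rule gpt_eqI) (auto simp: mact_def)

lemma mact_gadd: "mact k n M (gadd P Q) = gadd (mact k n M P) (mact k n M Q)"
  by (rule gpt_eqI) (auto simp: mact_def gadd_def algebra_simps sum.distrib prod.distrib power_int_mult_distrib)

lemma mact_gscale: "mact k n M (gscale e P) = gscale e (mact k n M P)"
proof (rule gpt_eqI)
  fix i
  have "(x ^ e) powi a = (x powi a) ^ e" for x :: 'a and a :: int
    by (metis mult.commute power_int_mult power_int_of_nat)
  then show "snd (mact k n M (gscale e P)) i = snd (gscale e (mact k n M P)) i"
    by (simp add: mact_def gscale_def prod_power_distrib)
qed (auto simp: mact_def gscale_def sum_distrib_left algebra_simps)

lemma gscale_eq_mact:
  assumes "P \<in> Gpts n"
  shows "gscale e P = mact n n (\<lambda>i j. if i = j then int e else 0) P"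
proof (rule gpt_eqI)
  fix i
  have "(\<Prod>j<n. snd P j powi (if i = j then int e else 0)) = (\<Prod>j<n. if j = i then snd P j ^ e else 1)"
    by (intro prod.cong) auto
  then show "snd (gscale e P) i = snd (mact n n (\<lambda>i j. if i = j then int e else 0) P) i"
    using assms by (simp add: mact_def gscale_def Gpts_iff)
  have "(\<Sum>j<n. of_int (if i = j then int e else 0) * fst P j) = (\<Sum>j<n. if j = i then of_nat e * fst P j else 0)"
    by (intro sum.cong) auto
  then show "fst (gscale e P) i = fst (mact n n (\<lambda>i j. if i = j then int e else 0) P) i"
    using assms by (simp add: mact_def gscale_def Gpts_iff)
qed

section \<open>Adjoining square roots, and multiplication by an integer\<close>

lemma hom_on_0_diff:
  assumes "is_subring A" "hom_on A \<phi>"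
  shows "\<phi> 0 = 0" "a \<in> A \<Longrightarrow> b \<in> A \<Longrightarrow> \<phi> (a - b) = \<phi> a - \<phi> b"
proof -
  have add: "\<phi> (a + b) = \<phi> a + \<phi> b" if "a \<in> A" "b \<in> A" for a b
    using assms(2) that by (auto simp: hom_on_def)
  show "\<phi> (a - b) = \<phi> a - \<phi> b" if "a \<in> A" "b \<in> A" for a b
    using add[OF subring_diff[OF assms(1) that] that(2)] by simp
  from this[OF subring_0[OF assms(1)] subring_0[OF assms(1)]] show "\<phi> 0 = 0" by simp
qed

text \<open>Because \<open>x\<close> is integral over \<open>A\<close>, every homomorphism extends,
  with no denominator to avoid. The value of \<open>x\<close> must be one of the two roots
  \<open>c\<close> and \<open>- c\<close> of \<open>\<phi> (x * x)\<close>; the norm of a linear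
  relation shows that each relation admits at least one of them, and two relations demanding
  different signs contradict each other.\<close>

lemma (in prime_ext) hom_extension_square:
  fixes \<phi> :: "'b \<Rightarrow> 'a::field_char_0"
  assumes alg_closed: "\<And>p::'a poly. degree p > 0 \<Longrightarrow> \<exists>x. poly p x = 0"
    and sq: "x * x \<in> A" and \<phi>: "hom_on A \<phi>" "\<And>a. a \<in> A \<Longrightarrow> a \<in> P \<Longrightarrow> \<phi> a = 0"
  shows "\<exists>\<psi>. hom_on (alg A {x}) \<psi> \<and> (\<forall>a\<in>A. \<psi> a = \<phi> a) \<and> (\<forall>a\<in>alg A {x}. a \<in> P \<longrightarrow> \<psi> a = 0)"
proof -
  note PI = prime_inD(1)[OF P]
  have hom: "\<phi> (a + b) = \<phi> a + \<phi> b" "\<phi> (a * b) = \<phi> a * \<phi> b" if "a \<in> A" "b \<in> A" for a b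
    using \<phi>(1) that by (auto simp: hom_on_def)
  note hom0 = hom_on_0_diff[OF A \<phi>(1)]
  have inB: "a \<in> B" if "a \<in> A" for a using that AB by blast
  obtain c where "poly [:- \<phi> (x * x), 0, 1:] c = 0" using alg_closed[of "[:- \<phi> (x * x), 0, 1:]"] by auto
  then have c: "c * c = \<phi> (x * x)" by (simp add: algebra_simps)
  define good where "good d \<longleftrightarrow> (\<forall>\<alpha>\<in>A. \<forall>\<beta>\<in>A. \<alpha> + \<beta> * x \<in> P \<longrightarrow> \<phi> \<alpha> + \<phi> \<beta> * d = 0)" for d
  have norm: "\<phi> \<alpha> * \<phi> \<alpha> = (\<phi> \<beta> * c) * (\<phi> \<beta> * c)" if *: "\<alpha> \<in> A" "\<beta> \<in> A" "\<alpha> + \<beta> * x \<in> P" for \<alpha> \<beta>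
  proof -
    have "\<alpha> - \<beta> * x \<in> B" using * inB xB by (intro subring_diff[OF B] subring_mult[OF B]) auto
    from ideal_inD(5)[OF PI *(3) this] have "\<alpha> * \<alpha> - (\<beta> * \<beta>) * (x * x) \<in> P" by (simp add: algebra_simps)
    then have "\<phi> (\<alpha> * \<alpha> - (\<beta> * \<beta>) * (x * x)) = 0"
      using subring_diff[OF A subring_mult[OF A *(1,1)] subring_mult[OF A subring_mult[OF A *(2,2)] sq]]
      by (intro \<phi>(2))
    then show ?thesis
      using * sq by (simp add: hom0 hom subring_mult[OF A] c[symmetric] algebra_simps)
  qed
  have "good c \<or> good (- c)"
  proof (rule ccontr)
    assume "\<not> (good c \<or> good (- c))"
    then obtain \<alpha> \<beta> \<alpha>' \<beta>' where *: "\<alpha> \<in> A" "\<beta> \<in> A" "\<alpha> + \<beta> * x \<in> P" "\<phi> \<alpha> + \<phi> \<beta> * c \<noteq> 0"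
      "\<alpha>' \<in> A" "\<beta>' \<in> A" "\<alpha>' + \<beta>' * x \<in> P" "\<phi> \<alpha>' + \<phi> \<beta>' * (- c) \<noteq> 0"
      unfolding good_def by blast
    have 1: "\<phi> \<alpha> = \<phi> \<beta> * c"
      using norm[OF *(1-3)] *(4) unfolding square_eq_iff by (auto simp: add_eq_0_iff)
    have 2: "\<phi> \<alpha>' = - (\<phi> \<beta>' * c)"
      using norm[OF *(5-7)] *(8) unfolding square_eq_iff by auto
    \<comment> \<open>Eliminating \<open>x\<close> between the two relations leaves an element of
      \<open>A\<close> in \<open>P\<close>, whose image turns out to be twice a nonzero
      product.\<close>
    have "\<beta>' * (\<alpha> + \<beta> * x) - \<beta> * (\<alpha>' + \<beta>' * x) \<in> P"
      using * inB by (intro ideal_in_diff[OF B PI] ideal_inD(4)[OF PI]) auto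
    then have "\<phi> (\<beta>' * \<alpha> - \<beta> * \<alpha>') = 0"
      using * by (intro \<phi>(2) subring_diff[OF A] subring_mult[OF A]) (auto simp: algebra_simps)
    then have "\<phi> \<beta>' * (\<phi> \<beta> * c) + \<phi> \<beta> * (\<phi> \<beta>' * c) = 0"
      using * by (simp add: hom0 hom subring_mult[OF A] 1 2)
    then have "2 * (\<phi> \<beta> * (\<phi> \<beta>' * c)) = 0" by (simp add: algebra_simps)
    then have "\<phi> \<beta> * (\<phi> \<beta>' * c) = 0" by simp
    then show False using *(4,8) 1 2 by auto
  qed
  then obtain d where d: "d * d = \<phi> (x * x)" "good d"
    using c by (metis minus_mult_minus)
  \<comment> \<open>Since \<open>x * x\<close> lies in \<open>A\<close>, every polynomial value
    reduces to linear form, so goodness of \<open>d\<close>, stated for linear relations, covers all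
    of them.\<close>
  have red: "\<exists>\<alpha>\<in>A. \<exists>\<beta>\<in>A. poly p x = \<alpha> + \<beta> * x \<and> poly (map_poly \<phi> p) d = \<phi> \<alpha> + \<phi> \<beta> * d"
    if "p \<in> polys A" for p
    using that
  proof (induction p)
    case 0
    then show ?case using subring_0[OF A] hom0 by (intro bexI[of _ 0]) auto
  next
    case (pCons a p)
    have coeffs: "coeff (pCons a p) k \<in> A" for k using pCons.prems by (auto simp: polys_def)
    have a: "a \<in> A" using coeffs[of 0] by simp
    have p: "p \<in> polys A" using coeffs[of "Suc k" for k] by (simp add: polys_def)
    obtain \<alpha> \<beta> where *: "\<alpha> \<in> A" "\<beta> \<in> A" "poly p x = \<alpha> + \<beta> * x" "poly (map_poly \<phi> p) d = \<phi> \<alpha> + \<phi> \<beta> * d"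
      using pCons.IH[OF p] by blast
    have "a + \<beta> * (x * x) \<in> A" by (rule subring_add[OF A a subring_mult[OF A *(2) sq]])
    moreover have "poly (map_poly \<phi> (pCons a p)) d = \<phi> (a + \<beta> * (x * x)) + \<phi> \<alpha> * d"
      using a * sq by (simp add: map_poly_pCons hom0 hom subring_mult[OF A] d(1)[symmetric] algebra_simps)
    moreover have "poly (pCons a p) x = (a + \<beta> * (x * x)) + \<alpha> * x"
      by (simp add: * algebra_simps)
    ultimately show ?case using *(1) by blast
  qed
  have "\<exists>\<psi>. hom_on (alg A {x}) \<psi> \<and> (\<forall>a\<in>A. \<psi> a = \<phi> a) \<and> \<psi> x = d
    \<and> (\<forall>a\<in>alg A {x}. a \<in> P \<longrightarrow> \<psi> a = 0)
    \<and> (\<forall>p\<in>polys A. \<psi> (poly p x) = poly (map_poly \<phi> p) d)"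
  proof (rule hom_extension_by_value[OF \<phi>(1)])
    fix p assume p: "p \<in> polys A" "poly p x \<in> P"
    then show "poly (map_poly \<phi> p) d = 0" using red[OF p(1)] d(2) unfolding good_def by auto
  qed
  then show ?thesis by blast
qed

lemma finite_hom_extension_square:
  fixes \<phi> :: "'b::comm_ring_1 \<Rightarrow> 'a::field_char_0"
  assumes alg_closed: "\<And>p::'a poly. degree p > 0 \<Longrightarrow> \<exists>x. poly p x = 0"
    and B: "is_subring B" "prime_in B P" and A: "is_subring A" "A \<subseteq> B"
    and X: "finite X" "X \<subseteq> B" "\<And>x. x \<in> X \<Longrightarrow> x * x \<in> A"
    and \<phi>: "hom_on A \<phi>" "\<And>a. a \<in> A \<Longrightarrow> a \<in> P \<Longrightarrow> \<phi> a = 0"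
  shows "\<exists>\<psi>. hom_on (alg A X) \<psi> \<and> (\<forall>a\<in>A. \<psi> a = \<phi> a) \<and> (\<forall>a\<in>alg A X. a \<in> P \<longrightarrow> \<psi> a = 0)"
  using X
proof (induction X rule: finite_induct)
  case empty
  then show ?case using \<phi> by (intro exI[of _ \<phi>]) (simp add: alg_empty[OF A(1)])
next
  case (insert x X)
  define C where "C = alg A X"
  have eq: "alg A (insert x X) = alg C {x}" by (simp add: C_def alg_alg)
  have AC: "A \<subseteq> C" unfolding C_def by (rule subsetI) (rule alg_base)
  interpret E: prime_ext B P C x
    using B A insert.prems alg_least[OF B(1) A(2)] alg_subring[OF A(1)]
    by unfold_locales (auto simp: C_def)
  obtain \<psi>1 where \<psi>1: "hom_on C \<psi>1" "\<forall>a\<in>A. \<psi>1 a = \<phi> a" "\<forall>a\<in>C. a \<in> P \<longrightarrow> \<psi>1 a = 0"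
    using insert unfolding C_def by auto
  have "\<exists>\<psi>. hom_on (alg C {x}) \<psi> \<and> (\<forall>a\<in>C. \<psi> a = \<psi>1 a) \<and> (\<forall>a\<in>alg C {x}. a \<in> P \<longrightarrow> \<psi> a = 0)"
    using insert.prems AC \<psi>1 by (intro E.hom_extension_square alg_closed) auto
  then obtain \<psi> where "hom_on (alg C {x}) \<psi>" "\<forall>a\<in>C. \<psi> a = \<psi>1 a" "\<forall>a\<in>alg C {x}. a \<in> P \<longrightarrow> \<psi> a = 0"
    by blast
  then show ?case using \<psi>1(2) AC unfolding eq by (intro exI[of _ \<psi>]) auto
qed

lemma not_transcI: "p \<in> polys A \<Longrightarrow> poly p x \<in> P \<Longrightarrow> coeff p k \<notin> P \<Longrightarrow> \<not> transc P A x"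
  by (auto simp: transc_def)

definition pull :: "('s \<Rightarrow> 't) \<Rightarrow> ('t \<Rightarrow> 'a) \<Rightarrow> 's \<Rightarrow> 'a" where
  "pull \<phi> f = (\<lambda>p. f (\<phi> p))"

lemma pull_apply [simp]: "pull \<phi> f p = f (\<phi> p)"
  by (simp add: pull_def)

lemma subring_pull_laurent: "is_subring (pull \<phi> ` laurent m)"
  unfolding is_subring_def
proof (intro conjI ballI)
  have "1 = pull \<phi> 1" by (simp add: fun_eq_iff)
  then show "1 \<in> pull \<phi> ` laurent m" using subring_1[OF subring_laurent] by blast
  fix a b assume "a \<in> pull \<phi> ` laurent m" "b \<in> pull \<phi> ` laurent m"
  then obtain f g where *: "f \<in> laurent m" "g \<in> laurent m" "a = pull \<phi> f" "b = pull \<phi> g" by blast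
  have "a - b = pull \<phi> (f - g)" "a * b = pull \<phi> (f * g)" by (auto simp: * fun_eq_iff)
  then show "a - b \<in> pull \<phi> ` laurent m" "a * b \<in> pull \<phi> ` laurent m"
    using subring_diff[OF subring_laurent *(1,2)] subring_mult[OF subring_laurent *(1,2)] by blast+
qed

lemma cst_in_pull: "cst c \<in> pull \<phi> ` laurent m"
proof -
  have "cst c = pull \<phi> (cst c)" by (simp add: fun_eq_iff)
  then show ?thesis using laurent_cst by blast
qed

lemma pull_gscale_laurent: "pull (gscale e) ` laurent m \<subseteq> laurent m"
  using morph_gscale[of m e] unfolding morph_def pull_def by blast

context alg_closed_field
begin

text \<open>The coordinate ring is algebraic over the functions of \<open>gscale e p\<close>:
  \<open>wc j\<close> and \<open>wi j\<close> have their \<open>e\<close>-th powers there, and so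
  does \<open>zc j\<close> up to the factor \<open>e\<close>, already in first power. Hence
  \<open>ideal_meets_base\<close> finds a separating function in the smaller ring.\<close>

lemma gscale_separates:
  fixes X Y :: "'a gpt set"
  assumes XY: "gvariety m X" "gvariety m Y" "X \<subset> Y" and e: "e > 0"
  shows "\<exists>f\<in>laurent m. (\<forall>p\<in>X. f (gscale e p) = 0) \<and> (\<exists>p\<in>Y. f (gscale e p) \<noteq> 0)"
proof -
  define A where "A = pull (gscale e :: 'a gpt \<Rightarrow> _) ` laurent m"
  have A: "is_subring A" "A \<subseteq> laurent m"
    unfolding A_def by (rule subring_pull_laurent, rule pull_gscale_laurent)
  have PY: "prime_in (laurent m) (van m Y)" using XY by (simp add: gvariety_iff prime_van)
  have sub: "van m Y \<subseteq> van m X" using XY(3) by (intro van_antimono) blast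
  have "\<not> van m X \<subseteq> van m Y"
    using XY subset_iff_van[of Y m X] unfolding gvariety_iff by blast
  then obtain g where g: "g \<in> van m X" "g \<notin> van m Y" by blast
  have "laurent m \<subseteq> alg A (lgens m)"
    unfolding laurent_def
  proof (rule alg_mono)
    show "range cst \<subseteq> A" unfolding A_def by (rule image_subsetI) (rule cst_in_pull)
  qed simp
  then have gA: "g \<in> alg A (lgens m)" using g(1) unfolding van_def by blast
  obtain y where y: "y \<in> Y" using XY(3) by blast
  have nz: "f \<notin> van m Y" if "f y \<noteq> 0" for f :: "'a gpt \<Rightarrow> 'a" using that y unfolding van_def by blast
  have zero: "0 \<in> van m Y" by (rule ideal_inD(2)[OF ideal_van])
  have root: "\<not> transc (van m Y) A x" if "x ^ e \<in> A" for x
  proof (rule not_transcI)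
    show "monom 1 e - [:x ^ e:] \<in> polys A"
      using that by (intro polys_diff[OF A(1)] polys_monom[OF A(1)] polys_const[OF A(1)] subring_1[OF A(1)])
    show "poly (monom 1 e - [:x ^ e:]) x \<in> van m Y" using zero by (simp add: poly_monom)
    show "coeff (monom 1 e - [:x ^ e:]) e \<notin> van m Y"
      using e by (simp add: coeff_pCons nz split: nat.split)
  qed
  have "\<not> transc (van m Y) A x" if x: "x \<in> lgens m" for x
  proof -
    consider j where "j < m" "x = zc j" | j where "j < m" "x = wc j" | j where "j < m" "x = wi j"
      using x unfolding lgens_def by blast
    then show ?thesis
    proof cases
      case 1
      show ?thesis
      proof (rule not_transcI)
        have "pull (gscale e) (zc j) \<in> A" unfolding A_def using 1 laurent_zc by blast
        then show "[:- pull (gscale e) (zc j), cst (of_nat e):] \<in> polys A"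
          using cst_in_pull by (intro polys_pCons[OF A(1)] polys_0[OF A(1)] subring_uminus[OF A(1)]) (auto simp: A_def)
        have "poly [:- pull (gscale e) (zc j), cst (of_nat e):] x = 0"
          by (simp add: 1 fun_eq_iff gscale_def)
        then show "poly [:- pull (gscale e) (zc j), cst (of_nat e):] x \<in> van m Y" using zero by simp
        show "coeff [:- pull (gscale e) (zc j), cst (of_nat e):] 1 \<notin> van m Y"
          using e by (simp add: nz)
      qed
    next
      case 2
      have pow: "(f ^ k) p = f p ^ k" for f :: "'a gpt \<Rightarrow> 'a" and k p by (induction k) auto
      have "x ^ e = pull (gscale e) (wc j)" by (rule ext) (simp add: 2 pow gscale_def)
      then have "x ^ e \<in> A" unfolding A_def using 2(1) laurent_wc by blast
      then show ?thesis by (rule root)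
    next
      case 3
      have pow: "(f ^ k) p = f p ^ k" for f :: "'a gpt \<Rightarrow> 'a" and k p by (induction k) auto
      have "x ^ e = pull (gscale e) (wi j)" by (rule ext) (simp add: 3 pow gscale_def power_inverse)
      then have "x ^ e \<in> A" unfolding A_def using 3(1) laurent_wi by blast
      then show ?thesis by (rule root)
    qed
  qed
  moreover have "lgens m \<subseteq> laurent m" unfolding laurent_def by (rule subsetI) (rule alg_gen)
  ultimately have "\<exists>h\<in>A. h \<in> van m X \<and> h \<notin> van m Y"
    using ideal_meets_base[OF subring_laurent PY A finite_lgens _ _ ideal_van sub gA g] by blast
  then obtain f where "f \<in> laurent m" "pull (gscale e) f \<in> van m X" "pull (gscale e) f \<notin> van m Y"
    unfolding A_def by blast
  then show ?thesis using A(2) unfolding A_def van_def by (intro bexI[of _ f]) auto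
qed

text \<open>By \<open>gscale_separates\<close>, strict steps of a chain stay strict after
  multiplication by \<open>e\<close>.\<close>

lemma kdim_gscale:
  fixes X :: "'a gpt set"
  assumes X: "gvariety m X" and e: "e > 0"
  shows "kdim X \<le> kdim (cl m (gscale e ` X))"
proof -
  note gs = morph_imp_zmorph[OF morph_gscale]
  obtain c where c: "vchain m c (kdim X)" "c (kdim X) \<subseteq> X" using kdim_chain[OF X] by blast
  have gv: "gvariety m (c l)" if "l \<le> kdim X" for l using c that by (simp add: vchain_def)
  have "vchain m (\<lambda>l. cl m (gscale e ` c l)) (kdim X)"
    unfolding vchain_def
  proof (intro conjI allI impI)
    fix l assume "l \<le> kdim X"
    then show "gvariety m (cl m (gscale e ` c l))" by (intro gvariety_image[OF gv gs])
  next
    fix l assume l: "l < kdim X"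
    have sub: "c l \<subset> c (Suc l)" using c l by (simp add: vchain_def)
    have G: "gscale e ` c l' \<subseteq> Gpts m" if "l' \<le> kdim X" for l'
      using gv[OF that] unfolding gvariety_iff by (intro zmorph_Gpts[OF gs]) simp
    have gvl: "gvariety m (c l)" "gvariety m (c (Suc l))" using l by (auto intro!: gv)
    obtain f where f: "f \<in> laurent m" "\<forall>p\<in>c l. f (gscale e p) = 0" "\<exists>p\<in>c (Suc l). f (gscale e p) \<noteq> 0"
      using gscale_separates[OF gvl sub e] by blast
    have "\<forall>p\<in>cl m (gscale e ` c l). f p = 0"
      using f G[of l] l by (subst cl_vanish) auto
    moreover have "\<not> (\<forall>p\<in>cl m (gscale e ` c (Suc l)). f p = 0)"
      using f G[of "Suc l"] l by (subst cl_vanish) auto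
    moreover have "cl m (gscale e ` c l) \<subseteq> cl m (gscale e ` c (Suc l))"
      using sub by (intro cl_mono image_mono) blast
    ultimately show "cl m (gscale e ` c l) \<subset> cl m (gscale e ` c (Suc l))" by blast
  qed
  then show ?thesis
  proof (rule kdim_ge[rotated])
    show "cl m (gscale e ` c (kdim X)) \<subseteq> cl m (gscale e ` X)" using c(2) by (intro cl_mono image_mono)
  qed (rule zclosed_in_cl)
qed

text \<open>Covers matrices that factor through \<open>M\<close> only over the rationals:
  \<open>e\<close> clears the denominators of the factor.\<close>

lemma kdim_mact_le:
  fixes X :: "'a gpt set"
  assumes X: "gvariety n X" and e: "e > 0"
    and C: "\<And>p. p \<in> X \<Longrightarrow> gscale e (mact k n M1 p) = mact k l C (mact l n M p)"
  shows "kdim (cl k (mact k n M1 ` X)) \<le> kdim (cl l (mact l n M ` X))"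
proof -
  note gs = morph_imp_zmorph[OF morph_gscale]
  note ma = morph_imp_zmorph[OF morph_mact]
  have XG: "X \<subseteq> Gpts n" using X by (simp add: gvariety_iff)
  have "kdim (cl k (mact k n M1 ` X)) \<le> kdim (cl k (gscale e ` cl k (mact k n M1 ` X)))"
    by (intro kdim_gscale gvariety_image[OF X ma] e)
  also have "cl k (gscale e ` cl k (mact k n M1 ` X)) = cl k (gscale e ` mact k n M1 ` X)"
    by (intro cl_image_cl zmorph_Gpts[OF ma] gs XG)
  also have "gscale e ` mact k n M1 ` X = mact k l C ` mact l n M ` X"
    unfolding image_image using C by (intro image_cong) auto
  also have "cl k (mact k l C ` mact l n M ` X) = cl k (mact k l C ` cl l (mact l n M ` X))"
    by (intro cl_image_cl[symmetric] zmorph_Gpts[OF ma] ma XG)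
  also have "kdim \<dots> \<le> kdim (cl l (mact l n M ` X))"
    by (rule kdim_image_le[OF gvariety_image[OF X ma] morph_mact])
  finally show ?thesis .
qed

text \<open>The variety \<^term>\<open>U\<close> is a component of the preimage of \<^term>\<open>V\<close> under multiplication by 2; it
  still covers all of \<^term>\<open>V\<close> because a point extends along each adjunction of a square root.\<close>

theorem half_variety:
  fixes V :: "'a gpt set"
  assumes V: "gvariety n V"
  obtains U where "gvariety n U" "gscale 2 ` U = V"
proof -
  have VG: "V \<subseteq> Gpts n" and VC: "cl n V = V" using V by (auto simp: gvariety_iff)
  have half: "\<exists>u\<in>Gpts n. gscale 2 u = v" if v: "v \<in> Gpts n" for v :: "'a gpt"
  proof -
    have "\<exists>c. c\<^sup>2 = a" for a :: 'a
      using alg_closed[of "[:- a, 0, 1:]"] by (auto simp: power2_eq_square algebra_simps)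
    then obtain s where s: "\<And>a::'a. (s a)\<^sup>2 = a" by metis
    define u where "u = (\<lambda>j. fst v j / 2, \<lambda>j. if j < n then s (snd v j) else 1)"
    have "s (snd v j) \<noteq> 0" for j using s[of "snd v j"] Gpts_nz[OF v] by (metis zero_neq_numeral power_zero_numeral)
    then have "u \<in> Gpts n" using v by (auto simp: u_def Gpts_iff)
    moreover have "gscale 2 u = v" using v by (auto intro!: gpt_eqI simp: u_def gscale_def s Gpts_iff)
    ultimately show ?thesis by blast
  qed
  define A where "A = pull (gscale 2 :: 'a gpt \<Rightarrow> _) ` laurent n"
  have A: "is_subring A" "A \<subseteq> laurent n"
    unfolding A_def by (rule subring_pull_laurent, rule pull_gscale_laurent)
  define Z where "Z = {p \<in> Gpts n. gscale 2 p \<in> V}"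
  have pullZ: "pull (gscale 2) f \<in> van n Z \<longleftrightarrow> f \<in> van n V" if f: "f \<in> laurent n" for f
  proof -
    have "gscale 2 ` Z = V"
    proof
      show "V \<subseteq> gscale 2 ` Z"
      proof
        fix v assume v: "v \<in> V"
        then obtain u where "u \<in> Gpts n" "gscale 2 u = v" using half VG by blast
        then show "v \<in> gscale 2 ` Z" using v unfolding Z_def by blast
      qed
    qed (auto simp: Z_def)
    moreover have "pull (gscale 2) f \<in> laurent n" using A(2) f unfolding A_def by blast
    ultimately show ?thesis using f unfolding van_def by auto
  qed
  \<comment> \<open>Functions of the doubled point that do not vanish identically on
    \<open>V\<close>; the zero set of a prime missing \<open>S\<close> has an image that is dense in
    \<open>V\<close>.\<close>
  define S where "S = pull (gscale 2) ` (laurent n - van n V)"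
  have PV: "prime_in (laurent n) (van n V)" using V by (simp add: gvariety_iff prime_van)
  have "S \<subseteq> laurent n" using A(2) unfolding A_def S_def by blast
  moreover have "1 \<in> S"
  proof -
    have "1 = pull (gscale 2 :: 'a gpt \<Rightarrow> _) 1" by (simp add: fun_eq_iff)
    then show ?thesis unfolding S_def using prime_inD(2)[OF PV] subring_1[OF subring_laurent] by blast
  qed
  moreover have "a * b \<in> S" if ab: "a \<in> S" "b \<in> S" for a b
  proof -
    obtain f g where *: "f \<in> laurent n" "f \<notin> van n V" "g \<in> laurent n" "g \<notin> van n V"
      "a = pull (gscale 2) f" "b = pull (gscale 2) g" using ab unfolding S_def by blast
    have "a * b = pull (gscale 2) (f * g)" by (simp add: * fun_eq_iff)
    moreover have "f * g \<in> laurent n" "f * g \<notin> van n V"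
      using * prime_inD(3)[OF PV *(1,3)] subring_mult[OF subring_laurent] by blast+
    ultimately show ?thesis unfolding S_def by blast
  qed
  moreover have "S \<inter> van n Z = {}" using pullZ unfolding S_def by blast
  ultimately obtain Q where Q: "prime_in (laurent n) Q" "van n Z \<subseteq> Q" "Q \<inter> S = {}"
    using exists_prime_avoiding[OF subring_laurent ideal_van] by metis
  have "Z \<subseteq> Gpts n" by (auto simp: Z_def)
  then have base: "van n (Gpts n) \<subseteq> Q" using Q(2) van_antimono by blast
  define U where "U = zeros n Q"
  have U: "gvariety n U" unfolding U_def by (rule zeros_prime(2)[OF Q(1) base])
  have "gscale 2 ` U \<subseteq> V"
  proof
    fix v assume "v \<in> gscale 2 ` U"
    then obtain u where u: "u \<in> U" "v = gscale 2 u" by blast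
    then have uG: "u \<in> Gpts n" by (auto simp: U_def zeros_def)
    have "v \<in> cl n V"
      unfolding cl_iff[OF VG]
    proof (intro conjI ballI impI)
      show "v \<in> Gpts n" using u uG gscale_in_Gpts by blast
      fix f assume f: "f \<in> laurent n" "\<forall>q\<in>V. f q = 0"
      then have "pull (gscale 2) f \<in> Q" using pullZ[OF f(1)] Q(2) by (auto simp: van_def)
      then show "f v = 0" using u unfolding U_def zeros_def by auto
    qed
    then show "v \<in> V" using VC by simp
  qed
  moreover have "V \<subseteq> gscale 2 ` U"
  proof
    fix v assume v: "v \<in> V"
    then obtain u where u: "u \<in> Gpts n" "gscale 2 u = v" using half VG by blast
    \<comment> \<open>The chosen half \<open>u\<close> of \<open>v\<close> need not lie in
      \<open>U\<close>. Evaluation at \<open>u\<close> is compatible with \<open>Q\<close> on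
      \<open>A\<close>, and its extension from \<open>A\<close> to all functions may replace
      \<open>u\<close> by another half of \<open>v\<close> that does.\<close>
    define \<phi> where "\<phi> = (\<lambda>h :: 'a gpt \<Rightarrow> 'a. h u)"
    have \<phi>A: "hom_on A \<phi>" by (simp add: hom_on_def \<phi>_def)
    have \<phi>Q: "\<phi> a = 0" if a: "a \<in> A" "a \<in> Q" for a
    proof -
      obtain f where f: "f \<in> laurent n" "a = pull (gscale 2) f" using a unfolding A_def by blast
      then have "f \<in> van n V" using a Q(3) unfolding S_def by blast
      then show ?thesis using v u f by (simp add: \<phi>_def van_def)
    qed
    have wcL: "wc ` {..<n} \<subseteq> laurent n" using laurent_wc by blast
    have sq: "x * x \<in> A" if x: "x \<in> wc ` {..<n}" for x
    proof -
      obtain j where j: "j < n" "x = wc j" using x by blast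
      have "x * x = pull (gscale 2) (wc j)" by (simp add: j fun_eq_iff gscale_def power2_eq_square)
      then show ?thesis unfolding A_def using laurent_wc[OF j(1)] by blast
    qed
    have "\<exists>\<psi>. hom_on (alg A (wc ` {..<n})) \<psi> \<and> (\<forall>a\<in>A. \<psi> a = \<phi> a)
      \<and> (\<forall>a\<in>alg A (wc ` {..<n}). a \<in> Q \<longrightarrow> \<psi> a = 0)"
      by (rule finite_hom_extension_square[OF _ subring_laurent Q(1) A finite_imageI[OF finite_lessThan] wcL _ \<phi>A])
        (erule alg_closed, erule sq, erule (1) \<phi>Q)
    then obtain \<psi> where \<psi>: "hom_on (alg A (wc ` {..<n})) \<psi>" "\<forall>a\<in>A. \<psi> a = \<phi> a"
      "\<forall>a\<in>alg A (wc ` {..<n}). a \<in> Q \<longrightarrow> \<psi> a = 0"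
      by (elim exE conjE)
    \<comment> \<open>Only square roots have to be adjoined: \<open>zc j\<close> is one half of a
      function of the double, and \<open>inverse b\<close> is \<open>b\<close> times the inverse of
      its square.\<close>
    have "laurent n \<subseteq> alg A (wc ` {..<n})"
    proof -
      note alA = alg_subring[OF A(1), of "wc ` {..<n}"]
      have AA: "a \<in> alg A (wc ` {..<n})" if "a \<in> A" for a using that by (rule alg_base)
      have pA: "pull (gscale 2) f \<in> A" if "f \<in> laurent n" for f using that unfolding A_def by blast
      have c: "cst c \<in> alg A (wc ` {..<n})" for c :: 'a using cst_in_pull unfolding A_def by (intro alg_base)
      have w: "wc j \<in> alg A (wc ` {..<n})" if "j < n" for j using that by (intro alg_gen) simp
      have "lgens n \<subseteq> alg A (wc ` {..<n})"
      proof
        fix x :: "'a gpt \<Rightarrow> 'a" assume "x \<in> lgens n"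
        then consider j where "j < n" "x = zc j" | j where "j < n" "x = wc j" | j where "j < n" "x = wi j"
          unfolding lgens_def by blast
        then show "x \<in> alg A (wc ` {..<n})"
        proof cases
          case 1
          have "x = cst (1/2) * pull (gscale 2) (zc j)" by (simp add: 1 fun_eq_iff gscale_def)
          then show ?thesis using alg_mult[OF c AA[OF pA[OF laurent_zc[OF 1(1)]]]] by simp
        next
          case 3
          have inv: "inverse b = b * inverse (b\<^sup>2)" for b :: 'a by (simp add: power2_eq_square field_simps)
          have "x = wc j * pull (gscale 2) (wi j)"
            unfolding 3 by (rule ext) (simp only: wi_apply wc_apply pull_apply times_fun_apply gscale_def snd_conv inv[symmetric])
          then show ?thesis using alg_mult[OF w[OF 3(1)] AA[OF pA[OF laurent_wi[OF 3(1)]]]] by simp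
        qed (use w in simp)
      qed
      moreover have "range cst \<subseteq> alg A (wc ` {..<n})" by (rule image_subsetI) (rule c)
      ultimately show ?thesis unfolding laurent_def by (intro alg_least[OF alA])
    qed
    then have hom: "hom_on (laurent n) \<psi>" and kill: "\<And>f. f \<in> laurent n \<Longrightarrow> f \<in> Q \<Longrightarrow> \<psi> f = 0"
      using \<psi> unfolding hom_on_def by blast+
    have \<psi>A: "\<psi> a = a u" if "a \<in> A" for a using \<psi>(2) that by (simp add: \<phi>_def)
    have \<psi>c: "\<psi> (cst c) = c" for c
    proof -
      have "cst c \<in> A" unfolding A_def by (rule cst_in_pull)
      from \<psi>A[OF this] show ?thesis by simp
    qed
    have \<psi>v: "\<psi> f = 0" if "f \<in> van n (Gpts n)" for f
      using kill[of f] that base unfolding van_def by blast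
    obtain p where p: "p \<in> Gpts n" "\<And>f. f \<in> laurent n \<Longrightarrow> \<psi> f = f p"
      by (rule laurent_hom_eval[OF hom \<psi>c]) (erule \<psi>v, rule that)
    have "p \<in> U"
      unfolding U_def zeros_def using p kill ideal_inD(1)[OF prime_inD(1)[OF Q(1)]] by force
    moreover have "gscale 2 p = v"
    proof (rule gpt_eqI)
      have ev: "f (gscale 2 p) = f v" if f: "f \<in> laurent n" for f
      proof -
        have "pull (gscale 2) f \<in> A" unfolding A_def using f by blast
        then show ?thesis using \<psi>A[of "pull (gscale 2) f"] p(2)[of "pull (gscale 2) f"] A(2) u by auto
      qed
      have G: "gscale 2 p \<in> Gpts n" "v \<in> Gpts n" using p v VG gscale_in_Gpts by blast+
      fix j
      show "fst (gscale 2 p) j = fst v j"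
        using ev[OF laurent_zc, of j] G by (cases "j < n") (auto simp: Gpts_iff)
      show "snd (gscale 2 p) j = snd v j"
        using ev[OF laurent_wc, of j] G by (cases "j < n") (auto simp: Gpts_iff)
    qed
    ultimately show "v \<in> gscale 2 ` U" by blast
  qed
  ultimately show ?thesis using that U by blast
qed

end

section \<open>Density of the graph of conjugation\<close>

text \<open>Irreducibility of a product by slices. If \<open>f\<close> and \<open>g\<close> are
  nonzero at two values of \<open>F\<close>, irreducibility of \<open>X\<close> gives one first
  argument that serves both with their own second arguments; irreducibility of \<open>Y\<close> then
  gives a common second argument.\<close>

lemma irr_bimorph:
  assumes X: "irr n X" "X \<subseteq> Gpts n" and Y: "irr n Y" "Y \<subseteq> Gpts n"
    and F1: "\<And>R. R \<in> Y \<Longrightarrow> zmorph n k (\<lambda>Q. F Q R)" and F2: "\<And>Q. Q \<in> X \<Longrightarrow> zmorph n k (F Q)"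
  shows "irr k {F Q R |Q R. Q \<in> X \<and> R \<in> Y}"
  unfolding irr_def
proof (intro conjI ballI impI)
  show "{F Q R |Q R. Q \<in> X \<and> R \<in> Y} \<noteq> {}" using X Y unfolding irr_def by blast
  fix f g assume fg: "f \<in> laurent k" "g \<in> laurent k" "\<forall>p\<in>{F Q R |Q R. Q \<in> X \<and> R \<in> Y}. f p * g p = 0"
  show "(\<forall>p\<in>{F Q R |Q R. Q \<in> X \<and> R \<in> Y}. f p = 0) \<or> (\<forall>p\<in>{F Q R |Q R. Q \<in> X \<and> R \<in> Y}. g p = 0)"
  proof (rule ccontr)
    assume "\<not> ?thesis"
    then obtain Q0 R0 Q1 R1 where *: "Q0 \<in> X" "R0 \<in> Y" "f (F Q0 R0) \<noteq> 0" "Q1 \<in> X" "R1 \<in> Y" "g (F Q1 R1) \<noteq> 0"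
      by blast
    obtain f' where f': "f' \<in> laurent n" "\<And>p. p \<in> Gpts n \<Longrightarrow> f' p = 0 \<longleftrightarrow> f (F p R0) = 0"
      using zmorph_pull[OF F1[OF *(2)] fg(1)] by blast
    obtain g' where g': "g' \<in> laurent n" "\<And>p. p \<in> Gpts n \<Longrightarrow> g' p = 0 \<longleftrightarrow> g (F p R1) = 0"
      using zmorph_pull[OF F1[OF *(5)] fg(2)] by blast
    have "\<exists>Q\<in>X. f' Q * g' Q \<noteq> 0"
    proof (rule ccontr)
      assume "\<not> ?thesis"
      then have "(\<forall>p\<in>X. f' p = 0) \<or> (\<forall>p\<in>X. g' p = 0)" using X(1) f'(1) g'(1) unfolding irr_def by blast
      then show False using * f'(2) g'(2) X(2) by blast
    qed
    then obtain Q where Q: "Q \<in> X" "f' Q \<noteq> 0" "g' Q \<noteq> 0" by auto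
    then have Q': "f (F Q R0) \<noteq> 0" "g (F Q R1) \<noteq> 0" using f'(2) g'(2) X(2) by blast+
    obtain f'' where f'': "f'' \<in> laurent n" "\<And>p. p \<in> Gpts n \<Longrightarrow> f'' p = 0 \<longleftrightarrow> f (F Q p) = 0"
      using zmorph_pull[OF F2[OF Q(1)] fg(1)] by blast
    obtain g'' where g'': "g'' \<in> laurent n" "\<And>p. p \<in> Gpts n \<Longrightarrow> g'' p = 0 \<longleftrightarrow> g (F Q p) = 0"
      using zmorph_pull[OF F2[OF Q(1)] fg(2)] by blast
    have "f'' R * g'' R = 0" if R: "R \<in> Y" for R
    proof -
      have "f (F Q R) * g (F Q R) = 0" using fg(3) Q(1) R by blast
      then show ?thesis using f''(2)[of R] g''(2)[of R] R Y(2) by auto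
    qed
    then have "(\<forall>p\<in>Y. f'' p = 0) \<or> (\<forall>p\<in>Y. g'' p = 0)" using Y(1) f''(1) g''(1) unfolding irr_def by blast
    then show False using * Q' f''(2) g''(2) Y(2) by blast
  qed
qed

section \<open>Nonvanishing of polynomials at conjugate pairs\<close>

lemma gpoly_on_curve:
  fixes f :: "('a::comm_ring_1) gpt \<Rightarrow> 'a"
  assumes "gpoly f"
  shows "\<exists>p. \<forall>s. f (\<lambda>j. poly (u j) s, \<lambda>j. poly (v j) s) = poly p s"
  using assms
proof induction
  case (gpoly_const c)
  then show ?case by (intro exI[of _ "[:c:]"]) simp
next
  case (gpoly_add f g)
  then show ?case by (metis poly_add)
next
  case (gpoly_mult f g)
  then show ?case by (metis poly_mult)
qed auto

text \<open>Restriction to the line through \<open>P\<close> and \<open>Q\<close>, with parameters 0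
  and 1 at these points, reduces the claim to polynomials in one variable.\<close>

lemma gpoly_common_nonzero:
  fixes f g :: "('a::field_char_0) gpt \<Rightarrow> 'a"
  assumes "gpoly f" "gpoly g" "f P \<noteq> 0" "g Q \<noteq> 0"
  obtains S where "f S \<noteq> 0" "g S \<noteq> 0"
proof -
  define u v where "u j = [:fst P j, fst Q j - fst P j:]" and "v j = [:snd P j, snd Q j - snd P j:]" for j
  obtain p q where p: "\<And>s. f (\<lambda>j. poly (u j) s, \<lambda>j. poly (v j) s) = poly p s"
    and q: "\<And>s. g (\<lambda>j. poly (u j) s, \<lambda>j. poly (v j) s) = poly q s"
    using gpoly_on_curve assms(1,2) by metis
  have "poly p 0 \<noteq> 0" using p[of 0] assms(3) by (simp add: u_def v_def)
  moreover have "poly q 1 \<noteq> 0" using q[of 1] assms(4) by (simp add: u_def v_def)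
  ultimately have "p * q \<noteq> 0" by auto
  then obtain s where "poly (p * q) s \<noteq> 0" using poly_all_0_iff_0 by blast
  then show ?thesis using that p[of s] q[of s] by (metis mult_eq_0_iff poly_mult)
qed

lemma gpoly_finite_support:
  assumes "gpoly f"
  shows "\<exists>N. \<forall>P Q. (\<forall>j<N. fst P j = fst Q j \<and> snd P j = snd Q j) \<longrightarrow> f P = f Q"
  using assms
proof induction
  case (gpoly_z j)
  then show ?case by (intro exI[of _ "Suc j"]) auto
next
  case (gpoly_w j)
  then show ?case by (intro exI[of _ "Suc j"]) auto
next
  case (gpoly_add f g)
  then obtain M N where MN: "\<forall>P Q. (\<forall>j<M. fst P j = fst Q j \<and> snd P j = snd Q j) \<longrightarrow> f P = f Q"
    "\<forall>P Q. (\<forall>j<N. fst P j = fst Q j \<and> snd P j = snd Q j) \<longrightarrow> g P = g Q" by blast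
  show ?case
  proof (intro exI[of _ "max M N"] allI impI)
    fix P Q :: "(nat \<Rightarrow> 'a) \<times> (nat \<Rightarrow> 'a)" assume "\<forall>j<max M N. fst P j = fst Q j \<and> snd P j = snd Q j"
    then have "\<forall>j<M. fst P j = fst Q j \<and> snd P j = snd Q j" "\<forall>j<N. fst P j = fst Q j \<and> snd P j = snd Q j"
      by simp_all
    then have "f P = f Q" "g P = g Q" using MN by blast+
    then show "f P + g P = f Q + g Q" by simp
  qed
next
  case (gpoly_mult f g)
  then obtain M N where MN: "\<forall>P Q. (\<forall>j<M. fst P j = fst Q j \<and> snd P j = snd Q j) \<longrightarrow> f P = f Q"
    "\<forall>P Q. (\<forall>j<N. fst P j = fst Q j \<and> snd P j = snd Q j) \<longrightarrow> g P = g Q" by blast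
  show ?case
  proof (intro exI[of _ "max M N"] allI impI)
    fix P Q :: "(nat \<Rightarrow> 'a) \<times> (nat \<Rightarrow> 'a)" assume "\<forall>j<max M N. fst P j = fst Q j \<and> snd P j = snd Q j"
    then have "\<forall>j<M. fst P j = fst Q j \<and> snd P j = snd Q j" "\<forall>j<N. fst P j = fst Q j \<and> snd P j = snd Q j"
      by simp_all
    then have "f P = f Q" "g P = g Q" using MN by blast+
    then show "f P * g P = f Q * g Q" by simp
  qed
qed auto

lemma gpoly_subst:
  assumes "gpoly f"
  shows "gpoly (\<lambda>P. f (\<lambda>j. if j < d then fst P j else 0, \<lambda>j. if j < d then snd P j else 0))"
  using assms
proof induction
  case (gpoly_z j)
  then show ?case by (cases "j < d") (auto intro: gpoly.intros)
next
  case (gpoly_w j)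
  then show ?case by (cases "j < d") (auto intro: gpoly.intros)
qed (auto intro: gpoly.intros)

locale conj_field = alg_closed_field ty for ty :: "'a::field_char_0 itself" +
  fixes \<sigma> :: "'a \<Rightarrow> 'a" and ii :: 'a
  assumes sigma_add: "\<And>x y. \<sigma> (x + y) = \<sigma> x + \<sigma> y"
    and sigma_mult: "\<And>x y. \<sigma> (x * y) = \<sigma> x * \<sigma> y"
    and sigma_invol: "\<And>x. \<sigma> (\<sigma> x) = x"
    and sigma_nonid: "\<exists>x. \<sigma> x \<noteq> x"
    and i_sq: "ii\<^sup>2 = -1"
begin

lemma sigma_0 [simp]: "\<sigma> 0 = 0"
  using sigma_add[of 0 0] by simp

lemma sigma_minus: "\<sigma> (- x) = - \<sigma> x"
  using sigma_add[of x "- x"] by (simp add: add_eq_0_iff)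

lemma sigma_diff: "\<sigma> (x - y) = \<sigma> x - \<sigma> y"
  using sigma_add[of x "- y"] by (simp add: sigma_minus)

lemma sigma_eq_0_iff [simp]: "\<sigma> x = 0 \<longleftrightarrow> x = 0"
  using sigma_invol[of x] by auto

lemma sigma_1 [simp]: "\<sigma> 1 = 1"
  using sigma_mult[of 1 1] by simp

lemma sigma_of_nat [simp]: "\<sigma> (of_nat k) = of_nat k"
  by (induction k) (auto simp: sigma_add)

lemma sigma_of_int [simp]: "\<sigma> (of_int k) = of_int k"
  by (cases k) (auto simp: sigma_minus sigma_add sigma_diff)

lemma sigma_inverse: "\<sigma> (inverse x) = inverse (\<sigma> x)"
proof (cases "x = 0")
  case False
  then have "\<sigma> x * \<sigma> (inverse x) = 1" by (simp flip: sigma_mult)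
  then show ?thesis by (metis inverse_unique)
qed simp

lemma sigma_power: "\<sigma> (x ^ k) = \<sigma> x ^ k"
  by (induction k) (auto simp: sigma_mult)

lemma sigma_powi: "\<sigma> (x powi k) = \<sigma> x powi k"
  by (simp add: power_int_def sigma_power sigma_inverse)

lemma sigma_sum: "\<sigma> (\<Sum>s\<in>S. f s) = (\<Sum>s\<in>S. \<sigma> (f s))"
  by (induction S rule: infinite_finite_induct) (auto simp: sigma_add)

lemma sigma_prod: "\<sigma> (\<Prod>s\<in>S. f s) = (\<Prod>s\<in>S. \<sigma> (f s))"
  by (induction S rule: infinite_finite_induct) (auto simp: sigma_mult)

lemma square_root: "\<exists>c. c\<^sup>2 = (a::'a)"
  using alg_closed[of "[:- a, 0, 1:]"] by (auto simp: power2_eq_square algebra_simps)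

lemma i_nonzero: "ii \<noteq> 0"
  using i_sq by auto

text \<open>If \<open>ii\<close> were fixed, take \<open>y\<close> with
  \<open>\<sigma> y = - y\<close> and a square root \<open>s\<close> of it: then
  \<open>\<sigma> s\<close> is \<open>ii * s\<close> up to sign, and applying
  \<open>\<sigma>\<close> once more gives \<open>- s\<close> instead of \<open>s\<close>.\<close>

lemma sigma_i: "\<sigma> ii = - ii"
proof -
  have "(\<sigma> ii)\<^sup>2 = ii\<^sup>2" by (simp add: i_sq sigma_minus flip: sigma_power)
  then consider "\<sigma> ii = ii" | "\<sigma> ii = - ii" unfolding power2_eq_iff by blast
  then show ?thesis
  proof cases
    case 1
    obtain x where x: "\<sigma> x \<noteq> x" using sigma_nonid by blast
    define y where "y = x - \<sigma> x"
    have y: "\<sigma> y = - y" "y \<noteq> 0" using x by (auto simp: y_def sigma_diff sigma_invol)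
    obtain s where s: "s\<^sup>2 = y" using square_root by blast
    have "(\<sigma> s)\<^sup>2 = (ii * s)\<^sup>2" by (simp add: s y power_mult_distrib i_sq flip: sigma_power)
    then have "\<sigma> s = ii * s \<or> \<sigma> s = - (ii * s)" by (simp add: power2_eq_iff)
    then have "\<sigma> (\<sigma> s) = ii\<^sup>2 * s" by (auto simp: sigma_mult sigma_minus 1 power2_eq_square)
    then have "2 * s = 0" by (simp add: sigma_invol i_sq)
    then show ?thesis using s y by simp
  qed simp
qed

text \<open>A square root \<open>s\<close> of \<open>u\<close> makes \<open>u * \<sigma> u\<close>
  the square of the fixed element \<open>s * \<sigma> s\<close>, hence positive. The other sign is
  excluded because -1 is not a square in the fixed field: its roots are \<open>ii\<close> and
  \<open>- ii\<close>, which are not fixed.\<close>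

lemma absv_square:
  assumes "u \<noteq> 0"
  shows "absv \<sigma> (u\<^sup>2) = u * \<sigma> u"
  unfolding absv_def
proof (rule the_equality)
  obtain s where s: "s\<^sup>2 = u" using square_root by blast
  have "\<exists>t. \<sigma> t = t \<and> t \<noteq> 0 \<and> u * \<sigma> u = t\<^sup>2"
  proof (intro exI[of _ "s * \<sigma> s"] conjI)
    show "\<sigma> (s * \<sigma> s) = s * \<sigma> s" by (simp add: sigma_mult sigma_invol mult.commute)
    show "s * \<sigma> s \<noteq> 0" using s assms by auto
    show "u * \<sigma> u = (s * \<sigma> s)\<^sup>2" by (simp add: power_mult_distrib s flip: sigma_power)
  qed
  then show *: "\<sigma> (u * \<sigma> u) = u * \<sigma> u \<and> (\<exists>t. \<sigma> t = t \<and> t \<noteq> 0 \<and> u * \<sigma> u = t\<^sup>2) \<and> (u * \<sigma> u)\<^sup>2 = u\<^sup>2 * \<sigma> (u\<^sup>2)"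
    by (simp add: sigma_mult sigma_invol sigma_power power_mult_distrib mult.commute)
  fix r assume r: "\<sigma> r = r \<and> (\<exists>t. \<sigma> t = t \<and> t \<noteq> 0 \<and> r = t\<^sup>2) \<and> r\<^sup>2 = u\<^sup>2 * \<sigma> (u\<^sup>2)"
  then have "r\<^sup>2 = (u * \<sigma> u)\<^sup>2" using * by simp
  then consider "r = u * \<sigma> u" | "r = - (u * \<sigma> u)" by (auto simp: power2_eq_iff)
  then show "r = u * \<sigma> u"
  proof cases
    case 2
    obtain a b where ab: "\<sigma> a = a" "a \<noteq> 0" "r = a\<^sup>2" "\<sigma> b = b" "b \<noteq> 0" "u * \<sigma> u = b\<^sup>2" using r * by blast
    have "(a / b)\<^sup>2 = ii\<^sup>2" using 2 ab by (simp add: power_divide i_sq)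
    then have "a / b = ii \<or> a / b = - ii" by (simp add: power2_eq_iff)
    moreover have "\<sigma> (a / b) = a / b" by (simp add: divide_inverse sigma_mult sigma_inverse ab)
    ultimately have "\<sigma> ii = ii" by (metis minus_minus sigma_minus)
    then have "2 * ii = 0" using sigma_i by (metis mult_2 right_minus)
    then show ?thesis using i_nonzero by simp
  qed
qed

definition smap :: "'a gpt \<Rightarrow> 'a gpt" where
  "smap P = (\<lambda>j. \<sigma> (fst P j), \<lambda>j. \<sigma> (snd P j))"

lemma smap_smap [simp]: "smap (smap P) = P"
  by (simp add: smap_def sigma_invol)

lemma smap_in_Gpts: "P \<in> Gpts n \<Longrightarrow> smap P \<in> Gpts n"
  by (auto simp: Gpts_iff smap_def)

lemma smap_mact: "smap (mact k n M P) = mact k n M (smap P)"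
  by (rule gpt_eqI) (auto simp: smap_def mact_def sigma_sum sigma_prod sigma_mult sigma_powi)

text \<open>Conjugating the value as well undoes the effect on the coordinates, so that in total
  only the coefficients are conjugated.\<close>

lemma laurent_smap:
  assumes "f \<in> laurent n"
  shows "(\<lambda>p. \<sigma> (f (smap p))) \<in> laurent n"
  using assms
proof (induction rule: laurent_induct)
  case (cst c)
  then show ?case by (simp add: laurent_const)
next
  case (zc j)
  then show ?case by (simp add: smap_def sigma_invol laurent_fst)
next
  case (wc j)
  then show ?case by (simp add: smap_def sigma_invol laurent_snd)
next
  case (wi j)
  then show ?case by (simp add: smap_def sigma_invol sigma_inverse laurent_inverse_snd)
next
  case (add f g)
  then show ?case using laurent_add[OF add(3,4)] by (simp add: sigma_add)
next
  case (mult f g)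
  then show ?case using laurent_mult[OF mult(3,4)] by (simp add: sigma_mult)
qed

lemma zmorph_smap: "zmorph n n smap"
  unfolding zmorph_def
proof (intro conjI ballI)
  show "smap ` Gpts n \<subseteq> Gpts n" by (rule image_subsetI) (rule smap_in_Gpts)
  fix f :: "'a gpt \<Rightarrow> 'a" assume "f \<in> laurent n"
  then show "\<exists>g\<in>laurent n. \<forall>p\<in>Gpts n. g p = 0 \<longleftrightarrow> f (smap p) = 0"
    by (intro bexI[OF _ laurent_smap]) auto
qed

lemma gvariety_smap: "gvariety n X \<Longrightarrow> gvariety n (smap ` X)"
  by (rule gvariety_iso_image[OF _ zmorph_smap zmorph_smap]) simp_all

lemma kdim_smap_le:
  assumes X: "gvariety n X"
  shows "kdim X \<le> kdim (smap ` X)"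
proof -
  obtain c where c: "vchain n c (kdim X)" "c (kdim X) \<subseteq> X" using kdim_chain[OF X] by blast
  have "vchain n (\<lambda>l. smap ` c l) (kdim X)"
    by (rule vchain_iso_image[OF c(1) zmorph_smap zmorph_smap]) simp_all
  then show ?thesis
    using c(2) gvariety_smap[OF X] by (intro kdim_ge[where c = "\<lambda>l. smap ` c l"]) (auto simp: gvariety_def)
qed

text \<open>The isogeny of sum and difference. At a point and its conjugate the two blocks are the
  real parts and moduli, and \<open>ii\<close> times the imaginary parts with the phases, of the
  doubled point.\<close>

definition lam :: "nat \<Rightarrow> 'a gpt \<Rightarrow> 'a gpt \<Rightarrow> 'a gpt" where
  "lam n Q R = (\<lambda>j. if j < n then fst Q j + fst R j else if j < 2 * n then fst Q (j - n) - fst R (j - n) else 0,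
     \<lambda>j. if j < n then snd Q j * snd R j else if j < 2 * n then snd Q (j - n) * inverse (snd R (j - n)) else 1)"

lemma realis_gscale:
  assumes "Q \<in> Gpts n"
  shows "realis \<sigma> ii n (gscale 2 Q) = lam n Q (smap Q)"
proof (rule gpt_eqI)
  have two: "\<sigma> 2 = 2" using sigma_of_nat[of 2] by simp
  fix j
  have Re: "ReK \<sigma> (2 * x) = x + \<sigma> x" and Im: "ii * ImK \<sigma> ii (2 * x) = x - \<sigma> x" for x
    using i_nonzero by (auto simp: ReK_def ImK_def sigma_mult two field_simps)
  show "fst (realis \<sigma> ii n (gscale 2 Q)) j = fst (lam n Q (smap Q)) j"
    by (simp add: realis_def lam_def gscale_def smap_def Re Im)
  have Th: "Theta \<sigma> (x\<^sup>2) = x * inverse (\<sigma> x)" if "x \<noteq> 0" for x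
    unfolding Theta_def absv_square[OF that] using that by (simp add: power2_eq_square field_simps)
  show "snd (realis \<sigma> ii n (gscale 2 Q)) j = snd (lam n Q (smap Q)) j"
    using Gpts_nz[OF assms] by (simp add: realis_def lam_def gscale_def smap_def absv_square Th)
qed

text \<open>A pair written as \<open>s + ii * t\<close> and \<open>s - ii * t\<close> is conjugate
  when \<open>s\<close> and \<open>t\<close> are fixed by \<open>\<sigma>\<close>; the fixed field
  is infinite, so a polynomial in one variable that vanishes on it is zero. Coordinates are freed
  one at a time, and finitely many suffice because \<open>f\<close> depends on finitely
  many.\<close>

lemma gpoly_conj_nonzero:
  assumes f: "gpoly f" "f P \<noteq> (0::'a)"
  obtains c where "f (c, \<lambda>j. \<sigma> (c j)) \<noteq> 0"
proof (rule ccontr)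
  assume "\<not> thesis"
  then have zero: "f (c, \<lambda>j. \<sigma> (c j)) = 0" for c using that by blast
  obtain N where N: "\<And>P Q. (\<forall>j<N. fst P j = fst Q j \<and> snd P j = snd Q j) \<Longrightarrow> f P = f Q"
    using gpoly_finite_support[OF f(1)] by blast
  define R where "R = {r. \<sigma> r = r}"
  have infR: "infinite R"
  proof
    assume "finite R"
    moreover have "range (of_nat :: nat \<Rightarrow> 'a) \<subseteq> R" by (auto simp: R_def)
    ultimately have "finite (range (of_nat :: nat \<Rightarrow> 'a))" by (rule finite_subset[rotated])
    then show False using range_inj_infinite[OF inj_of_nat] by blast
  qed
  have polyR: "poly p x = 0" if "\<And>r. r \<in> R \<Longrightarrow> poly p r = 0" for p x
  proof -
    have "p = 0"
    proof (rule ccontr)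
      assume "p \<noteq> 0"
      then have "finite {x. poly p x = 0}" by (rule poly_roots_finite)
      moreover have "R \<subseteq> {x. poly p x = 0}" using that by blast
      ultimately show False using infR finite_subset by blast
    qed
    then show ?thesis by simp
  qed
  \<comment> \<open>Induction on the number \<open>k\<close> of leading coordinates in which
    \<open>b\<close> is not tied to \<open>a\<close> by conjugation.\<close>
  have "f (a, b) = 0" if "\<And>j. j \<ge> k \<Longrightarrow> b j = \<sigma> (a j)" for k a b
    using that
  proof (induction k arbitrary: a b)
    case 0
    then have "b = (\<lambda>j. \<sigma> (a j))" by auto
    then show ?case using zero by simp
  next
    case (Suc k)
    define g where "g s t = f (a(k := s + ii * t), b(k := s - ii * t))" for s t
    have g0: "g s t = 0" if "s \<in> R" "t \<in> R" for s t
    proof -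
      have "\<sigma> (s + ii * t) = s - ii * t" using that by (simp add: R_def sigma_add sigma_mult sigma_i)
      then show ?thesis
        unfolding g_def using Suc.prems by (intro Suc.IH) (auto simp: le_Suc_eq less_eq_Suc_le)
    qed
    have line: "\<exists>p. \<forall>x. g (poly u x) (poly v x) = poly p x" for u v
    proof -
      obtain p where "\<forall>x. f (\<lambda>j. poly (if j = k then u + [:ii:] * v else [:a j:]) x,
          \<lambda>j. poly (if j = k then u - [:ii:] * v else [:b j:]) x) = poly p x"
        using gpoly_on_curve[OF f(1)] by metis
      moreover have "(\<lambda>j. poly (if j = k then u + [:ii:] * v else [:a j:]) x) = a(k := poly u x + ii * poly v x)"
        "(\<lambda>j. poly (if j = k then u - [:ii:] * v else [:b j:]) x) = b(k := poly u x - ii * poly v x)" for x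
        by auto
      ultimately show ?thesis unfolding g_def by auto
    qed
    have g1: "g s t = 0" if "t \<in> R" for s t
    proof -
      obtain p where "\<forall>x. g (poly [:0, 1:] x) (poly [:t:] x) = poly p x" using line by blast
      then have p: "g x t = poly p x" for x by simp
      have "poly p r = 0" if "r \<in> R" for r using g0[OF that \<open>t \<in> R\<close>] p[of r] by simp
      then have "poly p s = 0" by (rule polyR)
      then show ?thesis using p[of s] by simp
    qed
    have g2: "g s t = 0" for s t
    proof -
      obtain p where "\<forall>x. g (poly [:s:] x) (poly [:0, 1:] x) = poly p x" using line by blast
      then have p: "g s x = poly p x" for x by simp
      have "poly p r = 0" if "r \<in> R" for r using g1[OF that, of s] p[of r] by simp
      then have "poly p t = 0" by (rule polyR)
      then show ?thesis using p[of t] by simp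
    qed
    have "(a k + b k) / 2 + ii * ((a k - b k) / (2 * ii)) = a k" "(a k + b k) / 2 - ii * ((a k - b k) / (2 * ii)) = b k"
      using i_nonzero by (auto simp: field_simps)
    then show ?case using g2[of "(a k + b k) / 2" "(a k - b k) / (2 * ii)"] by (simp add: g_def)
  qed
  \<comment> \<open>The second half of \<open>P\<close> is kept below \<open>N\<close>, where
    \<open>f\<close> looks, and replaced by conjugates beyond.\<close>
  from this[of N "\<lambda>j. if j < N then snd P j else \<sigma> (fst P j)" "fst P"]
  have "f (fst P, \<lambda>j. if j < N then snd P j else \<sigma> (fst P j)) = 0" by simp
  then show False using N[of P "(fst P, \<lambda>j. if j < N then snd P j else \<sigma> (fst P j))"] f(2) by simp
qed

end

section \<open>The function ring of a product\<close>

definition pairring :: "nat \<Rightarrow> (('a::field) gpt \<times> 'a gpt \<Rightarrow> 'a) set" where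
  "pairring n = alg (range cst) (pull fst ` lgens n \<union> pull snd ` lgens n)"

definition pvan :: "nat \<Rightarrow> ('a::field) gpt set \<Rightarrow> 'a gpt set \<Rightarrow> ('a gpt \<times> 'a gpt \<Rightarrow> 'a) set" where
  "pvan n X Y = {h \<in> pairring n. \<forall>Q\<in>X. \<forall>R\<in>Y. h (Q, R) = 0}"

lemma subring_pairring: "is_subring (pairring n)"
  unfolding pairring_def by (rule alg_subring[OF subring_cst])

lemma lgens_laurent: "x \<in> lgens n \<Longrightarrow> x \<in> laurent n"
  unfolding laurent_def by (rule alg_gen)

lemma pairring_slices:
  assumes "h \<in> pairring n"
  shows "(\<lambda>Q. h (Q, R)) \<in> laurent n \<and> (\<lambda>R. h (Q, R)) \<in> laurent n"
  using assms unfolding pairring_def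
proof (induction rule: alg.induct)
  case (alg_base a)
  then obtain c where "a = cst c" by blast
  then show ?case by (simp add: laurent_const)
next
  case (alg_gen a)
  then consider x where "x \<in> lgens n" "a = pull fst x" | x where "x \<in> lgens n" "a = pull snd x" by blast
  then show ?case by cases (simp_all add: laurent_const lgens_laurent)
next
  case (alg_add a b)
  then show ?case
    using laurent_add[of "\<lambda>Q. a (Q, R)" n "\<lambda>Q. b (Q, R)"] laurent_add[of "\<lambda>R. a (Q, R)" n "\<lambda>R. b (Q, R)"]
    by simp
next
  case (alg_mult a b)
  then show ?case
    using laurent_mult[of "\<lambda>Q. a (Q, R)" n "\<lambda>Q. b (Q, R)"] laurent_mult[of "\<lambda>R. a (Q, R)" n "\<lambda>R. b (Q, R)"]
    by simp
qed

lemma pull_in_pairring: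
  fixes f :: "'a::field gpt \<Rightarrow> 'a"
  assumes "f \<in> laurent n"
  shows "pull fst f \<in> pairring n" "pull snd f \<in> pairring n"
proof -
  have hom: "pull \<phi> (g + h) = pull \<phi> g + pull \<phi> h" "pull \<phi> (g * h) = pull \<phi> g * pull \<phi> h"
    for g h :: "'a gpt \<Rightarrow> 'a" and \<phi> :: "'a gpt \<times> 'a gpt \<Rightarrow> 'a gpt" by (auto simp: fun_eq_iff)
  have K: "pull \<phi> ` range cst \<subseteq> (range cst :: ('a gpt \<times> 'a gpt \<Rightarrow> 'a) set)"
    for \<phi> :: "'a gpt \<times> 'a gpt \<Rightarrow> 'a gpt"
  proof (rule image_subsetI)
    fix a :: "'a gpt \<Rightarrow> 'a" assume "a \<in> range cst"
    then obtain c where "a = cst c" by blast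
    moreover have "pull \<phi> (cst c) = cst c" by (simp add: fun_eq_iff)
    ultimately show "pull \<phi> a \<in> range cst" by blast
  qed
  have "pull \<phi> ` laurent n \<subseteq> pairring n" if "pull \<phi> ` lgens n \<subseteq> pull fst ` lgens n \<union> pull snd ` lgens n"
    for \<phi> :: "'a gpt \<times> 'a gpt \<Rightarrow> 'a gpt"
    unfolding laurent_def pairring_def alg_image[where \<theta> = "pull \<phi>", OF hom, symmetric]
    by (rule alg_mono[OF K that])
  then show "pull fst f \<in> pairring n" "pull snd f \<in> pairring n"
    using assms by blast+
qed

text \<open>Algebraicity is witnessed by one relation, which \<open>\<theta>\<close> transports
  together with its surviving coefficient.\<close>

lemma not_transc_image:
  assumes \<theta>: "\<theta> 0 = 0" "\<And>a b. \<theta> (a + b) = \<theta> a + \<theta> b" "\<And>a b. \<theta> (a * b) = \<theta> a * \<theta> b"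
    and x: "\<not> transc V C x" and C: "C \<subseteq> L" "\<theta> ` C \<subseteq> A"
    and V: "V \<subseteq> L" "\<And>f. f \<in> L \<Longrightarrow> \<theta> f \<in> P \<longleftrightarrow> f \<in> V"
  shows "\<not> transc P A (\<theta> x)"
proof -
  obtain p k where p: "p \<in> polys C" "poly p x \<in> V" "coeff p k \<notin> V"
    using x unfolding transc_def by blast
  show ?thesis
  proof (rule not_transcI)
    show "map_poly \<theta> p \<in> polys A" using p(1) \<theta>(1) C(2) by (auto simp: polys_def coeff_map_poly)
    show "poly (map_poly \<theta> p) (\<theta> x) \<in> P"
      using p(2) V unfolding poly_map_hom[where \<theta> = \<theta>, OF \<theta>] by blast
    have "coeff p k \<in> L" using p(1) C(1) by (auto simp: polys_def)
    then show "coeff (map_poly \<theta> p) k \<notin> P" using p(3) V(2) by (simp add: coeff_map_poly \<theta>(1))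
  qed
qed

lemma irrD:
  "irr m S \<Longrightarrow> f \<in> laurent m \<Longrightarrow> g \<in> laurent m \<Longrightarrow> \<forall>p\<in>S. f p * g p = 0
    \<Longrightarrow> (\<forall>p\<in>S. f p = 0) \<or> (\<forall>p\<in>S. g p = 0)"
  unfolding irr_def by blast

text \<open>The argument of \<open>irr_bimorph\<close> for functions on pairs: first a
  \<open>Q\<close> at which a slice of \<open>f\<close> and a slice of \<open>g\<close> are nonzero,
  then an \<open>R\<close> for that \<open>Q\<close>.\<close>

lemma prime_pvan:
  assumes X: "irr n X" and Y: "irr n Y"
  shows "prime_in (pairring n) (pvan n X Y)"
  unfolding prime_in_def
proof (intro conjI ballI impI)
  show "ideal_in (pairring n) (pvan n X Y)"
    unfolding ideal_in_def pvan_def using subring_intros[OF subring_pairring[of n]] by auto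
  show "1 \<notin> pvan n X Y" using X Y by (auto simp: pvan_def irr_def)
  fix f g assume fg: "f \<in> pairring n" "g \<in> pairring n" "f * g \<in> pvan n X Y"
  show "f \<in> pvan n X Y \<or> g \<in> pvan n X Y"
  proof (rule ccontr)
    assume "\<not> ?thesis"
    then obtain Q0 R0 Q1 R1 where *: "Q0 \<in> X" "R0 \<in> Y" "f (Q0, R0) \<noteq> 0" "Q1 \<in> X" "R1 \<in> Y" "g (Q1, R1) \<noteq> 0"
      using fg(1,2) unfolding pvan_def by blast
    have sl: "(\<lambda>Q. f (Q, R)) \<in> laurent n" "(\<lambda>R. f (Q, R)) \<in> laurent n"
      "(\<lambda>Q. g (Q, R)) \<in> laurent n" "(\<lambda>R. g (Q, R)) \<in> laurent n" for Q R
      using pairring_slices[OF fg(1)] pairring_slices[OF fg(2)] by blast+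
    have "\<not> (\<forall>Q\<in>X. f (Q, R0) * g (Q, R1) = 0)"
    proof
      assume "\<forall>Q\<in>X. f (Q, R0) * g (Q, R1) = 0"
      then have "(\<forall>Q\<in>X. f (Q, R0) = 0) \<or> (\<forall>Q\<in>X. g (Q, R1) = 0)"
        by (rule irrD[OF X sl(1) sl(3)])
      then show False using * by blast
    qed
    then obtain Q where Q: "Q \<in> X" "f (Q, R0) \<noteq> 0" "g (Q, R1) \<noteq> 0" by auto
    have "\<forall>R\<in>Y. f (Q, R) * g (Q, R) = 0" using fg(3) Q(1) by (simp add: pvan_def)
    then have "(\<forall>R\<in>Y. f (Q, R) = 0) \<or> (\<forall>R\<in>Y. g (Q, R) = 0)"
      by (rule irrD[OF Y sl(2) sl(4)])
    then show False using * Q by blast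
  qed
qed

text \<open>A repeated entry would satisfy a monic linear relation. Distinctness is what allows
  values to be prescribed entry by entry.\<close>

lemma indep_distinct:
  assumes A: "is_subring A" and P: "0 \<in> P" "1 \<notin> P" and ts: "indep P A ts"
  shows "distinct ts"
  using ts
proof (induction ts)
  case (Cons t ts)
  have "t \<notin> set ts"
  proof
    assume "t \<in> set ts"
    define C where "C = alg A (set ts)"
    have C: "is_subring C" unfolding C_def by (rule alg_subring[OF A])
    have "t \<in> C" unfolding C_def using \<open>t \<in> set ts\<close> by (rule alg_gen)
    then have "[:- t, 1:] \<in> polys C"
      by (intro polys_pCons[OF C] polys_0[OF C] subring_uminus[OF C] subring_1[OF C])
    moreover have "poly [:- t, 1:] t \<in> P" using P by simp
    moreover have "transc P C t" using Cons.prems by (simp add: C_def)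
    ultimately have "coeff [:- t, 1:] 1 \<in> P" unfolding transc_def by blast
    then show False using P by simp
  qed
  then show ?case using Cons by simp
qed simp

context alg_closed_field
begin

text \<open>Independent functions behave as free variables, so their values can be prescribed at
  will: at each adjunction all relations specialise to the zero polynomial.\<close>

lemma hom_of_indep:
  fixes U :: "'a gpt set"
  assumes U: "irr m U" and ts: "indep (van m U) (range cst) ts" "set ts \<subseteq> laurent m"
  shows "\<exists>\<phi>. hom_on (alg (range cst) (set ts)) \<phi> \<and> (\<forall>a. \<phi> (cst a) = a) \<and> (\<forall>t\<in>set ts. \<phi> t = val t)
    \<and> (\<forall>f\<in>alg (range cst) (set ts). f \<in> van m U \<longrightarrow> \<phi> f = 0)"
  using ts
proof (induction ts)
  case Nil
  obtain y where y: "y \<in> U" using U unfolding irr_def by blast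
  show ?case
    by (intro exI[of _ "\<lambda>f. f y"]) (use y in \<open>auto simp: hom_on_def van_def\<close>)
next
  case (Cons t ts)
  define C where "C = alg (range cst) (set ts)"
  have eq: "alg (range cst) (set (t # ts)) = alg C {t}" by (simp add: C_def alg_alg)
  obtain \<phi> where \<phi>: "hom_on C \<phi>" "\<forall>a. \<phi> (cst a) = a" "\<forall>t\<in>set ts. \<phi> t = val t" "\<forall>f\<in>C. f \<in> van m U \<longrightarrow> \<phi> f = 0"
  proof -
    have "indep (van m U) (range cst) ts" "set ts \<subseteq> laurent m"
      using Cons.prems by (simp_all del: cst_apply)
    from Cons.IH[OF this] show ?thesis using that unfolding C_def by (elim exE conjE)
  qed
  have CL: "C \<subseteq> laurent m"
    unfolding C_def using Cons.prems by (intro alg_least[OF subring_laurent cst_subset_laurent]) simp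
  interpret E: prime_ext "laurent m" "van m U" C t
    using Cons.prems CL U alg_subring[OF subring_cst]
    by unfold_locales (simp_all add: subring_laurent prime_van C_def del: cst_apply)
  have "\<exists>\<psi>. hom_on (alg C {t}) \<psi> \<and> (\<forall>a\<in>C. \<psi> a = \<phi> a) \<and> \<psi> t = val t
    \<and> (\<forall>a\<in>alg C {t}. a \<in> van m U \<longrightarrow> \<psi> a = 0)
    \<and> (\<forall>p\<in>polys C. \<psi> (poly p t) = poly (map_poly \<phi> p) (val t))"
  proof (rule E.hom_extension_by_value[OF \<phi>(1)])
    fix p assume p: "p \<in> polys C" "poly p t \<in> van m U"
    have "coeff (map_poly \<phi> p) k = 0" for k
    proof -
      have "coeff p k \<in> van m U" using Cons.prems(1) p by (simp add: transc_def C_def del: cst_apply)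
      moreover have "coeff p k \<in> C" using p by (simp add: polys_def)
      ultimately show ?thesis using \<phi>(4) by (simp add: coeff_map_poly hom_on_0_diff(1)[OF E.A \<phi>(1)])
    qed
    then have "map_poly \<phi> p = 0" by (intro poly_eqI) simp
    then show "poly (map_poly \<phi> p) (val t) = 0" by simp
  qed
  then obtain \<psi> where \<psi>: "hom_on (alg C {t}) \<psi>" "\<forall>a\<in>C. \<psi> a = \<phi> a" "\<psi> t = val t"
    "\<forall>a\<in>alg C {t}. a \<in> van m U \<longrightarrow> \<psi> a = 0" by (elim exE conjE)
  have "cst a \<in> C" for a unfolding C_def by (intro alg_base) blast
  moreover have "s \<in> C" if "s \<in> set ts" for s unfolding C_def using that by (rule alg_gen)
  ultimately have "\<psi> (cst a) = a" "s \<in> set ts \<Longrightarrow> \<psi> s = val s" for a s using \<phi>(2,3) \<psi>(2) by metis+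
  then have "hom_on (alg C {t}) \<psi> \<and> (\<forall>a. \<psi> (cst a) = a) \<and> (\<forall>s\<in>set (t # ts). \<psi> s = val s)
    \<and> (\<forall>f\<in>alg C {t}. f \<in> van m U \<longrightarrow> \<psi> f = 0)"
    using \<psi>(1,3,4) by (simp del: cst_apply)
  then show ?case unfolding eq by blast
qed

text \<open>A further transcendental function would yield, by \<open>vchain_of_indep\<close>, a
  chain longer than \<open>kdim U\<close>.\<close>

lemma maximal_indep:
  fixes U :: "'a gpt set"
  assumes U: "gvariety m U"
  obtains ts where "indep (van m U) (range cst) ts" "set ts \<subseteq> laurent m"
    "\<And>x. x \<in> laurent m \<Longrightarrow> \<not> transc (van m U) (alg (range cst) (set ts)) x"
proof -
  obtain ts where ts: "length ts = kdim U" "set ts \<subseteq> laurent m" "indep (van m U) (range cst) ts"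
    using kdim_indep[OF U] by blast
  have "\<not> transc (van m U) (alg (range cst) (set ts)) x" if x: "x \<in> laurent m" for x
  proof
    assume "transc (van m U) (alg (range cst) (set ts)) x"
    then have *: "indep (van m U) (range cst) (x # ts)" "set (x # ts) \<subseteq> laurent m" using ts x by auto
    obtain c where "vchain m c (length (x # ts))" "c (length (x # ts)) = U"
      by (rule vchain_of_indep[OF U *]) (rule that)
    then have "length (x # ts) \<le> kdim U" using U by (intro kdim_ge[of m U c]) (simp_all add: gvariety_def)
    then show False using ts by simp
  qed
  then show ?thesis using that ts by blast
qed

end

text \<open>One polynomial \<open>q\<close> serves both the values of \<open>f\<close> at points and
  its values under homomorphisms with prescribed images of \<open>ts\<close>: the former shows that
  \<open>q\<close> is not identically zero, the latter is evaluated at the chosen images.\<close>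

lemma alg_as_gpoly:
  fixes ts :: "('s \<Rightarrow> 'a::field) list"
  assumes "f \<in> alg (range cst) (set ts)"
  shows "\<exists>q. gpoly q \<and> (\<forall>s. f s = q (\<lambda>j. if j < length ts then (ts ! j) s else 0, \<lambda>_. 0)) \<and>
    (\<forall>\<phi> c. hom_on (alg (range cst) (set ts)) \<phi> \<and> (\<forall>a. \<phi> (cst a) = a) \<and> (\<forall>j<length ts. \<phi> (ts ! j) = c j)
      \<longrightarrow> \<phi> f = q (\<lambda>j. if j < length ts then c j else 0, \<lambda>_. 0))"
proof -
  define E where "E s = (\<lambda>j. if j < length ts then (ts ! j) s else 0, \<lambda>_::nat. 0 :: 'a)" for s
  define F where "F c = (\<lambda>j. if j < length ts then c j else 0, \<lambda>_::nat. 0 :: 'a)" for c :: "nat \<Rightarrow> 'a"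
  define S where "S = {(\<phi> :: ('s \<Rightarrow> 'a) \<Rightarrow> 'a, c). hom_on (alg (range cst) (set ts)) \<phi> \<and> (\<forall>a. \<phi> (cst a) = a)
    \<and> (\<forall>j<length ts. \<phi> (ts ! j) = c j)}"
  define good where "good f q \<longleftrightarrow> gpoly q \<and> (\<forall>s. f s = q (E s)) \<and> (\<forall>\<phi> c. (\<phi>, c) \<in> S \<longrightarrow> \<phi> f = q (F c))"
    for f and q :: "'a gpt \<Rightarrow> 'a"
  have hom: "\<phi> (a + b) = \<phi> a + \<phi> b" "\<phi> (a * b) = \<phi> a * \<phi> b"
    if "(\<phi>, c) \<in> S" "a \<in> alg (range cst) (set ts)" "b \<in> alg (range cst) (set ts)" for \<phi> c a b
    using that unfolding S_def hom_on_def by blast+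
  have "\<exists>q. good f q"
    using assms
  proof (induction rule: alg.induct)
    case (alg_base a)
    then obtain c where a: "a = cst c" by blast
    have "good (cst c) (\<lambda>_. c)"
      unfolding good_def S_def by (auto intro: gpoly_const)
    then show ?case unfolding a by blast
  next
    case (alg_gen a)
    then obtain j where j: "j < length ts" "a = ts ! j" by (metis in_set_conv_nth)
    then have "good a (\<lambda>P. fst P j)"
      unfolding good_def S_def E_def F_def by (auto intro: gpoly_z)
    then show ?case by blast
  next
    case (alg_add a b)
    then obtain p q where "good a p" "good b q" by blast
    then have "good (a + b) (\<lambda>P. p P + q P)"
      unfolding good_def using hom(1)[OF _ alg_add(1,2)] by (simp add: gpoly.gpoly_add)
    then show ?case by blast
  next
    case (alg_mult a b)
    then obtain p q where "good a p" "good b q" by blast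
    then have "good (a * b) (\<lambda>P. p P * q P)"
      unfolding good_def using hom(2)[OF _ alg_mult(1,2)] by (simp add: gpoly.gpoly_mult)
    then show ?case by blast
  qed
  then show ?thesis unfolding good_def E_def F_def S_def by (simp del: cst_apply)
qed

context conj_field
begin

text \<open>Both sides of the product are finite over affine space via maximal independent lists \<^term>\<open>ts\<close>
  and their conjugates, so a function on the product divides a polynomial \<^term>\<open>h\<close> in these; and
  points of \<^term>\<open>U\<close> realise generic values of \<^term>\<open>ts\<close>, where \<^term>\<open>h (Q, smap Q)\<close> cannot vanish.\<close>

theorem graph_dense:
  assumes U: "gvariety n U" and g: "g \<in> pairring n" "\<And>Q. Q \<in> U \<Longrightarrow> g (Q, smap Q) = 0"
    and QR: "Q \<in> U" "R \<in> smap ` U"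
  shows "g (Q, R) = 0"
proof (rule ccontr)
  assume "g (Q, R) \<noteq> 0"
  define P where "P = pvan n U (smap ` U)"
  have irrU: "irr n U" and UG: "U \<subseteq> Gpts n" and irrS: "irr n (smap ` U)"
    using U gvariety_smap[OF U] by (auto simp: gvariety_iff)
  have PP: "prime_in (pairring n) P" unfolding P_def by (rule prime_pvan[OF irrU irrS])
  have gP: "g \<notin> P" using \<open>g (Q, R) \<noteq> 0\<close> QR unfolding P_def pvan_def by blast
  obtain ts where ts: "indep (van n U) (range cst) ts" "set ts \<subseteq> laurent n"
    "\<And>x. x \<in> laurent n \<Longrightarrow> \<not> transc (van n U) (alg (range cst) (set ts)) x"
    by (rule maximal_indep[OF U]) (rule that)
  define C where "C = alg (range cst) (set ts)"
  define d where "d = length ts"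
  have C: "is_subring C" "C \<subseteq> laurent n"
    unfolding C_def by (rule alg_subring[OF subring_cst], rule alg_least[OF subring_laurent cst_subset_laurent ts(2)])
  \<comment> \<open>\<open>\<theta>2\<close> makes a function on \<open>U\<close> into one on the
    conjugate of \<open>U\<close>; it is a ring homomorphism that conjugates constants, so the
    single list \<open>ts\<close> serves both factors.\<close>
  define \<theta>1 \<theta>2 where "\<theta>1 = (\<lambda>(f :: 'a gpt \<Rightarrow> 'a) (p :: 'a gpt \<times> 'a gpt). f (fst p))"
    and "\<theta>2 = (\<lambda>(f :: 'a gpt \<Rightarrow> 'a) (p :: 'a gpt \<times> 'a gpt). \<sigma> (f (smap (snd p))))"
  have h1: "\<theta>1 0 = 0" "\<theta>1 (a + b) = \<theta>1 a + \<theta>1 b" "\<theta>1 (a * b) = \<theta>1 a * \<theta>1 b" for a b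
    by (auto simp: \<theta>1_def fun_eq_iff)
  have h2: "\<theta>2 0 = 0" "\<theta>2 (a + b) = \<theta>2 a + \<theta>2 b" "\<theta>2 (a * b) = \<theta>2 a * \<theta>2 b" for a b
    by (auto simp: \<theta>2_def fun_eq_iff sigma_add sigma_mult)
  define A where "A = alg (range cst) (\<theta>1 ` set ts \<union> \<theta>2 ` set ts)"
  have A1: "is_subring A" unfolding A_def by (rule alg_subring[OF subring_cst])
  have L1: "\<theta>1 f \<in> pairring n" "\<theta>2 f \<in> pairring n" if "f \<in> laurent n" for f
    using pull_in_pairring(1)[OF that] pull_in_pairring(2)[OF laurent_smap[OF that]]
    unfolding \<theta>1_def \<theta>2_def pull_def by simp_all
  have cstP: "range cst \<subseteq> pairring n" unfolding pairring_def by (rule subsetI) (rule alg_base)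
  have "\<theta>1 ` set ts \<union> \<theta>2 ` set ts \<subseteq> pairring n" using L1 ts(2) by blast
  then have A2: "A \<subseteq> pairring n" unfolding A_def by (rule alg_least[OF subring_pairring cstP])
  have K: "\<theta>1 ` range cst \<subseteq> range cst" "\<theta>2 ` range cst \<subseteq> range cst"
  proof -
    have "\<theta>1 (cst c) = cst c" "\<theta>2 (cst c) = cst (\<sigma> c)" for c
      by (auto simp: \<theta>1_def \<theta>2_def fun_eq_iff)
    then show "\<theta>1 ` range cst \<subseteq> range cst" "\<theta>2 ` range cst \<subseteq> range cst"
      by (intro image_subsetI; elim rangeE; simp del: cst_apply)+
  qed
  have CA: "\<theta>1 ` C \<subseteq> A" "\<theta>2 ` C \<subseteq> A"
    unfolding C_def A_def alg_image[where \<theta> = \<theta>1, OF h1(2,3), symmetric]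
      alg_image[where \<theta> = \<theta>2, OF h2(2,3), symmetric]
    using K by (auto intro!: alg_mono del: subsetI)
  have P1: "\<theta>1 f \<in> P \<longleftrightarrow> f \<in> van n U" "\<theta>2 f \<in> P \<longleftrightarrow> f \<in> van n U" if "f \<in> laurent n" for f
    using that L1[OF that] QR unfolding P_def pvan_def van_def \<theta>1_def \<theta>2_def by auto
  have VL: "van n U \<subseteq> laurent n" unfolding van_def by blast
  have nontr: "\<not> transc P A (\<theta>1 x)" "\<not> transc P A (\<theta>2 x)" if "x \<in> laurent n" for x
    using not_transc_image[where \<theta> = \<theta>1, OF h1 _ C(2) CA(1) VL P1(1)]
      not_transc_image[where \<theta> = \<theta>2, OF h2 _ C(2) CA(2) VL P1(2)] ts(3)[OF that]
    unfolding C_def by blast+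
  define G where "G = (pull fst ` lgens n \<union> pull snd ` lgens n :: ('a gpt \<times> 'a gpt \<Rightarrow> 'a) set)"
  have G\<theta>: "G \<subseteq> \<theta>1 ` laurent n \<union> \<theta>2 ` laurent n"
  proof
    fix x assume "x \<in> G"
    then consider y where "y \<in> lgens n" "x = pull fst y" | y where "y \<in> lgens n" "x = pull snd y"
      unfolding G_def by blast
    then show "x \<in> \<theta>1 ` laurent n \<union> \<theta>2 ` laurent n"
    proof cases
      case 1
      then have "x = \<theta>1 y" by (simp add: \<theta>1_def pull_def)
      then show ?thesis using lgens_laurent[OF 1(1)] by blast
    next
      case 2
      then have "x = \<theta>2 (\<lambda>p. \<sigma> (y (smap p)))" by (simp add: \<theta>2_def pull_def sigma_invol)
      then show ?thesis using laurent_smap[OF lgens_laurent[OF 2(1)]] by blast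
    qed
  qed
  have "\<not> transc P A x" if "x \<in> G" for x
    using G\<theta> that nontr by blast
  moreover have "finite G" unfolding G_def by (simp add: finite_lgens)
  moreover have "G \<subseteq> pairring n" unfolding pairring_def G_def by (rule subsetI) (rule alg_gen)
  moreover have gA: "g \<in> alg A G"
  proof -
    have "range cst \<subseteq> A" unfolding A_def by (rule subsetI) (rule alg_base)
    then have "pairring n \<subseteq> alg A G" unfolding pairring_def G_def by (rule alg_mono) simp
    then show ?thesis using g(1) by blast
  qed
  ultimately obtain h v where h: "h \<in> A" "h \<notin> P" "h - v * g \<in> P"
    using finite_alg_multiple_in_base[OF subring_pairring PP A1 A2 _ _ _ _ gP, of G] by blast
  have hD: "h (S, smap S) = 0" if S: "S \<in> U" for S
  proof -
    have "(h - v * g) (S, smap S) = 0" using h(3) S unfolding P_def pvan_def by blast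
    then show ?thesis using g(2)[OF S] by simp
  qed
  obtain p where p: "gpoly p" "\<And>S T. h (S, T) = p (\<lambda>j. if j < d then (ts ! j) S else 0,
     \<lambda>j. if j < d then \<sigma> ((ts ! j) (smap T)) else 0)"
  proof -
    have "\<exists>p. gpoly p \<and> (\<forall>S T. h (S, T) = p (\<lambda>j. if j < d then (ts ! j) S else 0,
       \<lambda>j. if j < d then \<sigma> ((ts ! j) (smap T)) else 0))"
      using h(1) unfolding A_def
    proof (induction rule: alg.induct)
      case (alg_base a)
      then obtain c where "a = cst c" by blast
      then show ?case by (intro exI[of _ "\<lambda>_. c"]) (auto intro: gpoly_const)
    next
      case (alg_gen a)
      then consider j where "j < d" "a = \<theta>1 (ts ! j)" | j where "j < d" "a = \<theta>2 (ts ! j)"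
        unfolding d_def by (auto simp: in_set_conv_nth)
      then show ?case
      proof cases
        case 1
        then show ?thesis by (intro exI[of _ "\<lambda>P. fst P j"]) (auto intro: gpoly_z simp: \<theta>1_def)
      next
        case 2
        then show ?thesis by (intro exI[of _ "\<lambda>P. snd P j"]) (auto intro: gpoly_w simp: \<theta>2_def)
      qed
    next
      case (alg_add a b)
      then obtain p q where "gpoly p" "gpoly q" "\<And>S T. a (S, T) = p (\<lambda>j. if j < d then (ts ! j) S else 0,
         \<lambda>j. if j < d then \<sigma> ((ts ! j) (smap T)) else 0)"
        "\<And>S T. b (S, T) = q (\<lambda>j. if j < d then (ts ! j) S else 0,
         \<lambda>j. if j < d then \<sigma> ((ts ! j) (smap T)) else 0)" by auto
      then show ?case by (intro exI[of _ "\<lambda>P. p P + q P"]) (auto intro: gpoly.gpoly_add)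
    next
      case (alg_mult a b)
      then obtain p q where "gpoly p" "gpoly q" "\<And>S T. a (S, T) = p (\<lambda>j. if j < d then (ts ! j) S else 0,
         \<lambda>j. if j < d then \<sigma> ((ts ! j) (smap T)) else 0)"
        "\<And>S T. b (S, T) = q (\<lambda>j. if j < d then (ts ! j) S else 0,
         \<lambda>j. if j < d then \<sigma> ((ts ! j) (smap T)) else 0)" by auto
      then show ?case by (intro exI[of _ "\<lambda>P. p P * q P"]) (auto intro: gpoly.gpoly_mult)
    qed
    then show ?thesis using that by blast
  qed
  have pr: "prime_in (laurent n) (van n U)" using irrU by (simp add: prime_van)
  have one: "1 \<in> alg C (lgens n)" "1 \<notin> van n U"
    using subring_1[OF alg_subring[OF C(1)]] prime_inD(2)[OF pr] by auto
  have lg: "lgens n \<subseteq> laurent n" using lgens_laurent by blast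
  \<comment> \<open>\<open>H\<close> describes the exceptional locus: prescribed values of
    \<open>ts\<close> for which \<open>H\<close> is nonzero are attained at a point of
    \<open>U\<close>.\<close>
  have "\<exists>H\<in>C. H \<notin> van n U \<and> (\<forall>\<phi> :: _ \<Rightarrow> 'a. hom_on C \<phi> \<and> (\<forall>a\<in>C. a \<in> van n U \<longrightarrow> \<phi> a = 0) \<and> \<phi> H \<noteq> 0 \<longrightarrow>
    (\<exists>\<psi>. hom_on (alg C (lgens n)) \<psi> \<and> (\<forall>a\<in>C. \<psi> a = \<phi> a) \<and> (\<forall>a\<in>alg C (lgens n). a \<in> van n U \<longrightarrow> \<psi> a = 0) \<and> \<psi> 1 \<noteq> 0))"
    by (rule finite_alg_hom_extension[OF _ subring_laurent pr C finite_lgens lg one]) (erule alg_closed)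
  then obtain H where H: "H \<in> C" "H \<notin> van n U"
    and ext: "\<And>\<phi> :: _ \<Rightarrow> 'a. hom_on C \<phi> \<and> (\<forall>a\<in>C. a \<in> van n U \<longrightarrow> \<phi> a = 0) \<and> \<phi> H \<noteq> 0 \<Longrightarrow>
    (\<exists>\<psi>. hom_on (alg C (lgens n)) \<psi> \<and> (\<forall>a\<in>C. \<psi> a = \<phi> a) \<and> (\<forall>a\<in>alg C (lgens n). a \<in> van n U \<longrightarrow> \<psi> a = 0) \<and> \<psi> 1 \<noteq> 0)"
    by blast
  obtain q where q: "gpoly q" "\<forall>s. H s = q (\<lambda>j. if j < d then (ts ! j) s else 0, \<lambda>_. 0)"
    "\<forall>\<phi> c. hom_on C \<phi> \<and> (\<forall>a. \<phi> (cst a) = a) \<and> (\<forall>j<d. \<phi> (ts ! j) = c j)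
      \<longrightarrow> \<phi> H = q (\<lambda>j. if j < d then c j else 0, \<lambda>_. 0)"
    using alg_as_gpoly[OF H(1)[unfolded C_def]] unfolding C_def d_def by (elim exE conjE)
  define p' q' where "p' P = p (\<lambda>j. if j < d then fst P j else 0, \<lambda>j. if j < d then snd P j else 0)"
    and "q' P = q (\<lambda>j. if j < d then fst P j else 0, \<lambda>_. 0)" for P
  have "gpoly p'" unfolding p'_def using gpoly_subst[OF p(1)] .
  have "gpoly (\<lambda>P. q (\<lambda>j. if j < d then fst P j else 0, \<lambda>j. if j < 0 then snd P j else 0))"
    using q(1) 
  proof induction
    case (gpoly_z j)
    then show ?case by (cases "j < d") (auto intro: gpoly.intros)
  qed (auto intro: gpoly.intros)
  then have "gpoly q'" unfolding q'_def by simp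
  obtain S0 T0 where S0: "S0 \<in> U" "T0 \<in> smap ` U" "h (S0, T0) \<noteq> 0"
    using h(1,2) A2 unfolding P_def pvan_def by blast
  obtain S1 where S1: "S1 \<in> U" "H S1 \<noteq> 0" using H C(2) unfolding van_def by blast
  have p0: "p' (\<lambda>j. (ts ! j) S0, \<lambda>j. \<sigma> ((ts ! j) (smap T0))) \<noteq> 0"
    using S0(3) p(2)[of S0 T0] by (simp add: p'_def cong: if_cong)
  have q0: "q' (\<lambda>j. (ts ! j) S1, \<lambda>_. 0) \<noteq> 0" using S1(2) q(2) by (simp add: q'_def cong: if_cong)
  \<comment> \<open>\<open>p'\<close> represents \<open>h\<close> and \<open>q'\<close> represents
    \<open>H\<close>; neither is identically zero, so their product is nonzero somewhere and hence
    at some conjugate pair.\<close>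
  obtain E where "p' E \<noteq> 0" "q' E \<noteq> 0"
    by (rule gpoly_common_nonzero[OF \<open>gpoly p'\<close> \<open>gpoly q'\<close> p0 q0]) (rule that)
  then have "p' E * q' E \<noteq> 0" by simp
  then obtain c where c: "p' (c, \<lambda>j. \<sigma> (c j)) * q' (c, \<lambda>j. \<sigma> (c j)) \<noteq> 0"
    by (rule gpoly_conj_nonzero[OF gpoly_mult[OF \<open>gpoly p'\<close> \<open>gpoly q'\<close>]]) (rule that)
  have "distinct ts"
    using indep_distinct[OF subring_cst _ _ ts(1)] one(2) ideal_inD(2)[OF ideal_van] by blast
  then have "\<exists>val. \<forall>j<d. val (ts ! j) = c j"
    unfolding d_def
    by (intro exI[of _ "\<lambda>t. c (SOME j. j < length ts \<and> ts ! j = t)"] allI impI)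
      (rule arg_cong[where f = c], rule some_equality, auto simp: nth_eq_iff_index_eq)
  then obtain val where val: "\<forall>j<d. val (ts ! j) = c j" by blast
  obtain \<phi> where \<phi>: "hom_on C \<phi>" "\<forall>a. \<phi> (cst a) = a" "\<forall>t\<in>set ts. \<phi> t = val t"
    "\<forall>f\<in>C. f \<in> van n U \<longrightarrow> \<phi> f = 0"
    using hom_of_indep[OF irrU ts(1,2), of val] unfolding C_def by (elim exE conjE)
  have \<phi>c: "\<forall>j<d. \<phi> (ts ! j) = c j" using \<phi>(3) val by (simp add: d_def)
  have "\<phi> H \<noteq> 0" using q(3) \<phi>(1,2) \<phi>c c by (simp add: q'_def cong: if_cong)
  then obtain \<psi> where \<psi>: "hom_on (alg C (lgens n)) \<psi>" "\<forall>a\<in>C. \<psi> a = \<phi> a"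
    "\<forall>a\<in>alg C (lgens n). a \<in> van n U \<longrightarrow> \<psi> a = 0"
    using ext[of \<phi>] \<phi>(1,4) by blast
  have KC: "range cst \<subseteq> C" unfolding C_def by (rule subsetI) (rule alg_base)
  have LC: "laurent n \<subseteq> alg C (lgens n)" unfolding laurent_def by (rule alg_mono[OF KC]) simp
  have hom: "hom_on (laurent n) \<psi>" using \<psi>(1) LC unfolding hom_on_def by blast
  have \<psi>c: "\<psi> (cst a) = a" for a using \<psi>(2) KC \<phi>(2) by (metis rangeI subsetD)
  have \<psi>U: "\<psi> f = 0" if "f \<in> laurent n" "f \<in> van n U" for f using \<psi>(3) LC that by blast
  have \<psi>v: "\<psi> f = 0" if "f \<in> van n (Gpts n)" for f
    using \<psi>U that van_antimono[OF UG, of n] unfolding van_def by blast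
  obtain S where S: "S \<in> Gpts n" "\<And>f. f \<in> laurent n \<Longrightarrow> \<psi> f = f S"
    by (rule laurent_hom_eval[OF hom \<psi>c]) (erule \<psi>v, rule that)
  have "S \<in> zeros n (van n U)"
    unfolding zeros_def using S(1) S(2)[symmetric] \<psi>U unfolding van_def by auto
  then have "S \<in> U" using zeros_van[OF U] by simp
  have tS: "(ts ! j) S = c j" if "j < d" for j
  proof -
    have "ts ! j \<in> set ts" using that by (simp add: d_def)
    moreover have "ts ! j \<in> C" unfolding C_def using calculation by (rule alg_gen)
    ultimately show ?thesis using S(2)[of "ts ! j"] \<psi>(2) \<phi>c that ts(2) by auto
  qed
  \<comment> \<open>The functions in the second block take conjugate values at the conjugate point,
    so \<open>h\<close> is evaluated exactly at the chosen conjugate pair.\<close>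
  have "h (S, smap S) = p' (c, \<lambda>j. \<sigma> (c j))"
    unfolding p(2) p'_def by (intro arg_cong[where f = p] prod_eqI ext) (auto simp: tS)
  then show False using hD[OF \<open>S \<in> U\<close>] c by simp
qed

lemma zmorph_lam: "R \<in> Gpts n \<Longrightarrow> zmorph n (2 * n) (\<lambda>Q. lam n Q R)" "Q \<in> Gpts n \<Longrightarrow> zmorph n (2 * n) (lam n Q)"
  and lam_in_Gpts: "Q \<in> Gpts n \<Longrightarrow> R \<in> Gpts n \<Longrightarrow> lam n Q R \<in> Gpts (2 * n)"
  and lam_pairring: "f \<in> laurent (2 * n) \<Longrightarrow> (\<lambda>p. f (lam n (fst p) (snd p))) \<in> pairring n"
proof -
  show G: "lam n Q R \<in> Gpts (2 * n)" if "Q \<in> Gpts n" "R \<in> Gpts n" for Q R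
    using Gpts_nz[OF that(1)] Gpts_nz[OF that(2)] by (simp add: Gpts_iff lam_def)
  show pr: "(\<lambda>p. f (lam n (fst p) (snd p))) \<in> pairring n" if "f \<in> laurent (2 * n)" for f
    using that
  proof (induction rule: laurent_induct)
    case (cst c)
    have "cst c \<in> pairring n" unfolding pairring_def by (intro alg_base) blast
    then show ?case by (simp add: cst_def)
  next
    case (zc j)
    show ?case
    proof (cases "j < n")
      case True
      from subring_add[OF subring_pairring pull_in_pairring(1)[OF laurent_zc[OF True]] pull_in_pairring(2)[OF laurent_zc[OF True]]]
      show ?thesis using True by (simp add: lam_def plus_fun_def pull_def)
    next
      case False
      then have j: "j - n < n" using zc by simp
      from subring_diff[OF subring_pairring pull_in_pairring(1)[OF laurent_zc[OF j]] pull_in_pairring(2)[OF laurent_zc[OF j]]]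
      show ?thesis using False zc by (simp add: lam_def fun_diff_def pull_def)
    qed
  next
    case (wc j)
    show ?case
    proof (cases "j < n")
      case True
      from subring_mult[OF subring_pairring pull_in_pairring(1)[OF laurent_wc[OF True]] pull_in_pairring(2)[OF laurent_wc[OF True]]]
      show ?thesis using True by (simp add: lam_def times_fun_def pull_def)
    next
      case False
      then have j: "j - n < n" using wc by simp
      from subring_mult[OF subring_pairring pull_in_pairring(1)[OF laurent_wc[OF j]] pull_in_pairring(2)[OF laurent_wi[OF j]]]
      show ?thesis using False wc by (simp add: lam_def times_fun_def pull_def)
    qed
  next
    case (wi j)
    show ?case
    proof (cases "j < n")
      case True
      from subring_mult[OF subring_pairring pull_in_pairring(1)[OF laurent_wi[OF True]] pull_in_pairring(2)[OF laurent_wi[OF True]]]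
      show ?thesis using True by (simp add: lam_def times_fun_def pull_def)
    next
      case False
      then have j: "j - n < n" using wi by simp
      from subring_mult[OF subring_pairring pull_in_pairring(1)[OF laurent_wi[OF j]] pull_in_pairring(2)[OF laurent_wc[OF j]]]
      show ?thesis using False wi by (simp add: lam_def times_fun_def pull_def)
    qed
  next
    case (add f g)
    then show ?case using subring_add[OF subring_pairring add(3,4)] by (simp add: plus_fun_def)
  next
    case (mult f g)
    then show ?case using subring_mult[OF subring_pairring mult(3,4)] by (simp add: times_fun_def)
  qed
  have sl: "(\<lambda>Q. f (lam n Q R)) \<in> laurent n" "(\<lambda>R. f (lam n Q R)) \<in> laurent n" if "f \<in> laurent (2 * n)" for f Q R
    using pairring_slices[OF pr[OF that], of R Q] by simp_all
  show "zmorph n (2 * n) (\<lambda>Q. lam n Q R)" if "R \<in> Gpts n"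
    unfolding morph_def by (intro morph_imp_zmorph[unfolded morph_def] conjI ballI image_subsetI G that sl)
  show "zmorph n (2 * n) (lam n Q)" if "Q \<in> Gpts n"
    unfolding morph_def by (intro morph_imp_zmorph[unfolded morph_def] conjI ballI image_subsetI G that sl)
qed

text \<open>Realisations of doubles form the image under \<open>lam n\<close> of the graph of
  conjugation. By \<open>graph_dense\<close> a function vanishing there vanishes on the image of all
  pairs, so both images have the same closure; irreducibility is then that of a product.\<close>

lemma restr_eq:
  assumes U: "gvariety n U"
  shows "restr \<sigma> ii n (gscale 2 ` U) = cl (2 * n) {lam n Q R |Q R. Q \<in> U \<and> R \<in> smap ` U}"
    and "gvariety (2 * n) (restr \<sigma> ii n (gscale 2 ` U))"
proof -
  define D where "D = {lam n Q R |Q R. Q \<in> U \<and> R \<in> smap ` U}"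
  have UG: "U \<subseteq> Gpts n" using U by (simp add: gvariety_iff)
  have SG: "smap ` U \<subseteq> Gpts n" using UG smap_in_Gpts by blast
  have DG: "D \<subseteq> Gpts (2 * n)" using UG SG lam_in_Gpts unfolding D_def by blast
  define \<Delta> where "\<Delta> = (\<lambda>Q. lam n Q (smap Q)) ` U"
  have "realis \<sigma> ii n ` gscale 2 ` U = \<Delta>"
    unfolding image_image \<Delta>_def using UG by (intro image_cong realis_gscale) auto
  then have r: "restr \<sigma> ii n (gscale 2 ` U) = cl (2 * n) \<Delta>" by (simp add: restr_def)
  have "\<Delta> \<subseteq> D" unfolding \<Delta>_def D_def by blast
  then have \<Delta>G: "\<Delta> \<subseteq> Gpts (2 * n)" using DG by blast
  have "D \<subseteq> cl (2 * n) \<Delta>"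
  proof
    fix x assume x: "x \<in> D"
    then obtain Q R where QR: "x = lam n Q R" "Q \<in> U" "R \<in> smap ` U" unfolding D_def by blast
    have "f x = 0" if f: "f \<in> laurent (2 * n)" "\<forall>q\<in>\<Delta>. f q = 0" for f
      using graph_dense[OF U lam_pairring[OF f(1)] _ QR(2,3)] f(2) QR(1) unfolding \<Delta>_def by simp
    then show "x \<in> cl (2 * n) \<Delta>" unfolding cl_iff[OF \<Delta>G] using x DG by blast
  qed
  then have "cl (2 * n) \<Delta> = cl (2 * n) D"
    using cl_least[OF _ \<Delta>G] cl_mono[OF \<open>\<Delta> \<subseteq> D\<close>] by blast
  then show eq: "restr \<sigma> ii n (gscale 2 ` U) = cl (2 * n) {lam n Q R |Q R. Q \<in> U \<and> R \<in> smap ` U}"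
    using r by (simp add: D_def)
  have "irr (2 * n) D"
    unfolding D_def
  proof (rule irr_bimorph)
    show "irr n U" "irr n (smap ` U)" using U gvariety_smap[OF U] by (auto simp: gvariety_iff)
    show "zmorph n (2 * n) (\<lambda>Q. lam n Q R)" if "R \<in> smap ` U" for R
      by (rule zmorph_lam(1)[OF subsetD[OF SG that]])
    show "zmorph n (2 * n) (lam n Q)" if "Q \<in> U" for Q
      by (rule zmorph_lam(2)[OF subsetD[OF UG that]])
  qed (fact UG SG)+
  then show "gvariety (2 * n) (restr \<sigma> ii n (gscale 2 ` U))"
    unfolding eq D_def[symmetric] by (rule gvariety_cl[OF DG])
qed

end

section \<open>Ranks and dimensions of sums\<close>

definition rows_indep :: "nat set \<Rightarrow> nat \<Rightarrow> (nat \<Rightarrow> nat \<Rightarrow> int) \<Rightarrow> bool" where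
  "rows_indep I n M \<longleftrightarrow> (\<forall>c::nat \<Rightarrow> int. (\<forall>j<n. (\<Sum>i\<in>I. c i * M i j) = 0) \<longrightarrow> (\<forall>i\<in>I. c i = 0))"

text \<open>Gaussian elimination of the last column by a pivot row \<open>p\<close>, carried out
  without division.\<close>

lemma rows_dependent:
  assumes "finite I" "card I > n"
  shows "\<not> rows_indep I n M"
  using assms
proof (induction n arbitrary: I M)
  case 0
  then have "I \<noteq> {}" by auto
  then show ?case unfolding rows_indep_def by (auto intro!: exI[of _ "\<lambda>_. 1"])
next
  case (Suc n)
  show ?case
  proof (cases "\<forall>i\<in>I. M i n = 0")
    case True
    obtain c k where c: "\<forall>j<n. (\<Sum>i\<in>I. c i * M i j) = 0" "k \<in> I" "c k \<noteq> 0"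
      using Suc.IH[of I M] Suc.prems unfolding rows_indep_def by auto
    have "\<forall>j<Suc n. (\<Sum>i\<in>I. c i * M i j) = 0" using c(1) True by (auto simp: less_Suc_eq)
    then show ?thesis using c(2,3) unfolding rows_indep_def by blast
  next
    case False
    then obtain p where p: "p \<in> I" "M p n \<noteq> 0" by blast
    define M' where "M' i j = M p n * M i j - M i n * M p j" for i j
    have "card (I - {p}) > n" using Suc.prems p by simp
    then obtain c k where c: "\<forall>j<n. (\<Sum>i\<in>I - {p}. c i * M' i j) = 0" "k \<in> I - {p}" "c k \<noteq> 0"
      using Suc.IH[of "I - {p}" M'] Suc.prems unfolding rows_indep_def by auto
    \<comment> \<open>The coefficient of the pivot row is chosen so that this combination of the
      original rows equals the given combination of the reduced rows.\<close>
    define d where "d i = (if i = p then - (\<Sum>i\<in>I - {p}. c i * M i n) else c i * M p n)" for i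
    have "(\<Sum>i\<in>I. d i * M i j) = (\<Sum>i\<in>I - {p}. c i * M' i j)" for j
    proof -
      have "(\<Sum>i\<in>I. d i * M i j) = d p * M p j + (\<Sum>i\<in>I - {p}. d i * M i j)"
        using Suc.prems p by (simp add: sum.remove)
      also have "(\<Sum>i\<in>I - {p}. d i * M i j) = (\<Sum>i\<in>I - {p}. c i * M p n * M i j)"
        by (intro sum.cong) (auto simp: d_def)
      also have "d p * M p j = - (\<Sum>i\<in>I - {p}. c i * M i n * M p j)"
        by (simp add: d_def sum_distrib_right)
      finally show ?thesis
        by (simp add: M'_def algebra_simps sum_subtractf)
    qed
    moreover have "M' i n = 0" for i by (simp add: M'_def)
    ultimately have "\<forall>j<Suc n. (\<Sum>i\<in>I. d i * M i j) = 0" using c(1) by (auto simp: less_Suc_eq)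
    moreover have "d k \<noteq> 0" "k \<in> I" using c(2,3) p by (auto simp: d_def)
    ultimately show ?thesis unfolding rows_indep_def by blast
  qed
qed

lemma rows_indep_card: "finite I \<Longrightarrow> rows_indep I n M \<Longrightarrow> card I \<le> n"
  using rows_dependent[of I n M] by force

lemma finite_indep_cards: "finite {card I |I. I \<subseteq> {..<k} \<and> rows_indep I n M}"
  by (rule finite_subset[of _ "{..k}"]) (auto dest: card_mono[OF finite_lessThan])

lemma mrank_eq: "mrank k n M = Max {card I |I. I \<subseteq> {..<k} \<and> rows_indep I n M}"
  by (simp add: mrank_def rows_indep_def)

lemma mrank_ge: "I \<subseteq> {..<k} \<Longrightarrow> rows_indep I n M \<Longrightarrow> card I \<le> mrank k n M"
  unfolding mrank_eq by (intro Max_ge finite_indep_cards) blast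

lemma mrank_attained:
  obtains I where "I \<subseteq> {..<k}" "rows_indep I n M" "card I = mrank k n M"
proof -
  have "rows_indep {} n M" by (simp add: rows_indep_def)
  then have "{card I |I. I \<subseteq> {..<k} \<and> rows_indep I n M} \<noteq> {}" by blast
  from Max_in[OF finite_indep_cards this] show ?thesis using that unfolding mrank_eq[symmetric] by auto
qed

lemma mrank_full_iff: "mrank p n M = p \<longleftrightarrow> rows_indep {..<p} n M"
proof
  assume p: "mrank p n M = p"
  obtain I where I: "I \<subseteq> {..<p}" "rows_indep I n M" "card I = mrank p n M" by (rule mrank_attained)
  then have "I = {..<p}" using p by (intro card_subset_eq) auto
  then show "rows_indep {..<p} n M" using I by simp
next
  assume M: "rows_indep {..<p} n M"
  obtain I where I: "I \<subseteq> {..<p}" "rows_indep I n M" "card I = mrank p n M" by (rule mrank_attained)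
  have "mrank p n M \<le> p" using card_mono[OF finite_lessThan I(1)] I(3) by simp
  then show "mrank p n M = p" using mrank_ge[OF order_refl M] by simp
qed

lemma mrank_le_cols: "mrank k n M \<le> n"
proof -
  obtain I where I: "I \<subseteq> {..<k}" "rows_indep I n M" "card I = mrank k n M" by (rule mrank_attained)
  then show ?thesis using rows_indep_card[OF finite_subset[OF I(1)] I(2)] by simp
qed

text \<open>A zero row cannot occur in an independent set, so every independent set lies in
  \<open>I\<close>.\<close>

lemma mrank_eq_card:
  assumes "I \<subseteq> {..<k}" "rows_indep I n M" "\<And>i j. i < k \<Longrightarrow> i \<notin> I \<Longrightarrow> j < n \<Longrightarrow> M i j = 0"
  shows "mrank k n M = card I"
proof (rule antisym[OF _ mrank_ge[OF assms(1,2)]])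
  obtain J where J: "J \<subseteq> {..<k}" "rows_indep J n M" "card J = mrank k n M" by (rule mrank_attained)
  have "J \<subseteq> I"
  proof
    fix i assume i: "i \<in> J"
    show "i \<in> I"
    proof (rule ccontr)
      assume "i \<notin> I"
      have "(\<Sum>t\<in>J. (if t = i then 1 else 0) * M t j) = 0" if "j < n" for j
        using assms(3)[OF _ \<open>i \<notin> I\<close> that] i J(1) by (intro sum.neutral) auto
      then show False
        using J(2)[unfolded rows_indep_def, THEN spec[of _ "\<lambda>t. if t = i then 1 else 0"]] i by auto
    qed
  qed
  then have "card J \<le> card I" using finite_subset[OF assms(1)] by (intro card_mono) auto
  then show "mrank k n M \<le> card I" using J(3) by simp
qed

text \<open>Each unit row depends on the \<open>n\<close> independent rows, so a multiple of it is
  an integer combination of them; the different multiples are then brought to one common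
  \<open>e\<close>.\<close>

lemma full_rank_left_inverse:
  assumes I: "I \<subseteq> {..<p}" "rows_indep I n C" "card I = n"
  obtains e E where "e > 0" "\<And>i j. i < n \<Longrightarrow> j < n \<Longrightarrow> (\<Sum>t<p. E i t * C t j) = (if i = j then int e else 0)"
proof -
  have fin: "finite I" using I(1) finite_subset by blast
  have pI: "p \<notin> I" using I(1) by auto
  have "\<exists>dc. fst dc \<noteq> 0 \<and> (\<forall>j<n. (\<Sum>i\<in>I. snd dc i * C i j) = (if l = j then fst dc else 0))" for l
  proof -
    define C' where "C' = C(p := (\<lambda>j. if l = j then 1 else 0))"
    have "\<not> rows_indep (insert p I) n C'"
      using fin pI I(3) by (intro rows_dependent) auto
    then obtain c k where c: "\<forall>j<n. (\<Sum>i\<in>insert p I. c i * C' i j) = 0" "k \<in> insert p I" "c k \<noteq> 0"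
      unfolding rows_indep_def by blast
    have split: "(\<Sum>i\<in>I. c i * C i j) = - (c p * (if l = j then 1 else 0))" if "j < n" for j
    proof -
      have "(\<Sum>i\<in>insert p I. c i * C' i j) = c p * C' p j + (\<Sum>i\<in>I. c i * C' i j)"
        using fin pI by simp
      also have "(\<Sum>i\<in>I. c i * C' i j) = (\<Sum>i\<in>I. c i * C i j)"
        using pI by (intro sum.cong) (auto simp: C'_def)
      finally have eq: "c p * C' p j + (\<Sum>i\<in>I. c i * C i j) = 0" using c(1)[rule_format, OF that] by linarith
      have "C' p j = (if l = j then 1 else 0)" by (simp add: C'_def)
      from eq[unfolded this] show ?thesis by (rule minus_unique[THEN sym])
    qed
    have "c p \<noteq> 0"
    proof
      assume "c p = 0"
      have "(\<Sum>i\<in>I. c i * C i j) = 0" if "j < n" for j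
        unfolding split[OF that] \<open>c p = 0\<close> by simp
      then have "\<forall>i\<in>I. c i = 0" using I(2) unfolding rows_indep_def by blast
      then show False using c(2,3) \<open>c p = 0\<close> by blast
    qed
    show ?thesis
    proof (intro exI[of _ "(- c p, c)"] conjI allI impI)
      show "(\<Sum>i\<in>I. snd (- c p, c) i * C i j) = (if l = j then fst (- c p, c) else 0)" if "j < n" for j
        unfolding snd_conv fst_conv split[OF that] by simp
    qed (use \<open>c p \<noteq> 0\<close> in simp)
  qed
  then have "\<forall>l. \<exists>dc. fst dc \<noteq> 0 \<and> (\<forall>j<n. (\<Sum>i\<in>I. snd dc i * C i j) = (if l = j then fst dc else 0))"
    by (rule allI)
  then obtain dc where "\<forall>l. fst (dc l) \<noteq> 0 \<and> (\<forall>j<n. (\<Sum>i\<in>I. snd (dc l) i * C i j) = (if l = j then fst (dc l) else 0))"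
    by (rule choice[THEN exE])
  then have dc: "\<And>l. fst (dc l) \<noteq> 0"
    "\<And>l j. j < n \<Longrightarrow> (\<Sum>i\<in>I. snd (dc l) i * C i j) = (if l = j then fst (dc l) else 0)" by blast+
  define d c where "d l = fst (dc l)" and "c l = snd (dc l)" for l
  note dc = dc[folded d_def c_def]
  define D where "D = (\<Prod>l<n. d l)"
  have "D \<noteq> 0" using dc(1) by (simp add: D_def)
  have "\<exists>m. D * D = m * d l" if "l < n" for l
  proof -
    have "d l dvd D" unfolding D_def using that by (intro dvd_prodI) auto
    then show ?thesis by (metis dvd_def dvd_mult mult.commute)
  qed
  then have "\<forall>l. \<exists>m. l < n \<longrightarrow> D * D = m * d l" by blast
  then obtain m where m: "\<And>l. l < n \<Longrightarrow> D * D = m l * d l" by (rule choice[THEN exE]) blast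
  \<comment> \<open>The product \<open>D\<close> of the denominators may be negative; its square is
    positive.\<close>
  define e where "e = nat (D * D)"
  have e: "int e = D * D" by (simp add: e_def)
  have "e > 0" using e \<open>D \<noteq> 0\<close> by (metis mult_eq_0_iff of_nat_0 gr0I)
  define E where "E l t = (if t \<in> I then m l * c l t else 0)" for l t
  have "(\<Sum>t<p. E l t * C t j) = (if l = j then int e else 0)" if "l < n" "j < n" for l j
  proof -
    have "(\<Sum>t<p. E l t * C t j) = (\<Sum>t\<in>I. m l * (c l t * C t j))"
      using I(1) by (intro sum.mono_neutral_cong_right) (auto simp: E_def algebra_simps)
    also have "\<dots> = m l * (if l = j then d l else 0)"
      using dc(2)[OF that(2)] by (simp flip: sum_distrib_left)
    finally show ?thesis using m[OF that(1)] e by simp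
  qed
  then show ?thesis using that \<open>e > 0\<close> by blast
qed

context alg_closed_field
begin

text \<open>What rotundity and simplicity say about images under matrices with any number of rows,
  counted by independent rows; the last clause says that full rank loses no dimension.\<close>

definition full_bounds :: "nat \<Rightarrow> 'a gpt set \<Rightarrow> bool" where
  "full_bounds n U \<longleftrightarrow> (\<forall>p C I. I \<subseteq> {..<p} \<and> rows_indep I n C \<longrightarrow>
     card I \<le> kdim (cl p (mact p n C ` U)) \<and>
     (0 < card I \<and> card I < n \<longrightarrow> card I < kdim (cl p (mact p n C ` U))) \<and>
     (card I = n \<longrightarrow> kdim U \<le> kdim (cl p (mact p n C ` U))))"

section \<open>Dimensions of images under integer matrices\<close>

lemma gscale_1: "gscale 1 P = P"
  by (simp add: gscale_def)

text \<open>Lets \<open>U\<close> stand in for the variety of its doubles: matrices commute with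
  doubling, and doubling preserves dimension.\<close>

lemma kdim_mact_gscale:
  fixes U :: "'a gpt set"
  assumes U: "gvariety n U"
  shows "kdim (cl k (mact k n C ` gscale 2 ` U)) = kdim (cl k (mact k n C ` U))"
proof -
  note ma = morph_imp_zmorph[OF morph_mact]
  have UG: "U \<subseteq> Gpts n" using U by (simp add: gvariety_iff)
  have gv: "gvariety k (cl k (mact k n C ` U))" by (rule gvariety_image[OF U ma])
  have "mact k n C ` gscale 2 ` U = gscale 2 ` mact k n C ` U"
    unfolding image_image by (intro image_cong refl mact_gscale)
  moreover have "cl k (gscale 2 ` cl k (mact k n C ` U)) = cl k (gscale 2 ` mact k n C ` U)"
    by (intro cl_image_cl zmorph_Gpts[OF ma UG] morph_imp_zmorph[OF morph_gscale])
  ultimately show ?thesis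
    using kdim_image_le[OF gv morph_gscale, of 2] kdim_gscale[OF gv, of 2] by simp
qed

text \<open>A selection matrix moves the chosen rows to the top, and the rest is padded with zero
  rows. The result may be read with any number \<open>k\<close> of rows, in particular as a square
  matrix.\<close>

lemma select_rows:
  fixes U :: "'a gpt set"
  assumes U: "gvariety n U" and I: "I \<subseteq> {..<p}" "rows_indep I n C"
  obtains C' where "rows_indep {..<card I} n C'" "\<forall>i\<ge>card I. \<forall>j. C' i j = 0"
    "\<forall>k. kdim (cl k (mact k n C' ` U)) \<le> kdim (cl p (mact p n C ` U))"
proof -
  have fin: "finite I" using I(1) finite_subset by blast
  define k where "k = card I"
  obtain h where h: "bij_betw h {..<k} I"
    using ex_bij_betw_nat_finite[OF fin] by (auto simp: k_def atLeast0LessThan)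
  define C' where "C' i j = (if i < k then C (h i) j else 0)" for i j
  have ind: "rows_indep {..<k} n C'"
    unfolding rows_indep_def
  proof (intro allI impI ballI)
    fix c i assume c: "\<forall>j<n. (\<Sum>i<k. c i * C' i j) = 0" and i: "i \<in> {..<k}"
    define g where "g = the_inv_into {..<k} h"
    have gh: "g (h l) = l" if "l < k" for l
      using h that unfolding g_def by (auto simp: bij_betw_def intro!: the_inv_into_f_f)
    have "(\<Sum>i\<in>I. c (g i) * C i j) = (\<Sum>l<k. c l * C' l j)" for j
      using gh by (subst sum.reindex_bij_betw[OF h, symmetric]) (auto simp: C'_def intro!: sum.cong)
    then have "\<forall>i\<in>I. c (g i) = 0" using I(2) c unfolding rows_indep_def by (auto dest: spec[of _ "\<lambda>i. c (g i)"])
    then show "c i = 0" using gh[of i] i h by (metis bij_betw_apply lessThan_iff)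
  qed
  have le: "kdim (cl l (mact l n C' ` U)) \<le> kdim (cl p (mact p n C ` U))" for l
  proof (rule kdim_mact_le[OF U, of 1])
    define E where "E i t = (if i < k \<and> t = h i then 1 else 0 :: int)" for i t
    have "(\<Sum>t<p. E i t * C t j) = C' i j" for i j
    proof (cases "i < k")
      case True
      then have "h i < p" using h I(1) by (auto simp: bij_betw_def)
      have "(\<Sum>t<p. E i t * C t j) = (\<Sum>t<p. if t = h i then C t j else 0)"
        using True by (intro sum.cong) (auto simp: E_def)
      then show ?thesis using True \<open>h i < p\<close> by (simp add: C'_def)
    qed (simp add: E_def C'_def)
    moreover fix u assume "u \<in> U"
    then have "u \<in> Gpts n" using U by (auto simp: gvariety_iff)
    ultimately show "gscale 1 (mact l n C' u) = mact l p E (mact p n C u)"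
      unfolding gscale_1 by (simp add: mact_mact)
  qed simp
  show ?thesis
    using ind le by (intro that[of C']) (auto simp: k_def C'_def)
qed

text \<open>Rotundity and simplicity speak of square matrices, to which \<open>select_rows\<close>
  pads. For full rank, a left inverse up to a factor recovers \<open>U\<close> from its
  image.\<close>

lemma full_bounds_half:
  fixes U :: "'a gpt set"
  assumes U: "gvariety n U" and V: "rotund n (gscale 2 ` U)" "simple_var n (gscale 2 ` U)"
  shows "full_bounds n U"
  unfolding full_bounds_def
proof (intro allI impI)
  fix p C I assume "I \<subseteq> {..<p} \<and> rows_indep I n C"
  then have I: "I \<subseteq> {..<p}" "rows_indep I n C" by auto
  have fin: "finite I" using I(1) finite_subset by blast
  define k where "k = card I"
  have kn: "k \<le> n" unfolding k_def by (rule rows_indep_card[OF fin I(2)])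
  obtain C' where C': "rows_indep {..<k} n C'" "\<forall>i\<ge>k. \<forall>j. C' i j = 0"
    "\<forall>l. kdim (cl l (mact l n C' ` U)) \<le> kdim (cl p (mact p n C ` U))"
    unfolding k_def by (rule select_rows[OF U I])
  have rk: "mrank n n C' = k"
    using mrank_eq_card[of "{..<k}" n n C'] kn C'(1,2) by simp
  have "kdim (cl n (mact n n C' ` U)) \<le> kdim (cl p (mact p n C ` U))" using C'(3) by blast
  moreover have "kdim (mimg n n C' (gscale 2 ` U)) = kdim (cl n (mact n n C' ` U))"
    unfolding mimg_def by (rule kdim_mact_gscale[OF U])
  moreover have "k \<le> kdim (mimg n n C' (gscale 2 ` U))"
    using V(1)[unfolded rotund_def, THEN spec[of _ C']] unfolding rk .
  moreover have "k < kdim (mimg n n C' (gscale 2 ` U))" if "0 < k" "k < n"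
    using V(2)[unfolded simple_var_def, THEN conjunct2, THEN conjunct2, THEN spec[of _ C']] that unfolding rk by blast
  moreover have "kdim U \<le> kdim (cl p (mact p n C ` U))" if "k = n"
  proof -
    have cI: "card I = n" using that by (simp add: k_def)
    obtain e E where e: "e > 0" "\<And>i j. i < n \<Longrightarrow> j < n \<Longrightarrow> (\<Sum>t<p. E i t * C t j) = (if i = j then int e else 0)"
      using full_rank_left_inverse[OF I cI] by blast
    have UG: "U \<subseteq> Gpts n" using U by (simp add: gvariety_iff)
    define J where "J = (\<lambda>i j::nat. if i = j then 1 else 0 :: int)"
    have id: "mact n n J u = u" if "u \<in> Gpts n" for u :: "'a gpt"
      using gscale_eq_mact[OF that, of 1] unfolding gscale_1 J_def of_nat_1 by simp
    have "kdim (cl n (mact n n J ` U)) \<le> kdim (cl p (mact p n C ` U))"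
    proof (rule kdim_mact_le[OF U e(1)])
      fix u assume "u \<in> U"
      then have u: "u \<in> Gpts n" using UG by blast
      show "gscale e (mact n n J u) = mact n p E (mact p n C u)"
        unfolding id[OF u] gscale_eq_mact[OF u] mact_mact[OF u] by (rule mact_cong) (simp add: e(2))
    qed
    moreover have "mact n n J ` U = U" using id UG by force
    moreover have "cl n U = U" using U by (simp add: gvariety_iff)
    ultimately show ?thesis by simp
  qed
  ultimately show "card I \<le> kdim (cl p (mact p n C ` U)) \<and>
     (0 < card I \<and> card I < n \<longrightarrow> card I < kdim (cl p (mact p n C ` U))) \<and>
     (card I = n \<longrightarrow> kdim U \<le> kdim (cl p (mact p n C ` U)))"
    unfolding k_def by linarith
qed

section \<open>Sums of two matrix images\<close>

definition msum :: "nat \<Rightarrow> nat \<Rightarrow> (nat \<Rightarrow> nat \<Rightarrow> int) \<Rightarrow> (nat \<Rightarrow> nat \<Rightarrow> int) \<Rightarrow> 'a gpt set \<Rightarrow> 'a gpt set \<Rightarrow> 'a gpt set" where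
  "msum p n A B X Y = {gadd (mact p n A Q) (mact p n B R) |Q R. Q \<in> X \<and> R \<in> Y}"

lemma msum_commute: "msum p n A B X Y = msum p n B A Y X"
proof -
  have "msum p n A B X Y \<subseteq> msum p n B A Y X" for A B X Y
  proof
    fix P assume "P \<in> msum p n A B X Y"
    then obtain Q R where "Q \<in> X" "R \<in> Y" "P = gadd (mact p n B R) (mact p n A Q)"
      unfolding msum_def by (auto simp: gadd_commute)
    then show "P \<in> msum p n B A Y X" unfolding msum_def by blast
  qed
  then show ?thesis by (intro subset_antisym)
qed

lemma zmorph_gadd_mact:
  assumes "b \<in> Gpts p"
  shows "zmorph n p (\<lambda>Q. gadd b (mact p n A Q))"
  by (rule zmorph_comp[OF morph_imp_zmorph[OF morph_mact] morph_imp_zmorph[OF morph_gadd[OF assms]]])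

lemma msum_variety:
  fixes X Y :: "'a gpt set"
  assumes X: "gvariety n X" and Y: "gvariety n Y"
  shows "msum p n A B X Y \<subseteq> Gpts p" "gvariety p (cl p (msum p n A B X Y))"
proof -
  have XG: "X \<subseteq> Gpts n" "irr n X" and YG: "Y \<subseteq> Gpts n" "irr n Y" using X Y by (auto simp: gvariety_iff)
  show sub: "msum p n A B X Y \<subseteq> Gpts p"
    unfolding msum_def using XG YG gadd_in_Gpts mact_in_Gpts by blast
  have "irr p (msum p n A B X Y)"
    unfolding msum_def
  proof (rule irr_bimorph[OF XG(2,1) YG(2,1)])
    fix R assume "R \<in> Y"
    then have "mact p n B R \<in> Gpts p" using YG mact_in_Gpts by blast
    from zmorph_gadd_mact[OF this] show "zmorph n p (\<lambda>Q. gadd (mact p n A Q) (mact p n B R))"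
      by (simp add: gadd_commute)
  next
    fix Q assume "Q \<in> X"
    then have "mact p n A Q \<in> Gpts p" using XG mact_in_Gpts by blast
    from zmorph_gadd_mact[OF this] show "zmorph n p (\<lambda>R. gadd (mact p n A Q) (mact p n B R))" .
  qed
  then show "gvariety p (cl p (msum p n A B X Y))" by (rule gvariety_cl[OF sub])
qed

lemma gvariety_translate:
  fixes X :: "'a gpt set"
  assumes "gvariety p X" "b \<in> Gpts p"
  shows "gvariety p (gadd b ` X)"
  using assms(1)
proof (rule gvariety_iso_image)
  show "zmorph p p (gadd b)" by (rule morph_imp_zmorph[OF morph_gadd[OF assms(2)]])
  show "zmorph p p (gadd (ginv b))" by (rule morph_imp_zmorph[OF morph_gadd[OF ginv_in_Gpts[OF assms(2)]]])
qed (simp_all add: gadd_ginv[OF assms(2)])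

lemma vchain_translate:
  fixes c :: "nat \<Rightarrow> 'a gpt set"
  assumes "vchain p c k" "b \<in> Gpts p"
  shows "vchain p (\<lambda>l. gadd b ` c l) k"
  using assms(1)
proof (rule vchain_iso_image)
  show "zmorph p p (gadd b)" by (rule morph_imp_zmorph[OF morph_gadd[OF assms(2)]])
  show "zmorph p p (gadd (ginv b))" by (rule morph_imp_zmorph[OF morph_gadd[OF ginv_in_Gpts[OF assms(2)]]])
qed (simp_all add: gadd_ginv[OF assms(2)])

lemma kdim_translate:
  fixes X :: "'a gpt set"
  assumes X: "gvariety p X" and b: "b \<in> Gpts p"
  shows "kdim (gadd b ` X) = kdim X"
proof -
  have ge: "kdim Y \<le> kdim (gadd a ` Y)" if Y: "gvariety p Y" and a: "a \<in> Gpts p" for Y :: "'a gpt set" and a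
  proof -
    obtain c where c: "vchain p c (kdim Y)" "c (kdim Y) \<subseteq> Y" using kdim_chain[OF Y] by blast
    have "zclosed_in (Gpts p) (gadd a ` Y)" using gvariety_translate[OF Y a] by (simp add: gvariety_def)
    then show ?thesis using c(2) by (intro kdim_ge[OF _ vchain_translate[OF c(1) a]] image_mono)
  qed
  have "gadd (ginv b) ` gadd b ` X = X"
    unfolding image_image gadd_ginv(1)[OF b] by simp
  then show ?thesis
    using ge[OF X b] ge[OF gvariety_translate[OF X b] ginv_in_Gpts[OF b]] by simp
qed

text \<open>The chain for \<^term>\<open>B\<close> lifts to a chain of subvarieties of the second factor; below its smallest
  member sits a translate of the chain for \<^term>\<open>A\<close>.\<close>

lemma kdim_msum_ge:
  fixes X Y :: "'a gpt set"
  assumes X: "gvariety n X" and Y: "gvariety n Y"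
    and J: "\<And>i j. i \<in> J \<Longrightarrow> j < n \<Longrightarrow> A i j = 0"
  shows "kdim (cl p (mact p n A ` X)) + kdim (cl p (mact p n (\<lambda>i j. if i \<in> J then B i j else 0) ` Y))
    \<le> kdim (cl p (msum p n A B X Y))"
proof -
  define B' where "B' = (\<lambda>i j. if i \<in> J then B i j else 0)"
  define k where "k = kdim (cl p (mact p n B' ` Y))"
  define l where "l = kdim (cl p (mact p n A ` X))"
  \<comment> \<open>Projection to the rows in \<open>J\<close>, where \<open>A\<close> is zero; it
    forgets the first summand.\<close>
  define \<pi> :: "'a gpt \<Rightarrow> 'a gpt" where "\<pi> = mact p p (\<lambda>i j. if i = j \<and> i \<in> J then 1 else 0 :: int) "
  have XG: "X \<subseteq> Gpts n" "X \<noteq> {}" and YG: "Y \<subseteq> Gpts n" using X Y by (auto simp: gvariety_iff irr_def)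
  have pi: "\<pi> (gadd (mact p n A Q) (mact p n B R)) = mact p n B' R" if "Q \<in> Gpts n" "R \<in> Gpts n" for Q R
  proof -
    have e: "(\<Sum>t<p. (if i = t \<and> i \<in> J then 1 else 0) * M t j) = (if i \<in> J then M i j else 0)"
      if "i < p" for i j and M :: "nat \<Rightarrow> nat \<Rightarrow> int"
    proof -
      have "(\<Sum>t<p. (if i = t \<and> i \<in> J then 1 else 0) * M t j) = (\<Sum>t<p. if t = i then (if i \<in> J then M i j else 0) else 0)"
        by (intro sum.cong) auto
      then show ?thesis using that by simp
    qed
    have "\<pi> (mact p n A Q) = mact p n (\<lambda>_ _. 0) Q"
      unfolding \<pi>_def mact_mact[OF that(1)] by (rule mact_cong) (use J in \<open>simp add: e\<close>)
    moreover have "\<pi> (mact p n B R) = mact p n B' R"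
      unfolding \<pi>_def mact_mact[OF that(2)] by (rule mact_cong) (simp add: e B'_def)
    moreover have "gadd (mact p n (\<lambda>_ _. 0) Q) P = P" for P
      by (rule gpt_eqI) (auto simp: gadd_def mact_def)
    ultimately show ?thesis unfolding \<pi>_def mact_gadd by simp
  qed
  obtain c where c: "vchain n c k" "c k = Y" and
    sep: "\<And>l. l < k \<Longrightarrow> \<exists>f\<in>laurent p. (\<forall>q\<in>c l. f (mact p n B' q) = 0) \<and> (\<exists>q\<in>c (Suc l). f (mact p n B' q) \<noteq> 0)"
    unfolding k_def
  proof (rule vchain_over_image[OF Y morph_mact[of n p B']], goal_cases)
    case (1 c)
    show ?case by (rule 1(1)[of c, OF 1(2,3)]) (rule 1(4))
  qed
  have gvc: "gvariety n (c m)" if "m \<le> k" for m using c(1) that by (simp add: vchain_def)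
  have cG: "c m \<subseteq> Gpts n" if "m \<le> k" for m using gvc[OF that] by (simp add: gvariety_iff)
  define Z where "Z m = cl p (msum p n A B X (c m))" for m
  have Z: "gvariety p (Z m)" if "m \<le> k" for m unfolding Z_def by (rule msum_variety(2)[OF X gvc[OF that]])
  \<comment> \<open>A function separating two members of the lifted chain depends only on the rows
    of \<open>B'\<close>, so after composition with \<open>\<pi>\<close> it separates the
    corresponding sums.\<close>
  have Zstep: "Z m \<subset> Z (Suc m)" if m: "m < k" for m
  proof -
    obtain f where f: "f \<in> laurent p" "\<forall>q\<in>c m. f (mact p n B' q) = 0" "\<exists>q\<in>c (Suc m). f (mact p n B' q) \<noteq> 0"
      using sep[OF m] by blast
    define g where "g = (\<lambda>P. f (\<pi> P))"
    have gL: "g \<in> laurent p" using morph_mact[of p p] f(1) unfolding g_def \<pi>_def morph_def by blast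
    have gv: "g (gadd (mact p n A Q) (mact p n B R)) = f (mact p n B' R)" if "Q \<in> X" "R \<in> Gpts n" for Q R
      unfolding g_def using pi[of Q R] XG that by auto
    have "g P = 0" if "P \<in> msum p n A B X (c m)" for P
      using that gv f(2) cG[of m] m unfolding msum_def by fastforce
    then have "\<forall>P\<in>Z m. g P = 0"
      unfolding Z_def using m by (subst cl_vanish[OF msum_variety(1)[OF X gvc] gL]) auto
    moreover have "\<not> (\<forall>P\<in>Z (Suc m). g P = 0)"
    proof -
      obtain R where R: "R \<in> c (Suc m)" "f (mact p n B' R) \<noteq> 0" using f(3) by blast
      obtain Q where Q: "Q \<in> X" using XG by blast
      have "gadd (mact p n A Q) (mact p n B R) \<in> msum p n A B X (c (Suc m))"
        using Q R unfolding msum_def by blast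
      moreover have "R \<in> Gpts n" using R(1) cG[of "Suc m"] m by auto
      then have "g (gadd (mact p n A Q) (mact p n B R)) \<noteq> 0" using gv[OF Q] R(2) by metis
      ultimately show ?thesis
        unfolding Z_def using m by (subst cl_vanish[OF msum_variety(1)[OF X gvc] gL]) auto
    qed
    moreover have "c m \<subseteq> c (Suc m)" using c(1) m unfolding vchain_def by blast
    then have "Z m \<subseteq> Z (Suc m)" unfolding Z_def msum_def by (intro cl_mono) blast
    ultimately show ?thesis by blast
  qed
  obtain R0 where R0: "R0 \<in> c 0" using gvc[of 0] by (auto simp: gvariety_iff irr_def)
  define b where "b = mact p n B R0"
  have b: "b \<in> Gpts p" unfolding b_def using R0 cG[of 0] by (intro mact_in_Gpts) auto
  have gvA: "gvariety p (cl p (mact p n A ` X))" by (rule gvariety_image[OF X morph_imp_zmorph[OF morph_mact]])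
  obtain d where d: "vchain p d l" "d l \<subseteq> cl p (mact p n A ` X)"
    unfolding l_def
  proof (rule kdim_chain[OF gvA], goal_cases)
    case (1 d)
    show ?case by (rule 1(1)[of d, OF 1(2,3)])
  qed
  have dt: "vchain p (\<lambda>m. gadd b ` d m) l" by (rule vchain_translate[OF d(1) b])
  have "gadd b ` d l \<subseteq> gadd b ` cl p (mact p n A ` X)" using d(2) by (rule image_mono)
  also have "\<dots> \<subseteq> cl p (gadd b ` mact p n A ` X)"
    by (rule zmorph_cl_subset[OF zmorph_Gpts[OF morph_imp_zmorph[OF morph_mact] XG(1)] morph_imp_zmorph[OF morph_gadd[OF b]]])
  also have "\<dots> \<subseteq> Z 0"
    unfolding Z_def
  proof (rule cl_mono)
    show "gadd b ` mact p n A ` X \<subseteq> msum p n A B X (c 0)"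
    proof
      fix P assume "P \<in> gadd b ` mact p n A ` X"
      then obtain Q where "Q \<in> X" "P = gadd (mact p n A Q) (mact p n B R0)"
        unfolding b_def by (auto simp: gadd_commute)
      then show "P \<in> msum p n A B X (c 0)" using R0 unfolding msum_def by blast
    qed
  qed
  finally have base: "gadd b ` d l \<subseteq> Z 0" .
  \<comment> \<open>The chains are joined at \<open>l\<close>. \<open>Z 0\<close> is skipped: it may
    equal the translate below it, and the strict inclusion of \<open>Z 0\<close> in
    \<open>Z 1\<close> is what makes this step strict.\<close>
  define e where "e m = (if m \<le> l then gadd b ` d m else Z (m - l))" for m
  have "vchain p e (l + k)"
    unfolding vchain_def
  proof (intro conjI allI impI)
    fix m assume m: "m \<le> l + k"
    show "gvariety p (e m)"
    proof (cases "m \<le> l")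
      case True
      then show ?thesis using dt unfolding vchain_def e_def by simp
    next
      case False
      then show ?thesis using Z[of "m - l"] m unfolding e_def by simp
    qed
  next
    fix m assume m: "m < l + k"
    consider "m < l" | "m = l" | "m > l" by linarith
    then show "e m \<subset> e (Suc m)"
    proof cases
      case 1
      then show ?thesis using dt unfolding vchain_def e_def by simp
    next
      case 2
      then show ?thesis using base Zstep[of 0] m unfolding e_def by auto
    next
      case 3
      then have "Suc m - l = Suc (m - l)" "m - l < k" using m by auto
      then show ?thesis using Zstep[of "m - l"] 3 unfolding e_def by simp
    qed
  qed
  moreover have "e (l + k) \<subseteq> cl p (msum p n A B X Y)"
  proof (cases "k = 0")
    case True
    then show ?thesis using base c(2) unfolding e_def Z_def by simp
  next
    case False
    then show ?thesis using c(2) unfolding e_def Z_def by simp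
  qed
  ultimately have "l + k \<le> kdim (cl p (msum p n A B X Y))" by (intro kdim_ge[OF zclosed_in_cl])
  then show ?thesis unfolding l_def k_def B'_def .
qed

text \<open>Row operations \<open>E\<close> keep the independent rows \<open>I\<close> of
  \<open>A\<close> and make all its other rows zero. By joint independence the transformed rows of
  \<open>B\<close> outside \<open>I\<close> are independent, so \<open>kdim_msum_ge\<close>
  distributes the \<open>p\<close> rows over the two factors.\<close>

lemma msum_rank_bound:
  fixes X Y :: "'a gpt set"
  assumes X: "gvariety n X" and Y: "gvariety n Y"
    and ind: "\<And>c. (\<And>j. j < n \<Longrightarrow> (\<Sum>i<p. c i * A i j) = 0) \<Longrightarrow> (\<And>j. j < n \<Longrightarrow> (\<Sum>i<p. c i * B i j) = 0)
      \<Longrightarrow> \<forall>i<p. c i = (0::int)"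
  shows "\<exists>I A' B'. I \<subseteq> {..<p} \<and> card I = mrank p n A \<and> rows_indep I n A' \<and> rows_indep ({..<p} - I) n B' \<and>
     kdim (cl p (mact p n A' ` X)) + kdim (cl p (mact p n B' ` Y)) \<le> kdim (cl p (msum p n A B X Y))"
proof -
  obtain I where I: "I \<subseteq> {..<p}" "rows_indep I n A" "card I = mrank p n A" by (rule mrank_attained)
  have fin: "finite I" using I(1) finite_subset by blast
  have "\<exists>c. c i \<noteq> 0 \<and> (\<forall>t. t \<notin> insert i I \<longrightarrow> c t = 0) \<and> (\<forall>j<n. (\<Sum>t<p. c t * A t j) = 0)"
    if i: "i < p" "i \<notin> I" for i
  proof -
    have sub: "insert i I \<subseteq> {..<p}" using i I(1) by auto
    have "\<not> rows_indep (insert i I) n A"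
      using mrank_ge[OF sub, of n A] I(3) fin i by auto
    then obtain c k where c: "\<forall>j<n. (\<Sum>t\<in>insert i I. c t * A t j) = 0" "k \<in> insert i I" "c k \<noteq> 0"
      unfolding rows_indep_def by blast
    have "c i \<noteq> 0"
    proof
      assume "c i = 0"
      then have "\<forall>j<n. (\<Sum>t\<in>I. c t * A t j) = 0" using c(1) fin i by simp
      then have "\<forall>t\<in>I. c t = 0" using I(2) unfolding rows_indep_def by blast
      then show False using c(2,3) \<open>c i = 0\<close> by auto
    qed
    define c' where "c' t = (if t \<in> insert i I then c t else 0)" for t
    have "(\<Sum>t<p. c' t * A t j) = (\<Sum>t\<in>insert i I. c t * A t j)" for j
      using sub by (intro sum.mono_neutral_cong_right) (auto simp: c'_def)
    then show ?thesis using c(1) \<open>c i \<noteq> 0\<close> by (intro exI[of _ c']) (auto simp: c'_def)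
  qed
  then have "\<forall>i. \<exists>c. i < p \<and> i \<notin> I \<longrightarrow>
      c i \<noteq> 0 \<and> (\<forall>t. t \<notin> insert i I \<longrightarrow> c t = 0) \<and> (\<forall>j<n. (\<Sum>t<p. c t * A t j) = 0)" by blast
  then obtain c where "\<forall>i. i < p \<and> i \<notin> I \<longrightarrow>
      c i i \<noteq> 0 \<and> (\<forall>t. t \<notin> insert i I \<longrightarrow> c i t = 0) \<and> (\<forall>j<n. (\<Sum>t<p. c i t * A t j) = 0)"
    by (rule choice[THEN exE])
  then have c: "\<And>i. i < p \<Longrightarrow> i \<notin> I \<Longrightarrow> c i i \<noteq> 0"
    "\<And>i t. i < p \<Longrightarrow> i \<notin> I \<Longrightarrow> t \<notin> insert i I \<Longrightarrow> c i t = 0"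
    "\<And>i j. i < p \<Longrightarrow> i \<notin> I \<Longrightarrow> j < n \<Longrightarrow> (\<Sum>t<p. c i t * A t j) = 0" by blast+
  \<comment> \<open>A row \<open>i\<close> outside \<open>I\<close> is replaced by its dependency
    \<open>c i\<close> on the rows in \<open>I\<close>, in which \<open>i\<close> has a nonzero
    coefficient.\<close>
  define E where "E i t = (if i \<in> I then (if t = i then 1 else 0) else c i t)" for i t
  define A' B' where "A' = (\<lambda>i j. \<Sum>t<p. E i t * A t j)" and "B' = (\<lambda>i j. \<Sum>t<p. E i t * B t j)"
  define J where "J = {..<p} - I"
  define B'' where "B'' = (\<lambda>i j. if i \<in> J then B' i j else 0)"
  have EI: "A' i j = A i j" if "i \<in> I" for i j
  proof -
    have "A' i j = (\<Sum>t<p. if t = i then A t j else 0)" unfolding A'_def E_def using that by (intro sum.cong) auto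
    then show ?thesis using that I(1) by auto
  qed
  then have "rows_indep I n A'" using I(2) unfolding rows_indep_def by simp
  have A'J: "A' i j = 0" if "i \<in> J" "j < n" for i j
    using c(3)[of i j] that unfolding A'_def E_def J_def by simp
  have "rows_indep J n B''"
    unfolding rows_indep_def
  proof (intro allI impI ballI)
    fix x i assume x: "\<forall>j<n. (\<Sum>i\<in>J. x i * B'' i j) = 0" and i: "i \<in> J"
    \<comment> \<open>The coefficients of the relation in terms of the original rows. The
      combination annihilates \<open>A\<close> as well as \<open>B\<close>, so it is
      trivial.\<close>
    define y where "y t = (\<Sum>i\<in>J. x i * E i t)" for t
    have comb: "(\<Sum>t<p. y t * M t j) = (\<Sum>i\<in>J. x i * (\<Sum>t<p. E i t * M t j))" for M and j :: nat
      unfolding y_def sum_distrib_left sum_distrib_right by (subst sum.swap) (simp add: mult.assoc)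
    have "(\<Sum>t<p. y t * A t j) = 0" if "j < n" for j
      unfolding comb using A'J[OF _ that] unfolding A'_def by (intro sum.neutral) simp
    moreover have "(\<Sum>t<p. y t * B t j) = 0" if "j < n" for j
    proof -
      have "(\<Sum>i\<in>J. x i * (\<Sum>t<p. E i t * B t j)) = (\<Sum>i\<in>J. x i * B'' i j)"
        by (intro sum.cong) (auto simp: B''_def B'_def)
      then show ?thesis unfolding comb using x that by simp
    qed
    ultimately have "y i = 0" using ind i unfolding J_def by blast
    moreover have "y i = (\<Sum>l\<in>J. if l = i then x i * c i i else 0)"
      unfolding y_def using i c(2) by (intro sum.cong) (auto simp: E_def J_def)
    ultimately have "x i * c i i = 0" using i by (simp add: J_def)
    then show "x i = 0" using c(1) i by (auto simp: J_def)
  qed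
  note ma = morph_imp_zmorph[OF morph_mact]
  have img: "mact p p E ` msum p n A B X Y = msum p n A' B' X Y"
  proof -
    have *: "mact p p E (gadd (mact p n A Q) (mact p n B R)) = gadd (mact p n A' Q) (mact p n B' R)"
      if "Q \<in> X" "R \<in> Y" for Q R
    proof -
      have "Q \<in> Gpts n" "R \<in> Gpts n" using that X Y by (auto simp: gvariety_iff)
      then show ?thesis by (simp add: mact_gadd mact_mact A'_def B'_def)
    qed
    show ?thesis
    proof
      show "mact p p E ` msum p n A B X Y \<subseteq> msum p n A' B' X Y"
        unfolding msum_def using * by blast
      show "msum p n A' B' X Y \<subseteq> mact p p E ` msum p n A B X Y"
        unfolding msum_def using *[symmetric] by blast
    qed
  qed
  have "kdim (cl p (mact p n A' ` X)) + kdim (cl p (mact p n B'' ` Y)) \<le> kdim (cl p (msum p n A' B' X Y))"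
    unfolding B''_def by (rule kdim_msum_ge[OF X Y A'J])
  also have "\<dots> = kdim (cl p (mact p p E ` cl p (msum p n A B X Y)))"
    unfolding img[symmetric] by (subst cl_image_cl[OF msum_variety(1)[OF X Y] ma]) simp
  also have "\<dots> \<le> kdim (cl p (msum p n A B X Y))"
    by (rule kdim_image_le[OF msum_variety(2)[OF X Y] morph_mact])
  finally show ?thesis
    using I(1,3) \<open>rows_indep I n A'\<close> \<open>rows_indep J n B''\<close> unfolding J_def by blast
qed

text \<open>With \<open>a\<close> the rank of \<open>A\<close>, the two factors contribute at least
  \<open>a\<close> and \<open>p - a\<close>, and strictly more unless these numbers are 0 or
  \<open>n\<close>. Equality leaves only the extreme values, and at \<open>n\<close> it bounds the
  dimension of the factor concerned.\<close>

lemma msum_equality: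
  fixes X Y :: "'a gpt set"
  assumes X: "gvariety n X" "full_bounds n X" and Y: "gvariety n Y" "full_bounds n Y"
    and ind: "\<And>c. (\<And>j. j < n \<Longrightarrow> (\<Sum>i<p. c i * A i j) = 0) \<Longrightarrow> (\<And>j. j < n \<Longrightarrow> (\<Sum>i<p. c i * B i j) = 0)
      \<Longrightarrow> \<forall>i<p. c i = (0::int)"
  shows "p \<le> kdim (cl p (msum p n A B X Y))"
    and "kdim (cl p (msum p n A B X Y)) = p \<Longrightarrow> mrank p n A \<in> {0, n} \<and> p - mrank p n A \<in> {0, n} \<and>
      mrank p n A \<le> p \<and> (mrank p n A = n \<longrightarrow> kdim X \<le> n) \<and> (p - mrank p n A = n \<longrightarrow> kdim Y \<le> n)"
proof -
  have "\<exists>I A' B'. I \<subseteq> {..<p} \<and> card I = mrank p n A \<and> rows_indep I n A' \<and> rows_indep ({..<p} - I) n B' \<and>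
     kdim (cl p (mact p n A' ` X)) + kdim (cl p (mact p n B' ` Y)) \<le> kdim (cl p (msum p n A B X Y))"
    using ind by (rule msum_rank_bound[OF X(1) Y(1)])
  then obtain I A' B' where I: "I \<subseteq> {..<p}" "card I = mrank p n A" "rows_indep I n A'" "rows_indep ({..<p} - I) n B'"
    and le: "kdim (cl p (mact p n A' ` X)) + kdim (cl p (mact p n B' ` Y)) \<le> kdim (cl p (msum p n A B X Y))"
    by (elim exE conjE)
  have J: "card ({..<p} - I) = p - mrank p n A" "mrank p n A \<le> p"
    using I(1,2) card_mono[OF finite_lessThan I(1)] finite_subset[OF I(1)] by (auto simp: card_Diff_subset)
  define a x y where "a = mrank p n A" and "x = kdim (cl p (mact p n A' ` X))" and "y = kdim (cl p (mact p n B' ` Y))"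
  have 1: "a \<le> x" "0 < a \<and> a < n \<longrightarrow> a < x" "a = n \<longrightarrow> kdim X \<le> x"
    using X(2) I(1,3) unfolding full_bounds_def I(2)[symmetric] a_def x_def by blast+
  have 2: "p - a \<le> y" "0 < p - a \<and> p - a < n \<longrightarrow> p - a < y" "p - a = n \<longrightarrow> kdim Y \<le> y"
    using Y(2) I(4) Diff_subset[of "{..<p}" I] unfolding full_bounds_def J(1)[symmetric] a_def y_def by blast+
  have 3: "a \<le> n" "p - a \<le> n" "a \<le> p"
    using mrank_le_cols[of p n A] rows_indep_card[OF _ I(4)] J by (auto simp: a_def)
  show "p \<le> kdim (cl p (msum p n A B X Y))"
    using 1(1) 2(1) 3 le unfolding x_def[symmetric] y_def[symmetric] by linarith
  assume eq: "kdim (cl p (msum p n A B X Y)) = p"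
  have "x + y \<le> p" using le eq unfolding x_def y_def by simp
  then have "x = a" "y = p - a" using 1(1) 2(1) 3(3) by linarith+
  then show "mrank p n A \<in> {0, n} \<and> p - mrank p n A \<in> {0, n} \<and>
      mrank p n A \<le> p \<and> (mrank p n A = n \<longrightarrow> kdim X \<le> n) \<and> (p - mrank p n A = n \<longrightarrow> kdim Y \<le> n)"
    using 1 2 3 unfolding a_def by auto
qed

end

section \<open>Freeness and independence of characters\<close>

context
  fixes par :: "'a::field_char_0 \<Rightarrow> 'a gpt" and D :: "'a set" and X :: "'a gpt set" and \<tau> :: "'a gpt \<Rightarrow> 'a"
  assumes X: "X = par ` D" and D: "infinite D" and \<tau>: "gpoly \<tau>" "\<And>s. \<tau> (par s) = s"
    and curve: "\<And>f. gpoly f \<Longrightarrow> \<exists>p. \<forall>s. f (par s) = poly p s"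
begin

lemma curve_closed: "zclosed_in X C \<Longrightarrow> finite C \<or> C = X"
proof -
  assume "zclosed_in X C"
  then obtain F where F: "\<forall>f\<in>F. gpoly f" "C = {P\<in>X. \<forall>f\<in>F. f P = 0}"
    unfolding zclosed_in_def by blast
  show ?thesis
  proof (cases "\<forall>f\<in>F. \<forall>s. f (par s) = 0")
    case True
    then show ?thesis using F(2) X by blast
  next
    case False
    then obtain f s where f: "f \<in> F" "f (par s) \<noteq> 0" by blast
    obtain p where p: "\<And>s. f (par s) = poly p s" using curve F(1) f(1) by metis
    have "p \<noteq> 0" using f(2) p[of s] by auto
    have "C \<subseteq> par ` {s. poly p s = 0}"
    proof
      fix P assume P: "P \<in> C"
      then obtain t where t: "P = par t" using F(2) X by blast
      have "f P = 0" using P F(2) f(1) by blast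
      then show "P \<in> par ` {s. poly p s = 0}" using p[of t] t by simp
    qed
    then show ?thesis using finite_subset poly_roots_finite[OF \<open>p \<noteq> 0\<close>] by blast
  qed
qed

lemma curve_eqI: "P \<in> X \<Longrightarrow> Q \<in> X \<Longrightarrow> \<tau> P = \<tau> Q \<Longrightarrow> P = Q"
proof -
  assume "P \<in> X" "Q \<in> X" "\<tau> P = \<tau> Q"
  moreover then obtain s t where "P = par s" "Q = par t" using X by blast
  ultimately show ?thesis using \<tau>(2) by simp
qed

lemma curve_finite_closed:
  assumes "S \<subseteq> X" "finite S" "S \<subseteq> C" "C \<subseteq> X"
  shows "zclosed_in C S"
proof -
  define f where "f P = (\<Prod>a\<in>\<tau> ` S. \<tau> P - a)" for P
  have g: "gpoly f" unfolding f_def by (intro gpoly_prod gpoly_diff \<tau>(1) gpoly_const)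
  have "f P = 0 \<longleftrightarrow> P \<in> S" if "P \<in> C" for P
  proof -
    have "f P = 0 \<longleftrightarrow> \<tau> P \<in> \<tau> ` S" using assms(2) by (auto simp: f_def)
    also have "\<dots> \<longleftrightarrow> P \<in> S" using curve_eqI assms that by blast
    finally show ?thesis .
  qed
  then have "S = {P\<in>C. \<forall>h\<in>{f}. h P = 0}" using assms(3) by blast
  then show ?thesis using g assms(3) unfolding zclosed_in_def by blast
qed

lemma curve_irreducible_finite:
  assumes "zirred C" "C \<subseteq> X" "finite C"
  shows "\<exists>P. C = {P}"
proof -
  obtain P where P: "P \<in> C" using assms(1) unfolding zirred_def by blast
  have "zclosed_in C {P}" "zclosed_in C (C - {P})"
    using assms P by (intro curve_finite_closed; auto)+
  moreover have "C = {P} \<union> (C - {P})" using P by blast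
  ultimately have "{P} = C \<or> C - {P} = C" using assms(1) unfolding zirred_def by blast
  then show ?thesis using P by blast
qed

lemma curve_point_irreducible: "zirred {P}"
  unfolding zirred_def by blast

lemma curve_zcl:
  assumes "T \<subseteq> X"
  shows "zcl X T = (if finite T then T else X)"
proof (cases "finite T")
  case True
  have "zclosed_in X T" using curve_finite_closed assms True by blast
  then obtain F where F: "\<forall>f\<in>F. gpoly f" "T = {P\<in>X. \<forall>f\<in>F. f P = 0}"
    unfolding zclosed_in_def by blast
  have "zcl X T \<subseteq> T"
  proof
    fix P assume P: "P \<in> zcl X T"
    then have "f P = 0" if "f \<in> F" for f using that F unfolding zcl_def by blast
    then show "P \<in> T" using P F(2) unfolding zcl_def by blast
  qed
  then show ?thesis using assms True unfolding zcl_def by auto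
next
  case False
  have "f P = 0" if f: "gpoly f" "\<forall>Q\<in>T. f Q = 0" and P: "P \<in> X" for f P
  proof -
    obtain p where p: "\<And>s. f (par s) = poly p s" using curve f(1) by metis
    have "inj_on \<tau> T" using curve_eqI assms by (intro inj_onI) blast
    then have "infinite (\<tau> ` T)" using False finite_imageD by blast
    moreover have "\<tau> ` T \<subseteq> {s. poly p s = 0}"
    proof
      fix s assume "s \<in> \<tau> ` T"
      then obtain Q where Q: "Q \<in> T" "s = \<tau> Q" by blast
      then obtain t where "Q = par t" using assms X by blast
      then show "s \<in> {s. poly p s = 0}" using Q f(2) p[of t] \<tau>(2) by simp
    qed
    ultimately have "p = 0" using poly_roots_finite finite_subset by blast
    moreover obtain t where "P = par t" using P X by blast
    ultimately show ?thesis using p by simp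
  qed
  then have "X \<subseteq> zcl X T" unfolding zcl_def by blast
  then show ?thesis using False unfolding zcl_def by auto
qed

text \<open>Proper closed subsets of the curve are finite and finite irreducible sets are points, so
  a chain has at most one step, and it has one exactly when the closure is the whole curve.\<close>

lemma curve_kdim:
  assumes T: "T \<subseteq> X" "T \<noteq> {}"
  shows "kdim (zcl X T) = 1 \<longleftrightarrow> infinite T"
proof -
  define chains where "chains Y = {k. \<exists>c. (\<forall>i\<le>k. zclosed_in Y (c i) \<and> zirred (c i)) \<and> (\<forall>i<k. c i \<subset> c (Suc i))}"
    for Y :: "'a gpt set"
  have kdim: "kdim Y = Max (chains Y)" for Y :: "'a gpt set" by (simp add: kdim_def chains_def)
  have infX: "infinite X"
  proof
    assume "finite X"
    moreover have "\<tau> ` X = D" using \<tau>(2) unfolding X image_image by simp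
    ultimately show False using D finite_imageI by metis
  qed
  obtain P where P: "P \<in> T" using T by blast
  have no_below: False if c: "c (0::nat) \<subset> c 1" "zirred (c 0)" "zirred (c 1)" "c 1 \<subseteq> X" "finite (c 1)"
    for c :: "nat \<Rightarrow> 'a gpt set"
  proof -
    have "\<exists>P. c 1 = {P}" using curve_irreducible_finite[of "c 1"] c(3-5) by blast
    then obtain P where P: "c 1 = {P}" by (elim exE)
    have "c 0 \<subset> {P}" using c(1) unfolding P .
    then have "c 0 = {}" by (auto simp: psubset_eq subset_singleton_iff)
    moreover have "c 0 \<noteq> {}" using c(2) unfolding zirred_def by (rule conjunct1)
    ultimately show False by simp
  qed
  show ?thesis
  proof (cases "finite T")
    case True
    have "chains T = {0}"
    proof
      have "zclosed_in T {P}" using P T(1) by (intro curve_finite_closed) auto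
      then have "0 \<in> chains T"
        using curve_point_irreducible unfolding chains_def by (intro CollectI exI[of _ "\<lambda>_. {P}"]) simp
      then show "{0} \<subseteq> chains T" by simp
      show "chains T \<subseteq> {0}"
      proof
        fix k assume "k \<in> chains T"
        then obtain c where c: "\<forall>i\<le>k. zclosed_in T (c i) \<and> zirred (c i)" "\<forall>i<k. c i \<subset> c (Suc i)"
          unfolding chains_def mem_Collect_eq by (elim exE conjE)
        have "k = 0"
        proof (rule ccontr)
          assume "k \<noteq> 0"
          then have "c 0 \<subset> c 1" "zirred (c 0)" "zirred (c 1)" "zclosed_in T (c 1)" using c by auto
          moreover then have "c 1 \<subseteq> T" unfolding zclosed_in_def by blast
          moreover from this have "finite (c 1)" "c 1 \<subseteq> X"
            using T(1) True finite_subset[of "c 1" T] by simp_all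
          ultimately show False by (intro no_below)
        qed
        then show "k \<in> {0}" by simp
      qed
    qed
    then show ?thesis using True by (simp add: curve_zcl[OF T(1)] kdim)
  next
    case False
    have le: "k \<le> 1" if "k \<in> chains X" for k
    proof (rule ccontr)
      assume k: "\<not> k \<le> 1"
      obtain c where c: "\<forall>i\<le>k. zclosed_in X (c i) \<and> zirred (c i)" "\<forall>i<k. c i \<subset> c (Suc i)"
        using \<open>k \<in> chains X\<close> unfolding chains_def mem_Collect_eq by (elim exE conjE)
      have *: "zclosed_in X (c 1)" "zclosed_in X (c 2)" "zirred (c 0)" "zirred (c 1)" using c(1) k by simp_all
      have "c 0 \<subset> c 1" "c 1 \<subset> c 2" using c(2) k by (auto simp: numeral_2_eq_2)
      moreover have "c 1 \<subseteq> X" "c 2 \<subseteq> X" using *(1,2) unfolding zclosed_in_def by blast+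
      moreover from calculation have "finite (c 1)" using curve_closed[OF *(1)] by blast
      ultimately show False using * by (intro no_below)
    qed
    have "zirred X"
      unfolding zirred_def
    proof (intro conjI allI impI)
      show "X \<noteq> {}" using infX by auto
      fix A B assume "zclosed_in X A \<and> zclosed_in X B \<and> X = A \<union> B"
      then have AB: "zclosed_in X A" "zclosed_in X B" "X = A \<union> B" by blast+
      show "A = X \<or> B = X"
      proof (rule ccontr)
        assume "\<not> ?thesis"
        then have "finite A" "finite B" using curve_closed[OF AB(1)] curve_closed[OF AB(2)] by blast+
        then have "finite X" using AB(3) finite_UnI by metis
        then show False using infX by blast
      qed
    qed
    moreover have "zclosed_in X X" unfolding zclosed_in_def by (auto intro!: exI[of _ "{}"])
    moreover have "zclosed_in X {P}" using P T(1) by (intro curve_finite_closed) auto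
    moreover have "{P} \<subset> X"
    proof -
      have "{P} \<noteq> X" using infX by auto
      then show ?thesis using P T(1) by blast
    qed
    ultimately have "1 \<in> chains X"
      using curve_point_irreducible unfolding chains_def
      by (intro CollectI exI[of _ "\<lambda>i. if i = 0 then {P} else X"]) simp
    moreover have "finite (chains X)" using le by (intro finite_subset[of "chains X" "{..1}"]) auto
    ultimately have "Max (chains X) = 1" using le by (intro Max_eqI) auto
    then show ?thesis using False by (simp add: curve_zcl[OF T(1)] kdim)
  qed
qed

end

lemma Ga1_kdim:
  fixes T :: "('a::field_char_0) gpt set"
  assumes "T \<subseteq> Ga1" "T \<noteq> {}"
  shows "kdim (zcl Ga1 T) = 1 \<longleftrightarrow> infinite T"
proof (rule curve_kdim[where par = "\<lambda>t. (\<lambda>j. if j = 0 then t else 0, \<lambda>_. 1)" and D = UNIV and \<tau> = "\<lambda>P. fst P 0"])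
  show "Ga1 = range (\<lambda>t::'a. (\<lambda>j. if j = (0::nat) then t else 0, \<lambda>_::nat. 1))"
  proof
    show "Ga1 \<subseteq> range (\<lambda>t::'a. (\<lambda>j. if j = (0::nat) then t else 0, \<lambda>_::nat. 1))"
    proof
      fix P :: "'a gpt" assume P: "P \<in> Ga1"
      have "P = (\<lambda>j. if j = 0 then fst P 0 else 0, \<lambda>_. 1)"
        using P by (intro gpt_eqI) (auto simp: Ga1_def)
      then show "P \<in> range (\<lambda>t. (\<lambda>j. if j = 0 then t else 0, \<lambda>_. 1))" by blast
    qed
  qed (auto simp: Ga1_def)
  show "infinite (UNIV :: 'a set)" by (rule infinite_UNIV_char_0)
  show "\<exists>p. \<forall>s. f (\<lambda>j. if j = 0 then s else 0, \<lambda>_. 1) = poly p s" if f: "gpoly f" for f :: "'a gpt \<Rightarrow> 'a"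
  proof -
    obtain p where "\<forall>s. f (\<lambda>j. poly (if j = 0 then [:0, 1:] else 0) s, \<lambda>j. poly 1 s) = poly p s"
      using gpoly_on_curve[OF f, of "\<lambda>j. if j = 0 then [:0, 1:] else 0" "\<lambda>_. 1"] by blast
    moreover have "(\<lambda>j. poly (if j = 0 then [:0, 1:] else 0) s) = (\<lambda>j::nat. if j = 0 then s else 0)" for s :: 'a
      by auto
    ultimately show ?thesis by (intro exI[of _ p]) simp
  qed
qed (use assms in \<open>simp_all add: gpoly_z\<close>)

lemma Gm1_kdim:
  fixes T :: "('a::field_char_0) gpt set"
  assumes "T \<subseteq> Gm1" "T \<noteq> {}"
  shows "kdim (zcl Gm1 T) = 1 \<longleftrightarrow> infinite T"
proof (rule curve_kdim[where par = "\<lambda>t. (\<lambda>_. 0, \<lambda>j. if j = 0 then t else 1)" and D = "UNIV - {0}" and \<tau> = "\<lambda>P. snd P 0"])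
  show "Gm1 = (\<lambda>t::'a. (\<lambda>_::nat. 0, \<lambda>j. if j = (0::nat) then t else 1)) ` (UNIV - {0})"
  proof
    show "Gm1 \<subseteq> (\<lambda>t::'a. (\<lambda>_::nat. 0, \<lambda>j. if j = (0::nat) then t else 1)) ` (UNIV - {0})"
    proof
      fix P :: "'a gpt" assume P: "P \<in> Gm1"
      have "P = (\<lambda>_. 0, \<lambda>j. if j = 0 then snd P 0 else 1)"
        using P by (intro gpt_eqI) (auto simp: Gm1_def)
      moreover have "snd P 0 \<noteq> 0" using P by (auto simp: Gm1_def)
      ultimately show "P \<in> (\<lambda>t. (\<lambda>_. 0, \<lambda>j. if j = 0 then t else 1)) ` (UNIV - {0})" by blast
    qed
  qed (auto simp: Gm1_def)
  show "infinite (UNIV - {0} :: 'a set)" using infinite_UNIV_char_0[where 'a = 'a] by simp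
  show "\<exists>p. \<forall>s. f (\<lambda>_. 0, \<lambda>j. if j = 0 then s else 1) = poly p s" if f: "gpoly f" for f :: "'a gpt \<Rightarrow> 'a"
  proof -
    obtain p where "\<forall>s. f (\<lambda>j. poly 0 s, \<lambda>j. poly (if j = 0 then [:0, 1:] else 1) s) = poly p s"
      using gpoly_on_curve[OF f, of "\<lambda>_. 0" "\<lambda>j. if j = 0 then [:0, 1:] else 1"] by blast
    moreover have "(\<lambda>j. poly (if j = 0 then [:0, 1:] else 1) s) = (\<lambda>j::nat. if j = 0 then s else 1)" for s :: 'a
      by auto
    ultimately show ?thesis by (intro exI[of _ p]) simp
  qed
qed (use assms in \<open>simp_all add: gpoly_w\<close>)

text \<open>If \<open>f\<close> takes finitely many values \<open>a\<close> on \<open>S\<close>, the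
  product of all \<open>f - a\<close> vanishes on the closure.\<close>

lemma finite_values_cl:
  fixes f :: "'a::field gpt \<Rightarrow> 'a"
  assumes "f \<in> laurent m" "S \<subseteq> Gpts m"
  shows "finite (f ` cl m S) \<longleftrightarrow> finite (f ` S)"
proof
  assume fin: "finite (f ` S)"
  define g where "g = (\<lambda>p. \<Prod>a\<in>f ` S. f p + (- a))"
  have g: "g \<in> laurent m" unfolding g_def by (intro laurent_prod laurent_add laurent_const assms(1))
  have "g p = 0 \<longleftrightarrow> f p \<in> f ` S" for p using fin by (auto simp: g_def)
  moreover have "\<forall>p\<in>cl m S. g p = 0" unfolding cl_vanish[OF assms(2) g] using calculation by blast
  ultimately have "f ` cl m S \<subseteq> f ` S" by blast
  then show "finite (f ` cl m S)" using fin finite_subset by blast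
next
  assume "finite (f ` cl m S)"
  then show "finite (f ` S)" using cl_superset[OF assms(2)] finite_subset image_mono by metis
qed

text \<open>Each projection of the image is finite or dense in its curve according to the number of
  values of one coordinate, and taking the closure does not affect whether this number is
  finite.\<close>

lemma abs_free_iff:
  fixes V :: "('a::field_char_0) gpt set"
  assumes V: "V \<subseteq> Gpts n" "V \<noteq> {}"
  shows "abs_free n V \<longleftrightarrow> (\<forall>M. (\<exists>j<n. M 0 j \<noteq> 0) \<longrightarrow>
    infinite ((\<lambda>v. fst (mact 1 n M v) 0) ` V) \<and> infinite ((\<lambda>v. snd (mact 1 n M v) 0) ` V))"
proof -
  have a: "kdim (zcl Ga1 (proj_a ` mimg 1 n M V)) = 1 \<longleftrightarrow> infinite ((\<lambda>v. fst (mact 1 n M v) 0) ` V)"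
    and m: "kdim (zcl Gm1 (proj_m ` mimg 1 n M V)) = 1 \<longleftrightarrow> infinite ((\<lambda>v. snd (mact 1 n M v) 0) ` V)"
    for M
  proof -
    define S where "S = mact 1 n M ` V"
    have S: "S \<subseteq> Gpts 1" unfolding S_def using V(1) mact_in_Gpts by blast
    define Y where "Y = cl 1 S"
    have Y: "Y \<subseteq> Gpts 1" "Y \<noteq> {}"
      using cl_superset[OF S] V(2) cl_subset_Gpts unfolding Y_def S_def by blast+
    have mi: "mimg 1 n M V = Y" by (simp add: mimg_def Y_def S_def)
    have pa: "proj_a P = (\<lambda>j. if j = 0 then fst P 0 else 0, \<lambda>_. 1)" "proj_m P = (\<lambda>_. 0, \<lambda>j. if j = 0 then snd P 0 else 1)"
      if "P \<in> Y" for P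
    proof -
      have "P \<in> Gpts 1" using that Y(1) by blast
      then have "\<forall>j\<ge>1. fst P j = 0 \<and> snd P j = 1" by (simp add: Gpts_iff)
      then have "fst P j = (if j = 0 then fst P 0 else 0)" "snd P j = (if j = 0 then snd P 0 else 1)" for j
        by (cases j; simp)+
      then show "proj_a P = (\<lambda>j. if j = 0 then fst P 0 else 0, \<lambda>_. 1)" "proj_m P = (\<lambda>_. 0, \<lambda>j. if j = 0 then snd P 0 else 1)"
        unfolding proj_a_def proj_m_def by (intro gpt_eqI; simp)+
    qed
    have "proj_a ` Y \<subseteq> Ga1" "proj_m ` Y \<subseteq> Gm1"
      using Y(1) by (auto simp: proj_a_def proj_m_def Ga1_def Gm1_def Gpts_iff subset_iff)
    then have k: "kdim (zcl Ga1 (proj_a ` Y)) = 1 \<longleftrightarrow> infinite (proj_a ` Y)"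
      "kdim (zcl Gm1 (proj_m ` Y)) = 1 \<longleftrightarrow> infinite (proj_m ` Y)"
      using Y(2) Ga1_kdim[of "proj_a ` Y"] Gm1_kdim[of "proj_m ` Y"] by blast+
    have "proj_a ` Y = (\<lambda>t. (\<lambda>j. if j = 0 then t else 0, \<lambda>_. 1)) ` zc 0 ` Y"
      "zc 0 ` Y = (\<lambda>P. fst P 0) ` proj_a ` Y"
      "proj_m ` Y = (\<lambda>t. (\<lambda>_. 0, \<lambda>j. if j = 0 then t else 1)) ` wc 0 ` Y"
      "wc 0 ` Y = (\<lambda>P. snd P 0) ` proj_m ` Y"
      unfolding image_image zc_def wc_def by (intro image_cong refl; simp add: pa)+
    then have "finite (proj_a ` Y) \<longleftrightarrow> finite (zc 0 ` Y)" "finite (proj_m ` Y) \<longleftrightarrow> finite (wc 0 ` Y)"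
      by (metis finite_imageI)+
    moreover have "finite (zc 0 ` Y) \<longleftrightarrow> finite (zc 0 ` S)" "finite (wc 0 ` Y) \<longleftrightarrow> finite (wc 0 ` S)"
      unfolding Y_def by (intro finite_values_cl S laurent_zc laurent_wc; simp)+
    moreover have "zc 0 ` S = (\<lambda>v. fst (mact 1 n M v) 0) ` V" "wc 0 ` S = (\<lambda>v. snd (mact 1 n M v) 0) ` V"
      unfolding S_def image_image by simp_all
    ultimately show "kdim (zcl Ga1 (proj_a ` mimg 1 n M V)) = 1 \<longleftrightarrow> infinite ((\<lambda>v. fst (mact 1 n M v) 0) ` V)"
      "kdim (zcl Gm1 (proj_m ` mimg 1 n M V)) = 1 \<longleftrightarrow> infinite ((\<lambda>v. snd (mact 1 n M v) 0) ` V)"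
      using k unfolding mi by simp_all
  qed
  show ?thesis unfolding abs_free_def a m ..
qed

text \<open>Artin's argument for the independence of characters, with polynomials in an additive function
  as coefficients: translating by \<^term>\<open>s\<close> and subtracting \<^term>\<open>\<chi> e s\<close> times the relation lowers the
  degree of the coefficient of \<^term>\<open>\<chi> e\<close>.\<close>

lemma characters_independent:
  fixes \<chi> :: "'i \<Rightarrow> 's \<Rightarrow> 'a::field_char_0" and p :: "'i \<Rightarrow> 'a poly"
  assumes E: "finite E"
    and op: "\<And>x y. x \<in> S \<Longrightarrow> y \<in> S \<Longrightarrow> f x y \<in> S"
    and \<zeta>: "\<And>x y. x \<in> S \<Longrightarrow> y \<in> S \<Longrightarrow> \<zeta> (f x y) = \<zeta> x + \<zeta> y" "s1 \<in> S" "\<zeta> s1 \<noteq> 0"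
    and \<chi>: "\<And>i x y. i \<in> E \<Longrightarrow> x \<in> S \<Longrightarrow> y \<in> S \<Longrightarrow> \<chi> i (f x y) = \<chi> i x * \<chi> i y"
      "\<And>i x. i \<in> E \<Longrightarrow> x \<in> S \<Longrightarrow> \<chi> i x \<noteq> 0"
      "\<And>i j. i \<in> E \<Longrightarrow> j \<in> E \<Longrightarrow> i \<noteq> j \<Longrightarrow> \<exists>x\<in>S. \<chi> i x \<noteq> \<chi> j x"
    and rel: "\<And>x. x \<in> S \<Longrightarrow> (\<Sum>i\<in>E. poly (p i) (\<zeta> x) * \<chi> i x) = 0"
  shows "\<forall>i\<in>E. p i = 0"
proof -
  \<comment> \<open>Repeated composition with \<open>s1\<close> makes all positive multiples of
    \<open>\<zeta> s1\<close> values of \<open>\<zeta>\<close>.\<close>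
  have inf: "infinite (\<zeta> ` S)"
  proof
    assume fin: "finite (\<zeta> ` S)"
    have "of_nat (Suc k) * \<zeta> s1 \<in> \<zeta> ` S" for k
    proof (induction k)
      case 0
      then show ?case using \<zeta>(2) by simp
    next
      case (Suc k)
      then obtain x where x: "x \<in> S" "of_nat (Suc k) * \<zeta> s1 = \<zeta> x" by blast
      have "\<zeta> (f s1 x) = of_nat (Suc (Suc k)) * \<zeta> s1"
        unfolding \<zeta>(1)[OF \<zeta>(2) x(1)] x(2)[symmetric] by (simp add: algebra_simps)
      then show ?case using op[OF \<zeta>(2) x(1)] by (metis imageI)
    qed
    then have "range (\<lambda>k. of_nat (Suc k) * \<zeta> s1) \<subseteq> \<zeta> ` S" by blast
    then have "finite (range (\<lambda>k. of_nat (Suc k) * \<zeta> s1))" using fin finite_subset by blast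
    moreover have "inj (\<lambda>k. of_nat (Suc k) * \<zeta> s1)" using \<zeta>(3) by (intro injI) simp
    ultimately show False using range_inj_infinite by blast
  qed
  show ?thesis
    using E \<chi> rel
  proof (induction E arbitrary: p rule: finite_induct)
    case empty
    then show ?case by simp
  next
    case (insert e E)
    have IH: "\<forall>i\<in>E. q i = 0" if "\<And>x. x \<in> S \<Longrightarrow> (\<Sum>i\<in>E. poly (q i) (\<zeta> x) * \<chi> i x) = 0" for q :: "'i \<Rightarrow> 'a poly"
      using insert.prems(1-3) that by (intro insert.IH) blast+
    have "\<forall>i\<in>insert e E. q i = 0"
      if "\<And>x. x \<in> S \<Longrightarrow> (\<Sum>i\<in>insert e E. poly (q i) (\<zeta> x) * \<chi> i x) = 0" for q :: "'i \<Rightarrow> 'a poly"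
      using that
    \<comment> \<open>The measure separates the zero polynomial from nonzero constants.\<close>
    proof (induction "if q e = 0 then 0 else Suc (degree (q e))" arbitrary: q rule: less_induct)
      case less
      have sumE: "(\<Sum>i\<in>insert e E. poly (q i) (\<zeta> x) * \<chi> i x) = poly (q e) (\<zeta> x) * \<chi> e x + (\<Sum>i\<in>E. poly (q i) (\<zeta> x) * \<chi> i x)" for x
        using insert.hyps by simp
      show ?case
      proof (cases "q e = 0")
        case True
        have "(\<Sum>i\<in>E. poly (q i) (\<zeta> x) * \<chi> i x) = 0" if "x \<in> S" for x
          using less.prems[OF that] sumE[of x] True by simp
        then show ?thesis using IH[of q] True by simp
      next
        case False
        define r where "r s i = smult (\<chi> i s) (pcompose (q i) [:\<zeta> s, 1:]) - smult (\<chi> e s) (q i)" for s i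
        have r0: "\<forall>i\<in>insert e E. r s i = 0" if s: "s \<in> S" for s
        proof (rule less.hyps)
          have "r s e = smult (\<chi> e s) (pcompose (q e) [:\<zeta> s, 1:] - q e)"
            by (simp add: r_def smult_diff_right)
          moreover have "pcompose (q e) [:\<zeta> s, 1:] - q e = 0 \<or> degree (pcompose (q e) [:\<zeta> s, 1:] - q e) < degree (q e)"
          proof (cases "degree (q e) = 0")
            case True
            then obtain a where "q e = [:a:]" by (auto dest: degree_eq_zeroE)
            then show ?thesis by simp
          next
            case False
            have deg: "degree (pcompose (q e) [:\<zeta> s, 1:]) = degree (q e)" by (simp add: degree_pcompose)
            have "lead_coeff (pcompose (q e) [:\<zeta> s, 1:]) = lead_coeff (q e)"
              by (subst lead_coeff_comp) simp_all
            then have "coeff (pcompose (q e) [:\<zeta> s, 1:] - q e) (degree (q e)) = 0" using deg by simp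
            moreover have "degree (pcompose (q e) [:\<zeta> s, 1:] - q e) \<le> degree (q e)"
              using deg by (intro degree_diff_le) simp_all
            ultimately show ?thesis using False by (intro disjI2 degree_less_if_coeff_0) auto
          qed
          ultimately show "(if r s e = 0 then 0 else Suc (degree (r s e))) < (if q e = 0 then 0 else Suc (degree (q e)))"
            using False by (auto intro: le_less_trans[OF degree_smult_le])
          fix x assume x: "x \<in> S"
          have "(\<Sum>i\<in>insert e E. poly (r s i) (\<zeta> x) * \<chi> i x)
            = (\<Sum>i\<in>insert e E. poly (q i) (\<zeta> (f s x)) * \<chi> i (f s x) - \<chi> e s * (poly (q i) (\<zeta> x) * \<chi> i x))"
            using insert.prems(1)[OF _ s x] \<zeta>(1)[OF s x]
            by (intro sum.cong refl) (simp add: r_def poly_pcompose algebra_simps)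
          also have "\<dots> = 0"
            unfolding sum_subtractf sum_distrib_left[symmetric] less.prems[OF x] less.prems[OF op[OF s x]] by simp
          finally show "(\<Sum>i\<in>insert e E. poly (r s i) (\<zeta> x) * \<chi> i x) = 0" .
        qed
        \<comment> \<open>In the transformed relation, which is trivial, the coefficient in degree
          \<open>degree (q i)\<close> is the leading coefficient of \<open>q i\<close> times the
          difference of two characters at \<open>s\<close>.\<close>
        have qE: "q i = 0" if i: "i \<in> E" for i
        proof -
          have "i \<noteq> e" using i insert.hyps by auto
          then obtain s where s: "s \<in> S" "\<chi> i s \<noteq> \<chi> e s" using insert.prems(3)[of i e] i by auto
          have "coeff (r s i) (degree (q i)) = 0" using r0[OF s(1)] i by simp
          moreover have "coeff (pcompose (q i) [:\<zeta> s, 1:]) (degree (q i)) = lead_coeff (q i)"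
          proof -
            have "lead_coeff (pcompose (q i) [:\<zeta> s, 1:]) = lead_coeff (q i)"
              by (subst lead_coeff_comp) simp_all
            then show ?thesis by (simp add: degree_pcompose)
          qed
          ultimately have "(\<chi> i s - \<chi> e s) * lead_coeff (q i) = 0" by (simp add: r_def algebra_simps)
          then show ?thesis using s(2) by simp
        qed
        \<comment> \<open>Only the term of \<open>e\<close> is left; its coefficient vanishes at the
          infinitely many values of \<open>\<zeta>\<close>.\<close>
        have "poly (q e) (\<zeta> x) = 0" if x: "x \<in> S" for x
        proof -
          have "(\<Sum>i\<in>E. poly (q i) (\<zeta> x) * \<chi> i x) = 0" using qE by simp
          then have "poly (q e) (\<zeta> x) * \<chi> e x = 0" using less.prems[OF x] sumE[of x] by simp
          then show ?thesis using insert.prems(2)[OF _ x, of e] by simp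
        qed
        then have "\<zeta> ` S \<subseteq> {y. poly (q e) y = 0}" by blast
        then have "q e = 0" using inf poly_roots_finite finite_subset by blast
        then show ?thesis using False by simp
      qed
    qed
    then show ?case using insert.prems(4) by blast
  qed
qed

section \<open>Monomials in the multiplicative coordinates\<close>

definition wmono :: "nat \<Rightarrow> (nat \<Rightarrow> nat) \<Rightarrow> ('a::field) gpt \<Rightarrow> 'a" where
  "wmono n m P = (\<Prod>j<n. snd P j ^ m j)"

lemma wmono_gadd: "wmono n m (gadd P Q) = wmono n m P * wmono n m Q"
  by (simp add: wmono_def gadd_def power_mult_distrib prod.distrib)

lemma wmono_nz: "P \<in> Gpts n \<Longrightarrow> wmono n m P \<noteq> 0"
  by (simp add: wmono_def Gpts_nz)

lemma wmono_add: "wmono n (\<lambda>j. a j + b j) P = wmono n a P * wmono n b P"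
  by (simp add: wmono_def power_add prod.distrib)

lemma wmono_upd: "k < n \<Longrightarrow> m k = 0 \<Longrightarrow> wmono n (m(k := i)) P = snd P k ^ i * wmono n m P"
proof -
  assume k: "k < n" "m k = 0"
  have "wmono n m' P = snd P k ^ m' k * (\<Prod>j\<in>{..<n} - {k}. snd P j ^ m' j)" for m'
    unfolding wmono_def using k by (intro prod.remove) auto
  from this[of m] this[of "m(k := i)"] show ?thesis using k by (auto intro!: prod.cong)
qed

text \<open>Exponents are forced to vanish from \<open>k\<close> on, which leaves room for a power
  of the next coordinate when relations are compared.\<close>

lemma alg_wc_expansion:
  fixes f :: "'a::field gpt \<Rightarrow> 'a"
  assumes "f \<in> alg (range cst) (wc ` {..<k})" "k \<le> n"
  shows "\<exists>E c. finite E \<and> (\<forall>m\<in>E. \<forall>j\<ge>k. m j = (0::nat)) \<and> (\<forall>P. f P = (\<Sum>m\<in>E. c m * wmono n m P))"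
  using assms(1)
proof (induction rule: alg.induct)
  case (alg_base a)
  then obtain b where b: "a = cst b" by blast
  show ?case
    unfolding b by (intro exI[of _ "{\<lambda>_. 0}"] exI[of _ "\<lambda>_. b"]) (simp add: wmono_def)
next
  case (alg_gen a)
  then obtain j where j: "j < k" "a = wc j" by blast
  have "wmono n ((\<lambda>_. 0)(j := 1)) P = snd P j" for P :: "'a gpt"
    using wmono_upd[of j n "\<lambda>_. 0" 1 P] j(1) assms(2) by (simp add: wmono_def)
  then have "wc j P = (\<Sum>m\<in>{(\<lambda>_. 0)(j := 1)}. 1 * wmono n m P)" for P :: "'a gpt"
    unfolding wc_def by (simp del: fun_upd_apply One_nat_def)
  then have 1: "\<forall>P :: 'a gpt. wc j P = (\<Sum>m\<in>{(\<lambda>_. 0)(j := 1)}. 1 * wmono n m P)" by (rule allI)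
  have 2: "\<forall>m\<in>{(\<lambda>_. 0)(j := 1)}. \<forall>j\<ge>k. m j = (0::nat)" using j(1) by simp
  show ?case
    unfolding j(2)
  proof (rule exI, rule exI, intro conjI)
    show "finite {(\<lambda>_. 0)(j := 1::nat)}" by simp
    show "\<forall>m\<in>{(\<lambda>_. 0)(j := 1)}. \<forall>j\<ge>k. m j = (0::nat)" by (rule 2)
    show "\<forall>P :: 'a gpt. wc j P = (\<Sum>m\<in>{(\<lambda>_. 0)(j := 1)}. (\<lambda>_. 1) m * wmono n m P)" by (rule 1)
  qed
next
  case (alg_add a b)
  then obtain E c E' c' where *: "finite E" "\<forall>m\<in>E. \<forall>j\<ge>k. m j = 0" "\<forall>P. a P = (\<Sum>m\<in>E. c m * wmono n m P)"
    "finite E'" "\<forall>m\<in>E'. \<forall>j\<ge>k. m j = 0" "\<forall>P. b P = (\<Sum>m\<in>E'. c' m * wmono n m P)" by (elim exE conjE)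
  define d where "d m = (if m \<in> E then c m else 0) + (if m \<in> E' then c' m else 0)" for m
  have "(a + b) P = (\<Sum>m\<in>E \<union> E'. d m * wmono n m P)" for P
  proof -
    have "(\<Sum>m\<in>E. c m * wmono n m P) = (\<Sum>m\<in>E \<union> E'. (if m \<in> E then c m else 0) * wmono n m P)"
      "(\<Sum>m\<in>E'. c' m * wmono n m P) = (\<Sum>m\<in>E \<union> E'. (if m \<in> E' then c' m else 0) * wmono n m P)"
      using *(1,4) by (intro sum.mono_neutral_cong_left; auto)+
    then show ?thesis by (simp add: *(3,6)[rule_format] d_def algebra_simps sum.distrib)
  qed
  then have "finite (E \<union> E') \<and> (\<forall>m\<in>E \<union> E'. \<forall>j\<ge>k. m j = 0) \<and> (\<forall>P. (a + b) P = (\<Sum>m\<in>E \<union> E'. d m * wmono n m P))"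
    using *(1,2,4,5) by (intro conjI allI) auto
  then show ?case by (intro exI)
next
  case (alg_mult a b)
  then obtain E c E' c' where *: "finite E" "\<forall>m\<in>E. \<forall>j\<ge>k. m j = 0" "\<forall>P. a P = (\<Sum>m\<in>E. c m * wmono n m P)"
    "finite E'" "\<forall>m\<in>E'. \<forall>j\<ge>k. m j = 0" "\<forall>P. b P = (\<Sum>m\<in>E'. c' m * wmono n m P)" by (elim exE conjE)
  define g where "g = (\<lambda>x :: (nat \<Rightarrow> nat) \<times> (nat \<Rightarrow> nat). (\<lambda>j. fst x j + snd x j))"
  define d where "d m = (\<Sum>x\<in>{x \<in> E \<times> E'. g x = m}. c (fst x) * c' (snd x))" for m
  have "(a * b) P = (\<Sum>m\<in>g ` (E \<times> E'). d m * wmono n m P)" for P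
  proof -
    have "(a * b) P = (\<Sum>x\<in>E \<times> E'. (c (fst x) * c' (snd x)) * wmono n (g x) P)"
    proof -
      have "(a * b) P = (\<Sum>m\<in>E. c m * wmono n m P) * (\<Sum>m\<in>E'. c' m * wmono n m P)"
        using *(3)[THEN spec, of P] *(6)[THEN spec, of P] by simp
      also have "\<dots> = (\<Sum>(m, m')\<in>E \<times> E'. (c m * wmono n m P) * (c' m' * wmono n m' P))"
        unfolding sum_product by (rule sum.cartesian_product)
      also have "\<dots> = (\<Sum>x\<in>E \<times> E'. (c (fst x) * c' (snd x)) * wmono n (g x) P)"
        by (intro sum.cong refl) (auto simp: g_def wmono_add)
      finally show ?thesis .
    qed
    also have "\<dots> = (\<Sum>m\<in>g ` (E \<times> E'). \<Sum>x\<in>{x \<in> E \<times> E'. g x = m}. (c (fst x) * c' (snd x)) * wmono n (g x) P)"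
      using *(1,4) by (intro sum.image_gen) auto
    also have "\<dots> = (\<Sum>m\<in>g ` (E \<times> E'). d m * wmono n m P)"
      unfolding d_def sum_distrib_right by (intro sum.cong refl) auto
    finally show ?thesis .
  qed
  moreover have "\<forall>m\<in>g ` (E \<times> E'). \<forall>j\<ge>k. m j = 0" using *(2,5) unfolding g_def by auto
  ultimately have "finite (g ` (E \<times> E')) \<and> (\<forall>m\<in>g ` (E \<times> E'). \<forall>j\<ge>k. m j = 0)
    \<and> (\<forall>P. (a * b) P = (\<Sum>m\<in>g ` (E \<times> E'). d m * wmono n m P))" using *(1,4) by (intro conjI) auto
  then show ?case by (intro exI)
qed

section \<open>Cosets and the restriction of scalars\<close>

lemma sum_apply: "(\<Sum>i\<in>A. f i) P = (\<Sum>i\<in>A. f i P)" for f :: "'i \<Rightarrow> 's \<Rightarrow> 'a::comm_monoid_add"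
  by (induction A rule: infinite_finite_induct) auto

lemma poly_apply: "poly p x P = (\<Sum>i\<le>degree p. coeff p i P * x P ^ i)"
  for p :: "('s \<Rightarrow> 'a::comm_ring_1) poly"
proof -
  have pw: "(x ^ i) P = x P ^ i" for i by (induction i) auto
  show ?thesis unfolding poly_altdef sum_apply by (simp add: pw)
qed

lemma sum_lessThan_double: "(\<Sum>j<2 * n. f j) = (\<Sum>j<n. f j + f (n + j))" for f :: "nat \<Rightarrow> 'a::comm_monoid_add"
proof -
  have "(\<Sum>j<n + m. f j) = (\<Sum>j<n. f j) + (\<Sum>j<m. f (n + j))" for m
    by (induction m) (simp_all add: ac_simps)
  then show ?thesis by (simp add: mult_2 sum.distrib)
qed

lemma prod_lessThan_double: "(\<Prod>j<2 * n. f j) = (\<Prod>j<n. f j * f (n + j))" for f :: "nat \<Rightarrow> 'a::comm_monoid_mult"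
proof -
  have "(\<Prod>j<n + m. f j) = (\<Prod>j<n. f j) * (\<Prod>j<m. f (n + j))" for m
    by (induction m) (simp_all add: ac_simps)
  then show ?thesis by (simp add: mult_2 prod.distrib)
qed

context alg_closed_field
begin

text \<open>Reduces transcendence over the first \<open>k\<close> multiplicative coordinates to
  independence on \<open>S\<close> of monomials times powers of \<open>x\<close>; the coefficients
  of a relation are then zero as functions.\<close>

lemma transc_expansion:
  assumes S: "S \<subseteq> Gpts n" and k: "k \<le> n" and x: "x \<in> laurent n"
    and rel: "\<And>d E c. (\<And>i. i \<le> d \<Longrightarrow> finite (E i) \<and> (\<forall>m\<in>E i. \<forall>j\<ge>k. m j = 0)) \<Longrightarrow>
      (\<And>P. P \<in> S \<Longrightarrow> (\<Sum>i\<le>d. (\<Sum>m\<in>E i. c i m * wmono n m P) * x P ^ i) = 0) \<Longrightarrow>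
      \<forall>i\<le>d. \<forall>m\<in>E i. c i m = (0::'a)"
  shows "transc (van n S) (alg (range cst) (wc ` {..<k})) x"
  unfolding transc_def
proof (intro ballI impI allI)
  fix p i assume p: "p \<in> polys (alg (range cst) (wc ` {..<k}))" "poly p x \<in> van n S"
  have "\<forall>i. \<exists>Ec. finite (fst Ec) \<and> (\<forall>m\<in>fst Ec. \<forall>j\<ge>k. m j = (0::nat)) \<and> (\<forall>P. coeff p i P = (\<Sum>m\<in>fst Ec. snd Ec m * wmono n m P))"
  proof
    fix i
    have "coeff p i \<in> alg (range cst) (wc ` {..<k})" using p(1) by (simp add: polys_def)
    from alg_wc_expansion[OF this k] show "\<exists>Ec. finite (fst Ec) \<and> (\<forall>m\<in>fst Ec. \<forall>j\<ge>k. m j = (0::nat)) \<and> (\<forall>P. coeff p i P = (\<Sum>m\<in>fst Ec. snd Ec m * wmono n m P))"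
    proof (elim exE)
      fix E c assume "finite E \<and> (\<forall>m\<in>E. \<forall>j\<ge>k. m j = (0::nat)) \<and> (\<forall>P. coeff p i P = (\<Sum>m\<in>E. c m * wmono n m P))"
      then show ?thesis by (intro exI[of _ "(E, c)"]) (unfold fst_conv snd_conv)
    qed
  qed
  from choice[OF this] obtain g where
    "\<forall>i. finite (fst (g i)) \<and> (\<forall>m\<in>fst (g i). \<forall>j\<ge>k. m j = (0::nat)) \<and> (\<forall>P. coeff p i P = (\<Sum>m\<in>fst (g i). snd (g i) m * wmono n m P))"
    by (elim exE)
  then have g: "finite (fst (g i))" "\<forall>m\<in>fst (g i). \<forall>j\<ge>k. m j = (0::nat)"
    "coeff p i P = (\<Sum>m\<in>fst (g i). snd (g i) m * wmono n m P)" for i P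
    by (metis (lifting))+
  have z: "\<forall>i\<le>degree p. \<forall>m\<in>fst (g i). snd (g i) m = 0"
  proof (rule rel)
    fix i show "finite (fst (g i)) \<and> (\<forall>m\<in>fst (g i). \<forall>j\<ge>k. m j = 0)" using g(1,2) by simp
  next
    fix P assume "P \<in> S"
    then have "poly p x P = 0" using p(2) unfolding van_def by blast
    then show "(\<Sum>i\<le>degree p. (\<Sum>m\<in>fst (g i). snd (g i) m * wmono n m P) * x P ^ i) = 0"
      unfolding poly_apply g(3) .
  qed
  have "coeff p i = cst 0"
  proof (cases "i \<le> degree p")
    case True
    have "coeff p i P = 0" for P unfolding g(3) using z True by (intro sum.neutral) simp
    then show ?thesis by (intro ext) simp
  next
    case False
    then show ?thesis by (intro ext) (simp add: coeff_eq_0)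
  qed
  then show "coeff p i \<in> van n S" unfolding van_def using laurent_cst[of 0 n] by simp
qed

text \<open>On a set closed under addition, monomials are multiplicative characters and the first
  additive coordinate is additive. By \<open>characters_independent\<close> the functions
  \<open>wc j\<close> and \<open>zc 0\<close> are algebraically independent on \<open>S\<close>, and
  there are \<open>n + 1\<close> of them.\<close>

lemma monoid_kdim:
  fixes S :: "'a gpt set"
  assumes S: "gvariety n S" and n: "n > 0"
    and add: "\<And>P Q. P \<in> S \<Longrightarrow> Q \<in> S \<Longrightarrow> gadd P Q \<in> S"
    and char: "\<And>d::nat \<Rightarrow> int. \<exists>j<n. d j \<noteq> 0 \<Longrightarrow> \<exists>s\<in>S. (\<Prod>j<n. snd s j powi d j) \<noteq> 1"
    and s1: "s1 \<in> S" "fst s1 0 \<noteq> 0"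
  shows "n + 1 \<le> kdim S"
proof -
  have SG: "S \<subseteq> Gpts n" using S by (simp add: gvariety_iff)
  have dist: "\<exists>s\<in>S. wmono n m s \<noteq> wmono n m' s" if m: "\<forall>j\<ge>n. m j = 0" "\<forall>j\<ge>n. m' j = 0" "m \<noteq> m'" for m m'
  proof -
    have "\<exists>j<n. int (m j) - int (m' j) \<noteq> 0"
    proof (rule ccontr)
      assume "\<not> ?thesis"
      then have "m j = m' j" for j using m(1,2) by (cases "j < n") auto
      then show False using m(3) by blast
    qed
    from char[OF this] obtain s where s: "s \<in> S" "(\<Prod>j<n. snd s j powi (int (m j) - int (m' j))) \<noteq> 1" by blast
    have nz: "snd s j \<noteq> 0" for j using SG s(1) by (intro Gpts_nz) auto
    have "(\<Prod>j<n. snd s j powi (int (m j) - int (m' j))) = wmono n m s / wmono n m' s"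
      unfolding wmono_def prod_dividef[symmetric] by (simp add: power_int_diff nz)
    then have "wmono n m s \<noteq> wmono n m' s" using s(2) wmono_nz[of s n m'] SG s(1) by auto
    then show ?thesis using s(1) by blast
  qed
  have indep_char: "\<forall>i\<in>E. p i = 0"
    if E: "finite E" "\<And>i. i \<in> E \<Longrightarrow> \<forall>j\<ge>n. g i j = 0" "inj_on g E"
      and rel: "\<And>x. x \<in> S \<Longrightarrow> (\<Sum>i\<in>E. poly (p i) (fst x 0) * wmono n (g i) x) = 0"
    for E :: "'i set" and g p
  proof (rule characters_independent[where \<zeta> = "\<lambda>x. fst x 0" and S = S and f = gadd and \<chi> = "\<lambda>i. wmono n (g i)"])
    show "finite E" by (rule E)
    show "gadd x y \<in> S" if "x \<in> S" "y \<in> S" for x y using add that .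
    show "fst (gadd x y) 0 = fst x 0 + fst y 0" if "x \<in> S" "y \<in> S" for x y by (simp add: gadd_def)
    show "s1 \<in> S" "fst s1 0 \<noteq> 0" by (rule s1)+
    show "wmono n (g i) (gadd x y) = wmono n (g i) x * wmono n (g i) y" if "i \<in> E" "x \<in> S" "y \<in> S" for i x y
      by (rule wmono_gadd)
    show "wmono n (g i) x \<noteq> 0" if "i \<in> E" "x \<in> S" for i x using that SG by (intro wmono_nz) auto
    show "\<exists>x\<in>S. wmono n (g i) x \<noteq> wmono n (g j) x" if "i \<in> E" "j \<in> E" "i \<noteq> j" for i j
      using that E(2)[of i] E(2)[of j] inj_on_eq_iff[OF E(3)] by (intro dist) auto
  qed (rule rel)
  have w: "transc (van n S) (alg (range cst) (wc ` {..<k})) (wc k)" if k: "k < n" for k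
  proof (rule transc_expansion[OF SG])
    fix d E and c :: "nat \<Rightarrow> (nat \<Rightarrow> nat) \<Rightarrow> 'a"
    assume E: "\<And>i. i \<le> d \<Longrightarrow> finite (E i) \<and> (\<forall>m\<in>E i. \<forall>j\<ge>k. m j = 0)"
      and rel: "\<And>P. P \<in> S \<Longrightarrow> (\<Sum>i\<le>d. (\<Sum>m\<in>E i. c i m * wmono n m P) * wc k P ^ i) = 0"
    define F where "F = Sigma {..d} E"
    \<comment> \<open>The power of \<open>wc k\<close> is absorbed into the exponent at
      \<open>k\<close>, which is 0 in \<open>m\<close>; so different pairs give different
      characters.\<close>
    define g where "g = (\<lambda>(i, m :: nat \<Rightarrow> nat). m(k := i))"
    have "\<forall>x\<in>F. [:c (fst x) (snd x):] = 0"
    proof (rule indep_char)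
      show "finite F" unfolding F_def using E by (intro finite_SigmaI) auto
      show "\<forall>j\<ge>n. g x j = 0" if "x \<in> F" for x
        using that E k by (auto simp: F_def g_def)
      show "inj_on g F"
      proof (rule inj_onI)
        fix x y assume xy: "x \<in> F" "y \<in> F" "g x = g y"
        obtain i m i' m' where im: "x = (i, m)" "y = (i', m')" by (metis surj_pair)
        have m: "m k = 0" "m' k = 0" using xy E unfolding im F_def by auto
        have eq: "m(k := i) = m'(k := i')" using xy(3) by (simp add: im g_def)
        have "i = i'" using fun_cong[OF eq, of k] by simp
        moreover have "m j = m' j" for j using fun_cong[OF eq, of j] m by (cases "j = k") auto
        ultimately show "x = y" unfolding im by auto
      qed
      fix P assume P: "P \<in> S"
      have "(\<Sum>x\<in>F. poly [:c (fst x) (snd x):] (fst P 0) * wmono n (g x) P)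
        = (\<Sum>(i, m)\<in>F. c i m * wmono n m P * wc k P ^ i)"
      proof (rule sum.cong[OF refl])
        fix x assume x: "x \<in> F"
        obtain i m where im: "x = (i, m)" by (metis surj_pair)
        have "m k = 0" using x E unfolding im F_def by auto
        then have "wmono n (g x) P = snd P k ^ i * wmono n m P" unfolding im g_def prod.case by (rule wmono_upd[OF k])
        then show "poly [:c (fst x) (snd x):] (fst P 0) * wmono n (g x) P = (case x of (i, m) \<Rightarrow> c i m * wmono n m P * wc k P ^ i)"
          by (simp add: im wc_def)
      qed
      also have "\<dots> = (\<Sum>i\<le>d. \<Sum>m\<in>E i. c i m * wmono n m P * wc k P ^ i)"
        unfolding F_def using E by (intro sum.Sigma[symmetric]) auto
      also have "\<dots> = 0" using rel[OF P] unfolding sum_distrib_right .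
      finally show "(\<Sum>x\<in>F. poly [:c (fst x) (snd x):] (fst P 0) * wmono n (g x) P) = 0" .
    qed
    then show "\<forall>i\<le>d. \<forall>m\<in>E i. c i m = 0" unfolding F_def by auto
  qed (use k in \<open>simp_all add: laurent_wc\<close>)
  have z: "transc (van n S) (alg (range cst) (wc ` {..<n})) (zc 0)"
  proof (rule transc_expansion[OF SG])
    fix d E and c :: "nat \<Rightarrow> (nat \<Rightarrow> nat) \<Rightarrow> 'a"
    assume E: "\<And>i. i \<le> d \<Longrightarrow> finite (E i) \<and> (\<forall>m\<in>E i. \<forall>j\<ge>n. m j = 0)"
      and rel: "\<And>P. P \<in> S \<Longrightarrow> (\<Sum>i\<le>d. (\<Sum>m\<in>E i. c i m * wmono n m P) * zc 0 P ^ i) = 0"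
    define F where "F = (\<Union>i\<le>d. E i)"
    \<comment> \<open>Terms with the same monomial are collected into a polynomial in
      \<open>zc 0\<close>, the coefficient of a single character.\<close>
    define q where "q m = (\<Sum>i\<le>d. monom (if m \<in> E i then c i m else 0) i)" for m
    have finF: "finite F" unfolding F_def using E by simp
    have "\<forall>m\<in>F. q m = 0"
    proof (rule indep_char[of F "\<lambda>m. m" q])
      show "finite F" by (rule finF)
      show "\<forall>j\<ge>n. m j = 0" if "m \<in> F" for m using that E unfolding F_def by auto
      fix P assume P: "P \<in> S"
      have "(\<Sum>m\<in>F. poly (q m) (fst P 0) * wmono n m P)
        = (\<Sum>m\<in>F. \<Sum>i\<le>d. (if m \<in> E i then c i m else 0) * fst P 0 ^ i * wmono n m P)"
        by (simp add: q_def poly_sum poly_monom sum_distrib_right)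
      also have "\<dots> = (\<Sum>i\<le>d. \<Sum>m\<in>F. (if m \<in> E i then c i m else 0) * fst P 0 ^ i * wmono n m P)" by (rule sum.swap)
      also have "\<dots> = (\<Sum>i\<le>d. \<Sum>m\<in>E i. c i m * wmono n m P * zc 0 P ^ i)"
      proof (rule sum.cong[OF refl])
        fix i assume "i \<in> {..d}"
        then have "E i \<subseteq> F" unfolding F_def by blast
        then show "(\<Sum>m\<in>F. (if m \<in> E i then c i m else 0) * fst P 0 ^ i * wmono n m P) = (\<Sum>m\<in>E i. c i m * wmono n m P * zc 0 P ^ i)"
          using finF by (intro sum.mono_neutral_cong_right) (auto simp: zc_def)
      qed
      also have "\<dots> = 0" using rel[OF P] unfolding sum_distrib_right .
      finally show "(\<Sum>m\<in>F. poly (q m) (fst P 0) * wmono n m P) = 0" .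
    qed simp
    then have "coeff (q m) i = 0" if "m \<in> F" for m i using that by simp
    moreover have "coeff (q m) i = (if m \<in> E i then c i m else 0)" if "i \<le> d" for m i
      unfolding q_def coeff_sum coeff_monom using that by (simp add: sum.delta)
    ultimately show "\<forall>i\<le>d. \<forall>m\<in>E i. c i m = 0" unfolding F_def by (metis UN_I atMost_iff)
  qed (use n in \<open>simp_all add: laurent_zc\<close>)
  \<comment> \<open>\<open>wc k\<close> is transcendental over the coordinates of smaller index, so
    larger indices stand nearer the head.\<close>
  have "indep (van n S) (range cst) (map wc (rev [0..<k]))" if "k \<le> n" for k
    using that by (induction k) (simp_all add: w atLeast0LessThan)
  from this[of n] have ind: "indep (van n S) (range cst) (zc 0 # map wc (rev [0..<n]))"
    using z by (simp add: atLeast0LessThan)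
  have L: "set (zc 0 # map wc (rev [0..<n])) \<subseteq> laurent n"
    using n laurent_zc[of 0 n] laurent_wc[of _ n] by auto
  have "length (zc 0 # map wc (rev [0..<n])) \<le> kdim S"
  proof (rule vchain_of_indep[OF S ind L])
    fix c assume "vchain n c (length (zc 0 # map wc (rev [0..<n])))" "c (length (zc 0 # map wc (rev [0..<n]))) = S"
    then show "length (zc 0 # map wc (rev [0..<n])) \<le> kdim S"
      using S by (intro kdim_ge[of n S c]) (simp_all add: gvariety_def)
  qed
  then show ?thesis by simp
qed

text \<open>Equality of dimensions makes the sum a translate of both summands; then a translate of the first
  summand is closed under addition, which is impossible since no nontrivial character and no
  first coordinate are constant on it.\<close>

lemma msum_not_translate:
  fixes X Y :: "'a gpt set"
  assumes X: "gvariety n X" and Y: "gvariety n Y" and n: "n > 0"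
    and dim: "n \<le> kdim (cl n (mact n n A ` X))" "n \<le> kdim (cl n (mact n n B ` Y))"
      "kdim (cl n (msum n n A B X Y)) = n"
    and char: "\<And>d. \<exists>j<n. d j \<noteq> 0 \<Longrightarrow> infinite ((\<lambda>u. \<Prod>j<n. snd (mact n n A u) j powi d j) ` X)"
    and coord: "infinite ((\<lambda>u. fst (mact n n A u) 0) ` X)"
  shows False
proof -
  note ma = morph_imp_zmorph[OF morph_mact]
  have XG: "X \<subseteq> Gpts n" and YG: "Y \<subseteq> Gpts n" using X Y by (auto simp: gvariety_iff)
  define A' B' X' Y' W where "A' = mact n n A ` X" and "B' = mact n n B ` Y"
    and "X' = cl n A'" and "Y' = cl n B'" and "W = cl n (msum n n A B X Y)"
  have AG: "A' \<subseteq> Gpts n" and BG: "B' \<subseteq> Gpts n" unfolding A'_def B'_def using XG YG mact_in_Gpts by blast+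
  have X': "gvariety n X'" and Y': "gvariety n Y'" and W: "gvariety n W"
    unfolding X'_def Y'_def A'_def B'_def W_def by (intro gvariety_image[OF X ma] gvariety_image[OF Y ma] msum_variety X Y)+
  have X'G: "X' \<subseteq> Gpts n" and Y'G: "Y' \<subseteq> Gpts n" using X' Y' by (auto simp: gvariety_iff)
  have AX: "A' \<subseteq> X'" and BY: "B' \<subseteq> Y'" unfolding X'_def Y'_def using cl_superset AG BG by blast+
  have mG: "msum n n A B X Y \<subseteq> Gpts n" by (rule msum_variety(1)[OF X Y])
  have AB: "gadd a b \<in> W" if "a \<in> A'" "b \<in> B'" for a b
  proof -
    have "gadd a b \<in> msum n n A B X Y" using that unfolding A'_def B'_def msum_def by blast
    then show ?thesis unfolding W_def using cl_superset[OF mG] by blast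
  qed
  have closure: "gadd g ` cl n T \<subseteq> W" if "g \<in> Gpts n" "T \<subseteq> Gpts n" "gadd g ` T \<subseteq> W" for g T
  proof -
    have "gadd g ` cl n T \<subseteq> cl n (gadd g ` T)" by (rule zmorph_cl_subset[OF that(2) morph_imp_zmorph[OF morph_gadd[OF that(1)]]])
    also have "\<dots> \<subseteq> W" using that(3) mG unfolding W_def by (rule cl_least)
    finally show ?thesis .
  qed
  have BX: "gadd b ` X' \<subseteq> W" if "b \<in> B'" for b
    unfolding X'_def
  proof (rule closure[OF _ AG])
    show "gadd b ` A' \<subseteq> W" using AB[OF _ that] by (intro image_subsetI) (subst gadd_commute, blast)
  qed (use that BG in blast)
  \<comment> \<open>The sum is extended to the closures one argument at a time.\<close>
  have XY: "gadd x y \<in> W" if x: "x \<in> X'" and y: "y \<in> Y'" for x y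
  proof -
    have "gadd x ` Y' \<subseteq> W"
      unfolding Y'_def
    proof (rule closure[OF _ BG])
      show "gadd x ` B' \<subseteq> W" using BX x by (intro image_subsetI) (subst gadd_commute, blast)
    qed (use x X'G in blast)
    then show ?thesis using y by blast
  qed
  \<comment> \<open>A translate of dimension at least \<open>n\<close> inside the irreducible
    \<open>W\<close> of dimension \<open>n\<close> cannot be proper.\<close>
  have eq: "gadd g ` Z = W" if "gvariety n Z" "g \<in> Gpts n" "n \<le> kdim Z" "gadd g ` Z \<subseteq> W" for g Z
  proof (rule ccontr)
    assume "\<not> ?thesis"
    then have "gadd g ` Z \<subset> W" using that(4) by blast
    then have "kdim (gadd g ` Z) < kdim W" by (rule kdim_less[OF gvariety_translate[OF that(1,2)] W])
    then show False using that(3) dim(3) kdim_translate[OF that(1,2)] by (simp add: W_def)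
  qed
  have "X \<noteq> {}" "Y \<noteq> {}" using X Y by (auto simp: gvariety_iff irr_def)
  then obtain a b where a: "a \<in> A'" and b: "b \<in> B'" unfolding A'_def B'_def by blast
  have aG: "a \<in> Gpts n" and bG: "b \<in> Gpts n" using a b AG BG by blast+
  have WX: "gadd b ` X' = W"
    using dim(1) BX[OF b] by (intro eq X' bG) (simp_all add: X'_def A'_def)
  have WY: "gadd a ` Y' = W"
  proof (rule eq[OF Y' aG])
    show "n \<le> kdim Y'" using dim(2) by (simp add: Y'_def B'_def)
    show "gadd a ` Y' \<subseteq> W" using XY a AX by blast
  qed
  have kX: "kdim X' = n"
    using kdim_translate[OF X' bG] dim(3) unfolding WX by (simp add: W_def)
  \<comment> \<open>Translation by the inverse of \<open>a\<close> puts the neutral element into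
    \<open>S\<close>.\<close>
  define S where "S = gadd (ginv a) ` X'"
  have S: "gvariety n S" unfolding S_def by (intro gvariety_translate X' ginv_in_Gpts aG)
  have "infinite ((\<lambda>P. fst P 0) ` A')" using coord unfolding A'_def image_image .
  then have "\<not> (\<lambda>P. fst P 0) ` A' \<subseteq> {fst a 0}" using finite_subset by blast
  then obtain a1 where a1: "a1 \<in> A'" "fst a1 0 \<noteq> fst a 0" by blast
  have "n + 1 \<le> kdim S"
  proof (rule monoid_kdim[OF S n])
    fix P Q assume "P \<in> S" "Q \<in> S"
    then obtain x y where x: "x \<in> X'" "P = gadd (ginv a) x" and y: "y \<in> X'" "Q = gadd (ginv a) y" unfolding S_def by blast
    \<comment> \<open>\<open>W\<close> is both \<open>b + X'\<close> and \<open>a + Y'\<close>.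
      Write \<open>b + y = a + v\<close>, so that \<open>v = b + Q\<close>, and then
      \<open>x + v = b + u\<close>; cancelling \<open>b\<close> gives \<open>x + Q = u\<close> in
      \<open>X'\<close>.\<close>
    have "gadd b y \<in> gadd a ` Y'" unfolding WY WX[symmetric] using y(1) by (rule imageI)
    then obtain v where v: "v \<in> Y'" "gadd b y = gadd a v" by (rule imageE)
    have "gadd x v \<in> gadd b ` X'" unfolding WX by (rule XY[OF x(1) v(1)])
    then obtain u where u: "u \<in> X'" "gadd x v = gadd b u" by (rule imageE)
    have vQ: "v = gadd b Q"
      using gadd_ginv(1)[OF aG, of v] unfolding v(2)[symmetric] y(2) by (metis gadd_assoc gadd_commute)
    have "gadd b (gadd x Q) = gadd b u" using u(2) unfolding vQ by (metis gadd_assoc gadd_commute)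
    then have "gadd x Q = u" using gadd_ginv(1)[OF bG] by metis
    then have "gadd P Q = gadd (ginv a) u" unfolding x(2) by (simp add: gadd_assoc)
    then show "gadd P Q \<in> S" unfolding S_def using u(1) by blast
  next
    fix d :: "nat \<Rightarrow> int" assume d: "\<exists>j<n. d j \<noteq> 0"
    define f where "f P = (\<Prod>j<n. snd P j powi d j)" for P :: "'a gpt"
    have "infinite (f ` A')" using char[OF d] unfolding A'_def image_image f_def .
    then have "\<not> f ` A' \<subseteq> {f a}" using finite_subset by blast
    then obtain a' where a': "a' \<in> A'" "f a' \<noteq> f a" by blast
    have "snd a j \<noteq> 0" for j by (rule Gpts_nz[OF aG])
    then have "f a \<noteq> 0" by (simp add: f_def)
    have "f (gadd (ginv a) a') = f a' / f a"
      by (simp add: f_def gadd_def ginv_def power_int_mult_distrib power_int_inverse prod.distrib prod_inversef divide_inverse mult.commute flip: prod_inversef)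
    then have "f (gadd (ginv a) a') \<noteq> 1" using a'(2) \<open>f a \<noteq> 0\<close> by simp
    moreover have "gadd (ginv a) a' \<in> S" unfolding S_def using a'(1) AX by blast
    ultimately show "\<exists>s\<in>S. (\<Prod>j<n. snd s j powi d j) \<noteq> 1" unfolding f_def by blast
  next
    show "gadd (ginv a) a1 \<in> S" unfolding S_def using a1(1) AX by blast
    show "fst (gadd (ginv a) a1) 0 \<noteq> 0" using a1(2) by (simp add: gadd_def ginv_def)
  qed
  then show False using kdim_translate[OF X' ginv_in_Gpts[OF aG]] kX unfolding S_def by simp
qed

end

section \<open>Matrix images of the restriction of scalars\<close>

context conj_field
begin

lemma kdim_mact_smap:
  assumes U: "gvariety n U"
  shows "kdim (cl p (mact p n C ` U)) \<le> kdim (cl p (mact p n C ` smap ` U))"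
proof -
  note ma = morph_imp_zmorph[OF morph_mact]
  have UG: "U \<subseteq> Gpts n" using U by (simp add: gvariety_iff)
  have X: "gvariety p (cl p (mact p n C ` U))" by (rule gvariety_image[OF U ma])
  have "mact p n C ` smap ` U = smap ` mact p n C ` U" by (simp add: image_image smap_mact)
  also have "cl p \<dots> = cl p (smap ` cl p (mact p n C ` U))"
    by (rule cl_image_cl[OF zmorph_Gpts[OF ma UG] zmorph_smap, symmetric])
  also have "\<dots> = smap ` cl p (mact p n C ` U)" using gvariety_smap[OF X] by (simp add: gvariety_iff)
  finally show ?thesis using kdim_smap_le[OF X] by simp
qed

lemma full_bounds_smap:
  assumes U: "gvariety n U" and f: "full_bounds n U"
  shows "full_bounds n (smap ` U)"
  unfolding full_bounds_def
proof (intro allI impI)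
  fix p C I assume I: "I \<subseteq> {..<p} \<and> rows_indep I n C"
  have "kdim (smap ` U) \<le> kdim U"
    using kdim_smap_le[OF gvariety_smap[OF U]] by (simp add: image_image)
  moreover have "card I \<le> kdim (cl p (mact p n C ` U)) \<and>
     (0 < card I \<and> card I < n \<longrightarrow> card I < kdim (cl p (mact p n C ` U))) \<and>
     (card I = n \<longrightarrow> kdim U \<le> kdim (cl p (mact p n C ` U)))"
    using f I unfolding full_bounds_def by blast
  ultimately show "card I \<le> kdim (cl p (mact p n C ` smap ` U)) \<and>
     (0 < card I \<and> card I < n \<longrightarrow> card I < kdim (cl p (mact p n C ` smap ` U))) \<and>
     (card I = n \<longrightarrow> kdim (smap ` U) \<le> kdim (cl p (mact p n C ` smap ` U)))"
    using kdim_mact_smap[OF U, of p C] by linarith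
qed

definition sum_half :: "nat \<Rightarrow> (nat \<Rightarrow> nat \<Rightarrow> int) \<Rightarrow> nat \<Rightarrow> nat \<Rightarrow> int" where
  "sum_half n M = (\<lambda>i j. M i j + M i (n + j))"

definition diff_half :: "nat \<Rightarrow> (nat \<Rightarrow> nat \<Rightarrow> int) \<Rightarrow> nat \<Rightarrow> nat \<Rightarrow> int" where
  "diff_half n M = (\<lambda>i j. M i j - M i (n + j))"

lemma mact_lam:
  assumes Q: "Q \<in> Gpts n" and R: "R \<in> Gpts n"
  shows "mact p (2 * n) M (lam n Q R) = gadd (mact p n (sum_half n M) Q) (mact p n (diff_half n M) R)"
proof (rule gpt_eqI)
  fix i
  have nz: "snd Q j \<noteq> 0" "snd R j \<noteq> 0" for j by (rule Gpts_nz[OF Q], rule Gpts_nz[OF R])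
  show "fst (mact p (2 * n) M (lam n Q R)) i = fst (gadd (mact p n (sum_half n M) Q) (mact p n (diff_half n M) R)) i"
    unfolding mact_def gadd_def fst_conv sum_lessThan_double
    by (auto simp: sum_half_def diff_half_def lam_def algebra_simps simp flip: sum.distrib intro!: sum.cong)
  have "(\<Prod>j<2 * n. snd (lam n Q R) j powi M i j)
      = (\<Prod>j<n. snd Q j powi sum_half n M i j * snd R j powi diff_half n M i j)"
    unfolding prod_lessThan_double
  proof (rule prod.cong[OF refl])
    fix j assume "j \<in> {..<n}"
    then show "snd (lam n Q R) j powi M i j * snd (lam n Q R) (n + j) powi M i (n + j)
      = snd Q j powi sum_half n M i j * snd R j powi diff_half n M i j"
      by (simp add: lam_def sum_half_def diff_half_def power_int_add power_int_diff nz power_int_mult_distrib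
          power_int_divide_distrib field_simps)
  qed
  then show "snd (mact p (2 * n) M (lam n Q R)) i = snd (gadd (mact p n (sum_half n M) Q) (mact p n (diff_half n M) R)) i"
    by (simp add: mact_def gadd_def prod.distrib)
qed

text \<open>Sum and difference of the blocks determine twice each block, so a combination of rows
  that kills both also kills \<open>M\<close>.\<close>

lemma halves_indep:
  assumes "rows_indep {..<p} (2 * n) M"
    and c: "\<And>j. j < n \<Longrightarrow> (\<Sum>i<p. c i * sum_half n M i j) = 0" "\<And>j. j < n \<Longrightarrow> (\<Sum>i<p. c i * diff_half n M i j) = 0"
  shows "\<forall>i<p. c i = 0"
proof -
  have *: "(\<Sum>i<p. c i * M i j) = 0" "(\<Sum>i<p. c i * M i (n + j)) = 0" if "j < n" for j
    using c(1)[OF that] c(2)[OF that]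
    by (simp_all add: sum_half_def diff_half_def algebra_simps sum.distrib sum_subtractf)
  have "(\<Sum>i<p. c i * M i j) = 0" if "j < 2 * n" for j
    using *(1)[of j] *(2)[of "j - n"] that by (cases "j < n") auto
  then show ?thesis using assms(1) unfolding rows_indep_def by blast
qed

context
  fixes n :: nat and U :: "'a gpt set"
  assumes U: "gvariety n U" and V_simple: "simple_var n (gscale 2 ` U)"
begin

abbreviation "Vc \<equiv> restr \<sigma> ii n (gscale 2 ` U)"

lemma U_Gpts: "U \<subseteq> Gpts n" and U_nonempty: "U \<noteq> {}" and smap_U_Gpts: "smap ` U \<subseteq> Gpts n"
  using U smap_in_Gpts by (auto simp: gvariety_iff irr_def)

lemma full_bounds_U: "full_bounds n U"
  using V_simple by (intro full_bounds_half[OF U]) (auto simp: simple_var_def)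

lemma lam_set_Gpts: "{lam n Q R |Q R. Q \<in> U \<and> R \<in> smap ` U} \<subseteq> Gpts (2 * n)"
  using lam_in_Gpts U_Gpts smap_U_Gpts by blast

lemma mimg_restr: "mimg p (2 * n) M Vc = cl p (msum p n (sum_half n M) (diff_half n M) U (smap ` U))"
proof -
  have "cl p (mact p (2 * n) M ` Vc) = cl p (mact p (2 * n) M ` {lam n Q R |Q R. Q \<in> U \<and> R \<in> smap ` U})"
    unfolding restr_eq(1)[OF U] by (rule cl_image_cl[OF lam_set_Gpts morph_imp_zmorph[OF morph_mact]])
  also have "mact p (2 * n) M ` {lam n Q R |Q R. Q \<in> U \<and> R \<in> smap ` U}
    = msum p n (sum_half n M) (diff_half n M) U (smap ` U)"
  proof
    show "mact p (2 * n) M ` {lam n Q R |Q R. Q \<in> U \<and> R \<in> smap ` U} \<subseteq> msum p n (sum_half n M) (diff_half n M) U (smap ` U)"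
    proof (rule image_subsetI)
      fix P assume "P \<in> {lam n Q R |Q R. Q \<in> U \<and> R \<in> smap ` U}"
      then obtain Q R where QR: "P = lam n Q R" "Q \<in> U" "R \<in> smap ` U" by blast
      have "mact p (2 * n) M P = gadd (mact p n (sum_half n M) Q) (mact p n (diff_half n M) R)"
        unfolding QR(1) using QR(2,3) U_Gpts smap_U_Gpts by (intro mact_lam) blast+
      then show "mact p (2 * n) M P \<in> msum p n (sum_half n M) (diff_half n M) U (smap ` U)"
        unfolding msum_def using QR(2,3) by blast
    qed
    show "msum p n (sum_half n M) (diff_half n M) U (smap ` U) \<subseteq> mact p (2 * n) M ` {lam n Q R |Q R. Q \<in> U \<and> R \<in> smap ` U}"
    proof
      fix P assume "P \<in> msum p n (sum_half n M) (diff_half n M) U (smap ` U)"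
      then obtain Q R where QR: "P = gadd (mact p n (sum_half n M) Q) (mact p n (diff_half n M) R)" "Q \<in> U" "R \<in> smap ` U"
        unfolding msum_def by blast
      have "P = mact p (2 * n) M (lam n Q R)"
        unfolding QR(1) using QR(2,3) U_Gpts smap_U_Gpts by (intro mact_lam[symmetric]) blast+
      then show "P \<in> mact p (2 * n) M ` {lam n Q R |Q R. Q \<in> U \<and> R \<in> smap ` U}" using QR(2,3) by blast
    qed
  qed
  finally show ?thesis by (simp add: mimg_def)
qed

lemma smap_U: "gvariety n (smap ` U)" "full_bounds n (smap ` U)"
  by (rule gvariety_smap[OF U]) (rule full_bounds_smap[OF U full_bounds_U])

text \<open>\<open>select_rows\<close> reduces to independent rows, for which
  \<open>msum_equality\<close> gives one dimension per row.\<close>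

lemma restr_rotund: "rotund (2 * n) Vc"
  unfolding rotund_def
proof
  fix M
  obtain I where I: "I \<subseteq> {..<2 * n}" "rows_indep I (2 * n) M" "card I = mrank (2 * n) (2 * n) M"
    by (rule mrank_attained)
  obtain C where C: "rows_indep {..<card I} (2 * n) C" "\<forall>i\<ge>card I. \<forall>j. C i j = 0"
    "\<forall>k. kdim (cl k (mact k (2 * n) C ` Vc)) \<le> kdim (cl (2 * n) (mact (2 * n) (2 * n) M ` Vc))"
    by (rule select_rows[OF restr_eq(2)[OF U] I(1,2)])
  have "card I \<le> kdim (mimg (card I) (2 * n) C Vc)"
    unfolding mimg_restr using halves_indep[OF C(1)] by (rule msum_equality(1)[OF U full_bounds_U smap_U])
  also have "\<dots> \<le> kdim (mimg (2 * n) (2 * n) M Vc)" unfolding mimg_def using C(3) by blast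
  finally show "mrank (2 * n) (2 * n) M \<le> kdim (mimg (2 * n) (2 * n) M Vc)" unfolding I(3) .
qed

text \<open>Freeness passes from the doubles back to \<open>U\<close>, because infinitely many
  values after doubling or squaring need infinitely many values before.\<close>

lemma infinite_values:
  assumes "\<exists>j<n. C 0 j \<noteq> 0"
  shows "infinite ((\<lambda>u. fst (mact 1 n C u) 0) ` U)" "infinite ((\<lambda>u. snd (mact 1 n C u) 0) ` U)"
proof -
  have VG: "gscale 2 ` U \<subseteq> Gpts n" "gscale 2 ` U \<noteq> {}" using U_Gpts U_nonempty gscale_in_Gpts by blast+
  have "abs_free n (gscale 2 ` U)" using V_simple by (simp add: simple_var_def)
  from this[unfolded abs_free_iff[OF VG], THEN spec[of _ C], THEN mp, OF assms]
  have *: "infinite ((\<lambda>v. fst (mact 1 n C v) 0) ` gscale 2 ` U)" "infinite ((\<lambda>v. snd (mact 1 n C v) 0) ` gscale 2 ` U)"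
    by blast+
  have "(\<lambda>v. fst (mact 1 n C v) 0) ` gscale 2 ` U = (\<lambda>x. 2 * x) ` (\<lambda>u. fst (mact 1 n C u) 0) ` U"
    "(\<lambda>v. snd (mact 1 n C v) 0) ` gscale 2 ` U = (\<lambda>x. x ^ 2) ` (\<lambda>u. snd (mact 1 n C u) 0) ` U"
    unfolding image_image mact_gscale by (simp_all add: gscale_def)
  then show "infinite ((\<lambda>u. fst (mact 1 n C u) 0) ` U)" "infinite ((\<lambda>u. snd (mact 1 n C u) 0) ` U)"
    using * finite_imageI by (metis (no_types))+
qed

lemma infinite_values_smap:
  assumes "\<exists>j<n. C 0 j \<noteq> 0"
  shows "infinite ((\<lambda>u. fst (mact 1 n C u) 0) ` smap ` U)" "infinite ((\<lambda>u. snd (mact 1 n C u) 0) ` smap ` U)"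
proof -
  have inj: "inj \<sigma>" using sigma_invol by (metis injI)
  have "(\<lambda>u. fst (mact 1 n C u) 0) ` smap ` U = \<sigma> ` (\<lambda>u. fst (mact 1 n C u) 0) ` U"
    "(\<lambda>u. snd (mact 1 n C u) 0) ` smap ` U = \<sigma> ` (\<lambda>u. snd (mact 1 n C u) 0) ` U"
    unfolding image_image smap_mact[symmetric] by (simp_all add: smap_def)
  then show "infinite ((\<lambda>u. fst (mact 1 n C u) 0) ` smap ` U)" "infinite ((\<lambda>u. snd (mact 1 n C u) 0) ` smap ` U)"
    using infinite_values[of C, OF assms] by (simp_all add: finite_image_iff inj_on_subset[OF inj])
qed

text \<open>A nonzero row has a nonzero sum or difference of its halves. With the other argument
  fixed at one point, infinitely many values already occur along \<open>U\<close> or its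
  conjugate.\<close>

lemma restr_abs_free: "abs_free (2 * n) Vc"
proof -
  have sub: "Vc \<subseteq> Gpts (2 * n)" "Vc \<noteq> {}" using restr_eq(2)[OF U] by (auto simp: gvariety_iff irr_def)
  define D where "D = {lam n Q R |Q R. Q \<in> U \<and> R \<in> smap ` U}"
  have DV: "D \<subseteq> Vc" unfolding restr_eq(1)[OF U] D_def by (rule cl_superset[OF lam_set_Gpts])
  obtain Q0 where Q0: "Q0 \<in> U" using U_nonempty by blast
  show ?thesis
    unfolding abs_free_iff[OF sub]
  proof (intro allI impI)
    fix M :: "nat \<Rightarrow> nat \<Rightarrow> int" assume M: "\<exists>j<2 * n. M 0 j \<noteq> 0"
    have val: "fst (mact 1 (2 * n) M (lam n Q R)) 0 = fst (mact 1 n (sum_half n M) Q) 0 + fst (mact 1 n (diff_half n M) R) 0"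
      "snd (mact 1 (2 * n) M (lam n Q R)) 0 = snd (mact 1 n (sum_half n M) Q) 0 * snd (mact 1 n (diff_half n M) R) 0"
      if "Q \<in> U" "R \<in> smap ` U" for Q R
    proof -
      have "Q \<in> Gpts n" "R \<in> Gpts n" using that U_Gpts smap_U_Gpts by blast+
      then show "fst (mact 1 (2 * n) M (lam n Q R)) 0 = fst (mact 1 n (sum_half n M) Q) 0 + fst (mact 1 n (diff_half n M) R) 0"
        "snd (mact 1 (2 * n) M (lam n Q R)) 0 = snd (mact 1 n (sum_half n M) Q) 0 * snd (mact 1 n (diff_half n M) R) 0"
        by (simp_all add: mact_lam gadd_def)
    qed
    have nz: "snd (mact 1 n C P) 0 \<noteq> 0" if "P \<in> U \<union> smap ` U" for C and P :: "'a gpt"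
      using that U_Gpts smap_U_Gpts by (intro Gpts_nz[of _ 1] mact_in_Gpts[of _ n]) blast
    have inf_add: "infinite ((\<lambda>x. f x + c) ` T)" and inf_mult: "c \<noteq> 0 \<Longrightarrow> infinite ((\<lambda>x. f x * c) ` T)"
      if "infinite (f ` T)" for f :: "'a gpt \<Rightarrow> 'a" and c T
    proof -
      have "(\<lambda>x. f x + c) ` T = (\<lambda>y. y + c) ` f ` T" "(\<lambda>x. f x * c) ` T = (\<lambda>y. y * c) ` f ` T"
        by (simp_all add: image_image)
      moreover have "inj_on (\<lambda>y. y + c) (f ` T)" "c \<noteq> 0 \<Longrightarrow> inj_on (\<lambda>y. y * c) (f ` T)" by (intro inj_onI; simp)+
      ultimately show "infinite ((\<lambda>x. f x + c) ` T)" "c \<noteq> 0 \<Longrightarrow> infinite ((\<lambda>x. f x * c) ` T)"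
        using that by (simp_all add: finite_image_iff)
    qed
    have "(\<exists>j<n. sum_half n M 0 j \<noteq> 0) \<or> (\<exists>j<n. diff_half n M 0 j \<noteq> 0)"
    proof (rule ccontr)
      assume a: "\<not> ?thesis"
      have z: "M 0 j = 0" "M 0 (n + j) = 0" if "j < n" for j
      proof -
        have "sum_half n M 0 j = 0" "diff_half n M 0 j = 0" using a that by blast+
        then show "M 0 j = 0" "M 0 (n + j) = 0" unfolding sum_half_def diff_half_def by linarith+
      qed
      obtain j where j: "j < 2 * n" "M 0 j \<noteq> 0" using M by blast
      show False
      proof (cases "j < n")
        case True
        then show ?thesis using z(1) j(2) by simp
      next
        case False
        then have "j - n < n" "n + (j - n) = j" using j(1) by simp_all
        then show ?thesis using z(2)[of "j - n"] j(2) by simp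
      qed
    qed
    then have "infinite ((\<lambda>v. fst (mact 1 (2 * n) M v) 0) ` D) \<and> infinite ((\<lambda>v. snd (mact 1 (2 * n) M v) 0) ` D)"
    proof
      assume s: "\<exists>j<n. sum_half n M 0 j \<noteq> 0"
      define T where "T = (\<lambda>Q. lam n Q (smap Q0)) ` U"
      have "(\<lambda>v. fst (mact 1 (2 * n) M v) 0) ` T = (\<lambda>Q. fst (mact 1 n (sum_half n M) Q) 0 + fst (mact 1 n (diff_half n M) (smap Q0)) 0) ` U"
        "(\<lambda>v. snd (mact 1 (2 * n) M v) 0) ` T = (\<lambda>Q. snd (mact 1 n (sum_half n M) Q) 0 * snd (mact 1 n (diff_half n M) (smap Q0)) 0) ` U"
        unfolding T_def image_image by (intro image_cong refl val; use Q0 in blast)+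
      moreover have "snd (mact 1 n (diff_half n M) (smap Q0)) 0 \<noteq> 0" using Q0 by (intro nz) blast
      ultimately have "infinite ((\<lambda>v. fst (mact 1 (2 * n) M v) 0) ` T)" "infinite ((\<lambda>v. snd (mact 1 (2 * n) M v) 0) ` T)"
        using inf_add[OF infinite_values(1)[of "sum_half n M", OF s]] inf_mult[OF infinite_values(2)[of "sum_half n M", OF s]] by simp_all
      moreover have "T \<subseteq> D" unfolding T_def D_def using Q0 by blast
      ultimately show ?thesis using infinite_super[OF image_mono[of T D]] by blast
    next
      assume s: "\<exists>j<n. diff_half n M 0 j \<noteq> 0"
      define T where "T = lam n Q0 ` smap ` U"
      have "(\<lambda>v. fst (mact 1 (2 * n) M v) 0) ` T = (\<lambda>R. fst (mact 1 n (diff_half n M) R) 0 + fst (mact 1 n (sum_half n M) Q0) 0) ` smap ` U"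
        "(\<lambda>v. snd (mact 1 (2 * n) M v) 0) ` T = (\<lambda>R. snd (mact 1 n (diff_half n M) R) 0 * snd (mact 1 n (sum_half n M) Q0) 0) ` smap ` U"
        unfolding T_def image_image[of _ "lam n Q0"] by (intro image_cong refl; simp add: val[OF Q0] del: One_nat_def)+
      moreover have "snd (mact 1 n (sum_half n M) Q0) 0 \<noteq> 0" using Q0 by (intro nz) blast
      ultimately have "infinite ((\<lambda>v. fst (mact 1 (2 * n) M v) 0) ` T)" "infinite ((\<lambda>v. snd (mact 1 (2 * n) M v) 0) ` T)"
        using inf_add[OF infinite_values_smap(1)[of "diff_half n M", OF s]] inf_mult[OF infinite_values_smap(2)[of "diff_half n M", OF s]] by simp_all
      moreover have "T \<subseteq> D" unfolding T_def D_def using Q0 by blast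
      ultimately show ?thesis using infinite_super[OF image_mono[of T D]] by blast
    qed
    then show "infinite ((\<lambda>v. fst (mact 1 (2 * n) M v) 0) ` Vc) \<and> infinite ((\<lambda>v. snd (mact 1 (2 * n) M v) 0) ` Vc)"
      using infinite_super[OF image_mono[OF DV]] by blast
  qed
qed

text \<open>The bounds applied to the identity matrix.\<close>

lemma kdim_U_ge: "n \<le> kdim U"
proof -
  define J where "J = (\<lambda>i j::nat. if i = j then 1 else 0 :: int)"
  have "rows_indep {..<n} n J"
    unfolding rows_indep_def
  proof (intro allI impI ballI)
    fix c :: "nat \<Rightarrow> int" and i assume c: "\<forall>j<n. (\<Sum>i<n. c i * J i j) = 0" and i: "i \<in> {..<n}"
    have "(\<Sum>l<n. c l * J l i) = (\<Sum>l<n. if l = i then c l else 0)" by (intro sum.cong) (auto simp: J_def)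
    then show "c i = 0" using c i by simp
  qed
  then have "card {..<n} \<le> kdim (cl n (mact n n J ` U))" using full_bounds_U unfolding full_bounds_def by blast
  also have "\<dots> \<le> kdim U" by (rule kdim_image_le[OF U morph_mact])
  finally show ?thesis by simp
qed

text \<open>The equality is evaluated twice, with the factors exchanged, so that both the sum and
  the difference of the blocks are known to have rank 0 or \<open>n\<close>.\<close>

lemma restr_equality:
  assumes V: "gvariety n (gscale 2 ` U)" and p: "p > 0" "mrank p (2 * n) M = p"
    and eq: "kdim (mimg p (2 * n) M Vc) = p"
  shows "kdim (gscale 2 ` U) = n" and
    "p = 2 * n \<or> p = n \<and> mrank n n M = n \<and> mrank n n (\<lambda>a b. M a (n + b)) = n"
proof -
  define A B where "A = sum_half n M" and "B = diff_half n M"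
  have ind: "rows_indep {..<p} (2 * n) M" using p(2) by (simp add: mrank_full_iff)
  have AB: "\<forall>i<p. c i = 0" if "\<And>j. j < n \<Longrightarrow> (\<Sum>i<p. c i * A i j) = 0" "\<And>j. j < n \<Longrightarrow> (\<Sum>i<p. c i * B i j) = 0"
    for c using halves_indep[OF ind] that unfolding A_def B_def by blast
  have BA: "\<forall>i<p. c i = 0" if "\<And>j. j < n \<Longrightarrow> (\<Sum>i<p. c i * B i j) = 0" "\<And>j. j < n \<Longrightarrow> (\<Sum>i<p. c i * A i j) = 0"
    for c using AB[of c] that by blast
  have eqA: "kdim (cl p (msum p n A B U (smap ` U))) = p" using eq unfolding mimg_restr A_def B_def .
  then have eqB: "kdim (cl p (msum p n B A (smap ` U) U)) = p" by (subst msum_commute)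
  have a: "mrank p n A \<in> {0, n} \<and> p - mrank p n A \<in> {0, n} \<and> mrank p n A \<le> p \<and>
      (mrank p n A = n \<longrightarrow> kdim U \<le> n) \<and> (p - mrank p n A = n \<longrightarrow> kdim (smap ` U) \<le> n)"
    using AB eqA by (rule msum_equality(2)[OF U full_bounds_U smap_U])
  have b: "mrank p n B \<in> {0, n} \<and> p - mrank p n B \<in> {0, n} \<and> mrank p n B \<le> p \<and>
      (mrank p n B = n \<longrightarrow> kdim (smap ` U) \<le> n) \<and> (p - mrank p n B = n \<longrightarrow> kdim U \<le> n)"
    using BA eqB by (rule msum_equality(2)[OF smap_U U full_bounds_U])
  have n: "n > 0" and pn: "p = n \<or> p = 2 * n" using a p(1) by auto
  \<comment> \<open>Since \<open>p > 0\<close>, the rank of \<open>A\<close> or its complement in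
    \<open>p\<close> equals \<open>n\<close>; if this bounds the conjugate factor, conjugation
    transfers the bound to \<open>U\<close>.\<close>
  have "kdim U \<le> n" using a kdim_smap_le[OF U] p(1) by auto
  then have kU: "kdim U = n" using kdim_U_ge by simp
  have "cl n (gscale 2 ` U) = gscale 2 ` U" using V by (simp add: gvariety_iff)
  then show "kdim (gscale 2 ` U) = n"
    using kdim_gscale[OF U, of 2] kdim_image_le[OF U morph_gscale, of 2] kU by simp
  \<comment> \<open>The blocks are proportional, so a relation among the rows of one block is a
    relation among the rows of \<open>M\<close>.\<close>
  have opposite: "mrank n n M = n \<and> mrank n n (\<lambda>a b. M a (n + b)) = n"
    if pn: "p = n" and s: "s \<noteq> 0" "\<And>i j. i < n \<Longrightarrow> j < n \<Longrightarrow> M i (n + j) = s * M i j" for s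
  proof -
    have shift: "(\<Sum>i<n. c i * M i (n + j)) = s * (\<Sum>i<n. c i * M i j)" if "j < n" for c j
      unfolding sum_distrib_left using s(2) that by (intro sum.cong) auto
    have 1: "\<forall>i\<in>{..<n}. c i = 0" if c: "\<forall>j<n. (\<Sum>i<n. c i * M i j) = 0" for c
    proof -
      have "(\<Sum>i<n. c i * M i j) = 0" if j: "j < 2 * n" for j
      proof (cases "j < n")
        case True
        then show ?thesis using c by simp
      next
        case False
        then have "j - n < n" "n + (j - n) = j" using j by simp_all
        then show ?thesis using shift[of "j - n" c] c by simp
      qed
      then show ?thesis using ind unfolding rows_indep_def pn by blast
    qed
    have 2: "\<forall>i\<in>{..<n}. c i = 0" if c: "\<forall>j<n. (\<Sum>i<n. c i * M i (n + j)) = 0" for c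
      using 1[of c] c shift[of _ c] s(1) by simp
    show ?thesis unfolding mrank_full_iff rows_indep_def using 1 2 by blast
  qed
  have zero: "C i j = 0" if "mrank n n C = 0" "i < n" "j < n" for C i j
  proof (rule ccontr)
    assume "C i j \<noteq> 0"
    then have "rows_indep {i} n C" using that(3) unfolding rows_indep_def by auto
    then have "card {i} \<le> mrank n n C" using that(2) by (intro mrank_ge) auto
    then show False using that(1) by simp
  qed
  show "p = 2 * n \<or> p = n \<and> mrank n n M = n \<and> mrank n n (\<lambda>a b. M a (n + b)) = n"
  proof (cases "p = n")
    case False
    then show ?thesis using pn by blast
  next
    case pn: True
    have "mrank n n A = 0 \<or> mrank n n B = 0"
    proof (rule ccontr)
      assume "\<not> ?thesis"
      then have "mrank n n A = n" "mrank n n B = n" using a b unfolding pn by auto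
      then have iA: "rows_indep {..<n} n A" and iB: "rows_indep {..<n} n B" by (simp_all add: mrank_full_iff)
      \<comment> \<open>Independence of the rows of \<open>A\<close> makes a nontrivial character of
        the image a nontrivial character on \<open>U\<close>, where it takes infinitely many
        values.\<close>
      have row: "\<exists>j<n. (\<Sum>t<n. d t * A t j) \<noteq> 0" if "\<exists>j<n. d j \<noteq> 0" for d
        using iA that unfolding rows_indep_def by blast
      show False
      proof (rule msum_not_translate[OF U smap_U(1) n])
        show "n \<le> kdim (cl n (mact n n A ` U))"
          using full_bounds_U iA card_lessThan[of n] unfolding full_bounds_def by (metis order_refl)
        show "n \<le> kdim (cl n (mact n n B ` smap ` U))"
          using smap_U(2) iB card_lessThan[of n] unfolding full_bounds_def by (metis order_refl)
        show "kdim (cl n (msum n n A B U (smap ` U))) = n" using eqA unfolding pn .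
        have comp: "mact 1 n (\<lambda>_. d) (mact n n A u) = mact 1 n (\<lambda>i j. \<Sum>t<n. d t * A t j) u" if "u \<in> U" for d u
          using that U_Gpts by (intro mact_mact) blast
        show "infinite ((\<lambda>u. \<Prod>j<n. snd (mact n n A u) j powi d j) ` U)" if d: "\<exists>j<n. d j \<noteq> 0" for d
        proof -
          have "(\<lambda>u. \<Prod>j<n. snd (mact n n A u) j powi d j) ` U = (\<lambda>u. snd (mact 1 n (\<lambda>_. d) (mact n n A u)) 0) ` U"
            by (intro image_cong refl) (simp add: mact_def)
          also have "\<dots> = (\<lambda>u. snd (mact 1 n (\<lambda>i j. \<Sum>t<n. d t * A t j) u) 0) ` U"
            by (intro image_cong refl) (simp only: comp)
          finally show ?thesis
            using infinite_values(2)[of "\<lambda>i j. \<Sum>t<n. d t * A t j", OF row[OF d]] by simp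
        qed
        \<comment> \<open>The indicator of 0 picks out the first row of \<open>A\<close>, which is
          therefore nonzero.\<close>
        have "\<exists>j<n. (\<Sum>t<n. (if t = 0 then 1 else 0) * A t j) \<noteq> 0" using n by (intro row) auto
        moreover have "(\<Sum>t<n. (if t = 0 then 1 else 0) * A t j) = A 0 j" for j
        proof -
          have "(\<Sum>t<n. (if t = 0 then 1 else 0) * A t j) = (\<Sum>t<n. if t = 0 then A t j else 0)" by (intro sum.cong) auto
          then show ?thesis using n by simp
        qed
        ultimately have "\<exists>j<n. A 0 j \<noteq> 0" by simp
        then have "infinite ((\<lambda>u. fst (mact 1 n A u) 0) ` U)" by (rule infinite_values(1))
        then show "infinite ((\<lambda>u. fst (mact n n A u) 0) ` U)" using n by (simp add: mact_def)
      qed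
    qed
    then show ?thesis
    proof
      assume "mrank n n A = 0"
      then have "M i (n + j) = (-1) * M i j" if "i < n" "j < n" for i j
        using zero[of A i j] that by (simp add: A_def sum_half_def)
      then show ?thesis using opposite[OF pn, of "-1"] pn by simp
    next
      assume "mrank n n B = 0"
      then have "M i (n + j) = 1 * M i j" if "i < n" "j < n" for i j
        using zero[of B i j] that by (simp add: B_def diff_half_def)
      then show ?thesis using opposite[OF pn, of 1] pn by simp
    qed
  qed
qed

end

end

theorem theorem9p1:
  fixes \<sigma> :: "'a::field_char_0 \<Rightarrow> 'a" and i :: 'a and n :: nat and V :: "'a gpt set"
  assumes alg_closed: "\<And>p::'a poly. degree p > 0 \<Longrightarrow> \<exists>x. poly p x = 0"
    and sigma_add: "\<And>x y. \<sigma> (x + y) = \<sigma> x + \<sigma> y"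
    and sigma_mult: "\<And>x y. \<sigma> (x * y) = \<sigma> x * \<sigma> y"
    and sigma_invol: "\<And>x. \<sigma> (\<sigma> x) = x"
    and sigma_nonid: "\<exists>x. \<sigma> x \<noteq> x"
    and i_sq: "i\<^sup>2 = -1"
    and V_var: "gvariety n V"
    and V_simple: "simple_var n V"
  shows "gvariety (2 * n) (restr \<sigma> i n V) \<and> abs_free (2 * n) (restr \<sigma> i n V)
         \<and> rotund (2 * n) (restr \<sigma> i n V)
         \<and> (\<forall>p M. 0 < p \<and> mrank p (2 * n) M = p
                \<and> kdim (mimg p (2 * n) M (restr \<sigma> i n V)) = mrank p (2 * n) M
              \<longrightarrow> perf_rotund n V
                  \<and> (mrank p (2 * n) M = 2 * n
                     \<or> (mrank p (2 * n) M = n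
                        \<and> mrank n n M = n
                        \<and> mrank n n (\<lambda>a b. M a (n + b)) = n)))"
proof -
  interpret conj_field "TYPE('a)" \<sigma> i
    by unfold_locales (fact alg_closed sigma_add sigma_mult sigma_invol sigma_nonid i_sq)+
  obtain U where U: "gvariety n U" "gscale 2 ` U = V" by (rule half_variety[OF V_var])
  have S: "simple_var n (gscale 2 ` U)" unfolding U(2) by (rule V_simple)
  have V: "gvariety n (gscale 2 ` U)" unfolding U(2) by (rule V_var)
  show ?thesis
  proof (intro conjI allI impI)
    show "gvariety (2 * n) (restr \<sigma> i n V)" using restr_eq(2)[OF U(1)] unfolding U(2) .
    show "abs_free (2 * n) (restr \<sigma> i n V)" using restr_abs_free[OF U(1) S] unfolding U(2) .
    show "rotund (2 * n) (restr \<sigma> i n V)" using restr_rotund[OF U(1) S] unfolding U(2) .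
    fix p M assume "0 < p \<and> mrank p (2 * n) M = p \<and> kdim (mimg p (2 * n) M (restr \<sigma> i n V)) = mrank p (2 * n) M"
    then have p: "0 < p" "mrank p (2 * n) M = p" "kdim (mimg p (2 * n) M (restr \<sigma> i n (gscale 2 ` U))) = p"
      unfolding U(2) by simp_all
    show "perf_rotund n V" using restr_equality(1)[OF U(1) S V p] V_simple unfolding U(2) perf_rotund_def by blast
    show "mrank p (2 * n) M = 2 * n \<or> mrank p (2 * n) M = n \<and> mrank n n M = n \<and> mrank n n (\<lambda>a b. M a (n + b)) = n"
      unfolding p(2) by (rule restr_equality(2)[OF U(1) S V p])
  qed
qed

end
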